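(* Let $p$ be a prime and $n \geq 1$. Suppose $G$ is a virtually torsion-free discrete group which admits a finite $\underline{E}G$. Then $$\sum_{(H)} \chi_{\mathrm{orb}} (N(H)) \cdot \vert \Phi(H) \vert^n \cdot \Big ( \sum_{i=0}^{r(H/\Phi(H))} (-1)^i p^{n(r(H/\Phi(H))-i)+\binom{i}{2}} \cdot \binom{r(H/\Phi(H))}{i}_p \Big) \equiv 0 \mod \mathbb{Z}_{(p)},$$ where the sum runs over the conjugacy classes $(H)$ of finite abelian $p$-subgroups $H$ of $G$ generated by at most $n$ elements.
   Context: For a discrete group $G$, a $G$-CW complex is proper if all cell stabilizers are finite, and finite if it has finitely many $G$-orbits of cells. $\underline{E}G$ denotes the classifying $G$-space for proper actions: a $G$-CW complex such that for every subgroup $H\le G$ the fixed subspace $\underline{E}G^H$ is contractible if $H$ is finite and empty otherwise; it is unique up to $G$-homotopy equivalence. "$G$ admits a finite $\underline{E}G$" means that some model of $\underline{E}G$ is a finite $G$-CW complex. For $G$ virtually torsion-free, $\Lambda\le G$ a finite index torsion-free subgroup and $X$ a finite proper $G$-CW complex, $\chi^G_{\mathrm{orb}}(X) = \chi_{\mathbb{Q}}(\Lambda\backslash X)/[G:\Lambda]\in\mathbb{Q}$, where $\chi_{\mathbb{Q}}$ is the classical Euler characteristic (this is independent of $\Lambda$). If $G$ admits a finite $\underline{E}G$, then $\chi_{\mathrm{orb}}(G)=\chi^G_{\mathrm{orb}}(\underline{E}G)$. If $G$ is virtually torsion-free with a finite $\underline{E}G$ and $H\le G$ is finite, then $\underline{E}G^H$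 is a finite model of $\underline{E}N(H)$, where $N(H)$ is the normalizer of $H$ in $G$, so $\chi_{\mathrm{orb}}(N(H))$ is defined. For a finite abelian $p$-group $H$, the Frattini subgroup $\Phi(H)$ is the smallest subgroup such that $H/\Phi(H)$ is elementary abelian. For an elementary abelian $p$-group $E$, $r(E)$ is its rank (so $|E|=p^{r(E)}$). The $p$-binomial coefficient is $\binom{B}{i}_p=\frac{(p^B-1) \cdots (p^{B-i+1}-1) }{(p^i-1) \cdots (p-1)}$, with $\binom{B}{0}_p=1$. $\mathbb{Z}_{(p)}\subset\mathbb{Q}$ is the localization of $\mathbb{Z}$ at $p$; for rationals, $a\equiv b \mod \mathbb{Z}_{(p)}$ means $a-b\in\mathbb{Z}_{(p)}$. *)

theory Defs
  imports
    "HOL-Homology.Homology"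
    "HOL-Algebra.Group_Action"
    "HOL-Algebra.Generated_Groups"
    "HOL-Computational_Algebra.Primes"
begin

section \<open>G-CW complexes\<close>

definition unit_disc :: "nat \<Rightarrow> (nat \<Rightarrow> real) topology"
  where "unit_disc n = subtopology (Euclidean_space n) {x. (\<Sum>i<n. x i ^ 2) \<le> 1}"

definition disc_boundary :: "nat \<Rightarrow> (nat \<Rightarrow> real) set"
  where "disc_boundary n = {x \<in> topspace (unit_disc n). (\<Sum>i<n. x i ^ 2) = 1}"

definition disc_interior :: "nat \<Rightarrow> (nat \<Rightarrow> real) set"
  where "disc_interior n = {x \<in> topspace (unit_disc n). (\<Sum>i<n. x i ^ 2) < 1}"

definition G_space :: "('g, 'm) monoid_scheme \<Rightarrow> 'x topology \<Rightarrow> ('g \<Rightarrow> 'x \<Rightarrow> 'x) \<Rightarrow> bool"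
  where "G_space G X \<phi> \<longleftrightarrow>
    group_action G (topspace X) \<phi> \<and> (\<forall>g\<in>carrier G. continuous_map X X (\<phi> g))"

text \<open>An equivariant \<open>n\<close>-cell of type \<open>G/K\<close> is given by the subgroup \<open>K\<close> and a map \<open>q\<close> from the
  \<open>n\<close>-disc; its characteristic map \<open>G/K \<times> D^n \<rightarrow> X\<close> is \<open>(gK, x) \<mapsto> \<phi> g (q x)\<close>.\<close>

type_synonym ('g, 'x) equivariant_cell = "'g set \<times> ((nat \<Rightarrow> real) \<Rightarrow> 'x)"

text \<open>The index is shifted so that the empty skeleton is included: this is the union of the cells
  of dimension \<open>< n\<close>, that is, the skeleton of dimension \<open>n - 1\<close>.\<close>

definition skeleton_below ::
    "('g, 'm) monoid_scheme \<Rightarrow> ('g \<Rightarrow> 'x \<Rightarrow> 'x) \<Rightarrow> (nat \<Rightarrow> ('g, 'x) equivariant_cell set) \<Rightarrow> nat \<Rightarrow> 'x set"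
  where "skeleton_below G \<phi> cells n =
    (\<Union>m\<in>{..<n}. \<Union>(K, q)\<in>cells m. \<Union>g\<in>carrier G. \<phi> g ` q ` topspace (unit_disc m))"

text \<open>The third to fifth conjuncts say that the \<open>n\<close>-skeleton is the pushout of the
  \<open>(n-1)\<close>-skeleton and the disjoint union of the spaces \<open>G/K \<times> D^n\<close> along the spaces
  \<open>G/K \<times> S^(n-1)\<close>: as a set it is the \<open>(n-1)\<close>-skeleton together with the disjoint union of the
  \<open>G/K \<times> int D^n\<close>, and it has the quotient topology. The last one says that \<open>X\<close> is the colimit of
  its skeleta.\<close>

definition G_CW_structure ::
    "('g, 'm) monoid_scheme \<Rightarrow> 'x topology \<Rightarrow> ('g \<Rightarrow> 'x \<Rightarrow> 'x) \<Rightarrow>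
      (nat \<Rightarrow> ('g, 'x) equivariant_cell set) \<Rightarrow> bool"
  where "G_CW_structure G X \<phi> cells \<longleftrightarrow>
    topspace X = (\<Union>n. skeleton_below G \<phi> cells n) \<and>
    (\<forall>n. \<forall>(K, q)\<in>cells n.
        subgroup K G \<and> continuous_map (unit_disc n) X q \<and>
        (\<forall>k\<in>K. \<forall>x\<in>topspace (unit_disc n). \<phi> k (q x) = q x) \<and>
        q ` disc_boundary n \<subseteq> skeleton_below G \<phi> cells n) \<and>
    (\<forall>n. \<forall>(K, q)\<in>cells n. \<forall>g\<in>carrier G. \<forall>x\<in>disc_interior n.
        \<phi> g (q x) \<notin> skeleton_below G \<phi> cells n) \<and>
    (\<forall>n. \<forall>(K, q)\<in>cells n. \<forall>(L, r)\<in>cells n. \<forall>g\<in>carrier G. \<forall>h\<in>carrier G.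
        \<forall>x\<in>disc_interior n. \<forall>y\<in>disc_interior n.
        \<phi> g (q x) = \<phi> h (r y) \<longrightarrow> (K, q) = (L, r) \<and> g <#\<^bsub>G\<^esub> K = h <#\<^bsub>G\<^esub> K \<and> x = y) \<and>
    (\<forall>n. \<forall>A \<subseteq> skeleton_below G \<phi> cells (Suc n).
        closedin (subtopology X (skeleton_below G \<phi> cells (Suc n))) A \<longleftrightarrow>
          closedin (subtopology X (skeleton_below G \<phi> cells n)) (A \<inter> skeleton_below G \<phi> cells n) \<and>
          (\<forall>(K, q)\<in>cells n. \<forall>g\<in>carrier G.
            closedin (unit_disc n) {x \<in> topspace (unit_disc n). \<phi> g (q x) \<in> A})) \<and>
    (\<forall>A \<subseteq> topspace X. closedin X A \<longleftrightarrow>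
        (\<forall>n. closedin (subtopology X (skeleton_below G \<phi> cells n)) (A \<inter> skeleton_below G \<phi> cells n)))"

definition finite_G_CW_complex ::
    "('g, 'm) monoid_scheme \<Rightarrow> 'x topology \<Rightarrow> ('g \<Rightarrow> 'x \<Rightarrow> 'x) \<Rightarrow> bool"
  where "finite_G_CW_complex G X \<phi> \<longleftrightarrow>
    G_space G X \<phi> \<and> (\<exists>cells. G_CW_structure G X \<phi> cells \<and> finite (SIGMA n:UNIV. cells n))"

definition fixed_points :: "'x topology \<Rightarrow> ('g \<Rightarrow> 'x \<Rightarrow> 'x) \<Rightarrow> 'g set \<Rightarrow> 'x set"
  where "fixed_points X \<phi> H = {x \<in> topspace X. \<forall>h\<in>H. \<phi> h x = x}"

text \<open>The library's \<^const>\<open>contractible_space\<close> holds of the empty space, so that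
  nonemptiness has to be required separately. Properness needs no clause of its own: a cell
  stabilizer has a fixed point, and is therefore finite.\<close>

definition finite_EG_model ::
    "('g, 'm) monoid_scheme \<Rightarrow> 'x topology \<Rightarrow> ('g \<Rightarrow> 'x \<Rightarrow> 'x) \<Rightarrow> bool"
  where "finite_EG_model G X \<phi> \<longleftrightarrow>
    finite_G_CW_complex G X \<phi> \<and>
    (\<forall>H. subgroup H G \<longrightarrow>
      (if finite H
       then fixed_points X \<phi> H \<noteq> {} \<and> contractible_space (subtopology X (fixed_points X \<phi> H))
       else fixed_points X \<phi> H = {}))"

text \<open>A definition can only quantify over spaces on a fixed type. Every point of a finite
  \<open>G\<close>-CW complex is determined by a translate of an orbit representative among the cells and by
  a point of the disc, so that every finite \<open>G\<close>-CW complex has a homeomorphic copy on the type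
  below (the topology is an arbitrary one on a subset of this type); see
  \<open>finite_EG_model_imp_admits_finite_EG\<close>.\<close>

type_synonym 'g points = "'g \<times> nat \<times> (nat \<Rightarrow> real)"

definition admits_finite_EG :: "('g, 'm) monoid_scheme \<Rightarrow> bool"
  where "admits_finite_EG G \<longleftrightarrow>
    (\<exists>(X :: 'g points topology) \<phi>. finite_EG_model G X \<phi>)"

lemma G_CW_structure_cell:
  assumes "G_CW_structure G X \<phi> cells" "(K, q) \<in> cells n"
  shows "subgroup K G" "continuous_map (unit_disc n) X q"
    "\<And>k x. k \<in> K \<Longrightarrow> x \<in> topspace (unit_disc n) \<Longrightarrow> \<phi> k (q x) = q x"
    "q ` disc_boundary n \<subseteq> skeleton_below G \<phi> cells n"
proof -
  have "\<forall>n. \<forall>(K, q)\<in>cells n.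
      subgroup K G \<and> continuous_map (unit_disc n) X q \<and>
      (\<forall>k\<in>K. \<forall>x\<in>topspace (unit_disc n). \<phi> k (q x) = q x) \<and>
      q ` disc_boundary n \<subseteq> skeleton_below G \<phi> cells n"
    using assms(1) unfolding G_CW_structure_def by (elim conjE)
  from bspec[OF spec[OF this] assms(2)]
  show "subgroup K G" "continuous_map (unit_disc n) X q"
    "\<And>k x. k \<in> K \<Longrightarrow> x \<in> topspace (unit_disc n) \<Longrightarrow> \<phi> k (q x) = q x"
    "q ` disc_boundary n \<subseteq> skeleton_below G \<phi> cells n" by auto
qed

lemma G_CW_structure_inj:
  assumes "G_CW_structure G X \<phi> cells" "(K, q) \<in> cells n" "(L, r) \<in> cells n"
    "g \<in> carrier G" "h \<in> carrier G" "x \<in> disc_interior n" "y \<in> disc_interior n"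
    "\<phi> g (q x) = \<phi> h (r y)"
  shows "(K, q) = (L, r)" "g <#\<^bsub>G\<^esub> K = h <#\<^bsub>G\<^esub> K" "x = y"
proof -
  have "\<forall>n. \<forall>(K, q)\<in>cells n. \<forall>(L, r)\<in>cells n. \<forall>g\<in>carrier G. \<forall>h\<in>carrier G.
      \<forall>x\<in>disc_interior n. \<forall>y\<in>disc_interior n.
      \<phi> g (q x) = \<phi> h (r y) \<longrightarrow> (K, q) = (L, r) \<and> g <#\<^bsub>G\<^esub> K = h <#\<^bsub>G\<^esub> K \<and> x = y"
    using assms(1) unfolding G_CW_structure_def by (elim conjE)
  from bspec[OF spec[OF this] assms(2)] assms
  show "(K, q) = (L, r)" "g <#\<^bsub>G\<^esub> K = h <#\<^bsub>G\<^esub> K" "x = y" by fast+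
qed

lemma G_CW_structure_topspace:
  "G_CW_structure G X \<phi> cells \<Longrightarrow> topspace X = (\<Union>n. skeleton_below G \<phi> cells n)"
  unfolding G_CW_structure_def by (elim conjE)

lemma skeleton_below_translate:
  assumes "group_action G (topspace X) \<phi>" "G_CW_structure G X \<phi> cells"
    and "g \<in> carrier G" "x \<in> skeleton_below G \<phi> cells n"
  shows "\<phi> g x \<in> skeleton_below G \<phi> cells n"
proof -
  interpret group_action G "topspace X" \<phi> by fact
  interpret group G using group_hom group_hom_def by blast
  obtain m K q h y where *: "m < n" "(K, q) \<in> cells m" "h \<in> carrier G"
      "y \<in> topspace (unit_disc m)" "x = \<phi> h (q y)"
    using assms(4) by (auto simp: skeleton_below_def)
  have "continuous_map (unit_disc m) X q"
    using G_CW_structure_cell[OF assms(2) *(2)] by blast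
  then have "q y \<in> topspace X" using *(4) by (auto simp: continuous_map_def)
  then have "\<phi> g x = \<phi> (g \<otimes>\<^bsub>G\<^esub> h) (q y)"
    using * assms(3) by (simp add: composition_rule)
  moreover have "g \<otimes>\<^bsub>G\<^esub> h \<in> carrier G" using * assms(3) by simp
  ultimately show ?thesis using * unfolding skeleton_below_def by blast
qed

lemma skeleton_below_open_cell:
  assumes "group_action G (topspace X) \<phi>" "G_CW_structure G X \<phi> cells"
    and "x \<in> skeleton_below G \<phi> cells n"
  obtains m K q g y where "(K, q) \<in> cells m" "g \<in> carrier G" "y \<in> disc_interior m"
    "x = \<phi> g (q y)"
  using assms(3)
proof (induction n arbitrary: x thesis rule: less_induct)
  case (less n)
  obtain m K q g y where *: "m < n" "(K, q) \<in> cells m" "g \<in> carrier G"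
      "y \<in> topspace (unit_disc m)" "x = \<phi> g (q y)"
    using less.prems(2) by (auto simp: skeleton_below_def)
  show ?case
  proof (cases "y \<in> disc_interior m")
    case True
    then show ?thesis using * less.prems(1) by blast
  next
    case False
    then have "y \<in> disc_boundary m"
      using *(4) by (auto simp: disc_interior_def disc_boundary_def unit_disc_def)
    then have "q y \<in> skeleton_below G \<phi> cells m"
      using G_CW_structure_cell[OF assms(2) *(2)] by blast
    then have "x \<in> skeleton_below G \<phi> cells m"
      using skeleton_below_translate[OF assms(1,2)] * by blast
    with less show ?thesis using *(1) by blast
  qed
qed

lemma G_CW_open_cell:
  assumes "group_action G (topspace X) \<phi>" "G_CW_structure G X \<phi> cells" "x \<in> topspace X"
  obtains m K q g y where "(K, q) \<in> cells m" "g \<in> carrier G" "y \<in> disc_interior m"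
    "x = \<phi> g (q y)"
proof -
  obtain n where "x \<in> skeleton_below G \<phi> cells n"
    using G_CW_structure_topspace[OF assms(2)] assms(3) by blast
  from skeleton_below_open_cell[OF assms(1,2) this] that show ?thesis by metis
qed

lemma G_CW_structure_not_below:
  assumes "G_CW_structure G X \<phi> cells" "(K, q) \<in> cells n" "g \<in> carrier G" "x \<in> disc_interior n"
  shows "\<phi> g (q x) \<notin> skeleton_below G \<phi> cells n"
proof -
  have "\<forall>n. \<forall>(K, q)\<in>cells n. \<forall>g\<in>carrier G. \<forall>x\<in>disc_interior n.
      \<phi> g (q x) \<notin> skeleton_below G \<phi> cells n"
    using assms(1) unfolding G_CW_structure_def by (elim conjE)
  from bspec[OF spec[OF this] assms(2)] assms show ?thesis by fast
qed

lemma G_CW_structure_closedin_skeleton: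
  assumes "G_CW_structure G X \<phi> cells" "A \<subseteq> skeleton_below G \<phi> cells (Suc n)"
  shows "closedin (subtopology X (skeleton_below G \<phi> cells (Suc n))) A \<longleftrightarrow>
      closedin (subtopology X (skeleton_below G \<phi> cells n)) (A \<inter> skeleton_below G \<phi> cells n) \<and>
      (\<forall>(K, q)\<in>cells n. \<forall>g\<in>carrier G.
        closedin (unit_disc n) {x \<in> topspace (unit_disc n). \<phi> g (q x) \<in> A})"
proof -
  have "\<forall>n. \<forall>A \<subseteq> skeleton_below G \<phi> cells (Suc n).
        closedin (subtopology X (skeleton_below G \<phi> cells (Suc n))) A \<longleftrightarrow>
          closedin (subtopology X (skeleton_below G \<phi> cells n)) (A \<inter> skeleton_below G \<phi> cells n) \<and>
          (\<forall>(K, q)\<in>cells n. \<forall>g\<in>carrier G.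
            closedin (unit_disc n) {x \<in> topspace (unit_disc n). \<phi> g (q x) \<in> A})"
    using assms(1) unfolding G_CW_structure_def by (elim conjE)
  from mp[OF spec[OF spec[OF this]] assms(2)] show ?thesis .
qed

lemma G_CW_structure_closedin:
  assumes "G_CW_structure G X \<phi> cells" "A \<subseteq> topspace X"
  shows "closedin X A \<longleftrightarrow>
      (\<forall>n. closedin (subtopology X (skeleton_below G \<phi> cells n)) (A \<inter> skeleton_below G \<phi> cells n))"
proof -
  have "\<forall>A \<subseteq> topspace X. closedin X A \<longleftrightarrow>
      (\<forall>n. closedin (subtopology X (skeleton_below G \<phi> cells n)) (A \<inter> skeleton_below G \<phi> cells n))"
    using assms(1) unfolding G_CW_structure_def by (elim conjE)
  from mp[OF spec[OF this] assms(2)] show ?thesis .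
qed

lemma finite_EG_model_transport:
  fixes G (structure)
  assumes model: "finite_EG_model G X \<phi>" and homeo: "homeomorphic_maps X Y f f'"
  shows "finite_EG_model G Y (\<lambda>g. \<lambda>y\<in>topspace Y. f (\<phi> g (f' y)))"
proof -
  define \<psi> where "\<psi> = (\<lambda>g. \<lambda>y\<in>topspace Y. f (\<phi> g (f' y)))"
  note model' = model[unfolded finite_EG_model_def finite_G_CW_complex_def G_space_def]
  obtain cells where act: "group_action G (topspace X) \<phi>"
    and cont: "\<forall>g\<in>carrier G. continuous_map X X (\<phi> g)"
    and cw: "G_CW_structure G X \<phi> cells" and fin: "finite (SIGMA n:UNIV. cells n)"
    using model' by blast
  interpret group_action G "topspace X" \<phi> by fact
  interpret group G using group_hom group_hom_def by blast
  have hmap: "homeomorphic_map X Y f" using homeo by (auto simp: homeomorphic_map_maps)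
  have f: "f x \<in> topspace Y" "f' (f x) = x" if "x \<in> topspace X" for x
    using homeo that by (auto simp: homeomorphic_maps_def continuous_map_def)
  have f': "f' y \<in> topspace X" "f (f' y) = y" if "y \<in> topspace Y" for y
    using homeo that by (auto simp: homeomorphic_maps_def continuous_map_def)
  have \<phi>: "\<phi> g x \<in> topspace X" if "g \<in> carrier G" "x \<in> topspace X" for g x
    using element_image that by blast
  have \<psi>f: "\<psi> g (f x) = f (\<phi> g x)" if "x \<in> topspace X" for g x
    using f that by (simp add: \<psi>_def)
  have inj: "f x = f y \<longleftrightarrow> x = y" if "x \<in> topspace X" "y \<in> topspace X" for x y
    using f that by metis
  have fimg: "f ` topspace X = topspace Y"
    using f f' by (metis hmap homeomorphic_imp_surjective_map)

  have Bij: "\<psi> g \<in> Bij (topspace Y)" if g: "g \<in> carrier G" for g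
  proof -
    have "bij_betw f' (topspace Y) (topspace X)"
      by (rule bij_betwI[where g = f]) (use f f' in auto)
    moreover have "bij_betw (\<phi> g) (topspace X) (topspace X)"
      using bij_prop0[OF g] by (simp add: Bij_def)
    moreover have "bij_betw f (topspace X) (topspace Y)"
      by (rule bij_betwI[where g = f']) (use f f' in auto)
    ultimately have "bij_betw (f \<circ> (\<phi> g \<circ> f')) (topspace Y) (topspace Y)"
      by (meson bij_betw_trans)
    then have "bij_betw (\<psi> g) (topspace Y) (topspace Y)"
      by (rule iffD1[OF bij_betw_cong, rotated]) (simp add: \<psi>_def)
    then show ?thesis by (simp add: Bij_def \<psi>_def)
  qed
  have act': "group_action G (topspace Y) \<psi>"
    unfolding group_action_def group_hom_def group_hom_axioms_def
  proof (intro conjI)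
    show "Group.group G" by (rule is_group)
    show "Group.group (BijGroup (topspace Y))" by (rule group_BijGroup)
    show "\<psi> \<in> hom G (BijGroup (topspace Y))"
    proof (rule homI)
      fix g assume "g \<in> carrier G"
      then show "\<psi> g \<in> carrier (BijGroup (topspace Y))" using Bij by (simp add: BijGroup_def)
    next
      fix g h assume gh: "g \<in> carrier G" "h \<in> carrier G"
      have "\<psi> (g \<otimes> h) = compose (topspace Y) (\<psi> g) (\<psi> h)"
      proof
        fix y
        show "\<psi> (g \<otimes> h) y = compose (topspace Y) (\<psi> g) (\<psi> h) y"
          using gh f f' \<phi> composition_rule by (auto simp: \<psi>_def compose_def)
      qed
      then show "\<psi> (g \<otimes> h) = \<psi> g \<otimes>\<^bsub>BijGroup (topspace Y)\<^esub> \<psi> h"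
        using Bij gh by (simp add: BijGroup_def)
    qed
  qed
  have cont': "continuous_map Y Y (\<psi> g)" if g: "g \<in> carrier G" for g
  proof -
    have "continuous_map Y Y (f \<circ> (\<phi> g \<circ> f'))"
      using homeo cont g by (meson continuous_map_compose homeomorphic_maps_def)
    then show ?thesis by (rule continuous_map_eq) (simp add: \<psi>_def)
  qed

  define cells' where "cells' = (\<lambda>n. (\<lambda>(K, q). (K, f \<circ> q)) ` cells n)"
  let ?S = "skeleton_below G \<phi> cells" and ?S' = "skeleton_below G \<psi> cells'"
  note cell = G_CW_structure_cell[OF cw]
  have q: "q x \<in> topspace X" if "(K, q) \<in> cells n" "x \<in> topspace (unit_disc n)" for K q n x
    using cell(2)[OF that(1)] that(2) by (auto simp: continuous_map_def)
  have int: "x \<in> topspace (unit_disc n)" if "x \<in> disc_interior n" for x n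
    using that by (simp add: disc_interior_def)
  have sub: "?S n \<subseteq> topspace X" for n
    using G_CW_structure_topspace[OF cw] by blast
  have cell_img: "\<psi> g ` (f \<circ> q) ` topspace (unit_disc n) = f ` \<phi> g ` q ` topspace (unit_disc n)"
    if "(K, q) \<in> cells n" for K q n g
    using q[OF that] by (force simp: image_image \<psi>f)
  have S': "?S' n = f ` ?S n" for n
  proof -
    have "?S' n = (\<Union>m\<in>{..<n}. \<Union>(K, q)\<in>cells m. \<Union>g\<in>carrier G.
        \<psi> g ` (f \<circ> q) ` topspace (unit_disc m))"
      unfolding skeleton_below_def cells'_def by (simp add: image_image case_prod_unfold)
    also have "\<dots> = (\<Union>m\<in>{..<n}. \<Union>(K, q)\<in>cells m. \<Union>g\<in>carrier G.
        f ` \<phi> g ` q ` topspace (unit_disc m))"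
    proof (intro SUP_cong refl, goal_cases)
      case (1 m c)
      obtain K q where c: "c = (K, q)" by force
      show ?case unfolding c prod.case using cell_img 1 c by (intro SUP_cong refl) blast
    qed
    also have "\<dots> = f ` ?S n"
      unfolding skeleton_below_def by (simp add: image_UN case_prod_unfold)
    finally show ?thesis .
  qed
  have closed: "closedin (subtopology Y (f ` S)) (f ` B) \<longleftrightarrow> closedin (subtopology X S) B"
    if "S \<subseteq> topspace X" "B \<subseteq> S" for S B
  proof (rule homeomorphic_map_closedness)
    have "topspace X \<inter> S = S" "topspace Y \<inter> f ` S = f ` S" using that fimg by blast+
    then show "homeomorphic_map (subtopology X S) (subtopology Y (f ` S)) f"
      by (intro homeomorphic_map_subtopologies hmap) simp
    show "B \<subseteq> topspace (subtopology X S)" using that by auto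
  qed
  have Int: "f ` B \<inter> f ` S = f ` (B \<inter> S)" if "B \<subseteq> topspace X" "S \<subseteq> topspace X" for B S
    using that inj by (auto simp: image_iff subset_iff)
  have mem: "f x \<in> f ` B \<longleftrightarrow> x \<in> B" if "x \<in> topspace X" "B \<subseteq> topspace X" for x B
    using that inj by (auto simp: image_iff subset_iff)

  have cw': "G_CW_structure G Y \<psi> cells'"
    unfolding G_CW_structure_def
  proof (intro conjI)
    show "topspace Y = (\<Union>n. ?S' n)"
      using fimg G_CW_structure_topspace[OF cw] by (simp add: S' image_UN)
    show "\<forall>n. \<forall>(K, q)\<in>cells' n.
        subgroup K G \<and> continuous_map (unit_disc n) Y q \<and>
        (\<forall>k\<in>K. \<forall>x\<in>topspace (unit_disc n). \<psi> k (q x) = q x) \<and> q ` disc_boundary n \<subseteq> ?S' n"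
    proof (intro allI ballI, clarify)
      fix n K r assume "(K, r) \<in> cells' n"
      then obtain q where r: "r = f \<circ> q" and Kq: "(K, q) \<in> cells n" by (auto simp: cells'_def)
      have "continuous_map (unit_disc n) Y r"
        unfolding r using cell(2)[OF Kq] homeo by (meson continuous_map_compose homeomorphic_maps_def)
      moreover have "\<forall>k\<in>K. \<forall>x\<in>topspace (unit_disc n). \<psi> k (r x) = r x"
        using cell(3)[OF Kq] q[OF Kq] by (simp add: r \<psi>f)
      moreover have "r ` disc_boundary n \<subseteq> ?S' n"
        using cell(4)[OF Kq] by (auto simp: r S')
      ultimately show "subgroup K G \<and> continuous_map (unit_disc n) Y r \<and>
          (\<forall>k\<in>K. \<forall>x\<in>topspace (unit_disc n). \<psi> k (r x) = r x) \<and> r ` disc_boundary n \<subseteq> ?S' n"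
        using cell(1)[OF Kq] by blast
    qed
    show "\<forall>n. \<forall>(K, q)\<in>cells' n. \<forall>g\<in>carrier G. \<forall>x\<in>disc_interior n. \<psi> g (q x) \<notin> ?S' n"
    proof (intro allI ballI, clarify)
      fix n K r g x assume "(K, r) \<in> cells' n" and gx: "g \<in> carrier G" "x \<in> disc_interior n"
        and in_S: "\<psi> g (r x) \<in> ?S' n"
      then obtain q where r: "r = f \<circ> q" and Kq: "(K, q) \<in> cells n" by (auto simp: cells'_def)
      have "f (\<phi> g (q x)) \<in> f ` ?S n"
        using in_S q[OF Kq int[OF gx(2)]] by (simp add: r S' \<psi>f)
      then have "\<phi> g (q x) \<in> ?S n"
        using mem sub \<phi> gx q[OF Kq int[OF gx(2)]] by metis
      then show False using G_CW_structure_not_below[OF cw Kq gx] by blast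
    qed
    show "\<forall>n. \<forall>(K, q)\<in>cells' n. \<forall>(L, r)\<in>cells' n. \<forall>g\<in>carrier G. \<forall>h\<in>carrier G.
        \<forall>x\<in>disc_interior n. \<forall>y\<in>disc_interior n.
        \<psi> g (q x) = \<psi> h (r y) \<longrightarrow> (K, q) = (L, r) \<and> g <# K = h <# K \<and> x = y"
    proof (intro allI ballI, clarsimp)
      fix n K q' L r' g h x y
      assume "(K, q') \<in> cells' n" "(L, r') \<in> cells' n" and gh: "g \<in> carrier G" "h \<in> carrier G"
        and xy: "x \<in> disc_interior n" "y \<in> disc_interior n" and eq: "\<psi> g (q' x) = \<psi> h (r' y)"
      then obtain q r where q': "q' = f \<circ> q" and Kq: "(K, q) \<in> cells n"
        and r': "r' = f \<circ> r" and Lr: "(L, r) \<in> cells n" by (auto simp: cells'_def)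
      have "f (\<phi> g (q x)) = f (\<phi> h (r y))"
        using eq q[OF Kq int[OF xy(1)]] q[OF Lr int[OF xy(2)]] by (simp add: q' r' \<psi>f)
      then have "\<phi> g (q x) = \<phi> h (r y)"
        using inj \<phi> gh q[OF Kq int[OF xy(1)]] q[OF Lr int[OF xy(2)]] by metis
      from G_CW_structure_inj[OF cw Kq Lr gh xy this]
      show "K = L \<and> q' = r' \<and> g <# K = h <# K \<and> x = y" by (simp add: q' r')
    qed
    show "\<forall>n. \<forall>A \<subseteq> ?S' (Suc n). closedin (subtopology Y (?S' (Suc n))) A \<longleftrightarrow>
        closedin (subtopology Y (?S' n)) (A \<inter> ?S' n) \<and>
        (\<forall>(K, q)\<in>cells' n. \<forall>g\<in>carrier G.
          closedin (unit_disc n) {x \<in> topspace (unit_disc n). \<psi> g (q x) \<in> A})"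
    proof (intro allI impI)
      fix n A assume "A \<subseteq> ?S' (Suc n)"
      then obtain B where B: "B \<subseteq> ?S (Suc n)" "A = f ` B" by (auto simp: S' subset_image_iff)
      have BX: "B \<subseteq> topspace X" using B sub by blast
      have pre: "{x \<in> topspace (unit_disc n). \<psi> g ((f \<circ> q) x) \<in> A} =
          {x \<in> topspace (unit_disc n). \<phi> g (q x) \<in> B}" if "(K, q) \<in> cells n" "g \<in> carrier G" for K q g
        by (intro Collect_cong conj_cong refl)
          (simp add: \<psi>f B(2) mem[OF _ BX] q[OF that(1)] \<phi>[OF that(2)])
      have "(\<forall>(K, q)\<in>cells' n. \<forall>g\<in>carrier G.
          closedin (unit_disc n) {x \<in> topspace (unit_disc n). \<psi> g (q x) \<in> A}) \<longleftrightarrow>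
        (\<forall>(K, q)\<in>cells n. \<forall>g\<in>carrier G.
          closedin (unit_disc n) {x \<in> topspace (unit_disc n). \<psi> g ((f \<circ> q) x) \<in> A})"
        unfolding cells'_def by (simp add: case_prod_unfold)
      also have "\<dots> \<longleftrightarrow> (\<forall>(K, q)\<in>cells n. \<forall>g\<in>carrier G.
          closedin (unit_disc n) {x \<in> topspace (unit_disc n). \<phi> g (q x) \<in> B})"
      proof (intro ball_cong refl, goal_cases)
        case (1 c)
        obtain K q where c: "c = (K, q)" by force
        show ?case
          unfolding c prod.case
          by (intro ball_cong refl arg_cong[of _ _ "closedin (unit_disc n)"] pre[OF 1[unfolded c]])
      qed
      finally show "closedin (subtopology Y (?S' (Suc n))) A \<longleftrightarrow>
        closedin (subtopology Y (?S' n)) (A \<inter> ?S' n) \<and>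
        (\<forall>(K, q)\<in>cells' n. \<forall>g\<in>carrier G.
          closedin (unit_disc n) {x \<in> topspace (unit_disc n). \<psi> g (q x) \<in> A})"
        using G_CW_structure_closedin_skeleton[OF cw B(1)] closed[OF sub B(1)]
          closed[OF sub, of "B \<inter> ?S n" n] Int[OF BX sub, of n]
        by (simp add: S' B(2))
    qed
    show "\<forall>A \<subseteq> topspace Y. closedin Y A \<longleftrightarrow>
        (\<forall>n. closedin (subtopology Y (?S' n)) (A \<inter> ?S' n))"
    proof (intro allI impI)
      fix A assume "A \<subseteq> topspace Y"
      then obtain B where B: "B \<subseteq> topspace X" "A = f ` B"
        by (metis fimg subset_imageE)
      have "closedin Y A \<longleftrightarrow> closedin X B"
        unfolding B(2) by (rule homeomorphic_map_closedness[OF hmap B(1)])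
      moreover have "closedin (subtopology Y (?S' n)) (A \<inter> ?S' n) \<longleftrightarrow>
          closedin (subtopology X (?S n)) (B \<inter> ?S n)" for n
        using closed[OF sub, of "B \<inter> ?S n" n] Int[OF B(1) sub, of n] by (simp add: S' B(2))
      ultimately show "closedin Y A \<longleftrightarrow> (\<forall>n. closedin (subtopology Y (?S' n)) (A \<inter> ?S' n))"
        using G_CW_structure_closedin[OF cw B(1)] by simp
    qed
  qed
  have fin': "finite (SIGMA n:UNIV. cells' n)"
  proof (rule finite_subset)
    show "(SIGMA n:UNIV. cells' n) \<subseteq> (\<lambda>(n, K, q). (n, K, f \<circ> q)) ` (SIGMA n:UNIV. cells n)"
      unfolding cells'_def by force
  qed (use fin in simp)
  have fp: "fixed_points Y \<psi> H = f ` fixed_points X \<phi> H" if "subgroup H G" for H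
  proof -
    have "H \<subseteq> carrier G" using that subgroup.subset by blast
    then have "(\<forall>h\<in>H. \<psi> h (f x) = f x) \<longleftrightarrow> (\<forall>h\<in>H. \<phi> h x = x)" if "x \<in> topspace X" for x
      using that \<phi> inj \<psi>f by (metis subsetD)
    then show ?thesis unfolding fixed_points_def fimg[symmetric] by auto
  qed
  have contr: "contractible_space (subtopology Y (fixed_points Y \<psi> H)) \<longleftrightarrow>
      contractible_space (subtopology X (fixed_points X \<phi> H))" if "subgroup H G" for H
  proof -
    have "homeomorphic_map (subtopology X (fixed_points X \<phi> H))
        (subtopology Y (f ` fixed_points X \<phi> H)) f"
    proof (intro homeomorphic_map_subtopologies hmap)
      have "fixed_points X \<phi> H \<subseteq> topspace X" by (auto simp: fixed_points_def)
      then show "f ` (topspace X \<inter> fixed_points X \<phi> H) = topspace Y \<inter> f ` fixed_points X \<phi> H"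
        using fimg by blast
    qed
    then show ?thesis
      using fp[OF that] by (metis homeomorphic_map_imp_homeomorphic_space homeomorphic_space_contractibility)
  qed
  have "finite_EG_model G Y \<psi>"
    unfolding finite_EG_model_def finite_G_CW_complex_def G_space_def
    using act' cont' cw' fin' fp contr model' by (auto simp: finite_EG_model_def)
  then show ?thesis by (simp add: \<psi>_def)
qed

lemma finite_EG_model_imp_admits_finite_EG:
  fixes G :: "('g, 'm) monoid_scheme" and X :: "'x topology"
  assumes "finite_EG_model G X \<phi>"
  shows "admits_finite_EG G"
proof -
  note model' = assms[unfolded finite_EG_model_def finite_G_CW_complex_def G_space_def]
  obtain cells where act: "group_action G (topspace X) \<phi>"
    and cw: "G_CW_structure G X \<phi> cells" and fin: "finite (SIGMA n:UNIV. cells n)"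
    using model' by blast
  obtain e :: "nat \<Rightarrow> nat \<times> ('g, 'x) equivariant_cell" and N
    where e: "(SIGMA n:UNIV. cells n) = e ` {..<N}"
    using fin finite_imp_nat_seg_image_inj_on by (metis lessThan_def)
  define k :: "'g points \<Rightarrow> 'x" where "k = (\<lambda>(g, i, y). \<phi> g (snd (snd (e i)) y))"
  have "\<exists>a. k a = x" if x: "x \<in> topspace X" for x
  proof -
    obtain m K q g y where *: "(K, q) \<in> cells m" "x = \<phi> g (q y)"
      by (rule G_CW_open_cell[OF act cw x])
    then have "(m, K, q) \<in> e ` {..<N}" using e by blast
    then obtain i where "e i = (m, K, q)" by force
    then have "k (g, i, y) = x" by (simp add: k_def *)
    then show ?thesis ..
  qed
  then obtain f where f: "\<And>x. x \<in> topspace X \<Longrightarrow> k (f x) = x" by metis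
  define Y where "Y = pullback_topology (f ` topspace X) k X"
  have topY: "topspace Y = f ` topspace X"
    using f by (auto simp: Y_def topspace_pullback_topology)
  have "continuous_map Y X k"
    unfolding Y_def using continuous_map_pullback[OF continuous_map_id, of "f ` topspace X" k X] by simp
  moreover have "continuous_map X Y f"
    unfolding Y_def
  proof (rule continuous_map_pullback')
    show "continuous_map X X (k \<circ> f)"
      by (rule continuous_map_eq[OF continuous_map_id]) (simp add: f)
  qed auto
  ultimately have "homeomorphic_maps X Y f k"
    using f topY by (auto simp: homeomorphic_maps_def)
  from finite_EG_model_transport[OF assms this] show ?thesis
    unfolding admits_finite_EG_def by blast
qed


section \<open>Euler characteristics\<close>

definition Z_independent :: "('a, 'm) monoid_scheme \<Rightarrow> 'a set \<Rightarrow> bool"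
  where "Z_independent A S \<longleftrightarrow> S \<subseteq> carrier A \<and>
    (\<forall>c :: 'a \<Rightarrow> int. (\<Otimes>\<^bsub>A\<^esub>x\<in>S. x [^]\<^bsub>A\<^esub> c x) = \<one>\<^bsub>A\<^esub> \<longrightarrow> (\<forall>x\<in>S. c x = 0))"

text \<open>The rank of an abelian group \<open>A\<close>, that is, the dimension of the rational vector space
  \<open>\<rat> \<otimes> A\<close>. Meaningful only if the rank is finite.\<close>

definition abelian_group_rank :: "('a, 'm) monoid_scheme \<Rightarrow> nat"
  where "abelian_group_rank A = Sup {card S | S. finite S \<and> Z_independent A S}"

text \<open>As \<open>\<rat>\<close> is flat, \<open>H\<^sub>i(X; \<rat>) = \<rat> \<otimes> H\<^sub>i(X; \<int>)\<close>, so this is the dimension of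
  the rational homology.\<close>

definition betti_number :: "nat \<Rightarrow> 'x topology \<Rightarrow> nat"
  where "betti_number i X = abelian_group_rank (homology_group (int i) X)"

definition euler_characteristic :: "'x topology \<Rightarrow> int"
  where "euler_characteristic X =
    (\<Sum>i | betti_number i X \<noteq> 0. (-1) ^ i * int (betti_number i X))"

definition orbit_space ::
    "('g, 'm) monoid_scheme \<Rightarrow> 'x topology \<Rightarrow> ('g \<Rightarrow> 'x \<Rightarrow> 'x) \<Rightarrow> 'x set topology"
  where "orbit_space L X \<phi> = topology (\<lambda>U. U \<subseteq> orbits L (topspace X) \<phi> \<and>
    openin X {x \<in> topspace X. orbit L \<phi> x \<in> U})"

lemma openin_orbit_space:
  "openin (orbit_space L X \<phi>) U \<longleftrightarrow>
    U \<subseteq> orbits L (topspace X) \<phi> \<and> openin X {x \<in> topspace X. orbit L \<phi> x \<in> U}"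
proof -
  have "istopology (\<lambda>U. U \<subseteq> orbits L (topspace X) \<phi> \<and>
      openin X {x \<in> topspace X. orbit L \<phi> x \<in> U})" (is "istopology ?O")
    unfolding istopology_def
  proof (intro conjI allI impI)
    fix S T assume ST: "?O S" "?O T"
    show "S \<inter> T \<subseteq> orbits L (topspace X) \<phi>" using ST by blast
    have "{x \<in> topspace X. orbit L \<phi> x \<in> S \<inter> T} =
        {x \<in> topspace X. orbit L \<phi> x \<in> S} \<inter> {x \<in> topspace X. orbit L \<phi> x \<in> T}" by blast
    then show "openin X {x \<in> topspace X. orbit L \<phi> x \<in> S \<inter> T}" using ST by auto
  next
    fix \<U> assume U: "\<forall>K\<in>\<U>. ?O K"
    then show "\<Union>\<U> \<subseteq> orbits L (topspace X) \<phi>" by blast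
    have "{x \<in> topspace X. orbit L \<phi> x \<in> \<Union>\<U>} =
        \<Union>((\<lambda>K. {x \<in> topspace X. orbit L \<phi> x \<in> K}) ` \<U>)" by blast
    then show "openin X {x \<in> topspace X. orbit L \<phi> x \<in> \<Union>\<U>}" using U by auto
  qed
  then show ?thesis unfolding orbit_space_def by (simp add: topology_inverse')
qed

lemma quotient_map_orbit_space: "quotient_map X (orbit_space L X \<phi>) (orbit L \<phi>)"
proof -
  have "{x \<in> topspace X. orbit L \<phi> x \<in> orbits L (topspace X) \<phi>} = topspace X"
    by (auto simp: orbits_def)
  then have "openin (orbit_space L X \<phi>) (orbits L (topspace X) \<phi>)"
    by (simp add: openin_orbit_space)
  then have "topspace (orbit_space L X \<phi>) = orbits L (topspace X) \<phi>"
    by (meson openin_orbit_space openin_subset openin_topspace subset_antisym)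
  moreover have "orbit L \<phi> ` topspace X = orbits L (topspace X) \<phi>"
    by (auto simp: orbits_def)
  ultimately show ?thesis
    by (simp add: quotient_map_def openin_orbit_space)
qed

definition torsion_free_finite_index :: "('g, 'm) monoid_scheme \<Rightarrow> 'g set \<Rightarrow> bool"
  where "torsion_free_finite_index G L \<longleftrightarrow>
    subgroup L G \<and> finite (rcosets\<^bsub>G\<^esub> L) \<and>
    (\<forall>x\<in>L. \<forall>k::nat. k > 0 \<longrightarrow> x [^]\<^bsub>G\<^esub> k = \<one>\<^bsub>G\<^esub> \<longrightarrow> x = \<one>\<^bsub>G\<^esub>)"

definition virtually_torsion_free :: "('g, 'm) monoid_scheme \<Rightarrow> bool"
  where "virtually_torsion_free G \<longleftrightarrow> (\<exists>L. torsion_free_finite_index G L)"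

text \<open>The two choices below (of the subgroup, and of the finite model) do not affect the values.\<close>

definition orbifold_euler_space ::
    "('g, 'm) monoid_scheme \<Rightarrow> 'x topology \<Rightarrow> ('g \<Rightarrow> 'x \<Rightarrow> 'x) \<Rightarrow> rat"
  where "orbifold_euler_space G X \<phi> =
    (let L = (SOME L. torsion_free_finite_index G L)
     in of_int (euler_characteristic (orbit_space (G\<lparr>carrier := L\<rparr>) X \<phi>)) /
        of_nat (card (rcosets\<^bsub>G\<^esub> L)))"

definition orbifold_euler :: "('g, 'm) monoid_scheme \<Rightarrow> rat"
  where "orbifold_euler G =
    (let (X, \<phi>) = (SOME (X :: 'g points topology, \<phi>). finite_EG_model G X \<phi>)
     in orbifold_euler_space G X \<phi>)"


section \<open>Finite abelian p-subgroups\<close>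

definition elementary_abelian :: "nat \<Rightarrow> ('a, 'm) monoid_scheme \<Rightarrow> bool"
  where "elementary_abelian p E \<longleftrightarrow>
    comm_group E \<and> (\<forall>x\<in>carrier E. x [^]\<^bsub>E\<^esub> p = \<one>\<^bsub>E\<^esub>)"

definition frattini :: "nat \<Rightarrow> ('a, 'm) monoid_scheme \<Rightarrow> 'a set"
  where "frattini p H = \<Inter> {K. subgroup K H \<and> elementary_abelian p (H Mod K)}"

lemma elementary_abelian_Mod_iff:
  fixes P (structure)
  assumes "comm_group P" "subgroup K P"
  shows "elementary_abelian p (P Mod K) \<longleftrightarrow> (\<forall>x\<in>carrier P. x [^] p \<in> K)"
proof -
  interpret comm_group P by fact
  interpret normal K P using subgroup_imp_normal assms(2) .
  have pow: "(K #> x) [^]\<^bsub>P Mod K\<^esub> p = K #> (x [^] p)" if "x \<in> carrier P" for x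
    using FactGroup_pow that by metis
  have "K #> (x [^] p) = K \<longleftrightarrow> x [^] p \<in> K" if "x \<in> carrier P" for x
    using that by (meson assms(2) coset_join1 coset_join2 nat_pow_closed subset)
  then show ?thesis
    using pow abelian_FactGroup[OF assms(2)]
    by (auto simp: elementary_abelian_def carrier_FactGroup)
qed

lemma frattini_smallest:
  fixes P (structure)
  assumes "comm_group P"
  shows "subgroup (frattini p P) P" "elementary_abelian p (P Mod frattini p P)"
    "\<And>K. subgroup K P \<Longrightarrow> elementary_abelian p (P Mod K) \<Longrightarrow> frattini p P \<subseteq> K"
proof -
  interpret comm_group P by fact
  have "carrier P \<in> {K. subgroup K P \<and> elementary_abelian p (P Mod K)}"
    using assms by (simp add: elementary_abelian_Mod_iff subgroup_self)
  then show sub: "subgroup (frattini p P) P"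
    unfolding frattini_def by (intro subgroups_Inter) auto
  show "elementary_abelian p (P Mod frattini p P)"
    unfolding elementary_abelian_Mod_iff[OF assms sub]
    using assms by (auto simp: frattini_def elementary_abelian_Mod_iff)
  show "frattini p P \<subseteq> K" if "subgroup K P" "elementary_abelian p (P Mod K)" for K
    using that by (auto simp: frattini_def)
qed

definition generated_by_at_most :: "nat \<Rightarrow> ('a, 'm) monoid_scheme \<Rightarrow> bool"
  where "generated_by_at_most n H \<longleftrightarrow>
    (\<exists>S \<subseteq> carrier H. finite S \<and> card S \<le> n \<and> generate H S = carrier H)"

text \<open>For an elementary abelian \<open>p\<close>-group this is the dimension over the field with \<open>p\<close>
  elements.\<close>

definition group_rank :: "('a, 'm) monoid_scheme \<Rightarrow> nat"
  where "group_rank E = (LEAST r. generated_by_at_most r E)"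

definition abelian_p_subgroups :: "('g, 'm) monoid_scheme \<Rightarrow> nat \<Rightarrow> nat \<Rightarrow> 'g set set"
  where "abelian_p_subgroups G p n =
    {H. subgroup H G \<and> finite H \<and> (\<exists>k. card H = p ^ k) \<and>
        comm_group (G\<lparr>carrier := H\<rparr>) \<and> generated_by_at_most n (G\<lparr>carrier := H\<rparr>)}"

definition conjugacy_class :: "('g, 'm) monoid_scheme \<Rightarrow> 'g set \<Rightarrow> 'g set set"
  where "conjugacy_class G H = {g <#\<^bsub>G\<^esub> H #>\<^bsub>G\<^esub> inv\<^bsub>G\<^esub> g | g. g \<in> carrier G}"

text \<open>Hence sums over conjugacy classes of finite subgroups are finite sums.\<close>

lemma finite_conjugacy_classes:
  fixes G (structure)
  assumes "admits_finite_EG G"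
  shows "finite (conjugacy_class G ` {H. subgroup H G \<and> finite H})"
proof -
  obtain X :: "'a points topology" and \<phi> where "finite_EG_model G X \<phi>"
    using assms unfolding admits_finite_EG_def by blast
  note model = this[unfolded finite_EG_model_def finite_G_CW_complex_def G_space_def]
  then obtain cells where act: "group_action G (topspace X) \<phi>"
    and cw: "G_CW_structure G X \<phi> cells" and fin: "finite (SIGMA n:UNIV. cells n)"
    by blast
  have fx: "finite H \<longleftrightarrow> fixed_points X \<phi> H \<noteq> {}" if "subgroup H G" for H
    using model that by metis
  interpret group_action G "topspace X" \<phi> by fact
  interpret group G using group_hom group_hom_def by blast
  define \<K> where "\<K> = (fst \<circ> snd) ` (SIGMA n:UNIV. cells n)"
  note cell = G_CW_structure_cell[OF cw]
  have in_disc: "(\<lambda>_. 0) \<in> topspace (unit_disc n)" for n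
    by (auto simp: unit_disc_def topspace_Euclidean_space)
  have finK: "finite K" if "K \<in> \<K>" for K
  proof -
    obtain n q where q: "(K, q) \<in> cells n" using \<open>K \<in> \<K>\<close> unfolding \<K>_def by force
    have "q (\<lambda>_. 0) \<in> topspace X" using cell(2)[OF q] in_disc by (auto simp: continuous_map_def)
    then have "q (\<lambda>_. 0) \<in> fixed_points X \<phi> K"
      using cell(3)[OF q] in_disc by (auto simp: fixed_points_def)
    then show ?thesis using fx cell(1)[OF q] by blast
  qed
  have "conjugacy_class G H \<in> conjugacy_class G ` (\<Union>K\<in>\<K>. Pow K)"
    if H: "subgroup H G" "finite H" for H
  proof -
    obtain x where x: "x \<in> topspace X" "\<And>h. h \<in> H \<Longrightarrow> \<phi> h x = x"
      using fx H by (auto simp: fixed_points_def)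
    obtain m K q g y where *: "(K, q) \<in> cells m" "g \<in> carrier G" "y \<in> disc_interior m"
        "x = \<phi> g (q y)"
      using G_CW_open_cell[OF act cw x(1)] by metis
    have qy: "q y \<in> topspace X"
      using cell(2)[OF *(1)] *(3) by (auto simp: continuous_map_def disc_interior_def)
    have subH: "h \<in> carrier G" if "h \<in> H" for h using H that subgroup.subset by blast
    have inK: "inv g \<otimes> h \<otimes> g \<in> K" if h: "h \<in> H" for h
    proof -
      have eq: "\<phi> (h \<otimes> g) (q y) = \<phi> g (q y)"
        using x(2)[OF h] *(2,4) qy subH[OF h] by (simp add: composition_rule)
      have "(h \<otimes> g) <# K = g <# K"
        by (rule G_CW_structure_inj(2)[OF cw *(1) *(1) m_closed *(2) *(3) *(3) eq])
          (use *(2) subH[OF h] in auto)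
      moreover have "h \<otimes> g \<in> (h \<otimes> g) <# K"
        unfolding l_coset_def using subgroup.one_closed[OF cell(1)[OF *(1)]] *(2) subH[OF h]
        by (intro UN_I[of \<one>]) simp_all
      ultimately have "h \<otimes> g \<in> g <# K" by (rule subst)
      then obtain k where k: "k \<in> K" "h \<otimes> g = g \<otimes> k" unfolding l_coset_def by blast
      have kG: "k \<in> carrier G" by (rule subgroup.mem_carrier[OF cell(1)[OF *(1)] k(1)])
      have "inv g \<otimes> h \<otimes> g = inv g \<otimes> (h \<otimes> g)" using *(2) subH[OF h] by (simp add: m_assoc)
      also have "\<dots> = inv g \<otimes> (g \<otimes> k)" by (simp only: k(2))
      also have "\<dots> = k" using *(2) kG by (simp flip: m_assoc)
      finally show ?thesis using k(1) by (simp only:)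
    qed
    let ?H = "inv g <# H #> g"
    have img: "a <# A #> b = (\<lambda>h. a \<otimes> h \<otimes> b) ` A" for a b A
      unfolding l_coset_def r_coset_def by blast
    have sub: "?H \<subseteq> K" using inK unfolding img by blast
    have conj: "a <# ?H #> inv a = (a \<otimes> inv g) <# H #> inv (a \<otimes> inv g)" if "a \<in> carrier G" for a
    proof -
      have "a \<otimes> (inv g \<otimes> h \<otimes> g) \<otimes> inv a = (a \<otimes> inv g) \<otimes> h \<otimes> inv (a \<otimes> inv g)" if "h \<in> H" for h
        using subH[OF that] \<open>a \<in> carrier G\<close> *(2) by (simp add: inv_mult_group m_assoc)
      then show ?thesis unfolding img image_image by (intro image_cong refl)
    qed
    have "conjugacy_class G ?H = conjugacy_class G H"
    proof (intro subset_antisym subsetI)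
      fix C assume "C \<in> conjugacy_class G ?H"
      then obtain a where a: "a \<in> carrier G" "C = a <# ?H #> inv a"
        unfolding conjugacy_class_def mem_Collect_eq by (elim exE conjE)
      have "C = (a \<otimes> inv g) <# H #> inv (a \<otimes> inv g)"
        by (rule trans[OF a(2) conj[OF a(1)]])
      moreover have "a \<otimes> inv g \<in> carrier G" using a(1) *(2) by simp
      ultimately show "C \<in> conjugacy_class G H"
        unfolding conjugacy_class_def mem_Collect_eq by (intro exI conjI)
    next
      fix C assume "C \<in> conjugacy_class G H"
      then obtain a where a: "a \<in> carrier G" "C = a <# H #> inv a"
        unfolding conjugacy_class_def mem_Collect_eq by (elim exE conjE)
      have "a \<otimes> g \<otimes> inv g = a" using a(1) *(2) by (simp add: m_assoc)
      moreover have ag: "a \<otimes> g \<in> carrier G" using a(1) *(2) by simp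
      ultimately have "C = (a \<otimes> g) <# ?H #> inv (a \<otimes> g)"
        by (simp only: conj a(2))
      then show "C \<in> conjugacy_class G ?H"
        unfolding conjugacy_class_def mem_Collect_eq using ag by (intro exI conjI)
    qed
    moreover have "K \<in> \<K>"
      unfolding \<K>_def by (rule image_eqI[of _ _ "(m, K, q)"]) (use *(1) in auto)
    ultimately show ?thesis using sub by blast
  qed
  moreover have "finite (\<Union>K\<in>\<K>. Pow K)"
  proof (rule finite_UN_I)
    show "finite \<K>" unfolding \<K>_def using fin by (rule finite_imageI)
  qed (use finK in simp)
  ultimately show ?thesis
    by (intro finite_subset[OF _ finite_imageI[of _ "conjugacy_class G"]] image_subsetI) simp_all
qed

definition p_binomial :: "nat \<Rightarrow> nat \<Rightarrow> nat \<Rightarrow> rat"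
  where "p_binomial p B i =
    (\<Prod>j<i. of_nat p ^ (B - j) - 1) / (\<Prod>j<i. of_nat p ^ (i - j) - 1)"

definition localization_at :: "nat \<Rightarrow> rat set"
  where "localization_at p = {of_int a / of_int b | a b. \<not> int p dvd b}"

definition cong_mod_localization :: "nat \<Rightarrow> rat \<Rightarrow> rat \<Rightarrow> bool"
  where "cong_mod_localization p a b \<longleftrightarrow> a - b \<in> localization_at p"

end

theory Submission
  imports Defs "HOL-Analysis.Abstract_Topological_Spaces" "HOL-Algebra.Sylow" "HOL-Number_Theory.Cong"
begin

text \<open>
  Over a torsion-free subgroup \<open>L\<close> of finite index, a finite model \<open>X\<close> of the classifying space is a free cellular
  \<open>L\<close>-space, and an orbit of cells with stabilizer \<open>K\<close> splits into \<open>[G : L]/|K|\<close> orbits under \<open>L\<close>. As \<open>X\<close> is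
  contractible, the homotopy type of the orbit space does not depend on the model, so that the
  orbifold Euler characteristic of \<open>G\<close> is \<open>\<Sum> (-1)^n/|K|\<close>, summed over the orbits of cells. The orbits of cells of \<open>X^H\<close> under
  \<open>N(H)\<close> correspond to the \<open>K\<close>-classes of subgroups of the stabilizers \<open>K\<close> that are conjugate to \<open>H\<close>; hence the value for
  \<open>N(H)\<close> is \<open>\<Sum> (-1)^n m/|K|\<close>, where \<open>m\<close> is the number of such subgroups.

  By the \<open>q\<close>-binomial theorem, the factor by which the value for \<open>N(H)\<close> is multiplied is the number of generating
  \<open>n\<close>-tuples of \<open>H\<close>. Interchanging the sums turns the expression into \<open>\<Sum> (-1)^d |T(K)|/|K|\<close> over the orbits of \<open>d\<close>-cells, where
  \<open>T(K)\<close> is the set of commuting \<open>n\<close>-tuples of elements of \<open>p\<close>-power order of \<open>K\<close>. Frobenius' theorem and an induction on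
  \<open>n\<close> show that the \<open>p\<close>-part of \<open>|K|\<close> divides \<open>|T(K)|\<close>, so every summand is \<open>p\<close>-locally integral.
\<close>

section \<open>Ranks of abelian groups\<close>

text \<open>\<open>orbifold_euler\<close> chooses a torsion-free subgroup and a finite model anew
  for every normalizer, so the terms of the sum have no common origin at first. The reduction to one
  model of \<open>G\<close> works because the count of cells with reciprocal stabilizer orders shows
  neither choice. Two obstacles shape the topology. The Euler characteristic is defined by ranks of
  singular homology, so cells must be counted through homology of pairs; attaching one free orbit of
  cells at a time makes its image in the orbit space a single cell, to which excision applies.
  Independence of the model requires equivariant homotopies built cell by cell, and their continuity
  is a statement about a product with the interval; hence spaces are described by a coherence
  condition that survives such products and the passage to orbits. The hypothesis on
  \<open>n\<close> enters at the start of the induction on the length of tuples: there is one empty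
  tuple, and 1 is not divisible by the \<open>p\<close>-part of a stabilizer order in
  general.\<close>

definition Z_independent_family :: "('a, 'm) monoid_scheme \<Rightarrow> 'i set \<Rightarrow> ('i \<Rightarrow> 'a) \<Rightarrow> bool"
  where "Z_independent_family A I f \<longleftrightarrow> f \<in> I \<rightarrow> carrier A \<and>
    (\<forall>c :: 'i \<Rightarrow> int. (\<Otimes>\<^bsub>A\<^esub>i\<in>I. f i [^]\<^bsub>A\<^esub> c i) = \<one>\<^bsub>A\<^esub> \<longrightarrow> (\<forall>i\<in>I. c i = 0))"

definition has_rank :: "('a, 'm) monoid_scheme \<Rightarrow> 'a set \<Rightarrow> nat \<Rightarrow> bool"
  where "has_rank A X r \<longleftrightarrow>
    (\<exists>S \<subseteq> X. finite S \<and> Z_independent A S \<and> card S = r) \<and>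
    (\<forall>S \<subseteq> X. finite S \<longrightarrow> Z_independent A S \<longrightarrow> card S \<le> r)"

lemma has_rank_unique: "has_rank A X r \<Longrightarrow> has_rank A X s \<Longrightarrow> r = s"
  unfolding has_rank_def by (meson le_antisym)

lemma abelian_group_rank_eq:
  assumes "has_rank A (carrier A) r"
  shows "abelian_group_rank A = r"
  unfolding abelian_group_rank_def
proof (rule cSup_eq_maximum)
  show "r \<in> {card S |S. finite S \<and> Z_independent A S}"
    using assms unfolding has_rank_def by blast
  fix x assume "x \<in> {card S |S. finite S \<and> Z_independent A S}"
  then obtain S where "finite S" "Z_independent A S" "x = card S" by blast
  moreover from this have "S \<subseteq> carrier A" unfolding Z_independent_def by blast
  ultimately show "x \<le> r" using assms unfolding has_rank_def by simp
qed

lemma has_rank_bounded: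
  fixes A :: "('a, 'm) monoid_scheme"
  assumes "\<And>S. S \<subseteq> X \<Longrightarrow> finite S \<Longrightarrow> Z_independent A S \<Longrightarrow> card S \<le> b"
  obtains r where "has_rank A X r" "r \<le> b"
proof -
  let ?C = "{card S | S. S \<subseteq> X \<and> finite S \<and> Z_independent A S}"
  have "?C \<subseteq> {..b}" using assms by blast
  then have fin: "finite ?C" by (rule finite_subset) simp
  have "Z_independent A {}" by (simp add: Z_independent_def)
  then have "card ({} :: 'a set) \<in> ?C" by blast
  then have "Max ?C \<in> ?C" using fin by (intro Max_in) blast+
  then obtain S where "Max ?C = card S" "S \<subseteq> X" "finite S" "Z_independent A S" by blast
  moreover have "card T \<le> Max ?C" if "T \<subseteq> X" "finite T" "Z_independent A T" for T
    by (rule Max_ge[OF fin]) (use that in blast)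
  ultimately have "has_rank A X (Max ?C)" unfolding has_rank_def by auto
  moreover have "Max ?C \<le> b" using \<open>?C \<subseteq> {..b}\<close> \<open>Max ?C \<in> ?C\<close> by blast
  ultimately show ?thesis by (rule that)
qed

lemma has_rank_subset:
  assumes "has_rank A X r" "Y \<subseteq> X"
  obtains s where "has_rank A Y s" "s \<le> r"
proof -
  have "card S \<le> r" if "S \<subseteq> Y" "finite S" "Z_independent A S" for S
    using assms that unfolding has_rank_def by auto
  then show ?thesis using has_rank_bounded that by metis
qed

section \<open>Monomials with integer exponents and additivity of ranks\<close>

context comm_group
begin

lemma finprod_int_pow:
  fixes n :: int
  assumes "finite I" "f \<in> I \<rightarrow> carrier G"
  shows "(\<Otimes>i\<in>I. f i) [^] n = (\<Otimes>i\<in>I. f i [^] n)"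
  using assms by (induction I rule: finite_induct) (auto simp: int_pow_distrib Pi_iff)

text \<open>Substituting monomials into a monomial multiplies exponent matrices. This turns a
  relation between derived elements into one between the elements they are made of.\<close>

lemma finprod_combination:
  fixes e :: "'i \<Rightarrow> 'j \<Rightarrow> int" and d :: "'i \<Rightarrow> int"
  assumes "finite T" "finite U" "f \<in> U \<rightarrow> carrier G"
  shows "(\<Otimes>s\<in>T. (\<Otimes>x\<in>U. f x [^] e s x) [^] d s) = (\<Otimes>x\<in>U. f x [^] (\<Sum>s\<in>T. e s x * d s))"
  using assms
proof (induction T rule: finite_induct)
  case (insert t T)
  have "(\<Otimes>x\<in>U. f x [^] e t x) [^] d t = (\<Otimes>x\<in>U. f x [^] (e t x * d t))"
    using insert.prems by (subst finprod_int_pow) (auto simp: int_pow_pow Pi_iff intro!: finprod_cong)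
  then have "(\<Otimes>s\<in>insert t T. (\<Otimes>x\<in>U. f x [^] e s x) [^] d s) =
      (\<Otimes>x\<in>U. f x [^] (e t x * d t)) \<otimes> (\<Otimes>x\<in>U. f x [^] (\<Sum>s\<in>T. e s x * d s))"
    using insert by (subst finprod_insert) (auto simp: Pi_iff)
  also have "\<dots> = (\<Otimes>x\<in>U. f x [^] (e t x * d t) \<otimes> f x [^] (\<Sum>s\<in>T. e s x * d s))"
    using insert.prems by (subst finprod_multf) (auto simp: Pi_iff)
  also have "\<dots> = (\<Otimes>x\<in>U. f x [^] (\<Sum>s\<in>insert t T. e s x * d s))"
    using insert by (intro finprod_cong) (auto simp: int_pow_mult Pi_iff simp_implies_def)
  finally show ?case .
qed simp

text \<open>Two equal values would satisfy the relation with exponents 1 and -1. Families are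
  considered besides sets because a map may identify members before independence is known.\<close>

lemma Z_independent_family_image:
  assumes "finite I" and f: "Z_independent_family G I f"
  shows "inj_on f I" "Z_independent G (f ` I)"
proof -
  have fG: "f i \<in> carrier G" if "i \<in> I" for i
    using f that by (auto simp: Z_independent_family_def)
  show inj: "inj_on f I"
  proof (rule inj_onI, rule ccontr)
    fix i j assume ij: "i \<in> I" "j \<in> I" "f i = f j" "i \<noteq> j"
    define c where "c = (\<lambda>k. if k = i then 1 else if k = j then -1 else 0 :: int)"
    have "(\<Otimes>k\<in>I. f k [^] c k) = (\<Otimes>k\<in>{i, j}. f k [^] c k)"
      using ij assms(1) fG by (intro finprod_mono_neutral_cong_right) (auto simp: c_def)
    also have "\<dots> = \<one>" using ij fG by (simp add: c_def int_pow_neg)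
    finally have "c i = 0" using f ij(1) unfolding Z_independent_family_def by blast
    then show False by (simp add: c_def)
  qed
  show "Z_independent G (f ` I)"
    unfolding Z_independent_def
  proof (intro conjI allI impI)
    show "f ` I \<subseteq> carrier G" using fG by blast
    fix c :: "'a \<Rightarrow> int" assume "(\<Otimes>x\<in>f ` I. x [^] c x) = \<one>"
    then have "(\<Otimes>i\<in>I. f i [^] c (f i)) = \<one>"
      using inj fG by (subst (asm) finprod_reindex) auto
    then have "\<forall>i\<in>I. c (f i) = 0" using f unfolding Z_independent_family_def by (elim conjE allE[of _ "\<lambda>i. c (f i)"]) blast
    then show "\<forall>x\<in>f ` I. c x = 0" by blast
  qed
qed

lemma Z_independent_not_one:
  assumes "Z_independent G S" "finite S" shows "\<one> \<notin> S"
proof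
  assume "\<one> \<in> S"
  define c where "c = (\<lambda>x. if x = \<one> then 1 else 0 :: int)"
  have "(\<Otimes>x\<in>S. x [^] c x) = \<one>" by (rule finprod_one_eqI) (simp add: c_def)
  then show False using assms \<open>\<one> \<in> S\<close> by (auto simp: Z_independent_def c_def dest!: spec[of _ c])
qed

lemma has_rank_trivial: "has_rank G {\<one>} 0"
proof -
  have "S = {}" if "S \<subseteq> {\<one>}" "finite S" "Z_independent G S" for S
    using Z_independent_not_one that by blast
  moreover have "Z_independent G {}" by (simp add: Z_independent_def)
  ultimately show ?thesis by (auto simp: has_rank_def)
qed

end

lemma hom_finprod:
  assumes "comm_group B" "comm_group C" "f \<in> hom B C" "finite I" "g \<in> I \<rightarrow> carrier B"
  shows "f (\<Otimes>\<^bsub>B\<^esub>i\<in>I. g i) = (\<Otimes>\<^bsub>C\<^esub>i\<in>I. f (g i))"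
proof -
  interpret B: comm_group B by fact
  interpret C: comm_group C by fact
  interpret group_hom B C f using assms(3) by (unfold_locales) 
  show ?thesis using assms(4,5)
    by (induction I rule: finite_induct) (auto simp: Pi_iff)
qed

lemma hom_finprod_int_pow:
  fixes c :: "'i \<Rightarrow> int"
  assumes "comm_group B" "comm_group C" "f \<in> hom B C" "finite I" "g \<in> I \<rightarrow> carrier B"
  shows "f (\<Otimes>\<^bsub>B\<^esub>i\<in>I. g i [^]\<^bsub>B\<^esub> c i) = (\<Otimes>\<^bsub>C\<^esub>i\<in>I. f (g i) [^]\<^bsub>C\<^esub> c i)"
proof -
  interpret B: comm_group B by fact
  interpret C: comm_group C by fact
  interpret group_hom B C f using assms(3) by (unfold_locales)
  have "f (\<Otimes>\<^bsub>B\<^esub>i\<in>I. g i [^]\<^bsub>B\<^esub> c i) = (\<Otimes>\<^bsub>C\<^esub>i\<in>I. f (g i [^]\<^bsub>B\<^esub> c i))"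
    using assms by (intro hom_finprod) auto
  also have "\<dots> = (\<Otimes>\<^bsub>C\<^esub>i\<in>I. f (g i) [^]\<^bsub>C\<^esub> c i)"
    using assms(5) by (intro C.finprod_cong) (auto simp: hom_int_pow Pi_iff simp_implies_def)
  finally show ?thesis .
qed

text \<open>For the lower bound, an independent subset of the kernel is joined with lifts of an
  independent subset of the image. For the upper bound, an independent \<open>U\<close> is split
  into a part \<open>S1\<close> with independent image and a rest, and the rest is traded for
  equally many independent elements of the kernel.\<close>

lemma rank_kernel_image:
  assumes "comm_group B" "comm_group C" "f \<in> hom B C"
    and a: "has_rank B (kernel B C f) a" and c: "has_rank C (f ` carrier B) c"
  shows "has_rank B (carrier B) (a + c)"
proof -
  interpret B: comm_group B by fact
  interpret C: comm_group C by fact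
  interpret group_hom B C f using assms(3) by (unfold_locales)
  note hom_prod = hom_finprod_int_pow[OF assms(1-3)]
  obtain S where S: "S \<subseteq> kernel B C f" "finite S" "Z_independent B S" "card S = a"
    using a unfolding has_rank_def by blast
  obtain T where T: "T \<subseteq> f ` carrier B" "finite T" "Z_independent C T" "card T = c"
    using c unfolding has_rank_def by blast
  obtain l where l: "\<And>t. t \<in> T \<Longrightarrow> l t \<in> carrier B \<and> f (l t) = t"
    using T(1) by (metis image_iff subsetD)
  have inj: "inj_on l T" using l by (metis inj_onI)
  have SB: "S \<subseteq> carrier B" using S(1) by (auto simp: kernel_def)
  \<comment> \<open>A common element would be sent to \<open>\<one>\<close> and also into
    \<open>T\<close>, but an independent set does not contain \<open>\<one>\<close>.\<close>
  have disj: "S \<inter> l ` T = {}"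
    using S(1) l C.Z_independent_not_one[OF T(3,2)] by (auto simp: kernel_def)
  have "Z_independent B (S \<union> l ` T)"
    unfolding Z_independent_def
  proof (intro conjI allI impI)
    show "S \<union> l ` T \<subseteq> carrier B" using SB l by blast
    fix d :: "_ \<Rightarrow> int"
    assume "(\<Otimes>\<^bsub>B\<^esub>x\<in>S \<union> l ` T. x [^]\<^bsub>B\<^esub> d x) = \<one>\<^bsub>B\<^esub>"
    then have one: "(\<Otimes>\<^bsub>B\<^esub>x\<in>S. x [^]\<^bsub>B\<^esub> d x) \<otimes>\<^bsub>B\<^esub> (\<Otimes>\<^bsub>B\<^esub>x\<in>l ` T. x [^]\<^bsub>B\<^esub> d x) = \<one>\<^bsub>B\<^esub>"
      using S(2) T(2) disj SB l by (subst (asm) B.finprod_Un_disjoint) auto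
    have "f (\<Otimes>\<^bsub>B\<^esub>x\<in>S. x [^]\<^bsub>B\<^esub> d x) = (\<Otimes>\<^bsub>C\<^esub>x\<in>S. f x [^]\<^bsub>C\<^esub> d x)"
      using S SB by (intro hom_prod) auto
    also have "\<dots> = \<one>\<^bsub>C\<^esub>" using S(1) by (intro C.finprod_one_eqI) (auto simp: kernel_def)
    finally have fS: "f (\<Otimes>\<^bsub>B\<^esub>x\<in>S. x [^]\<^bsub>B\<^esub> d x) = \<one>\<^bsub>C\<^esub>" .
    have "f (\<Otimes>\<^bsub>B\<^esub>x\<in>l ` T. x [^]\<^bsub>B\<^esub> d x) = (\<Otimes>\<^bsub>C\<^esub>x\<in>l ` T. f x [^]\<^bsub>C\<^esub> d x)"
      using T l by (intro hom_prod) auto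
    also have "\<dots> = (\<Otimes>\<^bsub>C\<^esub>t\<in>T. t [^]\<^bsub>C\<^esub> d (l t))"
      using l inj T(3)
      by (subst C.finprod_reindex) (auto simp: simp_implies_def Z_independent_def intro!: C.finprod_cong C.int_pow_closed)
    finally have fT: "f (\<Otimes>\<^bsub>B\<^esub>x\<in>l ` T. x [^]\<^bsub>B\<^esub> d x) = (\<Otimes>\<^bsub>C\<^esub>t\<in>T. t [^]\<^bsub>C\<^esub> d (l t))" .
    have "f (\<Otimes>\<^bsub>B\<^esub>x\<in>S. x [^]\<^bsub>B\<^esub> d x) \<otimes>\<^bsub>C\<^esub> f (\<Otimes>\<^bsub>B\<^esub>x\<in>l ` T. x [^]\<^bsub>B\<^esub> d x) = \<one>\<^bsub>C\<^esub>"
      using SB l by (subst hom_mult[symmetric]) (auto simp: one intro!: B.finprod_closed)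
    moreover have "(\<Otimes>\<^bsub>C\<^esub>t\<in>T. t [^]\<^bsub>C\<^esub> d (l t)) \<in> carrier C"
      using T(3) by (intro C.finprod_closed) (auto simp: Z_independent_def)
    ultimately have "(\<Otimes>\<^bsub>C\<^esub>t\<in>T. t [^]\<^bsub>C\<^esub> d (l t)) = \<one>\<^bsub>C\<^esub>" by (simp add: fS fT)
    then have dT: "\<forall>t\<in>T. d (l t) = 0"
      using T(3) unfolding Z_independent_def by (elim conjE allE[of _ "\<lambda>t. d (l t)"]) blast
    then have "(\<Otimes>\<^bsub>B\<^esub>x\<in>l ` T. x [^]\<^bsub>B\<^esub> d x) = \<one>\<^bsub>B\<^esub>"
      by (intro B.finprod_one_eqI) auto
    moreover have "(\<Otimes>\<^bsub>B\<^esub>x\<in>S. x [^]\<^bsub>B\<^esub> d x) \<in> carrier B" using SB by (intro B.finprod_closed) auto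
    ultimately have "(\<Otimes>\<^bsub>B\<^esub>x\<in>S. x [^]\<^bsub>B\<^esub> d x) = \<one>\<^bsub>B\<^esub>" using one by simp
    then have "\<forall>x\<in>S. d x = 0" using S(3) unfolding Z_independent_def by blast
    with dT show "\<forall>x\<in>S \<union> l ` T. d x = 0" by blast
  qed
  moreover have "card (S \<union> l ` T) = a + c"
    using S T disj inj by (simp add: card_Un_disjoint card_image)
  moreover have "card U \<le> a + c" if U: "U \<subseteq> carrier B" "finite U" "Z_independent B U" for U
  proof -
    \<comment> \<open>\<open>S1\<close> will be a subset of \<open>U\<close> of largest cardinality
      whose image is an independent family; the bound \<open>card U\<close> guarantees that one
      exists.\<close>
    let ?P = "\<lambda>S. S \<subseteq> U \<and> Z_independent_family C S f"
    have "?P {}" by (simp add: Z_independent_family_def)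
    moreover have "\<forall>S. ?P S \<longrightarrow> card S < Suc (card U)" using U(2) by (simp add: card_mono less_Suc_eq_le)
    ultimately obtain S1 where S1: "?P S1" "\<And>S. ?P S \<Longrightarrow> card S \<le> card S1"
      using ex_has_greatest_nat[of ?P "{}" card "Suc (card U)"] by (metis less_imp_le)
    have finS1: "finite S1" using S1(1) U(2) finite_subset by blast
    have S1B: "S1 \<subseteq> carrier B" using S1(1) U(1) by blast
    have "card S1 \<le> c"
      using C.Z_independent_family_image[of S1 f] S1(1) finS1 S1B c
      unfolding has_rank_def by (metis card_image finite_imageI image_mono)
    moreover have "card (U - S1) \<le> a"
    proof -
      \<comment> \<open>By maximality of \<open>S1\<close>, the images of \<open>S1\<close> and of
        \<open>s\<close> satisfy a relation. The same monomial formed in \<open>U\<close> lies in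
        the kernel; within \<open>U - S1\<close> its only exponent that may differ from zero is the
        one at \<open>s\<close>, and that one does.\<close>
      have "\<exists>e :: _ \<Rightarrow> int. e s \<noteq> 0 \<and> (\<forall>x\<in>U - insert s S1. e x = 0) \<and>
          (\<Otimes>\<^bsub>B\<^esub>x\<in>U. x [^]\<^bsub>B\<^esub> e x) \<in> kernel B C f" if s: "s \<in> U - S1" for s
      proof -
        have "\<not> Z_independent_family C (insert s S1) f"
          using S1(1) S1(2)[of "insert s S1"] s finS1 by auto
        moreover have "f \<in> insert s S1 \<rightarrow> carrier C" using S1B U(1) s by auto
        ultimately obtain d :: "_ \<Rightarrow> int" where d: "(\<Otimes>\<^bsub>C\<^esub>i\<in>insert s S1. f i [^]\<^bsub>C\<^esub> d i) = \<one>\<^bsub>C\<^esub>"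
          and nz: "\<exists>i\<in>insert s S1. d i \<noteq> 0" unfolding Z_independent_family_def by blast
        have "d s \<noteq> 0"
        proof
          assume "d s = 0"
          moreover have "(\<Otimes>\<^bsub>C\<^esub>i\<in>S1. f i [^]\<^bsub>C\<^esub> d i) \<in> carrier C"
            using S1B by (intro C.finprod_closed) auto
          moreover have "f s [^]\<^bsub>C\<^esub> d s = \<one>\<^bsub>C\<^esub>" using \<open>d s = 0\<close> by simp
          ultimately have "(\<Otimes>\<^bsub>C\<^esub>i\<in>S1. f i [^]\<^bsub>C\<^esub> d i) = \<one>\<^bsub>C\<^esub>"
            using d s S1B U(1) finS1 by (subst (asm) C.finprod_insert) auto
          then show False using S1(1) nz \<open>d s = 0\<close> unfolding Z_independent_family_def by blast
        qed
        define e where "e = (\<lambda>x. if x \<in> insert s S1 then d x else 0)"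
        have "f (\<Otimes>\<^bsub>B\<^esub>x\<in>U. x [^]\<^bsub>B\<^esub> e x) = (\<Otimes>\<^bsub>C\<^esub>x\<in>U. f x [^]\<^bsub>C\<^esub> e x)"
          using U by (intro hom_prod) auto
        also have "\<dots> = (\<Otimes>\<^bsub>C\<^esub>x\<in>insert s S1. f x [^]\<^bsub>C\<^esub> d x)"
          using U s S1(1) S1B by (intro C.finprod_mono_neutral_cong_right) (auto simp: e_def)
        finally have "f (\<Otimes>\<^bsub>B\<^esub>x\<in>U. x [^]\<^bsub>B\<^esub> e x) = \<one>\<^bsub>C\<^esub>" using d by simp
        then have "(\<Otimes>\<^bsub>B\<^esub>x\<in>U. x [^]\<^bsub>B\<^esub> e x) \<in> kernel B C f"
          using U(1) by (auto simp: kernel_def intro!: B.finprod_closed)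
        then show ?thesis using \<open>d s \<noteq> 0\<close> by (intro exI[of _ e]) (auto simp: e_def)
      qed
      then obtain e where e: "\<And>s. s \<in> U - S1 \<Longrightarrow> (e s s :: int) \<noteq> 0 \<and> (\<forall>x\<in>U - insert s S1. e s x = 0) \<and>
          (\<Otimes>\<^bsub>B\<^esub>x\<in>U. x [^]\<^bsub>B\<^esub> e s x) \<in> kernel B C f" by metis
      define k where "k = (\<lambda>s. \<Otimes>\<^bsub>B\<^esub>x\<in>U. x [^]\<^bsub>B\<^esub> e s x)"
      \<comment> \<open>On \<open>U - S1\<close> the exponent matrix is diagonal with nonzero
        entries, so independence of \<open>U\<close> passes to the new elements.\<close>
      have "Z_independent_family B (U - S1) k"
        unfolding Z_independent_family_def
      proof (intro conjI allI impI ballI)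
        show "k \<in> U - S1 \<rightarrow> carrier B" using U(1) by (auto simp: k_def intro!: B.finprod_closed)
        fix d :: "_ \<Rightarrow> int" and s
        assume *: "(\<Otimes>\<^bsub>B\<^esub>s\<in>U - S1. k s [^]\<^bsub>B\<^esub> d s) = \<one>\<^bsub>B\<^esub>" and s: "s \<in> U - S1"
        have "(\<Otimes>\<^bsub>B\<^esub>x\<in>U. x [^]\<^bsub>B\<^esub> (\<Sum>s\<in>U - S1. e s x * d s)) = \<one>\<^bsub>B\<^esub>"
          using * U unfolding k_def by (subst (asm) B.finprod_combination[where f = "\<lambda>x. x"]) auto
        then have "(\<Sum>t\<in>U - S1. e t s * d t) = 0"
          using U(3) s unfolding Z_independent_def
          by (elim conjE allE[of _ "\<lambda>x. \<Sum>s\<in>U - S1. e s x * d s"]) blast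
        moreover have "e t s = 0" if "t \<in> U - S1 - {s}" for t using e[of t] that s by auto
        then have "(\<Sum>t\<in>U - S1. e t s * d t) = e s s * d s"
          using s U(2) by (subst sum.remove[of _ s]) auto
        ultimately show "d s = 0" using e[OF s] by simp
      qed
      from B.Z_independent_family_image[OF _ this] U(2)
      have "card (U - S1) = card (k ` (U - S1))" "Z_independent B (k ` (U - S1))"
        by (auto simp: card_image)
      moreover have "k ` (U - S1) \<subseteq> kernel B C f" using e by (auto simp: k_def)
      ultimately show ?thesis using a U(2) unfolding has_rank_def by auto
    qed
    moreover have "card U = card S1 + card (U - S1)"
      using S1(1) U(2) by (metis card_Diff_subset card_mono finS1 le_add_diff_inverse)
    ultimately show ?thesis by linarith
  qed
  moreover have "S \<union> l ` T \<subseteq> carrier B" using SB l by blast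
  ultimately show ?thesis using S(2) T(2) unfolding has_rank_def by blast
qed

text \<open>Lifts of an independent subset of the image form an independent family in
  \<open>B\<close>. So both ranks are bounded by \<open>r\<close> and exist, and
  \<open>rank_kernel_image\<close> forces their sum.\<close>

lemma has_rank_image:
  assumes "comm_group B" "comm_group C" "f \<in> hom B C" and r: "has_rank B (carrier B) r"
  obtains a c where "has_rank B (kernel B C f) a" "has_rank C (f ` carrier B) c" "r = a + c"
proof -
  interpret B: comm_group B by fact
  interpret C: comm_group C by fact
  interpret group_hom B C f using assms(3) by (unfold_locales)
  obtain a where a: "has_rank B (kernel B C f) a"
    by (rule has_rank_subset[OF r, of "kernel B C f"]) (auto simp: kernel_def)
  have bound: "card T \<le> r" if T: "T \<subseteq> f ` carrier B" "finite T" "Z_independent C T" for T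
  proof -
    obtain l where l: "\<And>t. t \<in> T \<Longrightarrow> l t \<in> carrier B \<and> f (l t) = t"
      using T(1) by (metis image_iff subsetD)
    have "Z_independent_family B T l"
      unfolding Z_independent_family_def
    proof (intro conjI allI impI)
      show "l \<in> T \<rightarrow> carrier B" using l by blast
      fix d :: "_ \<Rightarrow> int" assume *: "(\<Otimes>\<^bsub>B\<^esub>i\<in>T. l i [^]\<^bsub>B\<^esub> d i) = \<one>\<^bsub>B\<^esub>"
      have "f (\<Otimes>\<^bsub>B\<^esub>i\<in>T. l i [^]\<^bsub>B\<^esub> d i) = (\<Otimes>\<^bsub>C\<^esub>i\<in>T. f (l i) [^]\<^bsub>C\<^esub> d i)"
        using T l by (intro hom_finprod_int_pow[OF assms(1-3)]) auto
      also have "\<dots> = (\<Otimes>\<^bsub>C\<^esub>i\<in>T. i [^]\<^bsub>C\<^esub> d i)"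
        using T(3) l by (intro C.finprod_cong) (auto simp: simp_implies_def Z_independent_def)
      finally show "\<forall>i\<in>T. d i = 0" using T(3) * unfolding Z_independent_def by (metis hom_one)
    qed
    from B.Z_independent_family_image[OF T(2) this] l T(2) r show ?thesis
      unfolding has_rank_def by (metis card_image finite_imageI image_subsetI)
  qed
  obtain c where c: "has_rank C (f ` carrier B) c" by (rule has_rank_bounded[OF bound])
  show ?thesis using that[OF a c] rank_kernel_image[OF assms(1-3) a c] has_rank_unique r by blast
qed

lemma has_rank_iso:
  assumes "comm_group B" "comm_group C" "B \<cong> C" "has_rank B (carrier B) r"
  shows "has_rank C (carrier C) r"
proof -
  interpret B: comm_group B by fact
  interpret C: comm_group C by fact
  obtain f where f: "f \<in> iso B C" using assms(3) by (auto simp: is_iso_def)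
  then have hom: "f \<in> hom B C" and bij: "bij_betw f (carrier B) (carrier C)" by (auto simp: iso_def)
  interpret group_hom B C f using hom by (unfold_locales)
  have "kernel B C f = {\<one>\<^bsub>B\<^esub>}"
    using bij inj_iff_trivial_ker by (auto simp: bij_betw_def)
  moreover obtain a c where "has_rank B (kernel B C f) a" "has_rank C (f ` carrier B) c" "r = a + c"
    by (rule has_rank_image[OF assms(1,2) hom assms(4)])
  ultimately show ?thesis
    using B.has_rank_trivial has_rank_unique bij by (metis add_0 bij_betw_imp_surj_on)
qed

lemma has_rank_trivial_group:
  assumes "trivial_group A" shows "has_rank A (carrier A) 0"
proof -
  interpret group A using assms by (simp add: trivial_group_def)
  interpret comm_group A
    by (rule group_comm_groupI) (use assms in \<open>auto simp: trivial_group_def\<close>)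
  show ?thesis using has_rank_trivial assms by (simp add: trivial_group_def)
qed

lemma has_rank_integer_group: "has_rank integer_group (carrier integer_group) 1"
proof -
  interpret comm_group integer_group by (rule abelian_integer_group)
  have pow: "x [^]\<^bsub>integer_group\<^esub> n = n * x" for x n :: int by simp
  have "Z_independent integer_group {1}" by (auto simp: Z_independent_def)
  moreover have "card S \<le> 1" if S: "finite S" "Z_independent integer_group S" for S
  proof (rule ccontr)
    assume "\<not> card S \<le> 1"
    then obtain a b where ab: "a \<in> S" "b \<in> S" "a \<noteq> b"
      by (metis One_nat_def S(1) card_le_Suc0_iff_eq)
    \<comment> \<open>Two distinct integers satisfy the relation \<open>b * a - a * b = 0\<close>,
      and one of the exponents is nonzero.\<close>
    define c where "c = (\<lambda>x. if x = a then b else if x = b then - a else 0)"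
    have "(\<Otimes>\<^bsub>integer_group\<^esub>x\<in>S. x [^]\<^bsub>integer_group\<^esub> c x) =
        (\<Otimes>\<^bsub>integer_group\<^esub>x\<in>{a, b}. x [^]\<^bsub>integer_group\<^esub> c x)"
      using ab S(1) by (intro finprod_mono_neutral_cong_right) (auto simp: c_def)
    also have "\<dots> = \<one>\<^bsub>integer_group\<^esub>" using ab(3) by (auto simp: c_def)
    finally have "c a = 0 \<and> c b = 0" using S(2) ab unfolding Z_independent_def by blast
    then show False using ab(3) by (auto simp: c_def split: if_splits)
  qed
  ultimately show ?thesis
    unfolding has_rank_def by (metis (no_types, lifting) One_nat_def carrier_integer_group
        card_1_singleton_iff finite.emptyI finite.insertI subset_UNIV)
qed

section \<open>The Euler characteristic of a pair\<close>

definition has_euler :: "'x topology \<Rightarrow> 'x set \<Rightarrow> int \<Rightarrow> bool"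
  where "has_euler X A e \<longleftrightarrow> (\<exists>h N.
    (\<forall>i. has_rank (relative_homology_group (int i) X A)
            (carrier (relative_homology_group (int i) X A)) (h i)) \<and>
    (\<forall>i\<ge>N. h i = 0) \<and> e = (\<Sum>i<N. (-1) ^ i * int (h i)))"

lemma has_eulerI:
  assumes "\<And>i. has_rank (relative_homology_group (int i) X A)
            (carrier (relative_homology_group (int i) X A)) (h i)"
    and "\<And>i. i \<ge> N \<Longrightarrow> h i = 0" and "e = (\<Sum>i<N. (-1) ^ i * int (h i))"
  shows "has_euler X A e"
  using assms unfolding has_euler_def by blast

lemma euler_characteristic_eq:
  assumes "has_euler X {} e"
  shows "euler_characteristic X = e"
proof -
  obtain h N where h: "\<And>i. has_rank (homology_group (int i) X) (carrier (homology_group (int i) X)) (h i)"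
    and 0: "\<And>i. i \<ge> N \<Longrightarrow> h i = 0" and e: "e = (\<Sum>i<N. (-1) ^ i * int (h i))"
    using assms unfolding has_euler_def by blast
  have "betti_number i X = h i" for i
    unfolding betti_number_def by (rule abelian_group_rank_eq[OF h])
  then have "euler_characteristic X = (\<Sum>i | h i \<noteq> 0. (-1) ^ i * int (h i))"
    by (simp add: euler_characteristic_def)
  also have "\<dots> = e"
    unfolding e
  proof (intro sum.mono_neutral_left)
    show "{i. h i \<noteq> 0} \<subseteq> {..<N}"
    proof
      fix i assume "i \<in> {i. h i \<noteq> 0}"
      then have "\<not> N \<le> i" using 0[of i] by auto
      then show "i \<in> {..<N}" by simp
    qed
  qed auto
  finally show ?thesis .
qed

lemma has_euler_iso:
  assumes "has_euler X A e"
    and "\<And>i. relative_homology_group (int i) X A \<cong> relative_homology_group (int i) Y B"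
  shows "has_euler Y B e"
proof -
  obtain h N where "\<And>i. has_rank (relative_homology_group (int i) X A)
            (carrier (relative_homology_group (int i) X A)) (h i)"
    "\<And>i. i \<ge> N \<Longrightarrow> h i = 0" "e = (\<Sum>i<N. (-1) ^ i * int (h i))"
    using assms(1) unfolding has_euler_def by blast
  then show ?thesis
    by (intro has_eulerI[of Y B h N] has_rank_iso[OF _ _ assms(2)] abelian_relative_homology_group)
qed

text \<open>Exactness of the long sequence gives \<open>ha = k + u\<close>,
  \<open>h = u + v\<close>, and \<open>hd\<close> is \<open>v\<close> plus \<open>k\<close> shifted
  by one degree. The shift makes the ranks \<open>k\<close> of the boundary maps cancel in the
  alternating sum.\<close>

lemma has_euler_pair:
  assumes "has_euler (subtopology W A) {} a" "has_euler W A d"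
  shows "has_euler W {} (a + d)"
proof -
  let ?A = "\<lambda>i::nat. homology_group (int i) (subtopology W A)"
  let ?W = "\<lambda>i::nat. homology_group (int i) W"
  let ?D = "\<lambda>i::nat. relative_homology_group (int i) W A"
  let ?f = "\<lambda>i::nat. hom_induced (int i) (subtopology W A) {} W {} id"
  let ?g = "\<lambda>i::nat. hom_induced (int i) W {} W A id"
  let ?b = "\<lambda>i::nat. hom_boundary (int i) W A"
  note ab = abelian_relative_homology_group
  obtain ha N1 where ha: "\<And>i. has_rank (?A i) (carrier (?A i)) (ha i)"
    and N1: "\<And>i. i \<ge> N1 \<Longrightarrow> ha i = 0" and a: "a = (\<Sum>i<N1. (-1) ^ i * int (ha i))"
    using assms(1) unfolding has_euler_def by blast
  obtain hd N2 where hd: "\<And>i. has_rank (?D i) (carrier (?D i)) (hd i)"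
    and N2: "\<And>i. i \<ge> N2 \<Longrightarrow> hd i = 0" and d: "d = (\<Sum>i<N2. (-1) ^ i * int (hd i))"
    using assms(2) unfolding has_euler_def by blast
  have f: "?f i \<in> hom (?A i) (?W i)" and g: "?g i \<in> hom (?W i) (?D i)" for i
    using homology_exactness_axiom_3[of "int i" W A] by auto
  have b: "?b (Suc i) \<in> hom (?D (Suc i)) (?A i)" for i
    using homology_exactness_axiom_1[of "int (Suc i)" W A] by auto
  have kg: "kernel (?W i) (?D i) (?g i) = ?f i ` carrier (?A i)" for i
    using homology_exactness_axiom_3[of "int i" W A] by auto
  have kb: "kernel (?D (Suc i)) (?A i) (?b (Suc i)) = ?g (Suc i) ` carrier (?W (Suc i))" for i
    using homology_exactness_axiom_1[of "int (Suc i)" W A] by auto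
  have kf: "kernel (?A i) (?W i) (?f i) = ?b (Suc i) ` carrier (?D (Suc i))" for i
    using homology_exactness_axiom_2[of "int (Suc i)" W A] by auto
  \<comment> \<open>In degree 0 the boundary map ends in homology of degree -1, which is trivial. So
    the sequence ends with a surjection, and no \<open>k\<close> contributes to
    \<open>hd 0\<close>.\<close>
  have "kernel (?D 0) (homology_group (int 0 - 1) (subtopology W A)) (?b 0) = ?g 0 ` carrier (?W 0)"
    using homology_exactness_axiom_1[of "int 0" W A] by auto
  moreover have "kernel (?D 0) (homology_group (int 0 - 1) (subtopology W A)) (?b 0) = carrier (?D 0)"
  proof (rule group_hom.kernel_to_trivial_group)
    show "group_hom (?D 0) (homology_group (int 0 - 1) (subtopology W A)) (?b 0)"
      using homology_exactness_axiom_1[of "int 0" W A] by (simp add: group_hom_def group_hom_axioms_def)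
  qed (simp add: trivial_homology_group)
  ultimately have g0: "?g 0 ` carrier (?W 0) = carrier (?D 0)" by simp
  have "\<exists>k u. has_rank (?A i) (?b (Suc i) ` carrier (?D (Suc i))) k \<and>
      has_rank (?W i) (?f i ` carrier (?A i)) u \<and> ha i = k + u" for i
    using has_rank_image[OF ab ab f ha] kf by metis
  then obtain k u where k: "\<And>i. has_rank (?A i) (?b (Suc i) ` carrier (?D (Suc i))) (k i)"
    and u: "\<And>i. has_rank (?W i) (?f i ` carrier (?A i)) (u i)"
    and ku: "\<And>i. ha i = k i + u i" by metis
  have "\<exists>v. has_rank (?D i) (?g i ` carrier (?W i)) v \<and> hd i = v + (case i of 0 \<Rightarrow> 0 | Suc j \<Rightarrow> k j)" for i
  proof (cases i)
    case 0
    then show ?thesis using hd[of 0] g0 by auto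
  next
    case (Suc j)
    obtain v k' where "has_rank (?D (Suc j)) (kernel (?D (Suc j)) (?A j) (?b (Suc j))) v"
      "has_rank (?A j) (?b (Suc j) ` carrier (?D (Suc j))) k'" "hd (Suc j) = v + k'"
      by (rule has_rank_image[OF ab ab b hd])
    then show ?thesis using k[of j] has_rank_unique kb Suc by (metis nat.simps(5))
  qed
  then obtain v where v: "\<And>i. has_rank (?D i) (?g i ` carrier (?W i)) (v i)"
    and vk: "\<And>i. hd i = v i + (case i of 0 \<Rightarrow> 0 | Suc j \<Rightarrow> k j)" by metis
  define h where "h = (\<lambda>i. u i + v i)"
  have h: "has_rank (?W i) (carrier (?W i)) (h i)" for i
    unfolding h_def using u v by (intro rank_kernel_image[OF ab ab g]) (simp_all add: kg)
  define N where "N = max N1 N2"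
  have h0: "h i = 0" if "i \<ge> N" for i
    using N1[of i] N2[of i] ku[of i] vk[of i] that by (simp add: h_def N_def)
  \<comment> \<open>The partial sums cancel up to one term: the last \<open>k\<close>, whose partner
    sits in the next degree.\<close>
  have eu: "(\<Sum>i<n. (-1) ^ i * int (h i)) =
      (\<Sum>i<n. (-1) ^ i * int (ha i)) + (\<Sum>i<n. (-1) ^ i * int (hd i)) +
      (case n of 0 \<Rightarrow> 0 | Suc j \<Rightarrow> (-1) ^ n * int (k j))" for n
  proof (induction n)
    case (Suc n)
    then show ?case
      using ku[of n] vk[of n] by (cases n) (auto simp: h_def algebra_simps)
  qed simp
  have ext: "(\<Sum>i<N. (-1) ^ i * int (r i)) = (\<Sum>i<M. (-1) ^ i * int (r i))"
    if "M \<le> N" "\<And>i. i \<ge> M \<Longrightarrow> r i = 0" for M and r :: "nat \<Rightarrow> nat"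
    using that by (intro sum.mono_neutral_right) auto
  \<comment> \<open>The leftover term vanishes at \<open>N\<close> because it is a summand of the
    relative rank in degree \<open>N\<close>, which is zero.\<close>
  have "(case N of 0 \<Rightarrow> 0 | Suc j \<Rightarrow> (-1) ^ N * int (k j)) = 0"
    using vk[of N] N2[of N] by (cases N) (auto simp: N_def)
  then have eq: "(\<Sum>i<N. (-1) ^ i * int (h i)) = a + d"
    unfolding eu[of N] a d using ext[of N1 ha, OF _ N1] ext[of N2 hd, OF _ N2] by (simp add: N_def)
  show ?thesis by (rule has_eulerI[OF h h0 eq[symmetric]])
qed

section \<open>Coherent topologies\<close>

text \<open>The maps may overlap and need not be injective, which lets the condition pass to
  products and to orbit spaces. They share the parameter space \<open>P\<close> because the
  translates of one cell are attached together. The converse test, from \<open>W\<close> to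
  \<open>A\<close> and \<open>P\<close>, is continuity.\<close>

definition coherent :: "'x topology \<Rightarrow> 'x set \<Rightarrow> 'p topology \<Rightarrow> ('p \<Rightarrow> 'x) set \<Rightarrow> bool"
  where "coherent W A P E \<longleftrightarrow>
    A \<subseteq> topspace W \<and> (\<forall>e\<in>E. continuous_map P W e) \<and>
    topspace W = A \<union> (\<Union>e\<in>E. e ` topspace P) \<and>
    (\<forall>C \<subseteq> topspace W. openin (subtopology W A) (A \<inter> C) \<longrightarrow>
      (\<forall>e\<in>E. openin P {x \<in> topspace P. e x \<in> C}) \<longrightarrow> openin W C)"

lemma coherentD:
  assumes "coherent W A P E"
  shows "A \<subseteq> topspace W" "\<And>e. e \<in> E \<Longrightarrow> continuous_map P W e"
    "topspace W = A \<union> (\<Union>e\<in>E. e ` topspace P)"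
    "\<And>C. C \<subseteq> topspace W \<Longrightarrow> openin (subtopology W A) (A \<inter> C) \<Longrightarrow>
      (\<And>e. e \<in> E \<Longrightarrow> openin P {x \<in> topspace P. e x \<in> C}) \<Longrightarrow> openin W C"
proof -
  show "A \<subseteq> topspace W" "\<And>e. e \<in> E \<Longrightarrow> continuous_map P W e"
    "topspace W = A \<union> (\<Union>e\<in>E. e ` topspace P)"
    using assms unfolding coherent_def by blast+
  show "openin W C" if "C \<subseteq> topspace W" "openin (subtopology W A) (A \<inter> C)"
      "\<And>e. e \<in> E \<Longrightarrow> openin P {x \<in> topspace P. e x \<in> C}" for C
    using assms that unfolding coherent_def by simp
qed

lemma coherent_continuous_map:
  assumes W: "coherent W A P E" and A: "continuous_map (subtopology W A) X f"
    and E: "\<And>e. e \<in> E \<Longrightarrow> continuous_map P X (f \<circ> e)"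
  shows "continuous_map W X f"
  unfolding continuous_map_def
proof (intro conjI allI impI)
  note D = coherentD[OF W]
  show "f \<in> topspace W \<rightarrow> topspace X"
  proof
    fix w assume "w \<in> topspace W"
    then consider "w \<in> A" | e x where "e \<in> E" "x \<in> topspace P" "w = e x"
      unfolding D(3) by blast
    then show "f w \<in> topspace X"
    proof cases
      case 1
      then have "w \<in> topspace (subtopology W A)" using D(1) by auto
      then show ?thesis using A by (auto simp: continuous_map_def)
    next
      case 2
      then show ?thesis using E[of e] by (auto simp: continuous_map_def)
    qed
  qed
  fix U assume U: "openin X U"
  show "openin W {x \<in> topspace W. f x \<in> U}"
  proof (rule D(4))
    have "A \<inter> {x \<in> topspace W. f x \<in> U} = {x \<in> topspace (subtopology W A). f x \<in> U}" by auto
    then show "openin (subtopology W A) (A \<inter> {x \<in> topspace W. f x \<in> U})"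
      using openin_continuous_map_preimage[OF A U] by simp
    fix e assume e: "e \<in> E"
    have "{x \<in> topspace P. e x \<in> {x \<in> topspace W. f x \<in> U}} = {x \<in> topspace P. (f \<circ> e) x \<in> U}"
      using D(2)[OF e] by (auto simp: continuous_map_def)
    then show "openin P {x \<in> topspace P. e x \<in> {x \<in> topspace W. f x \<in> U}}"
      using openin_continuous_map_preimage[OF E[OF e] U] by simp
  qed auto
qed

text \<open>The tube lemma: the complement is the projection of a closed set along a compact factor,
  and such projections are closed maps.\<close>

lemma openin_slices_compact:
  assumes "openin (prod_topology Z X) S" "compactin Z K"
  shows "openin X {x \<in> topspace X. \<forall>z\<in>K. (z, x) \<in> S}"
proof -
  have KZ: "K \<subseteq> topspace Z" using assms(2) by (rule compactin_subset_topspace)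
  have "S \<subseteq> topspace Z \<times> topspace X" using openin_subset[OF assms(1)] by simp
  have "compact_space (subtopology Z K)" using assms(2) by (simp add: compactin_subspace)
  then have cl: "closed_map (prod_topology (subtopology Z K) X) X snd"
    by (rule Abstract_Topological_Spaces.closed_map_snd)
  have "openin (prod_topology (subtopology Z K) X) ((K \<times> topspace X) \<inter> S)"
    using assms(1) by (simp add: prod_topology_subtopology openin_subtopology_Int2)
  then have "closedin (prod_topology (subtopology Z K) X)
      (topspace (prod_topology (subtopology Z K) X) - (K \<times> topspace X) \<inter> S)"
    by (rule closedin_diff[OF closedin_topspace])
  then have "closedin X (snd ` (topspace (prod_topology (subtopology Z K) X) - (K \<times> topspace X) \<inter> S))"
    using cl by (simp add: closed_map_def)
  moreover have "{x \<in> topspace X. \<forall>z\<in>K. (z, x) \<in> S} =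
      topspace X - snd ` (topspace (prod_topology (subtopology Z K) X) - (K \<times> topspace X) \<inter> S)"
    using KZ by (force simp: image_iff)
  ultimately show ?thesis by (simp add: openin_diff)
qed

text \<open>A product with a locally compact space preserves coherence; this is what makes cellwise defined
  homotopies continuous.\<close>

lemma coherent_prod:
  assumes W: "coherent W A P E" and Z: "locally_compact_space Z" "Hausdorff_space Z"
  shows "coherent (prod_topology Z W) (topspace Z \<times> A) (prod_topology Z P) ((\<lambda>e (z, x). (z, e x)) ` E)"
proof -
  note D = coherentD[OF W]
  let ?Q = "prod_topology Z W"
  have sub: "subtopology ?Q (topspace Z \<times> A) = prod_topology Z (subtopology W A)"
    by (simp add: prod_topology_subtopology)
  have cont: "continuous_map (prod_topology Z P) ?Q (\<lambda>(z, x). (z, e x))" if "e \<in> E" for e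
    unfolding case_prod_unfold
    by (intro continuous_map_pairedI continuous_map_fst continuous_map_compose[OF continuous_map_snd D(2)[OF that], unfolded o_def])
  have top: "topspace ?Q = topspace Z \<times> A \<union>
      (\<Union>e\<in>(\<lambda>e (z, x). (z, e x)) ` E. e ` topspace (prod_topology Z P))"
    unfolding topspace_prod_topology D(3) by (auto simp: image_iff)
  have op: "openin ?Q T" if T: "T \<subseteq> topspace ?Q"
    and TA: "openin (prod_topology Z (subtopology W A)) (topspace Z \<times> A \<inter> T)"
    and TE: "\<And>e. e \<in> E \<Longrightarrow> openin (prod_topology Z P) {u \<in> topspace (prod_topology Z P). (fst u, e (snd u)) \<in> T}"
    for T
  proof (subst openin_subopen, intro ballI)
    fix u assume "u \<in> T"
    obtain z0 w0 where u: "u = (z0, w0)" by force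
    have z0: "z0 \<in> topspace Z" and w0: "w0 \<in> topspace W" using T \<open>u \<in> T\<close> u by auto
    have slice: "openin Z {z \<in> topspace Z. (z, w0) \<in> T}"
    proof -
      consider "w0 \<in> A" | e x where "e \<in> E" "x \<in> topspace P" "w0 = e x"
        using w0 unfolding D(3) by blast
      then show ?thesis
      proof cases
        case 1
        then have "continuous_map Z (prod_topology Z (subtopology W A)) (\<lambda>z. (z, w0))"
          using D(1) by (auto simp: continuous_map_paired continuous_map_id[unfolded id_def])
        from openin_continuous_map_preimage[OF this TA] show ?thesis using 1 by (simp cong: conj_cong)
      next
        case 2
        then have "continuous_map Z (prod_topology Z P) (\<lambda>z. (z, x))"
          by (auto simp: continuous_map_paired continuous_map_id[unfolded id_def])
        from openin_continuous_map_preimage[OF this TE[OF 2(1)]] show ?thesis using 2 by (simp cong: conj_cong)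
      qed
    qed
    have "neighbourhood_base_of (compactin Z) Z"
      using Z locally_compact_space_neighbourhood_base by blast
    then obtain U K where UK: "openin Z U" "compactin Z K" "z0 \<in> U" "U \<subseteq> K" "K \<subseteq> {z \<in> topspace Z. (z, w0) \<in> T}"
      using slice z0 u \<open>u \<in> T\<close> unfolding neighbourhood_base_of by (metis (no_types, lifting) mem_Collect_eq)
    \<comment> \<open>The box around the given point has as first side a neighbourhood inside the
      compact set \<open>K\<close>, taken from the slice through \<open>w0\<close>, and as second
      side all points whose slice contains \<open>K\<close>. Openness of \<open>V\<close> is then a
      question about \<open>W\<close> alone, to which coherence applies.\<close>
    define V where "V = {w \<in> topspace W. \<forall>z\<in>K. (z, w) \<in> T}"
    have KZ: "K \<subseteq> topspace Z" using UK(2) by (rule compactin_subset_topspace)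
    have "openin W V"
    proof (rule D(4))
      have "A \<inter> V = {x \<in> topspace (subtopology W A). \<forall>z\<in>K. (z, x) \<in> topspace Z \<times> A \<inter> T}"
        using KZ D(1) by (auto simp: V_def)
      then show "openin (subtopology W A) (A \<inter> V)"
        using openin_slices_compact[OF TA UK(2)] by simp
      fix e assume e: "e \<in> E"
      have "{x \<in> topspace P. e x \<in> V} = {x \<in> topspace P. \<forall>z\<in>K. (z, x) \<in>
          {u \<in> topspace (prod_topology Z P). (fst u, e (snd u)) \<in> T}}"
        using KZ D(2)[OF e] by (auto simp: V_def continuous_map_def)
      then show "openin P {x \<in> topspace P. e x \<in> V}"
        using openin_slices_compact[OF TE[OF e] UK(2)] by simp
    qed (auto simp: V_def)
    then have "openin ?Q (U \<times> V)" using UK(1) by (simp add: openin_prod_Times_iff)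
    moreover have "u \<in> U \<times> V" using UK w0 u by (auto simp: V_def)
    moreover have "U \<times> V \<subseteq> T" using UK(4) by (auto simp: V_def)
    ultimately show "\<exists>Q. openin ?Q Q \<and> u \<in> Q \<and> Q \<subseteq> T" by blast
  qed
  show ?thesis
    unfolding coherent_def
  proof (intro conjI ballI allI impI)
    show "topspace Z \<times> A \<subseteq> topspace ?Q" using D(1) by auto
    show "continuous_map (prod_topology Z P) ?Q e" if "e \<in> (\<lambda>e (z, x). (z, e x)) ` E" for e
      using that cont by auto
    show "openin ?Q T" if T: "T \<subseteq> topspace ?Q"
        "openin (subtopology ?Q (topspace Z \<times> A)) (topspace Z \<times> A \<inter> T)"
        "\<forall>e\<in>(\<lambda>e (z, x). (z, e x)) ` E. openin (prod_topology Z P) {x \<in> topspace (prod_topology Z P). e x \<in> T}"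
      for T
      using T by (intro op) (auto simp: sub case_prod_unfold)
  qed (rule top)
qed

section \<open>Discs\<close>

abbreviation disc_norm :: "nat \<Rightarrow> (nat \<Rightarrow> real) \<Rightarrow> real"
  where "disc_norm n x \<equiv> sqrt (\<Sum>i<n. x i ^ 2)"

lemma unit_disc_eq: "unit_disc n = subtopology (powertop_real UNIV) {x. (\<forall>i\<ge>n. x i = 0) \<and> disc_norm n x \<le> 1}"
  by (simp add: unit_disc_def Euclidean_space_def subtopology_subtopology Collect_conj_eq)

lemma topspace_unit_disc: "topspace (unit_disc n) = {x. (\<forall>i\<ge>n. x i = 0) \<and> disc_norm n x \<le> 1}"
  by (simp add: unit_disc_eq)

lemma disc_boundary_eq: "disc_boundary n = {x \<in> topspace (unit_disc n). disc_norm n x = 1}"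
  by (simp add: disc_boundary_def)

lemma disc_interior_eq: "disc_interior n = {x \<in> topspace (unit_disc n). disc_norm n x < 1}"
  by (simp add: disc_interior_def)

lemma disc_interior_boundary:
  "disc_interior n \<inter> disc_boundary n = {}" "topspace (unit_disc n) = disc_interior n \<union> disc_boundary n"
  by (auto simp: disc_boundary_eq disc_interior_eq topspace_unit_disc)

lemma continuous_map_unit_disc_iff:
  "continuous_map X (unit_disc n) f \<longleftrightarrow>
    (\<forall>k. continuous_map X euclideanreal (\<lambda>x. f x k)) \<and> f \<in> topspace X \<rightarrow> topspace (unit_disc n)"
  unfolding unit_disc_eq
  by (simp add: continuous_map_in_subtopology continuous_map_componentwise_UNIV)

lemma continuous_map_unit_disc_proj: "continuous_map (unit_disc n) euclideanreal (\<lambda>x. x k)"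
  unfolding unit_disc_eq by (intro continuous_intros) auto

lemma continuous_map_disc_norm: "continuous_map (unit_disc n) euclideanreal (disc_norm n)"
  by (intro continuous_map_sqrt continuous_map_sum continuous_map_real_pow continuous_map_unit_disc_proj) auto

lemma disc_norm_scale: "disc_norm n (\<lambda>i. x i * c) = disc_norm n x * \<bar>c\<bar>"
  by (simp add: power_mult_distrib real_sqrt_mult flip: sum_distrib_right)

lemma unit_disc_scale:
  assumes "x \<in> topspace (unit_disc n)" "\<bar>disc_norm n x * c\<bar> \<le> 1"
  shows "(\<lambda>i. x i * c) \<in> topspace (unit_disc n)"
proof -
  have "disc_norm n (\<lambda>i. x i * c) \<le> 1"
    unfolding disc_norm_scale using assms(2) by (simp add: abs_mult sum_nonneg)
  then show ?thesis using assms(1) by (simp add: topspace_unit_disc)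
qed

lemma contractible_unit_disc: "contractible_space (unit_disc n)"
proof -
  let ?I = "top_of_set {0..1::real}"
  have "continuous_map (prod_topology ?I (unit_disc n)) (unit_disc n) (\<lambda>(t, x). \<lambda>i. x i * (1 - t))"
    unfolding continuous_map_unit_disc_iff
  proof (intro conjI allI Pi_I)
    fix k
    have "continuous_map (prod_topology ?I (unit_disc n)) euclideanreal (\<lambda>u. snd u k)"
      using continuous_map_compose[OF continuous_map_snd continuous_map_unit_disc_proj] by (simp add: o_def)
    moreover have "continuous_map (prod_topology ?I (unit_disc n)) euclideanreal fst"
      by (rule continuous_map_into_fulltopology[OF continuous_map_fst])
    ultimately show "continuous_map (prod_topology ?I (unit_disc n)) euclideanreal
        (\<lambda>u. (case u of (t, x) \<Rightarrow> \<lambda>i. x i * (1 - t)) k)"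
      unfolding case_prod_unfold by (intro continuous_intros) auto
  next
    fix u assume u: "u \<in> topspace (prod_topology ?I (unit_disc n))"
    obtain t x where tx: "u = (t, x)" by force
    have t: "0 \<le> t" "t \<le> 1" and x: "x \<in> topspace (unit_disc n)" using u tx by auto
    have "disc_norm n x \<le> 1" "0 \<le> disc_norm n x" using x by (auto simp: topspace_unit_disc sum_nonneg)
    then have "disc_norm n x * (1 - t) \<le> 1 * 1" using t by (intro mult_mono) auto
    moreover have "0 \<le> disc_norm n x * (1 - t)" using t by (simp add: sum_nonneg)
    ultimately show "(case u of (t, x) \<Rightarrow> \<lambda>i. x i * (1 - t)) \<in> topspace (unit_disc n)"
      unfolding tx prod.case using x by (intro unit_disc_scale) auto
  qed
  then show ?thesis
    unfolding contractible_space_def homotopic_with_def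
    by (intro exI[of _ "\<lambda>_. 0"] exI[of _ "\<lambda>(t, x). \<lambda>i. x i * (1 - t)"]) auto
qed

text \<open>In positive dimension, contractibility of the disc identifies its homology relative to
  the boundary with the reduced homology of a sphere, one degree lower. In dimension 0 the boundary
  is empty and the disc is a point.\<close>

lemma has_euler_disc: "has_euler (unit_disc n) (disc_boundary n) ((-1) ^ n)"
proof -
  let ?H = "\<lambda>i. relative_homology_group (int i) (unit_disc n) (disc_boundary n)"
  have rank: "has_rank (?H i) (carrier (?H i)) (if i = n then 1 else 0)" for i
  proof (cases n)
    case 0
    have top: "topspace (unit_disc 0) = {\<lambda>_. 0}" by (auto simp: topspace_unit_disc)
    have bd: "disc_boundary 0 = {}" by (simp add: disc_boundary_def)
    have "path_connected_space (unit_disc 0)"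
      by (rule contractible_imp_path_connected_space[OF contractible_unit_disc])
    then have "homology_group 0 (unit_disc 0) \<cong> integer_group"
      using top by (simp add: isomorphic_integer_zeroth_homology_group)
    then have "has_rank (homology_group 0 (unit_disc 0)) (carrier (homology_group 0 (unit_disc 0))) 1"
      using has_rank_iso[OF abelian_integer_group abelian_relative_homology_group _ has_rank_integer_group]
      using group.iso_sym[OF group_relative_homology_group] by blast
    moreover have "has_rank (?H i) (carrier (?H i)) 0" if "i \<noteq> 0"
      using homology_dimension_axiom[OF top, of "int i"] that 0 bd
      by (intro has_rank_trivial_group) auto
    ultimately show ?thesis using 0 bd by auto
  next
    case (Suc m)
    \<comment> \<open>The comparison with reduced homology requires a nonempty subspace; the first
      unit vector lies on the boundary.\<close>
    have "(\<lambda>k. if k = 0 then 1 else 0) \<in> topspace (unit_disc n) \<inter> disc_boundary n"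
      using Suc by (simp add: disc_boundary_eq topspace_unit_disc power2_eq_square if_distrib[of "\<lambda>x. x * _"] cong: if_cong)
    then have "?H i \<cong> reduced_homology_group (int i - 1) (subtopology (unit_disc n) (disc_boundary n))"
      by (intro isomorphic_group_relative_homology_of_contractible contractible_unit_disc) blast
    moreover have "subtopology (unit_disc n) (disc_boundary n) = nsphere m"
    proof -
      have "topspace (Euclidean_space n) \<inter> ({x. (\<Sum>i<n. x i ^ 2) \<le> 1} \<inter> disc_boundary n) =
          topspace (Euclidean_space n) \<inter> {x. (\<Sum>i\<le>m. x i ^ 2) = 1}"
        by (auto simp: disc_boundary_def unit_disc_def lessThan_Suc_atMost Suc)
      then show ?thesis
        unfolding nsphere_def unit_disc_def subtopology_subtopology Suc by (metis subtopology_restrict)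
    qed
    ultimately have iso: "?H i \<cong> reduced_homology_group (int i - 1) (nsphere m)" by simp
    show ?thesis
    proof (cases "i = n")
      case True
      then have "?H i \<cong> integer_group"
        using iso reduced_homology_group_nsphere(1)[of m] Suc by (auto intro: iso_trans)
      then show ?thesis
        using True by (auto intro!: has_rank_iso[OF abelian_integer_group abelian_relative_homology_group _
              has_rank_integer_group, unfolded One_nat_def] group.iso_sym[OF group_relative_homology_group])
    next
      case False
      then have "trivial_group (reduced_homology_group (int i - 1) (nsphere m))"
        using Suc by (intro reduced_homology_group_nsphere(2)) auto
      then have "trivial_group (?H i)"
        using iso isomorphic_group_triviality by (metis group_reduced_homology_group group_relative_homology_group)
      then show ?thesis using False has_rank_trivial_group by auto
    qed
  qed
  have "(\<Sum>i<Suc n. (-1) ^ i * int (if i = n then 1 else 0)) = (-1) ^ n"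
    by (simp add: if_distrib[of int] if_distrib[of "\<lambda>x. _ * x"] cong: if_cong)
  then show ?thesis by (intro has_eulerI[OF rank, of "Suc n"]) auto
qed

section \<open>Attaching a cell\<close>

definition cell_attached :: "'x topology \<Rightarrow> 'x set \<Rightarrow> nat \<Rightarrow> ((nat \<Rightarrow> real) \<Rightarrow> 'x) \<Rightarrow> bool"
  where "cell_attached W A n e \<longleftrightarrow> coherent W A (unit_disc n) {e} \<and> e ` disc_boundary n \<subseteq> A \<and>
    inj_on e (disc_interior n) \<and> e ` disc_interior n \<inter> A = {}"

text \<open>The case to compare with: every attachment of an \<open>n\<close>-cell leads to the same
  pair in the open disc, and in this one the relative homology is known.\<close>

lemma cell_attached_disc: "cell_attached (unit_disc n) (disc_boundary n) n id"
proof -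
  let ?D = "unit_disc n"
  have "openin ?D C" if "C \<subseteq> topspace ?D" "openin ?D {x \<in> topspace ?D. id x \<in> C}" for C
  proof -
    have "{x \<in> topspace ?D. id x \<in> C} = C" using that(1) by auto
    then show ?thesis using that(2) by simp
  qed
  then show ?thesis
    using disc_interior_boundary[of n] unfolding cell_attached_def coherent_def by auto
qed

text \<open>Pushing the outer shell of the cell onto its boundary shows that \<open>A\<close> may be replaced by a
  neighbourhood of \<open>A\<close>, and then \<open>A\<close> can be excised.\<close>

lemma cell_attached_homology_interior:
  assumes att: "cell_attached W A n e"
  shows "relative_homology_group p W A \<cong>
    relative_homology_group p (subtopology (unit_disc n) (disc_interior n))
      {x \<in> disc_interior n. 1/2 \<le> disc_norm n x}"
proof -
  let ?I = "top_of_set {0..1::real}"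
  let ?D = "unit_disc n"
  have coh: "coherent W A ?D {e}" and bd: "e ` disc_boundary n \<subseteq> A"
    and inj: "inj_on e (disc_interior n)" and disj: "e ` disc_interior n \<inter> A = {}"
    using att by (auto simp: cell_attached_def)
  note D = coherentD[OF coh]
  have e: "continuous_map ?D W e" using D(2) by simp
  \<comment> \<open>The factor is 1 at time 0 and \<open>1 / max (1/2) (disc_norm n x)\<close> at
    time 1: points of norm at least 1/2 reach the boundary, and the inner ball is doubled. Boundary
    points keep the factor 1 at all times, so the motion can rest on \<open>A\<close>.\<close>
  define s where "s = (\<lambda>t x. (1 - t) + t / max (1/2) (disc_norm n x))"
  define \<theta> where "\<theta> = (\<lambda>(t, x). \<lambda>i::nat. x i * s t x)"
  \<comment> \<open>Off \<open>A\<close> a point has exactly one preimage in the open disc, so the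
    motion of the disc can be transported. \<open>He\<close> shows that the formula remains correct
    along the boundary, where the first branch applies.\<close>
  define H where "H = (\<lambda>(t, w). if w \<in> A then w else e (\<theta> (t, inv_into (disc_interior n) e w)))"
  define U where "U = A \<union> e ` {x \<in> topspace ?D. 1/2 \<le> disc_norm n x}"
  have nn: "0 \<le> disc_norm n x" for x by (simp add: sum_nonneg)
  have s_ge: "1 \<le> s t x" if "t \<in> {0..1}" "x \<in> topspace ?D" for t x
  proof -
    have "max (1/2) (disc_norm n x) \<le> 1" using that(2) by (auto simp: topspace_unit_disc)
    then have "1 \<le> 1 / max (1/2) (disc_norm n x)" by (auto simp: field_simps)
    then have "t * 1 \<le> t * (1 / max (1/2) (disc_norm n x))" using that(1) by (intro mult_left_mono) auto
    then show ?thesis by (simp add: s_def)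
  qed
  have s_le: "disc_norm n x * s t x \<le> 1" if "t \<in> {0..1}" "x \<in> topspace ?D" for t x
  proof -
    have "disc_norm n x \<le> 1" using that(2) by (auto simp: topspace_unit_disc)
    moreover have "disc_norm n x / max (1/2) (disc_norm n x) \<le> 1" by (simp add: divide_le_eq)
    ultimately have "(1 - t) * disc_norm n x + t * (disc_norm n x / max (1/2) (disc_norm n x)) \<le> (1 - t) * 1 + t * 1"
      using that(1) by (intro add_mono mult_left_mono) auto
    then show ?thesis by (simp add: s_def algebra_simps)
  qed
  have \<theta>_norm: "disc_norm n (\<theta> (t, x)) = disc_norm n x * s t x" if "t \<in> {0..1}" "x \<in> topspace ?D" for t x
    unfolding \<theta>_def prod.case disc_norm_scale using s_ge[OF that] by simp
  have \<theta>_D: "\<theta> (t, x) \<in> topspace ?D" if "t \<in> {0..1}" "x \<in> topspace ?D" for t x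
    unfolding \<theta>_def prod.case
  proof (rule unit_disc_scale[OF that(2)])
    have "0 \<le> s t x" using s_ge[OF that] by simp
    then have "0 \<le> disc_norm n x * s t x" by (intro mult_nonneg_nonneg nn)
    then show "\<bar>disc_norm n x * s t x\<bar> \<le> 1" using s_le[OF that] by simp
  qed
  have \<theta>_bd: "\<theta> (t, x) = x" if "t \<in> {0..1}" "x \<in> disc_boundary n" for t x
    using that by (simp add: \<theta>_def s_def disc_boundary_eq)
  have \<theta>_1: "\<theta> (1, x) \<in> disc_boundary n" if "x \<in> topspace ?D" "1/2 \<le> disc_norm n x" for x
  proof -
    have "disc_norm n (\<theta> (1, x)) = 1"
      using that by (subst \<theta>_norm) (auto simp: s_def max_def)
    then show ?thesis using \<theta>_D[of 1 x] that by (simp add: disc_boundary_eq)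
  qed
  have \<theta>_cont: "continuous_map (prod_topology ?I ?D) ?D \<theta>"
    unfolding continuous_map_unit_disc_iff
  proof (intro conjI allI Pi_I)
    fix k
    have "continuous_map (prod_topology ?I ?D) euclideanreal (\<lambda>u. snd u k)"
      using continuous_map_compose[OF continuous_map_snd continuous_map_unit_disc_proj] by (simp add: o_def)
    moreover have "continuous_map (prod_topology ?I ?D) euclideanreal fst"
      by (rule continuous_map_into_fulltopology[OF continuous_map_fst])
    moreover have "continuous_map (prod_topology ?I ?D) euclideanreal (\<lambda>u. disc_norm n (snd u))"
      using continuous_map_compose[OF continuous_map_snd continuous_map_disc_norm] by (simp add: o_def)
    ultimately show "continuous_map (prod_topology ?I ?D) euclideanreal (\<lambda>u. \<theta> u k)"
      unfolding \<theta>_def s_def case_prod_unfold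
      by (intro continuous_map_real_mult continuous_map_add continuous_map_diff continuous_map_real_divide
          continuous_map_real_max) auto
  next
    fix u assume "u \<in> topspace (prod_topology ?I ?D)"
    then show "\<theta> u \<in> topspace ?D" using \<theta>_D by (cases u) auto
  qed
  have He: "H (t, e x) = e (\<theta> (t, x))" if "t \<in> {0..1}" "x \<in> topspace ?D" for t x
  proof (cases "x \<in> disc_interior n")
    case True
    then have "e x \<notin> A" using disj by blast
    then show ?thesis using True inj by (simp add: H_def)
  next
    case False
    then have "x \<in> disc_boundary n" using that disc_interior_boundary by blast
    then show ?thesis using bd \<theta>_bd that by (auto simp: H_def)
  qed
  \<comment> \<open>Coherence of the product reduces continuity to the part over \<open>A\<close>,
    where \<open>H\<close> is the projection, and to the cell, where it is
    \<open>e \<circ> \<theta>\<close>.\<close>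
  have H_cont: "continuous_map (prod_topology ?I W) W H"
  proof (rule coherent_continuous_map[OF coherent_prod[OF coh]])
    show "locally_compact_space ?I" "Hausdorff_space ?I"
      by (auto intro: compact_imp_locally_compact_space Hausdorff_space_subtopology simp: compact_space_subtopology)
    show "continuous_map (subtopology (prod_topology ?I W) (topspace ?I \<times> A)) W H"
    proof (rule continuous_map_eq)
      show "continuous_map (subtopology (prod_topology ?I W) (topspace ?I \<times> A)) W snd"
        by (intro continuous_map_from_subtopology continuous_map_snd)
    qed (auto simp: H_def)
    fix f :: "real \<times> (nat \<Rightarrow> real) \<Rightarrow> real \<times> 'a"
    assume "f \<in> (\<lambda>e (z, x). (z, e x)) ` {e}"
    then have f: "f = (\<lambda>(z, x). (z, e x))" by simp
    show "continuous_map (prod_topology ?I ?D) W (H \<circ> f)"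
    proof (rule continuous_map_eq[OF continuous_map_compose[OF \<theta>_cont e]])
      fix u assume "u \<in> topspace (prod_topology ?I ?D)"
      then show "(e \<circ> \<theta>) u = (H \<circ> f) u" using He by (auto simp: f)
    qed
  qed
  have H0: "H (0, w) = w" if "w \<in> topspace W" for w
  proof (cases "w \<in> A")
    case False
    then have "w \<in> e ` topspace ?D" using that D(3) by simp
    then obtain x where x: "x \<in> topspace ?D" "w = e x" by blast
    then show ?thesis using He[of 0 x] by (simp add: \<theta>_def s_def)
  qed (simp add: H_def)
  have UW: "U \<subseteq> topspace W" using D(1) e by (auto simp: U_def continuous_map_def)
  have HA: "H (t, w) \<in> A" if "w \<in> A" for t w using that by (simp add: H_def)
  have HU: "H (t, w) \<in> U" if tw: "t \<in> {0..1}" "w \<in> U" for t w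
  proof (cases "w \<in> A")
    case False
    then obtain x where x: "x \<in> topspace ?D" "w = e x" "1/2 \<le> disc_norm n x"
      using tw(2) by (auto simp: U_def)
    have "disc_norm n x * 1 \<le> disc_norm n x * s t x" by (intro mult_left_mono s_ge[OF tw(1) x(1)] nn)
    then have "1/2 \<le> disc_norm n (\<theta> (t, x))" using x \<theta>_norm[OF tw(1) x(1)] by simp
    then show ?thesis using He[OF tw(1) x(1)] \<theta>_D[OF tw(1) x(1)] x(2) by (auto simp: U_def)
  qed (use HA in \<open>auto simp: U_def\<close>)
  have H1: "H (1, w) \<in> A" if w: "w \<in> U" for w
  proof (cases "w \<in> A")
    case False
    then obtain x where x: "x \<in> topspace ?D" "w = e x" "1/2 \<le> disc_norm n x"
      using w by (auto simp: U_def)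
    then show ?thesis using He[of 1 x] \<theta>_1[of x] bd by auto
  qed (use HA in auto)
  have r: "continuous_map W W (\<lambda>w. H (1, w))"
  proof -
    have "continuous_map W (prod_topology ?I W) (\<lambda>w. (1, w))"
      by (auto simp: continuous_map_paired continuous_map_id[unfolded id_def])
    from continuous_map_compose[OF this H_cont] show ?thesis by (simp add: o_def)
  qed
  have hom: "homotopic_with (\<lambda>h. h \<in> S \<rightarrow> S) W W (\<lambda>w. H (1, w)) id"
    if S: "\<And>t w. t \<in> {0..1} \<Longrightarrow> w \<in> S \<Longrightarrow> H (t, w) \<in> S" "S \<subseteq> topspace W" for S
  proof (rule homotopic_with_symD)
    show "homotopic_with (\<lambda>h. h \<in> S \<rightarrow> S) W W id (\<lambda>w. H (1, w))"
    proof (subst homotopic_with)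
      show "(h \<in> S \<rightarrow> S) = (k \<in> S \<rightarrow> S)" if "\<And>x. x \<in> topspace W \<Longrightarrow> h x = k x" for h k
        using S(2) that by (auto simp: Pi_iff subset_iff)
      show "\<exists>h. continuous_map (prod_topology ?I W) W h \<and> (\<forall>x\<in>topspace W. h (0, x) = id x) \<and>
          (\<forall>x\<in>topspace W. h (1, x) = H (1, x)) \<and> (\<forall>t\<in>{0..1}. (\<lambda>x. h (t, x)) \<in> S \<rightarrow> S)"
        using H_cont H0 S(1) by (intro exI[of _ H]) auto
    qed
  qed
  have 1: "relative_homology_group p W A \<cong> relative_homology_group p W U"
  proof (rule homotopy_equivalent_space_imp_isomorphic_relative_homology_groups)
    show "continuous_map W W id" "continuous_map W W (\<lambda>w. H (1, w))" by (simp_all add: r)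
    show "id \<in> A \<rightarrow> U" by (auto simp: U_def)
    show "(\<lambda>w. H (1, w)) \<in> U \<rightarrow> A" using H1 by auto
    show "homotopic_with (\<lambda>h. h \<in> A \<rightarrow> A) W W ((\<lambda>w. H (1, w)) \<circ> id) id"
      using hom[of A] HA D(1) by simp
    show "homotopic_with (\<lambda>h. h \<in> U \<rightarrow> U) W W (id \<circ> (\<lambda>w. H (1, w))) id"
      using hom[of U] HU UW by (simp add: o_def)
  qed

  have pre: "openin ?D {x \<in> topspace ?D. disc_norm n x \<in> T}" if "open T" for T
    by (rule openin_continuous_map_preimage[OF continuous_map_disc_norm]) (use that in simp)
  have int_open: "openin ?D (disc_interior n)"
    using pre[of "{..<1}"] by (simp add: disc_interior_eq)
  have not_A: "e x \<in> topspace W - A" if "x \<in> disc_interior n" for x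
    using that e disj disc_interior_boundary(2)[of n] unfolding continuous_map_def by blast
  have in_int: "x \<in> disc_interior n" if "x \<in> topspace ?D" "e x \<notin> A" for x
    using that bd disc_interior_boundary(2)[of n] by blast
  have openA: "openin W (topspace W - A)"
  proof (rule D(4))
    have "{x \<in> topspace ?D. e x \<in> topspace W - A} = disc_interior n"
      using not_A in_int disc_interior_boundary(2)[of n] by blast
    then show "openin ?D {x \<in> topspace ?D. f x \<in> topspace W - A}" if "f \<in> {e}" for f
      using int_open that by simp
  qed auto
  \<comment> \<open>An open collar between \<open>A\<close> and \<open>U\<close>: it places the
    closure of \<open>A\<close> in the interior of \<open>U\<close>, as excision demands.\<close>
  define V where "V = A \<union> e ` {x \<in> topspace ?D. 1/2 < disc_norm n x}"
  have "openin W V"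
  proof (rule D(4))
    show VW: "V \<subseteq> topspace W" using D(1) e by (auto simp: V_def continuous_map_def)
    have "A \<inter> V = A" by (auto simp: V_def)
    then show "openin (subtopology W A) (A \<inter> V)" using D(1) by (simp add: openin_subtopology_refl)
    have "x \<in> topspace ?D \<Longrightarrow> e x \<in> V \<Longrightarrow> 1/2 < disc_norm n x" for x
    proof (cases "x \<in> disc_interior n")
      case True
      assume "e x \<in> V"
      then obtain y where y: "y \<in> topspace ?D" "1/2 < disc_norm n y" "e x = e y"
        using True disj by (auto simp: V_def)
      then have "y \<in> disc_interior n" using in_int[OF y(1)] not_A[OF True] by simp
      then show ?thesis using inj True y by (auto dest: inj_onD)
    next
      case False
      assume "x \<in> topspace ?D"
      then have "x \<in> disc_boundary n" using False disc_interior_boundary(2)[of n] by blast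
      then show ?thesis by (simp add: disc_boundary_eq)
    qed
    then have "{x \<in> topspace ?D. e x \<in> V} = {x \<in> topspace ?D. disc_norm n x \<in> {1/2<..}}"
      by (auto simp: V_def)
    then show "openin ?D {x \<in> topspace ?D. f x \<in> V}" if "f \<in> {e}" for f
      using pre[of "{1/2<..}"] that by simp
  qed
  moreover have "V \<subseteq> U" by (auto simp: U_def V_def)
  ultimately have "V \<subseteq> W interior_of U" by (simp add: interior_of_maximal)
  moreover have "closedin W A" using openA D(1) by (simp add: closedin_def)
  ultimately have "W closure_of A \<subseteq> W interior_of U" by (auto simp: closure_of_closedin V_def)
  then have "hom_induced p (subtopology W (topspace W - A)) (U - A) (subtopology W (topspace W)) U id
    \<in> iso (relative_homology_group p (subtopology W (topspace W - A)) (U - A))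
          (relative_homology_group p (subtopology W (topspace W)) U)"
    by (rule homology_excision_axiom[OF _ UW])
  then have 2: "relative_homology_group p (subtopology W (topspace W - A)) (U - A) \<cong> relative_homology_group p W U"
    by (auto simp: is_iso_def)

  have img: "e ` disc_interior n = topspace W - A"
  proof (intro subset_antisym subsetI)
    fix w assume w: "w \<in> topspace W - A"
    then have "w \<in> e ` topspace ?D" unfolding D(3) by blast
    then show "w \<in> e ` disc_interior n" using w in_int by blast
  qed (use not_A in blast)
  \<comment> \<open>After \<open>A\<close> is removed a copy of the open disc remains. The map is
    open because the image of an open set misses \<open>A\<close> and has itself as preimage, so
    coherence applies.\<close>
  have "homeomorphic_map (subtopology ?D (disc_interior n)) (subtopology W (topspace W - A)) e"
  proof (rule bijective_open_imp_homeomorphic_map)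
    have top: "topspace (subtopology ?D (disc_interior n)) = disc_interior n"
      using disc_interior_boundary[of n] by auto
    show "continuous_map (subtopology ?D (disc_interior n)) (subtopology W (topspace W - A)) e"
      using e img top by (auto simp: continuous_map_in_subtopology intro!: continuous_map_from_subtopology)
    show "inj_on e (topspace (subtopology ?D (disc_interior n)))" unfolding top by (rule inj)
    show "e ` topspace (subtopology ?D (disc_interior n)) = topspace (subtopology W (topspace W - A))"
      unfolding top img by auto
    show "open_map (subtopology ?D (disc_interior n)) (subtopology W (topspace W - A)) e"
      unfolding open_map_def
    proof (intro allI impI)
      fix T assume T: "openin (subtopology ?D (disc_interior n)) T"
      have "openin ?D T" using T int_open by (meson openin_trans_full)
      have Ti: "T \<subseteq> disc_interior n" using openin_subset[OF T] top by simp
      have "openin W (e ` T)"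
      proof (rule D(4))
        show "e ` T \<subseteq> topspace W" using Ti img by blast
        have "A \<inter> e ` T = {}" using Ti disj by blast
        then show "openin (subtopology W A) (A \<inter> e ` T)" by simp
        have "{x \<in> topspace ?D. e x \<in> e ` T} = T"
        proof (intro subset_antisym subsetI)
          fix x assume "x \<in> {x \<in> topspace ?D. e x \<in> e ` T}"
          then obtain y where xy: "x \<in> topspace ?D" "y \<in> T" "e x = e y" by auto
          then have "x \<in> disc_interior n" using Ti not_A in_int by auto
          then show "x \<in> T" using xy Ti inj by (metis inj_onD subsetD)
        qed (use Ti disc_interior_boundary[of n] in auto)
        then show "openin ?D {x \<in> topspace ?D. f x \<in> e ` T}" if "f \<in> {e}" for f
          using that \<open>openin ?D T\<close> by simp
      qed
      moreover have "e ` T \<subseteq> topspace W - A" using Ti img by blast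
      ultimately show "openin (subtopology W (topspace W - A)) (e ` T)"
        using openA openin_open_subtopology by blast
    qed
  qed
  moreover have "e ` {x \<in> disc_interior n. 1/2 \<le> disc_norm n x} = U - A"
    using disj bd disc_interior_boundary[of n] by (auto simp: U_def)
  ultimately have "hom_induced p (subtopology ?D (disc_interior n)) {x \<in> disc_interior n. 1/2 \<le> disc_norm n x}
      (subtopology W (topspace W - A)) (U - A) e \<in>
    iso (relative_homology_group p (subtopology ?D (disc_interior n)) {x \<in> disc_interior n. 1/2 \<le> disc_norm n x})
      (relative_homology_group p (subtopology W (topspace W - A)) (U - A))"
    using disc_interior_boundary[of n] by (intro homeomorphic_map_relative_homology_iso) auto
  then have 3: "relative_homology_group p (subtopology ?D (disc_interior n)) {x \<in> disc_interior n. 1/2 \<le> disc_norm n x}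
      \<cong> relative_homology_group p (subtopology W (topspace W - A)) (U - A)"
    by (auto simp: is_iso_def)
  show ?thesis
    using 1 group.iso_sym[OF group_relative_homology_group 2] group.iso_sym[OF group_relative_homology_group 3]
    by (meson iso_trans)
qed

text \<open>The pair \<open>W\<close>, \<open>A\<close> and the disc with its boundary have the same
  relative homology, since both are carried to one pair in the open disc. The exact sequence then
  adds the contribution of the disc.\<close>

lemma has_euler_cell_attached:
  assumes "cell_attached W A n e" "has_euler (subtopology W A) {} a"
  shows "has_euler W {} (a + (-1) ^ n)"
proof (rule has_euler_pair[OF assms(2)])
  have "relative_homology_group p (unit_disc n) (disc_boundary n) \<cong> relative_homology_group p W A" for p
    using cell_attached_homology_interior[OF assms(1), of p]
      cell_attached_homology_interior[OF cell_attached_disc, of p n]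
    by (meson group.iso_sym group_relative_homology_group iso_trans)
  then show "has_euler W A ((-1) ^ n)" by (rule has_euler_iso[OF has_euler_disc])
qed

lemma has_euler_empty:
  assumes "topspace X = {}" shows "has_euler X {} 0"
  using assms
  by (intro has_eulerI[of _ _ "\<lambda>_. 0" 0] has_rank_trivial_group trivial_homology_group_empty) auto

section \<open>Extending equivariant maps over free cells\<close>

locale topological_action = group G for G (structure) +
  fixes X :: "'x topology" and \<phi> :: "'a \<Rightarrow> 'x \<Rightarrow> 'x"
  assumes action_continuous: "g \<in> carrier G \<Longrightarrow> continuous_map X X (\<phi> g)"
    and action_one: "x \<in> topspace X \<Longrightarrow> \<phi> \<one> x = x"
    and action_mult: "g \<in> carrier G \<Longrightarrow> h \<in> carrier G \<Longrightarrow> x \<in> topspace X \<Longrightarrow> \<phi> (g \<otimes> h) x = \<phi> g (\<phi> h x)"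
begin

lemma action_closed: "g \<in> carrier G \<Longrightarrow> x \<in> topspace X \<Longrightarrow> \<phi> g x \<in> topspace X"
  using action_continuous by (auto simp: continuous_map_def)

lemma action_inv: "g \<in> carrier G \<Longrightarrow> x \<in> topspace X \<Longrightarrow> \<phi> (inv g) (\<phi> g x) = x"
  by (simp add: action_one flip: action_mult)

lemma action_inv': "g \<in> carrier G \<Longrightarrow> x \<in> topspace X \<Longrightarrow> \<phi> g (\<phi> (inv g) x) = x"
  by (simp add: action_one flip: action_mult)

lemma in_orbit: "x \<in> topspace X \<Longrightarrow> x \<in> orbit G \<phi> x"
  using action_one unfolding orbit_def by force

lemma orbit_eq_iff:
  assumes x: "x \<in> topspace X" and y: "y \<in> topspace X"
  shows "orbit G \<phi> x = orbit G \<phi> y \<longleftrightarrow> (\<exists>g\<in>carrier G. y = \<phi> g x)"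
proof
  assume "orbit G \<phi> x = orbit G \<phi> y"
  then show "\<exists>g\<in>carrier G. y = \<phi> g x" using in_orbit[OF y] unfolding orbit_def by blast
next
  assume "\<exists>g\<in>carrier G. y = \<phi> g x"
  then obtain g where g: "g \<in> carrier G" "y = \<phi> g x" by blast
  have "\<phi> h y = \<phi> (h \<otimes> g) x" if "h \<in> carrier G" for h using g x that by (simp add: action_mult)
  moreover have "\<phi> h x = \<phi> (h \<otimes> inv g) y" if "h \<in> carrier G" for h
    using g x that by (simp add: action_mult action_inv action_closed)
  ultimately show "orbit G \<phi> x = orbit G \<phi> y"
    unfolding orbit_def using g(1) by (metis (no_types, lifting) inv_closed m_closed)
qed

lemma openin_translate:
  assumes "g \<in> carrier G" "openin X V"
  shows "openin X (\<phi> g ` V)"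
proof -
  have VX: "V \<subseteq> topspace X" using assms(2) by (rule openin_subset)
  have "\<phi> g ` V = {x \<in> topspace X. \<phi> (inv g) x \<in> V}"
  proof (intro subset_antisym subsetI)
    fix x assume "x \<in> {x \<in> topspace X. \<phi> (inv g) x \<in> V}"
    then show "x \<in> \<phi> g ` V" using action_inv'[OF assms(1)] by (intro image_eqI[of _ _ "\<phi> (inv g) x"]) auto
  qed (use VX assms(1) in \<open>auto simp: action_closed action_inv subset_iff\<close>)
  then show ?thesis
    using openin_continuous_map_preimage[OF action_continuous assms(2)] assms(1) by simp
qed

lemma topspace_orbit_space: "topspace (orbit_space G X \<phi>) = orbit G \<phi> ` topspace X"
  using quotient_map_orbit_space[of X G \<phi>] by (simp add: quotient_map_def)

lemma continuous_orbit: "continuous_map X (orbit_space G X \<phi>) (orbit G \<phi>)"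
  by (rule quotient_imp_continuous_map[OF quotient_map_orbit_space])

text \<open>The saturation of an open set is the union of its translates, hence open.\<close>

lemma openin_orbit_image:
  assumes "openin X V" shows "openin (orbit_space G X \<phi>) (orbit G \<phi> ` V)"
proof -
  have VX: "V \<subseteq> topspace X" using assms by (rule openin_subset)
  have "{x \<in> topspace X. orbit G \<phi> x \<in> orbit G \<phi> ` V} = (\<Union>g\<in>carrier G. \<phi> g ` V)"
    using VX by (auto simp: orbit_eq_iff[symmetric] action_closed subset_iff image_iff)
      (metis action_closed orbit_eq_iff subsetD VX)+
  moreover have "openin X (\<Union>g\<in>carrier G. \<phi> g ` V)" using openin_translate assms by blast
  moreover have "orbit G \<phi> ` V \<subseteq> orbits G (topspace X) \<phi>" using VX by (auto simp: orbits_def)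
  ultimately show ?thesis by (simp add: openin_orbit_space)
qed

end

text \<open>Freeness leaves the interior of the cell unconstrained: a map on one cell determines the
  map on all its translates, and only agreement on \<open>P'\<close> has to be ensured.
  \<open>P\<close> and \<open>P'\<close> stay abstract so that the lemma serves both a disc and the
  cylinder over it.\<close>

lemma equivariant_extension:
  fixes G (structure)
  assumes X: "topological_action G X \<psi>"
    and coh: "coherent W A P ((\<lambda>g. \<phi> g \<circ> e) ` carrier G)"
    and mult: "\<And>g h w. g \<in> carrier G \<Longrightarrow> h \<in> carrier G \<Longrightarrow> w \<in> topspace W \<Longrightarrow> \<phi> (g \<otimes> h) w = \<phi> g (\<phi> h w)"
    and one: "\<And>w. w \<in> topspace W \<Longrightarrow> \<phi> \<one> w = w"
    and A: "\<And>g a. g \<in> carrier G \<Longrightarrow> a \<in> A \<Longrightarrow> \<phi> g a \<in> A"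
    and eW: "\<And>x. x \<in> topspace P \<Longrightarrow> e x \<in> topspace W"
    and bd: "\<And>x. x \<in> P' \<Longrightarrow> e x \<in> A"
    and int: "\<And>g x. g \<in> carrier G \<Longrightarrow> x \<in> topspace P - P' \<Longrightarrow> \<phi> g (e x) \<notin> A"
    and inj: "\<And>g h x y. g \<in> carrier G \<Longrightarrow> h \<in> carrier G \<Longrightarrow> x \<in> topspace P - P' \<Longrightarrow> y \<in> topspace P - P' \<Longrightarrow>
        \<phi> g (e x) = \<phi> h (e y) \<Longrightarrow> g = h \<and> x = y"
    and f: "continuous_map (subtopology W A) X f"
    and f_eq: "\<And>g a. g \<in> carrier G \<Longrightarrow> a \<in> A \<Longrightarrow> f (\<phi> g a) = \<psi> g (f a)"
    and F: "continuous_map P X F" "\<And>x. x \<in> P' \<Longrightarrow> F x = f (e x)"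
  obtains f' where "continuous_map W X f'" "\<And>a. a \<in> A \<Longrightarrow> f' a = f a"
    "\<And>g w. g \<in> carrier G \<Longrightarrow> w \<in> topspace W \<Longrightarrow> f' (\<phi> g w) = \<psi> g (f' w)"
proof -
  interpret X: topological_action G X \<psi> by fact
  note D = coherentD[OF coh]
  \<comment> \<open>By \<open>inj\<close> only one pair qualifies, so the choice reads off the
    translating element and the parameter.\<close>
  define f' where "f' = (\<lambda>w. if w \<in> A then f w else
    (case (SOME (g, x). g \<in> carrier G \<and> x \<in> topspace P - P' \<and> w = \<phi> g (e x)) of (g, x) \<Rightarrow> \<psi> g (F x)))"
  have f'A: "f' a = f a" if "a \<in> A" for a using that by (simp add: f'_def)
  have f'e: "f' (\<phi> g (e x)) = \<psi> g (F x)" if g: "g \<in> carrier G" and x: "x \<in> topspace P" for g x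
  proof (cases "x \<in> P'")
    case True
    then show ?thesis using bd A g f'A f_eq F(2) by simp
  next
    case False
    define u where "u = (SOME (h, y). h \<in> carrier G \<and> y \<in> topspace P - P' \<and> \<phi> g (e x) = \<phi> h (e y))"
    have "case u of (h, y) \<Rightarrow> h \<in> carrier G \<and> y \<in> topspace P - P' \<and> \<phi> g (e x) = \<phi> h (e y)"
      unfolding u_def by (rule someI[of _ "(g, x)"]) (use g x False in simp)
    moreover obtain h y where u: "u = (h, y)" by force
    ultimately have "g = h \<and> x = y" using g x False by (intro inj) auto
    then have "u = (g, x)" using u by simp
    moreover have "f' (\<phi> g (e x)) = (case u of (g, x) \<Rightarrow> \<psi> g (F x))"
      using int[of g x] g x False by (simp add: f'_def u_def)
    ultimately show ?thesis by simp
  qed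
  have FX: "F x \<in> topspace X" if "x \<in> topspace P" for x
    using F(1) that by (auto simp: continuous_map_def)
  have "continuous_map W X f'"
  proof (rule coherent_continuous_map[OF coh])
    show "continuous_map (subtopology W A) X f'"
      by (rule continuous_map_eq[OF f]) (simp add: f'A)
    fix k assume "k \<in> (\<lambda>g. \<phi> g \<circ> e) ` carrier G"
    then obtain g where g: "g \<in> carrier G" "k = \<phi> g \<circ> e" by blast
    show "continuous_map P X (f' \<circ> k)"
      by (rule continuous_map_eq[OF continuous_map_compose[OF F(1) X.action_continuous[OF g(1)]]])
        (simp add: f'e g)
  qed
  moreover have "f' (\<phi> g w) = \<psi> g (f' w)" if g: "g \<in> carrier G" and w: "w \<in> topspace W" for g w
  proof -
    consider "w \<in> A" | h x where "h \<in> carrier G" "x \<in> topspace P" "w = \<phi> h (e x)"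
      using w unfolding D(3) by auto
    then show ?thesis
    proof cases
      case 1
      then show ?thesis using A f_eq f'A g by simp
    next
      case 2
      then have "\<phi> g w = \<phi> (g \<otimes> h) (e x)" using mult[of g h "e x"] eW g by simp
      then show ?thesis using 2 g by (simp add: f'e FX X.action_mult)
    qed
  qed
  ultimately show ?thesis using f'A that by blast
qed

text \<open>The space \<open>P\<close> is a cone over its boundary \<open>P'\<close>: \<open>\<nu>\<close> is the gauge of \<open>P\<close> and \<open>scal t y\<close> contracts
  \<open>y\<close> towards the centre \<open>c\<close>. So a contraction of \<open>X\<close> extends a map from \<open>P'\<close> radially.\<close>

lemma contractible_extension_cone:
  fixes scal :: "real \<Rightarrow> 'p \<Rightarrow> 'p" and \<nu> :: "'p \<Rightarrow> real"
  assumes X: "contractible_space X" "topspace X \<noteq> {}"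
    and P: "compact_space P" "Hausdorff_space P" and P': "closedin P P'"
    and scal: "continuous_map (prod_topology (top_of_set {0..1}) P) P (\<lambda>(t, y). scal t y)"
    and \<nu>_scal: "\<And>t y. t \<in> {0..1} \<Longrightarrow> y \<in> P' \<Longrightarrow> \<nu> (scal t y) = t"
    and inj: "\<And>t y z. t \<in> {0<..1} \<Longrightarrow> y \<in> P' \<Longrightarrow> z \<in> P' \<Longrightarrow> scal t y = scal t z \<Longrightarrow> y = z"
    and one: "\<And>y. y \<in> P' \<Longrightarrow> scal 1 y = y"
    and surj: "\<And>x. x \<in> topspace P \<Longrightarrow> \<exists>t\<in>{0..1}. \<exists>y\<in>P'. x = scal t y"
    and f: "continuous_map (subtopology P P') X f"
  obtains F where "continuous_map P X F" "\<And>x. x \<in> P' \<Longrightarrow> F x = f x"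
proof -
  let ?I = "top_of_set {0..1::real}"
  let ?Q = "prod_topology ?I (subtopology P P')"
  obtain a h where h: "continuous_map (prod_topology ?I X) X h"
      and h0: "\<And>x. h (0, x) = x" and h1: "\<And>x. h (1, x) = a"
    using X(1) unfolding contractible_space_def homotopic_with_def by auto
  have P'P: "P' \<subseteq> topspace P" using P' by (rule closedin_subset)
  have m_cont: "continuous_map ?Q P (\<lambda>(t, y). scal t y)"
    unfolding prod_topology_subtopology(2) by (rule continuous_map_from_subtopology[OF scal])
  \<comment> \<open>A continuous map from a compact space to a Hausdorff space is closed. So the
    cone map is a quotient map, and a map on \<open>P\<close> may be defined in the coordinates of
    the cone.\<close>
  have q: "quotient_map ?Q P (\<lambda>(t, y). scal t y)"
  proof (rule continuous_closed_imp_quotient_map[OF m_cont])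
    have "compact_space ?I" by (simp add: compact_space_subtopology)
    moreover have "compact_space (subtopology P P')"
      using P(1) P' by (simp add: closedin_compact_space compact_space_subtopology)
    ultimately have "compact_space ?Q" by (simp add: compact_space_prod_topology)
    then show "closed_map ?Q P (\<lambda>(t, y). scal t y)"
      using m_cont P(2) by (intro continuous_imp_closed_map)
    show "(\<lambda>(t, y). scal t y) ` topspace ?Q = topspace P"
    proof (intro subset_antisym subsetI)
      fix x assume "x \<in> topspace P"
      then obtain t y where "t \<in> {0..1}" "y \<in> P'" "x = scal t y" using surj by blast
      then show "x \<in> (\<lambda>(t, y). scal t y) ` topspace ?Q"
        using P'P by (intro image_eqI[of _ _ "(t, y)"]) auto
    qed (use continuous_map_image_subset_topspace[OF m_cont] in blast)
  qed
  \<comment> \<open>The contraction runs backwards: scale 1 gives \<open>f\<close>, and scale 0,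
    where all of \<open>P'\<close> is collapsed to the centre, gives the constant value
    \<open>a\<close>.\<close>
  have c: "continuous_map ?Q X (\<lambda>(t, y). h (1 - t, f y))"
  proof -
    have "continuous_map ?Q ?I (\<lambda>u. 1 - fst u)"
    proof (rule continuous_map_into_subtopology)
      have "continuous_map ?Q euclideanreal fst"
        by (rule continuous_map_into_fulltopology[OF continuous_map_fst])
      then show "continuous_map ?Q euclideanreal (\<lambda>u. 1 - fst u)" by (intro continuous_intros) auto
    qed auto
    moreover have "continuous_map ?Q X (\<lambda>u. f (snd u))"
      using continuous_map_compose[OF continuous_map_snd f] by (simp add: o_def)
    ultimately have "continuous_map ?Q (prod_topology ?I X) (\<lambda>u. (1 - fst u, f (snd u)))"
      by (intro continuous_map_pairedI)
    from continuous_map_compose[OF this h] show ?thesis by (simp add: o_def case_prod_unfold)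
  qed
  have fib: "(\<lambda>(t, y). h (1 - t, f y)) u = (\<lambda>(t, y). h (1 - t, f y)) v"
    if uv: "u \<in> topspace ?Q" "v \<in> topspace ?Q" "(\<lambda>(t, y). scal t y) u = (\<lambda>(t, y). scal t y) v" for u v
  proof -
    obtain t y s z where u: "u = (t, y)" and v: "v = (s, z)" by force
    have *: "t \<in> {0..1}" "s \<in> {0..1}" "y \<in> P'" "z \<in> P'" "scal t y = scal s z" using uv u v by auto
    then have "t = s" using \<nu>_scal by metis
    then show ?thesis using * inj[of t y z] h1 by (cases "t = 0") (auto simp: u v)
  qed
  obtain F where F: "continuous_map P X F"
      "\<And>u. u \<in> topspace ?Q \<Longrightarrow> F ((\<lambda>(t, y). scal t y) u) = (\<lambda>(t, y). h (1 - t, f y)) u"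
    by (rule quotient_map_lift_exists[OF q c fib]) (use that in blast)+
  have "F x = f x" if "x \<in> P'" for x
    using F(2)[of "(1, x)"] that one h0 P'P by auto
  then show ?thesis using that F(1) by blast
qed

section \<open>Compactness of discs, and extension of maps over discs and cylinders\<close>

lemma compact_unit_disc: "compact_space (unit_disc n)"
proof -
  let ?P = "powertop_real (UNIV :: nat set)"
  \<comment> \<open>Every coordinate lies in \<open>[-1, 1]\<close>, so the disc is a closed subset
    of a compact product.\<close>
  have "compactin ?P (PiE UNIV (\<lambda>_. {-1..1}))"
    by (simp add: compactin_PiE)
  moreover have "topspace (unit_disc n) \<subseteq> PiE UNIV (\<lambda>_. {-1..1})"
  proof
    fix x assume x: "x \<in> topspace (unit_disc n)"
    have "x i \<in> {-1..1}" for i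
    proof (cases "i < n")
      case True
      have "(x i)\<^sup>2 \<le> (\<Sum>i<n. (x i)\<^sup>2)" by (rule member_le_sum) (use True in auto)
      also have "\<dots> \<le> 1" using x by (simp add: topspace_unit_disc)
      finally have "\<bar>x i\<bar> \<le> 1" by (simp add: abs_square_le_1)
      then show ?thesis by auto
    qed (use x in \<open>auto simp: topspace_unit_disc\<close>)
    then show "x \<in> PiE UNIV (\<lambda>_. {-1..1})" by auto
  qed
  moreover have "closedin ?P (topspace (unit_disc n))"
  proof -
    have proj: "continuous_map ?P euclideanreal (\<lambda>x. x i)" for i
      by (intro continuous_map_product_projection) auto
    have "closedin ?P {x \<in> topspace ?P. x i \<in> {0}}" for i
      by (rule closedin_continuous_map_preimage[OF proj]) auto
    moreover have "closedin ?P {x \<in> topspace ?P. disc_norm n x \<in> {..1}}"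
      by (rule closedin_continuous_map_preimage[of _ euclideanreal])
        (auto intro!: continuous_map_sqrt continuous_map_sum continuous_map_real_pow proj)
    ultimately have "closedin ?P ((\<Inter>i\<in>{n..}. {x \<in> topspace ?P. x i \<in> {0}}) \<inter> {x \<in> topspace ?P. disc_norm n x \<in> {..1}})"
      by (intro closedin_Int closedin_INT) auto
    moreover have "(\<Inter>i\<in>{n..}. {x \<in> topspace ?P. x i \<in> {0}}) \<inter> {x \<in> topspace ?P. disc_norm n x \<in> {..1}} = topspace (unit_disc n)"
      by (auto simp: topspace_unit_disc)
    ultimately show ?thesis by simp
  qed
  ultimately have "compactin ?P (topspace (unit_disc n))" by (rule closed_compactin)
  then have "compactin ?P {x. (\<forall>i\<ge>n. x i = 0) \<and> disc_norm n x \<le> 1}"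
    by (simp only: topspace_unit_disc)
  then show ?thesis unfolding unit_disc_eq by (rule compact_space_subtopology)
qed

lemma Hausdorff_unit_disc: "Hausdorff_space (unit_disc n)"
  unfolding unit_disc_def by (intro Hausdorff_space_subtopology Hausdorff_Euclidean_space)

lemma closedin_disc_boundary: "closedin (unit_disc n) (disc_boundary n)"
proof -
  have "disc_boundary n = {x \<in> topspace (unit_disc n). disc_norm n x \<in> {1}}" by (auto simp: disc_boundary_eq)
  then show ?thesis using closedin_continuous_map_preimage[OF continuous_map_disc_norm, of "{1}" n] by simp
qed

lemma disc_norm_nonneg: "0 \<le> disc_norm n x" by (simp add: sum_nonneg)

lemma disc_norm_zero:
  assumes "x \<in> topspace (unit_disc n)" "disc_norm n x = 0" shows "x = (\<lambda>_. 0)"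
proof
  fix i
  have "\<forall>i\<in>{..<n}. (x i)\<^sup>2 = 0" using assms(2) by (subst sum_nonneg_eq_0_iff[symmetric]) auto
  then show "x i = 0" using assms(1) by (cases "i < n") (auto simp: topspace_unit_disc)
qed

lemma disc_scale_continuous:
  "continuous_map (prod_topology (top_of_set {0..1}) (unit_disc n)) (unit_disc n) (\<lambda>(t, x) i. x i * t)"
  unfolding continuous_map_unit_disc_iff
proof (intro conjI allI Pi_I)
  let ?I = "top_of_set {0..1::real}"
  fix k
  have "continuous_map (prod_topology ?I (unit_disc n)) euclideanreal (\<lambda>u. snd u k)"
    using continuous_map_compose[OF continuous_map_snd continuous_map_unit_disc_proj] by (simp add: o_def)
  moreover have "continuous_map (prod_topology ?I (unit_disc n)) euclideanreal fst"
    by (rule continuous_map_into_fulltopology[OF continuous_map_fst])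
  ultimately show "continuous_map (prod_topology ?I (unit_disc n)) euclideanreal
      (\<lambda>u. (case u of (t, x) \<Rightarrow> \<lambda>i. x i * t) k)"
    unfolding case_prod_unfold by (intro continuous_intros) auto
next
  fix u assume u: "u \<in> topspace (prod_topology (top_of_set {0..1::real}) (unit_disc n))"
  obtain t x where tx: "u = (t, x)" by force
  have t: "0 \<le> t" "t \<le> 1" and x: "x \<in> topspace (unit_disc n)" using u tx by auto
  have "disc_norm n x * t \<le> 1 * 1" using t x by (intro mult_mono disc_norm_nonneg) (auto simp: topspace_unit_disc)
  moreover have "0 \<le> disc_norm n x * t" by (intro mult_nonneg_nonneg disc_norm_nonneg t)
  ultimately show "(case u of (t, x) \<Rightarrow> \<lambda>i. x i * t) \<in> topspace (unit_disc n)"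
    unfolding tx prod.case using x by (intro unit_disc_scale) auto
qed

lemma disc_boundary_nonempty: "n > 0 \<Longrightarrow> (\<lambda>i. if i = 0 then 1 else 0) \<in> disc_boundary n"
  by (simp add: disc_boundary_eq topspace_unit_disc power2_eq_square if_distrib[of "\<lambda>x. x * _"] cong: if_cong)

lemma contractible_extension_disc:
  assumes X: "contractible_space X" "topspace X \<noteq> {}"
    and f: "continuous_map (subtopology (unit_disc n) (disc_boundary n)) X f"
  obtains F where "continuous_map (unit_disc n) X F" "\<And>x. x \<in> disc_boundary n \<Longrightarrow> F x = f x"
proof (cases "n = 0")
  case True
  \<comment> \<open>In dimension 0 there is no boundary from which to form a cone; the disc is a
    point, and any value extends the empty map.\<close>
  obtain a where "a \<in> topspace X" using X(2) by blast
  then have "continuous_map (unit_disc n) X (\<lambda>_. a)" by simp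
  moreover have "disc_boundary n = {}" using True by (simp add: disc_boundary_def)
  ultimately show ?thesis using that[of "\<lambda>_. a"] by simp
next
  case False
  have bd: "x \<in> topspace (unit_disc n) \<and> disc_norm n x = 1" if "x \<in> disc_boundary n" for x
    using that by (simp add: disc_boundary_eq)
  show ?thesis
  proof (rule contractible_extension_cone[where P = "unit_disc n" and P' = "disc_boundary n" and f = f and
        X = X and \<nu> = "\<lambda>x. disc_norm n x" and scal = "\<lambda>t x i. x i * t"])
    show "disc_norm n (\<lambda>i. y i * t) = t" if "t \<in> {0..1}" "y \<in> disc_boundary n" for t y
      using bd[OF that(2)] that(1) unfolding disc_norm_scale by simp
    show "y = z" if "t \<in> {0<..1}" "(\<lambda>i. y i * t) = (\<lambda>i. z i * t)" for t :: real and y z :: "nat \<Rightarrow> real"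
      using that by (auto simp: fun_eq_iff)
    show "\<exists>t\<in>{0..1}. \<exists>y\<in>disc_boundary n. x = (\<lambda>i. y i * t)" if x: "x \<in> topspace (unit_disc n)" for x
    proof (cases "disc_norm n x = 0")
      case True
      \<comment> \<open>The centre lies on every ray, so any boundary point will do; there is one
        because the dimension is positive.\<close>
      then have "x = (\<lambda>_. 0)" using disc_norm_zero x by blast
      then show ?thesis using disc_boundary_nonempty False by (intro bexI[of _ 0] bexI) auto
    next
      case nz: False
      let ?y = "\<lambda>i. x i * (1 / disc_norm n x)"
      have 1: "disc_norm n ?y = 1" unfolding disc_norm_scale using nz disc_norm_nonneg[of x n] by simp
      have "?y \<in> disc_boundary n"
        using x 1 by (simp add: disc_boundary_eq topspace_unit_disc)
      moreover have "disc_norm n x \<in> {0..1}" using x disc_norm_nonneg[of x n] by (auto simp: topspace_unit_disc)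
      moreover have "x = (\<lambda>i. ?y i * disc_norm n x)" using nz by auto
      ultimately show ?thesis by (intro bexI[of _ "disc_norm n x"] bexI[of _ ?y])
    qed
  qed (use that X f in \<open>auto simp: compact_unit_disc Hausdorff_unit_disc closedin_disc_boundary
      disc_scale_continuous\<close>)
qed

text \<open>Seen from its midpoint, the cylinder is again a cone, now over its two ends together
  with its side. This is what extends a homotopy over a cell when it is prescribed on the ends and
  over the boundary.\<close>

lemma contractible_extension_cylinder:
  assumes X: "contractible_space X" "topspace X \<noteq> {}"
    and f: "continuous_map (subtopology (prod_topology (top_of_set {0..1}) (unit_disc n))
        ({0, 1} \<times> topspace (unit_disc n) \<union> {0..1} \<times> disc_boundary n)) X f"
  obtains F where "continuous_map (prod_topology (top_of_set {0..1::real}) (unit_disc n)) X F"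
    "\<And>x. x \<in> {0, 1} \<times> topspace (unit_disc n) \<union> {0..1} \<times> disc_boundary n \<Longrightarrow> F x = f x"
proof -
  let ?I = "top_of_set {0..1::real}"
  let ?D = "unit_disc n"
  let ?P = "prod_topology ?I ?D"
  let ?P' = "{0, 1} \<times> topspace ?D \<union> {0..1} \<times> disc_boundary n"
  \<comment> \<open>The gauge of the cylinder around \<open>(1/2, 0)\<close>: the interval is
    rescaled to \<open>[-1, 1]\<close>, and the value 1 marks the ends and the side.\<close>
  define \<nu> where "\<nu> = (\<lambda>(s::real, x). max \<bar>2 * s - 1\<bar> (disc_norm n x))"
  define scal where "scal = (\<lambda>t (s::real, x). (1/2 + t * (s - 1/2), \<lambda>i::nat. x i * t))"
  have sub: "?P' \<subseteq> topspace ?P" using disc_interior_boundary(2)[of n] by auto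
  have P'_iff: "u \<in> ?P' \<longleftrightarrow> u \<in> topspace ?P \<and> \<nu> u = 1" for u
  proof (cases u)
    case (Pair s x)
    have "x \<in> topspace ?D \<Longrightarrow> disc_norm n x \<le> 1" by (simp add: topspace_unit_disc)
    then show ?thesis
      unfolding Pair \<nu>_def by (auto simp: disc_boundary_eq max_def abs_if split: if_splits)
  qed
  have \<nu>_le: "\<nu> u \<le> 1" if "u \<in> topspace ?P" for u
    using that by (cases u) (auto simp: \<nu>_def topspace_unit_disc abs_if)
  have \<nu>_scal: "\<nu> (scal t u) = t * \<nu> u" if "t \<ge> 0" for t u
  proof (cases u)
    case (Pair s x)
    have "\<bar>2 * (1/2 + t * (s - 1/2)) - 1\<bar> = t * \<bar>2 * s - 1\<bar>"
    proof -
      have "2 * (1/2 + t * (s - 1/2)) - 1 = t * (2 * s - 1)" by (simp add: algebra_simps)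
      then show ?thesis using that by (simp only: abs_mult abs_of_nonneg)
    qed
    moreover have "disc_norm n (\<lambda>i. x i * t) = t * disc_norm n x" unfolding disc_norm_scale using that by simp
    ultimately show ?thesis
      using that by (simp add: \<nu>_def scal_def Pair max_mult_distrib_left)
  qed
  have cl: "closedin ?P ?P'"
  proof (rule closedin_Un)
    have "closedin ?I {0, 1}" by (intro finite_imp_closedin) auto
    then show "closedin ?P ({0, 1} \<times> topspace ?D)" by (simp add: closedin_prod_Times_iff)
    have "closedin ?P (topspace ?I \<times> disc_boundary n)"
      unfolding closedin_prod_Times_iff using closedin_disc_boundary closedin_topspace by blast
    then show "closedin ?P ({0..1} \<times> disc_boundary n)" by simp
  qed
  have cont: "continuous_map (prod_topology ?I ?P) ?P (\<lambda>(t, y). scal t y)"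
  proof -
    let ?Q = "prod_topology ?I ?P"
    have t: "continuous_map ?Q euclideanreal (\<lambda>u. fst u)"
      by (rule continuous_map_into_fulltopology[OF continuous_map_fst])
    have s: "continuous_map ?Q euclideanreal (\<lambda>u. fst (snd u))"
      using continuous_map_compose[OF continuous_map_snd continuous_map_into_fulltopology[OF continuous_map_fst]] by (simp add: o_def)
    have "continuous_map ?Q ?I (\<lambda>u. 1/2 + fst u * (fst (snd u) - 1/2))"
    proof (rule continuous_map_into_subtopology)
      show "continuous_map ?Q euclideanreal (\<lambda>u. 1/2 + fst u * (fst (snd u) - 1/2))"
        using t s by (intro continuous_intros) auto
      show "(\<lambda>u. 1/2 + fst u * (fst (snd u) - 1/2)) \<in> topspace ?Q \<rightarrow> {0..1}"
      proof
        fix u assume "u \<in> topspace ?Q"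
        then have u: "0 \<le> fst u" "fst u \<le> 1" "0 \<le> fst (snd u)" "fst (snd u) \<le> 1" by auto
        have "\<bar>fst (snd u) - 1/2\<bar> \<le> 1/2" "\<bar>fst u\<bar> \<le> 1"
          by (rule abs_leI; use u in linarith)+
        then have "\<bar>fst u * (fst (snd u) - 1/2)\<bar> \<le> 1 * (1/2)"
          unfolding abs_mult by (intro mult_mono) simp_all
        then show "1/2 + fst u * (fst (snd u) - 1/2) \<in> {0..1}" by (auto simp: abs_le_iff)
      qed
    qed
    moreover have "continuous_map ?Q ?D (\<lambda>u i. snd (snd u) i * fst u)"
    proof -
      have "continuous_map ?Q (prod_topology ?I ?D) (\<lambda>u. (fst u, snd (snd u)))"
        using continuous_map_compose[OF continuous_map_snd continuous_map_snd, of ?I ?I ?D]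
        by (intro continuous_map_pairedI continuous_map_fst) (simp add: o_def)
      from continuous_map_compose[OF this disc_scale_continuous] show ?thesis by (simp add: o_def)
    qed
    ultimately have "continuous_map ?Q ?P (\<lambda>u. (1/2 + fst u * (fst (snd u) - 1/2), \<lambda>i. snd (snd u) i * fst u))"
      by (intro continuous_map_pairedI)
    then show ?thesis by (simp add: scal_def case_prod_unfold)
  qed
  have surj: "\<exists>t\<in>{0..1}. \<exists>y\<in>?P'. u = scal t y" if u: "u \<in> topspace ?P" for u
  proof (cases u)
    case (Pair s x)
    have s: "0 \<le> s" "s \<le> 1" and x: "x \<in> topspace ?D" using u Pair by auto
    have \<nu>0: "0 \<le> \<nu> u" by (simp add: Pair \<nu>_def le_max_iff_disj)
    show ?thesis
    proof (cases "\<nu> u = 0")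
      case True
      then have "\<bar>2 * s - 1\<bar> \<le> 0" "disc_norm n x \<le> 0" unfolding Pair \<nu>_def by (auto simp: max_def split: if_splits)
      then have "s = 1/2" "x = (\<lambda>_. 0)" using disc_norm_zero[OF x] disc_norm_nonneg[of x n] by auto
      then have "u = scal 0 (0, \<lambda>_. 0)" by (simp add: Pair scal_def)
      \<comment> \<open>Scaling by 0 sends every boundary point to the centre. The lower end is
        nonempty in every dimension, so dimension 0 is not exceptional here.\<close>
      moreover have "(0, \<lambda>_. 0) \<in> ?P'" by (auto simp: topspace_unit_disc)
      ultimately show ?thesis by (metis atLeastAtMost_iff order_refl zero_le_one)
    next
      case False
      define y where "y = (1/2 + (1 / \<nu> u) * (s - 1/2), \<lambda>i. x i * (1 / \<nu> u))"
      have y: "y = scal (1 / \<nu> u) u" by (simp add: y_def Pair scal_def)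
      have \<nu>y: "\<nu> y = 1" unfolding y using \<nu>0 False by (subst \<nu>_scal) auto
      have "\<bar>2 * fst y - 1\<bar> \<le> 1" "disc_norm n (snd y) \<le> 1"
        using \<nu>y unfolding \<nu>_def case_prod_unfold by linarith+
      moreover have "\<forall>i\<ge>n. snd y i = 0" using x by (simp add: y_def topspace_unit_disc)
      ultimately have "y \<in> topspace ?P" by (cases y) (auto simp: topspace_unit_disc abs_le_iff)
      then have "y \<in> ?P'" using P'_iff \<nu>y by blast
      moreover have "u = scal (\<nu> u) y"
        using False by (simp add: y_def scal_def Pair fun_eq_iff)
      ultimately show ?thesis using \<nu>0 \<nu>_le[OF u] by (metis atLeastAtMost_iff)
    qed
  qed
  have compact: "compact_space ?P"
    using compact_unit_disc by (simp add: compact_space_prod_topology compact_space_subtopology)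
  have Hausdorff: "Hausdorff_space ?P"
    using Hausdorff_unit_disc by (simp add: Hausdorff_space_prod_topology Hausdorff_space_subtopology)
  show ?thesis
  proof (rule contractible_extension_cone[where P = ?P and P' = ?P' and f = f and X = X and \<nu> = \<nu> and
        scal = scal, OF X compact Hausdorff cl cont])
    show "\<nu> (scal t y) = t" if "t \<in> {0..1}" "y \<in> ?P'" for t y
      using \<nu>_scal P'_iff that by auto
    show "y = z" if "t \<in> {0<..1}" "scal t y = scal t z" for t y z
      using that by (cases y; cases z) (auto simp: scal_def fun_eq_iff)
    show "scal 1 y = y" for y by (cases y) (simp add: scal_def)
  qed (use that surj f in blast)+
qed

section \<open>Free cellular actions\<close>

text \<open>A single free orbit of cells is attached at each step, in any order of the dimensions; the integer is the
  number of orbits of cells, counted with sign.\<close>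

inductive free_cellular ::
    "('a, 'm) monoid_scheme \<Rightarrow> 'x topology \<Rightarrow> ('a \<Rightarrow> 'x \<Rightarrow> 'x) \<Rightarrow> 'x set \<Rightarrow> int \<Rightarrow> bool"
  for G X \<phi>
  where
    empty: "free_cellular G X \<phi> {} 0"
  | attach: "free_cellular G X \<phi> B e \<Longrightarrow> B' \<subseteq> topspace X \<Longrightarrow>
      coherent (subtopology X B') B (unit_disc n) ((\<lambda>g. \<phi> g \<circ> q) ` carrier G) \<Longrightarrow>
      q ` topspace (unit_disc n) \<subseteq> B' \<Longrightarrow> q ` disc_boundary n \<subseteq> B \<Longrightarrow>
      (\<And>g x. g \<in> carrier G \<Longrightarrow> x \<in> disc_interior n \<Longrightarrow> \<phi> g (q x) \<notin> B) \<Longrightarrow>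
      (\<And>g h x y. g \<in> carrier G \<Longrightarrow> h \<in> carrier G \<Longrightarrow> x \<in> disc_interior n \<Longrightarrow> y \<in> disc_interior n \<Longrightarrow>
        \<phi> g (q x) = \<phi> h (q y) \<Longrightarrow> g = h \<and> x = y) \<Longrightarrow>
      free_cellular G X \<phi> B' (e + (-1) ^ n)"

section \<open>Equivariant maps and homotopies by induction over cells\<close>

lemma coherent_subtopology_mono:
  assumes "coherent W A P E" "A \<subseteq> A'" "A' \<subseteq> topspace W"
  shows "coherent W A' P E"
  unfolding coherent_def
proof (intro conjI allI impI)
  note D = coherentD[OF assms(1)]
  have "T = A' \<union> U" if "T = A \<union> U" "A' \<subseteq> T" for T U using that assms(2) by blast
  from this[OF D(3) assms(3)] show "topspace W = A' \<union> (\<Union>e\<in>E. e ` topspace P)" .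
  fix C assume C: "C \<subseteq> topspace W" "openin (subtopology W A') (A' \<inter> C)"
    "\<forall>e\<in>E. openin P {x \<in> topspace P. e x \<in> C}"
  show "openin W C"
  proof (rule D(4)[OF C(1)])
    have "A \<inter> (A' \<inter> C) = A \<inter> C" "subtopology (subtopology W A') A = subtopology W A"
      using assms(2) by (auto simp: subtopology_subtopology Int_absorb1)
    then show "openin (subtopology W A) (A \<inter> C)"
      using openin_subtopology_Int2[OF C(2), of A] by simp
  qed (use C(3) in blast)
qed (use assms coherentD(2)[OF assms(1)] in auto)

text \<open>The form of the pasting lemma for a cylinder: bottom, top and the part over the cells
  treated before.\<close>

lemma continuous_map_closed_cover3:
  assumes "closedin W C1" "closedin W C2" "closedin W C3" "topspace W \<subseteq> C1 \<union> C2 \<union> C3"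
    and "continuous_map (subtopology W C1) X f" "continuous_map (subtopology W C2) X f"
      "continuous_map (subtopology W C3) X f"
  shows "continuous_map W X f"
  unfolding continuous_map_closedin
proof (intro conjI allI impI)
  show "f \<in> topspace W \<rightarrow> topspace X"
    using assms(4-7) by (auto simp: continuous_map_def Pi_iff)
next
  fix T assume T: "closedin X T"
  have "closedin W {w \<in> topspace (subtopology W C). f w \<in> T}"
    if "closedin W C" "continuous_map (subtopology W C) X f" for C
    using closedin_continuous_map_preimage[OF that(2) T] that(1) by (rule closedin_trans_full)
  then have "closedin W ({w \<in> topspace (subtopology W C1). f w \<in> T} \<union>
      {w \<in> topspace (subtopology W C2). f w \<in> T} \<union> {w \<in> topspace (subtopology W C3). f w \<in> T})"
    using assms by (intro closedin_Un) auto
  moreover have "{w \<in> topspace (subtopology W C1). f w \<in> T} \<union>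
      {w \<in> topspace (subtopology W C2). f w \<in> T} \<union> {w \<in> topspace (subtopology W C3). f w \<in> T} =
      {w \<in> topspace W. f w \<in> T}"
    using assms(4) by auto
  ultimately show "closedin W {w \<in> topspace W. f w \<in> T}" by simp
qed

lemma (in topological_action) free_cellular_invariant:
  assumes "free_cellular G X \<phi> B e" "g \<in> carrier G" "x \<in> B"
  shows "\<phi> g x \<in> B"
  using assms
proof (induction arbitrary: x rule: free_cellular.induct)
  case (attach B e B' n q)
  note D = coherentD[OF attach.hyps(3)]
  have top: "topspace (subtopology X B') = B'" using attach.hyps(2) by auto
  consider "x \<in> B" | h y where "h \<in> carrier G" "y \<in> topspace (unit_disc n)" "x = \<phi> h (q y)"
    using D(3) attach.prems(2) unfolding top by auto
  then show ?case
  proof cases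
    case 1
    then show ?thesis using attach.IH[OF attach.prems(1)] D(1) top by blast
  next
    case 2
    then have "q y \<in> topspace X" using attach.hyps(2,4) by blast
    then have "\<phi> g x = (\<phi> (g \<otimes> h) \<circ> q) y" using 2 attach.prems(1) by (simp add: action_mult)
    then show ?thesis using D(3) 2 attach.prems(1) unfolding top by blast
  qed
qed simp

text \<open>Along each translate of the new cell the complement of \<open>B\<close> is the open
  disc, so coherence makes it open. Closedness is what permits pasting along
  \<open>B\<close>.\<close>

lemma free_cellular_closed:
  fixes G (structure)
  assumes B': "B' \<subseteq> topspace X"
    and coh: "coherent (subtopology X B') B (unit_disc n) ((\<lambda>g. \<phi> g \<circ> q) ` carrier G)"
    and bd: "\<And>g x. g \<in> carrier G \<Longrightarrow> x \<in> disc_boundary n \<Longrightarrow> \<phi> g (q x) \<in> B"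
    and int: "\<And>g x. g \<in> carrier G \<Longrightarrow> x \<in> disc_interior n \<Longrightarrow> \<phi> g (q x) \<notin> B"
  shows "closedin (subtopology X B') B"
proof -
  note D = coherentD[OF coh]
  have top: "topspace (subtopology X B') = B'" using B' by auto
  have "openin (subtopology X B') (B' - B)"
  proof (rule D(4))
    fix k assume k: "k \<in> (\<lambda>g. \<phi> g \<circ> q) ` carrier G"
    then obtain g where g: "g \<in> carrier G" "k = \<phi> g \<circ> q" by blast
    have "k x \<in> B'" if "x \<in> topspace (unit_disc n)" for x
      using D(2)[OF k] that top by (auto simp: continuous_map_def)
    then have "{x \<in> topspace (unit_disc n). k x \<in> B' - B} = topspace (unit_disc n) - disc_boundary n"
      using bd[OF g(1)] int[OF g(1)] g(2) disc_interior_boundary(2)[of n] by auto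
    then show "openin (unit_disc n) {x \<in> topspace (unit_disc n). k x \<in> B' - B}"
      using closedin_disc_boundary[of n] by (simp add: openin_diff)
  qed (use B' in auto)
  then show ?thesis using D(1) unfolding closedin_def top by blast
qed

text \<open>A contractible target puts no obstruction on any cell, and a free orbit puts no
  equivariance condition on a single cell. The domain does not have to be contractible.\<close>

lemma equivariant_map_exists:
  fixes G (structure)
  assumes Y: "topological_action G Y \<phi>" and X: "topological_action G X \<psi>"
    and contr: "contractible_space X" "topspace X \<noteq> {}"
    and B: "free_cellular G Y \<phi> B e"
  shows "\<exists>f. continuous_map (subtopology Y B) X f \<and> (\<forall>g\<in>carrier G. \<forall>y\<in>B. f (\<phi> g y) = \<psi> g (f y))"
  using B
proof (induction rule: free_cellular.induct)
  case empty
  show ?case by (simp add: continuous_map_def)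
next
  case (attach B e B' n q)
  interpret Y: topological_action G Y \<phi> by fact
  note D = coherentD[OF attach.hyps(3)]
  have top: "topspace (subtopology Y B') = B'" using attach.hyps(2) by auto
  have BB': "B \<subseteq> B'" using D(1) top by simp
  have sub: "subtopology (subtopology Y B') B = subtopology Y B"
    using BB' by (simp add: subtopology_subtopology Int_absorb1)
  obtain f where f: "continuous_map (subtopology Y B) X f"
    and f_eq: "\<And>g y. g \<in> carrier G \<Longrightarrow> y \<in> B \<Longrightarrow> f (\<phi> g y) = \<psi> g (f y)"
    using attach.IH by blast
  \<comment> \<open>Coherence speaks of the translates of \<open>q\<close>, so \<open>q\<close> is
    recovered as its translate by \<open>\<one>\<close>.\<close>
  have q: "continuous_map (unit_disc n) Y q"
  proof (rule continuous_map_eq)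
    show "continuous_map (unit_disc n) Y (\<phi> \<one> \<circ> q)"
      using D(2)[of "\<phi> \<one> \<circ> q"] by (auto intro: continuous_map_into_fulltopology)
    show "(\<phi> \<one> \<circ> q) x = q x" if "x \<in> topspace (unit_disc n)" for x
      using attach.hyps(2,4) that Y.action_one by auto
  qed
  have "continuous_map (subtopology (unit_disc n) (disc_boundary n)) (subtopology Y B) q"
    using q attach.hyps(5) by (intro continuous_map_into_subtopology continuous_map_from_subtopology) auto
  then have "continuous_map (subtopology (unit_disc n) (disc_boundary n)) X (f \<circ> q)"
    using f by (rule continuous_map_compose)
  then obtain F where F: "continuous_map (unit_disc n) X F"
      "\<And>x. x \<in> disc_boundary n \<Longrightarrow> F x = (f \<circ> q) x"
    using contractible_extension_disc[OF contr] by metis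
  have diff: "topspace (unit_disc n) - disc_boundary n = disc_interior n"
    using disc_interior_boundary[of n] by blast
  obtain f' where "continuous_map (subtopology Y B') X f'"
    "\<And>g w. g \<in> carrier G \<Longrightarrow> w \<in> topspace (subtopology Y B') \<Longrightarrow> f' (\<phi> g w) = \<psi> g (f' w)"
  proof (rule equivariant_extension[OF X attach.hyps(3), where P' = "disc_boundary n" and f = f and F = F])
    show "\<phi> (g \<otimes> h) w = \<phi> g (\<phi> h w)" if "g \<in> carrier G" "h \<in> carrier G" "w \<in> topspace (subtopology Y B')" for g h w
      using that Y.action_mult by simp
    show "\<phi> g a \<in> B" if "g \<in> carrier G" "a \<in> B" for g a
      using Y.free_cellular_invariant[OF attach.hyps(1) that] .
    show "g = h \<and> x = y" if "g \<in> carrier G" "h \<in> carrier G" "x \<in> topspace (unit_disc n) - disc_boundary n"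
      "y \<in> topspace (unit_disc n) - disc_boundary n" "\<phi> g (q x) = \<phi> h (q y)" for g h x y
      using attach.hyps(7) that unfolding diff by blast
    show "q x \<in> topspace (subtopology Y B')" if "x \<in> topspace (unit_disc n)" for x
      using attach.hyps(4) that unfolding top by blast
    show "continuous_map (subtopology (subtopology Y B') B) X f" using f by (simp add: sub)
    show "\<phi> g (q x) \<notin> B" if "g \<in> carrier G" "x \<in> topspace (unit_disc n) - disc_boundary n" for g x
      using attach.hyps(6) that unfolding diff by blast
    show "\<phi> \<one> w = w" if "w \<in> topspace (subtopology Y B')" for w using that Y.action_one by simp
    show "q x \<in> B" if "x \<in> disc_boundary n" for x using attach.hyps(5) that by blast
    show "f (\<phi> g a) = \<psi> g (f a)" if "g \<in> carrier G" "a \<in> B" for g a by (rule f_eq[OF that])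
    show "continuous_map (unit_disc n) X F" by (rule F(1))
    show "F x = f (q x)" if "x \<in> disc_boundary n" for x using F(2)[OF that] by simp
    fix f' assume "continuous_map (subtopology Y B') X f'"
      "\<And>g w. g \<in> carrier G \<Longrightarrow> w \<in> topspace (subtopology Y B') \<Longrightarrow> f' (\<phi> g w) = \<psi> g (f' w)"
    then show thesis by (rule that)
  qed
  then show ?case unfolding top by blast
qed

text \<open>The same induction with cylinders over cells in place of cells. The ends carry the two
  given maps, the side carries the homotopy obtained before.\<close>

lemma equivariant_homotopy_exists:
  fixes G (structure)
  assumes Y: "topological_action G Y \<phi>" and X: "topological_action G X \<psi>"
    and contr: "contractible_space X" "topspace X \<noteq> {}"
    and f0: "continuous_map Y X f0" "\<And>g y. g \<in> carrier G \<Longrightarrow> y \<in> topspace Y \<Longrightarrow> f0 (\<phi> g y) = \<psi> g (f0 y)"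
    and f1: "continuous_map Y X f1" "\<And>g y. g \<in> carrier G \<Longrightarrow> y \<in> topspace Y \<Longrightarrow> f1 (\<phi> g y) = \<psi> g (f1 y)"
    and B: "free_cellular G Y \<phi> B e"
  shows "\<exists>h. continuous_map (prod_topology (top_of_set {0..1::real}) (subtopology Y B)) X h \<and>
    (\<forall>y\<in>B. h (0, y) = f0 y \<and> h (1, y) = f1 y) \<and>
    (\<forall>g\<in>carrier G. \<forall>t\<in>{0..1}. \<forall>y\<in>B. h (t, \<phi> g y) = \<psi> g (h (t, y)))"
  using B
proof (induction rule: free_cellular.induct)
  case empty
  show ?case by (simp add: continuous_map_def)
next
  case (attach B e B' n q)
  interpret Y: topological_action G Y \<phi> by fact
  note D = coherentD[OF attach.hyps(3)]
  let ?I = "top_of_set {0..1::real}" and ?D = "unit_disc n"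
  let ?W = "prod_topology ?I (subtopology Y B')"
  let ?A = "{0, 1} \<times> B' \<union> {0..1} \<times> B"
  let ?\<phi> = "\<lambda>g (t::real, y). (t, \<phi> g y)" and ?q = "\<lambda>(t::real, x). (t, q x)"
  let ?P' = "{0, 1} \<times> topspace ?D \<union> {0..1} \<times> disc_boundary n"
  have B'Y: "B' \<subseteq> topspace Y" by fact
  have top: "topspace (subtopology Y B') = B'" using B'Y by auto
  have topW: "topspace ?W = {0..1} \<times> B'" using B'Y by auto
  have BB': "B \<subseteq> B'" using D(1) top by simp
  have sub: "subtopology (subtopology Y B') B = subtopology Y B"
    using BB' by (simp add: subtopology_subtopology Int_absorb1)
  have AW: "?A \<subseteq> topspace ?W" unfolding topW using BB' by auto
  have inv: "\<phi> g y \<in> B" if "g \<in> carrier G" "y \<in> B" for g y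
    using Y.free_cellular_invariant[OF attach.hyps(1) that] .
  have inv': "\<phi> g y \<in> B'" if "g \<in> carrier G" "y \<in> B'" for g y
    using Y.free_cellular_invariant[OF free_cellular.attach[OF attach.hyps] that] .
  obtain h where h: "continuous_map (prod_topology ?I (subtopology Y B)) X h"
    and h01: "\<And>y. y \<in> B \<Longrightarrow> h (0, y) = f0 y" "\<And>y. y \<in> B \<Longrightarrow> h (1, y) = f1 y"
    and h_eq: "\<And>g t y. g \<in> carrier G \<Longrightarrow> t \<in> {0..1} \<Longrightarrow> y \<in> B \<Longrightarrow> h (t, \<phi> g y) = \<psi> g (h (t, y))"
    using attach.IH by blast
  \<comment> \<open>Over \<open>B\<close> the homotopy built so far takes precedence;
    \<open>h01\<close> says that it agrees with the prescription on the ends. The last branch is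
    meant for time 1, the only other time that occurs in \<open>?A\<close> off
    \<open>B\<close>.\<close>
  define f where "f = (\<lambda>(t, y). if y \<in> B then h (t, y) else if t = 0 then f0 y else f1 y)"
  have fh: "f (t, y) = h (t, y)" if "y \<in> B" for t y using that by (simp add: f_def)
  have f0': "f (0, y) = f0 y" and f1': "f (1, y) = f1 y" for y using h01 by (simp_all add: f_def)
  have f_eq: "f (?\<phi> g w) = \<psi> g (f w)" if g: "g \<in> carrier G" and wA: "w \<in> ?A" for g w
  proof -
    obtain t y where w: "w = (t, y)" by force
    consider "y \<in> B" "t \<in> {0..1}" | "y \<in> B'" "t = 0" | "y \<in> B'" "t = 1"
      using wA unfolding w by blast
    then show ?thesis
    proof cases
      case 1
      then show ?thesis using inv g h_eq by (simp add: w fh)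
    next
      case 2
      then show ?thesis using g f0(2) B'Y by (auto simp: w f0')
    next
      case 3
      then show ?thesis using g f1(2) B'Y by (auto simp: w f1')
    qed
  qed
  have closed_B: "closedin (subtopology Y B') B"
    using attach.hyps(5) inv by (intro free_cellular_closed[OF B'Y attach.hyps(3) _ attach.hyps(6)]) auto
  have f: "continuous_map (subtopology ?W ?A) X f"
  proof (rule continuous_map_closed_cover3)
    have cl: "closedin ?W ({t} \<times> B')" if "t \<in> {0..1}" for t
    proof -
      have "closedin ?I {t}" using that by (intro finite_imp_closedin) auto
      moreover have "closedin (subtopology Y B') B'" using closedin_topspace[of "subtopology Y B'"] unfolding top .
      ultimately show ?thesis by (simp add: closedin_prod_Times_iff)
    qed
    have "closedin ?W (topspace ?I \<times> B)"
      unfolding closedin_prod_Times_iff using closed_B closedin_topspace by blast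
    then have cl': "closedin ?W ({0..1} \<times> B)" by simp
    show "closedin (subtopology ?W ?A) ({0} \<times> B')" "closedin (subtopology ?W ?A) ({1} \<times> B')"
      "closedin (subtopology ?W ?A) ({0..1} \<times> B)"
      by (rule closedin_subset_topspace[OF cl] closedin_subset_topspace[OF cl'], auto)+
    show "topspace (subtopology ?W ?A) \<subseteq> {0} \<times> B' \<union> {1} \<times> B' \<union> {0..1} \<times> B" by auto
    have snd: "continuous_map (subtopology (subtopology ?W ?A) C) Y snd" for C
      by (intro continuous_map_from_subtopology)
        (rule continuous_map_into_fulltopology[OF continuous_map_snd])
    show "continuous_map (subtopology (subtopology ?W ?A) ({0} \<times> B')) X f"
      by (rule continuous_map_eq[OF continuous_map_compose[OF snd f0(1)]]) (auto simp: f0')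
    show "continuous_map (subtopology (subtopology ?W ?A) ({1} \<times> B')) X f"
      by (rule continuous_map_eq[OF continuous_map_compose[OF snd f1(1)]]) (auto simp: f1')
    have "prod_topology ?I (subtopology (subtopology Y B') B) = subtopology ?W (topspace ?I \<times> B)"
      by (rule prod_topology_subtopology(2))
    moreover have "?A \<inter> ({0..1} \<times> B) = topspace ?I \<times> B" by auto
    ultimately have "subtopology (subtopology ?W ?A) ({0..1} \<times> B) = prod_topology ?I (subtopology Y B)"
      by (simp only: subtopology_subtopology[of ?W] sub)
    moreover have "continuous_map (prod_topology ?I (subtopology Y B)) X f"
      by (rule continuous_map_eq[OF h]) (auto simp: fh)
    ultimately show "continuous_map (subtopology (subtopology ?W ?A) ({0..1} \<times> B)) X f" by simp
  qed
  \<comment> \<open>The product is coherent relative to the cylinder over \<open>B\<close>; the ends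
    are then added to the subspace.\<close>
  have coh: "coherent ?W ?A (prod_topology ?I ?D) ((\<lambda>g. ?\<phi> g \<circ> ?q) ` carrier G)"
  proof (rule coherent_subtopology_mono)
    have "locally_compact_space ?I" "Hausdorff_space ?I"
      by (auto intro: compact_imp_locally_compact_space Hausdorff_space_subtopology simp: compact_space_subtopology)
    from coherent_prod[OF attach.hyps(3) this]
    have "coherent ?W (topspace ?I \<times> B) (prod_topology ?I ?D)
        ((\<lambda>e (z, x). (z, e x)) ` (\<lambda>g. \<phi> g \<circ> q) ` carrier G)" .
    moreover have "(\<lambda>e (z, x). (z, e x)) ` (\<lambda>g. \<phi> g \<circ> q) ` carrier G = (\<lambda>g. ?\<phi> g \<circ> ?q) ` carrier G"
      unfolding image_image by (intro image_cong refl) (auto simp: fun_eq_iff)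
    ultimately show "coherent ?W (topspace ?I \<times> B) (prod_topology ?I ?D) ((\<lambda>g. ?\<phi> g \<circ> ?q) ` carrier G)"
      by simp
  qed (use AW in auto)
  have q: "continuous_map ?D Y q"
  proof (rule continuous_map_eq)
    show "continuous_map ?D Y (\<phi> \<one> \<circ> q)"
      using D(2)[of "\<phi> \<one> \<circ> q"] by (auto intro: continuous_map_into_fulltopology)
    show "(\<phi> \<one> \<circ> q) x = q x" if "x \<in> topspace ?D" for x
      using attach.hyps(4) B'Y that Y.action_one by auto
  qed
  have qW: "?q x \<in> topspace ?W" if "x \<in> topspace (prod_topology ?I ?D)" for x
    using that attach.hyps(4) unfolding topW by auto
  have qA: "?q x \<in> ?A" if "x \<in> ?P'" for x
    using that attach.hyps(4,5) by auto
  have "continuous_map (prod_topology ?I ?D) ?W ?q"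
    unfolding case_prod_unfold
  proof (intro continuous_map_pairedI continuous_map_fst continuous_map_into_subtopology)
    show "continuous_map (prod_topology ?I ?D) Y (\<lambda>u. q (snd u))"
      using continuous_map_compose[OF continuous_map_snd q] by (simp add: o_def)
  qed (use attach.hyps(4) in auto)
  then have "continuous_map (subtopology (prod_topology ?I ?D) ?P') (subtopology ?W ?A) ?q"
  proof (intro continuous_map_into_subtopology continuous_map_from_subtopology)
    show "?q \<in> topspace (subtopology (prod_topology ?I ?D) ?P') \<rightarrow> ?A"
    proof
      fix u assume "u \<in> topspace (subtopology (prod_topology ?I ?D) ?P')"
      then show "?q u \<in> ?A" by (intro qA) auto
    qed
  qed
  then have "continuous_map (subtopology (prod_topology ?I ?D) ?P') X (f \<circ> ?q)"
    using f by (rule continuous_map_compose)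
  then obtain F where F: "continuous_map (prod_topology ?I ?D) X F"
      "\<And>x. x \<in> ?P' \<Longrightarrow> F x = (f \<circ> ?q) x"
    using contractible_extension_cylinder[OF contr] by metis
  \<comment> \<open>Off \<open>?P'\<close> the time is strictly between 0 and 1 and the point is
    interior to the disc, so freeness of the cell carries over to its cylinder.\<close>
  have diff: "t \<in> {0..1} \<and> t \<noteq> 0 \<and> t \<noteq> 1 \<and> x \<in> disc_interior n"
    if "(t, x) \<in> topspace (prod_topology ?I ?D) - ?P'" for t x
    using that disc_interior_boundary(2)[of n] by auto
  obtain f' where f': "continuous_map ?W X f'" "\<And>a. a \<in> ?A \<Longrightarrow> f' a = f a"
    "\<And>g w. g \<in> carrier G \<Longrightarrow> w \<in> topspace ?W \<Longrightarrow> f' (?\<phi> g w) = \<psi> g (f' w)"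
  proof (rule equivariant_extension[OF X coh, where P' = ?P' and f = f and F = F])
    show "?\<phi> (g \<otimes> h) w = ?\<phi> g (?\<phi> h w)" if "g \<in> carrier G" "h \<in> carrier G" "w \<in> topspace ?W" for g h w
      using that Y.action_mult by auto
    show "?\<phi> \<one> w = w" if "w \<in> topspace ?W" for w using that Y.action_one by auto
    show "?\<phi> g a \<in> ?A" if "g \<in> carrier G" "a \<in> ?A" for g a
      using that inv inv' by auto
    show "g = h \<and> x = y" if "g \<in> carrier G" "h \<in> carrier G" "x \<in> topspace (prod_topology ?I ?D) - ?P'"
      "y \<in> topspace (prod_topology ?I ?D) - ?P'" "?\<phi> g (?q x) = ?\<phi> h (?q y)" for g h x y
    proof -
      obtain t x' s y' where xy: "x = (t, x')" "y = (s, y')" by force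
      have "x' \<in> disc_interior n" "y' \<in> disc_interior n" using diff that(3,4) unfolding xy by blast+
      moreover have "t = s" "\<phi> g (q x') = \<phi> h (q y')" using that(5) unfolding xy by auto
      ultimately show ?thesis using attach.hyps(7)[OF that(1,2)] unfolding xy by blast
    qed
    show "?\<phi> g (?q x) \<notin> ?A" if g: "g \<in> carrier G" and x: "x \<in> topspace (prod_topology ?I ?D) - ?P'" for g x
    proof -
      obtain t x' where xt: "x = (t, x')" by force
      have "t \<noteq> 0" "t \<noteq> 1" "x' \<in> disc_interior n" using diff x unfolding xt by blast+
      then show ?thesis using attach.hyps(6)[OF g] unfolding xt by auto
    qed
    show "?q x \<in> topspace ?W" if "x \<in> topspace (prod_topology ?I ?D)" for x by (rule qW[OF that])
    show "?q x \<in> ?A" if "x \<in> ?P'" for x by (rule qA[OF that])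
    show "continuous_map (subtopology ?W ?A) X f" by (rule f)
    show "f (?\<phi> g w) = \<psi> g (f w)" if "g \<in> carrier G" "w \<in> ?A" for g w by (rule f_eq[OF that])
    show "continuous_map (prod_topology ?I ?D) X F" by (rule F(1))
    show "F x = f (?q x)" if "x \<in> ?P'" for x using F(2)[OF that] by simp
    fix f'
    assume "continuous_map ?W X f'" "\<And>a. a \<in> ?A \<Longrightarrow> f' a = f a"
      "\<And>g w. g \<in> carrier G \<Longrightarrow> w \<in> topspace ?W \<Longrightarrow> f' (?\<phi> g w) = \<psi> g (f' w)"
    then show thesis by (rule that)
  qed
  have "(0, y) \<in> ?A" "(1, y) \<in> ?A" if "y \<in> B'" for y using that by auto
  then have "\<forall>y\<in>B'. f' (0, y) = f0 y \<and> f' (1, y) = f1 y" using f'(2) f0' f1' by simp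
  moreover have "f' (t, \<phi> g y) = \<psi> g (f' (t, y))" if "g \<in> carrier G" "t \<in> {0..1}" "y \<in> B'" for g t y
    using f'(3)[OF that(1), of "(t, y)"] that unfolding topW by simp
  ultimately show ?case using f'(1) by blast
qed

section \<open>Orbit spaces of free cellular actions\<close>

lemma continuous_map_orbit_space_lift:
  fixes G (structure)
  assumes Y: "topological_action G Y \<phi>" and X: "topological_action G X \<psi>"
    and f: "continuous_map Y X f" "\<And>g y. g \<in> carrier G \<Longrightarrow> y \<in> topspace Y \<Longrightarrow> f (\<phi> g y) = \<psi> g (f y)"
  obtains k where "continuous_map (orbit_space G Y \<phi>) (orbit_space G X \<psi>) k"
    "\<And>y. y \<in> topspace Y \<Longrightarrow> k (orbit G \<phi> y) = orbit G \<psi> (f y)"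
proof -
  interpret Y: topological_action G Y \<phi> by fact
  interpret X: topological_action G X \<psi> by fact
  have fX: "f y \<in> topspace X" if "y \<in> topspace Y" for y using f(1) that by (auto simp: continuous_map_def)
  have fib: "(orbit G \<psi> \<circ> f) y = (orbit G \<psi> \<circ> f) z"
    if "y \<in> topspace Y" "z \<in> topspace Y" "orbit G \<phi> y = orbit G \<phi> z" for y z
    using that f(2) fX by (auto simp: Y.orbit_eq_iff X.orbit_eq_iff)
  show ?thesis
    by (rule quotient_map_lift_exists[OF quotient_map_orbit_space[of Y G \<phi>]
          continuous_map_compose[OF f(1) X.continuous_orbit] fib])
      (use that in auto)
qed

text \<open>The interval is locally compact and Hausdorff, so its product with the orbit map is
  still a quotient map, and an equivariant homotopy descends.\<close>

lemma homotopic_orbit_space_maps: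
  fixes G (structure)
  assumes Y: "topological_action G Y \<phi>" and X: "topological_action G X \<psi>"
    and h: "continuous_map (prod_topology (top_of_set {0..1::real}) Y) X h"
      "\<And>g t y. g \<in> carrier G \<Longrightarrow> t \<in> {0..1} \<Longrightarrow> y \<in> topspace Y \<Longrightarrow> h (t, \<phi> g y) = \<psi> g (h (t, y))"
    and k: "\<And>y. y \<in> topspace Y \<Longrightarrow> k (orbit G \<phi> y) = orbit G \<psi> (h (0, y))"
      "\<And>y. y \<in> topspace Y \<Longrightarrow> l (orbit G \<phi> y) = orbit G \<psi> (h (1, y))"
  shows "homotopic_with (\<lambda>_. True) (orbit_space G Y \<phi>) (orbit_space G X \<psi>) k l"
proof -
  interpret Y: topological_action G Y \<phi> by fact
  interpret X: topological_action G X \<psi> by fact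
  let ?I = "top_of_set {0..1::real}"
  have "locally_compact_space ?I" "Hausdorff_space ?I"
    by (auto intro: compact_imp_locally_compact_space Hausdorff_space_subtopology simp: compact_space_subtopology)
  then have q: "quotient_map (prod_topology ?I Y) (prod_topology ?I (orbit_space G Y \<phi>)) (\<lambda>(t, y). (t, orbit G \<phi> y))"
    by (intro quotient_map_prod_right quotient_map_orbit_space) auto
  have hX: "h u \<in> topspace X" if "u \<in> topspace (prod_topology ?I Y)" for u
    using h(1) that by (auto simp: continuous_map_def)
  have fib: "(orbit G \<psi> \<circ> h) u = (orbit G \<psi> \<circ> h) v"
    if "u \<in> topspace (prod_topology ?I Y)" "v \<in> topspace (prod_topology ?I Y)"
      "(\<lambda>(t, y). (t, orbit G \<phi> y)) u = (\<lambda>(t, y). (t, orbit G \<phi> y)) v" for u v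
  proof -
    obtain t y s z where uv: "u = (t, y)" "v = (s, z)" by force
    have ty: "t \<in> {0..1}" "y \<in> topspace Y" "z \<in> topspace Y" "t = s" "orbit G \<phi> y = orbit G \<phi> z"
      using that unfolding uv by auto
    then obtain g where g: "g \<in> carrier G" "z = \<phi> g y" using Y.orbit_eq_iff by blast
    have "h (t, y) \<in> topspace X" "h (t, z) \<in> topspace X" using ty by (auto intro: hX)
    moreover have "h (t, z) = \<psi> g (h (t, y))" using h(2) g ty by simp
    ultimately have "orbit G \<psi> (h (t, y)) = orbit G \<psi> (h (t, z))" using g(1) X.orbit_eq_iff by blast
    then show ?thesis by (simp add: uv ty(4))
  qed
  obtain H where H: "continuous_map (prod_topology ?I (orbit_space G Y \<phi>)) (orbit_space G X \<psi>) H"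
      "\<And>u. u \<in> topspace (prod_topology ?I Y) \<Longrightarrow> H ((\<lambda>(t, y). (t, orbit G \<phi> y)) u) = (orbit G \<psi> \<circ> h) u"
    by (rule quotient_map_lift_exists[OF q continuous_map_compose[OF h(1) X.continuous_orbit] fib]) (use that in blast)+
  have "H (0, c) = k c \<and> H (1, c) = l c" if c: "c \<in> topspace (orbit_space G Y \<phi>)" for c
  proof -
    obtain y where "y \<in> topspace Y" "c = orbit G \<phi> y" using c unfolding Y.topspace_orbit_space by blast
    then show ?thesis using H(2)[of "(0, y)"] H(2)[of "(1, y)"] k by auto
  qed
  then show ?thesis
    by (subst homotopic_with) (use H(1) in auto)
qed

text \<open>Any two equivariant maps from a free cellular space to a contractible one are joined by
  an equivariant homotopy; here they are \<open>u\<close> and the identity.\<close>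

lemma homotopic_orbit_space_id:
  fixes G (structure)
  assumes Z: "topological_action G Z \<theta>" "free_cellular G Z \<theta> (topspace Z) a"
      "contractible_space Z" "topspace Z \<noteq> {}"
    and u: "continuous_map Z Z u" "\<And>g z. g \<in> carrier G \<Longrightarrow> z \<in> topspace Z \<Longrightarrow> u (\<theta> g z) = \<theta> g (u z)"
    and m: "\<And>z. z \<in> topspace Z \<Longrightarrow> m (orbit G \<theta> z) = orbit G \<theta> (u z)"
  shows "homotopic_with (\<lambda>_. True) (orbit_space G Z \<theta>) (orbit_space G Z \<theta>) m id"
proof -
  have "\<exists>h. continuous_map (prod_topology (top_of_set {0..1::real}) (subtopology Z (topspace Z))) Z h \<and>
      (\<forall>y\<in>topspace Z. h (0, y) = u y \<and> h (1, y) = id y) \<and>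
      (\<forall>g\<in>carrier G. \<forall>t\<in>{0..1}. \<forall>y\<in>topspace Z. h (t, \<theta> g y) = \<theta> g (h (t, y)))"
    by (rule equivariant_homotopy_exists[where Y = Z and X = Z and \<phi> = \<theta> and \<psi> = \<theta>])
      (use Z u in simp_all)
  then obtain h where h: "continuous_map (prod_topology (top_of_set {0..1::real}) Z) Z h"
    "\<And>z. z \<in> topspace Z \<Longrightarrow> h (0, z) = u z" "\<And>z. z \<in> topspace Z \<Longrightarrow> h (1, z) = z"
    "\<And>g t z. g \<in> carrier G \<Longrightarrow> t \<in> {0..1} \<Longrightarrow> z \<in> topspace Z \<Longrightarrow> h (t, \<theta> g z) = \<theta> g (h (t, z))"
    unfolding id_apply subtopology_topspace by blast
  show ?thesis
    by (rule homotopic_orbit_space_maps[where h = h and X = Z and Y = Z and \<phi> = \<theta> and \<psi> = \<theta>])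
      (use Z(1) h m in simp_all)
qed

lemma orbit_spaces_homotopy_equivalent:
  fixes G (structure)
  assumes Y: "topological_action G Y \<phi>" "free_cellular G Y \<phi> (topspace Y) d"
      "contractible_space Y" "topspace Y \<noteq> {}"
    and X: "topological_action G X \<psi>" "free_cellular G X \<psi> (topspace X) e"
      "contractible_space X" "topspace X \<noteq> {}"
  shows "orbit_space G Y \<phi> homotopy_equivalent_space orbit_space G X \<psi>"
proof -
  obtain f where f: "continuous_map Y X f" "\<And>g y. g \<in> carrier G \<Longrightarrow> y \<in> topspace Y \<Longrightarrow> f (\<phi> g y) = \<psi> g (f y)"
    using equivariant_map_exists[OF Y(1) X(1,3,4) Y(2)] unfolding subtopology_topspace by blast
  obtain k where k: "continuous_map X Y k" "\<And>g x. g \<in> carrier G \<Longrightarrow> x \<in> topspace X \<Longrightarrow> k (\<psi> g x) = \<phi> g (k x)"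
    using equivariant_map_exists[OF X(1) Y(1,3,4) X(2)] unfolding subtopology_topspace by blast
  obtain f' where f': "continuous_map (orbit_space G Y \<phi>) (orbit_space G X \<psi>) f'"
      "\<And>y. y \<in> topspace Y \<Longrightarrow> f' (orbit G \<phi> y) = orbit G \<psi> (f y)"
    by (rule continuous_map_orbit_space_lift[where f = f, OF Y(1) X(1)]) (use f that in auto)
  obtain k' where k': "continuous_map (orbit_space G X \<psi>) (orbit_space G Y \<phi>) k'"
      "\<And>x. x \<in> topspace X \<Longrightarrow> k' (orbit G \<psi> x) = orbit G \<phi> (k x)"
    by (rule continuous_map_orbit_space_lift[where f = k, OF X(1) Y(1)]) (use k that in auto)
  have fX: "f y \<in> topspace X" if "y \<in> topspace Y" for y using f(1) that by (auto simp: continuous_map_def)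
  have kY: "k x \<in> topspace Y" if "x \<in> topspace X" for x using k(1) that by (auto simp: continuous_map_def)
  have "homotopic_with (\<lambda>_. True) (orbit_space G Y \<phi>) (orbit_space G Y \<phi>) (k' \<circ> f') id"
  proof (rule homotopic_orbit_space_id[OF Y])
    show "continuous_map Y Y (k \<circ> f)" by (rule continuous_map_compose[OF f(1) k(1)])
  qed (use f k fX f'(2) k'(2) in auto)
  moreover have "homotopic_with (\<lambda>_. True) (orbit_space G X \<psi>) (orbit_space G X \<psi>) (f' \<circ> k') id"
  proof (rule homotopic_orbit_space_id[OF X])
    show "continuous_map X X (f \<circ> k)" by (rule continuous_map_compose[OF k(1) f(1)])
  qed (use f k kY f'(2) k'(2) in auto)
  ultimately show ?thesis
    unfolding homotopy_equivalent_space_def using f'(1) k'(1) by blast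
qed

text \<open>A free orbit of cells has a single cell as image. That cell is embedded on its interior,
  because an identification of two of its points by a group element is excluded by freeness. So each
  orbit attaches one cell downstairs.\<close>

lemma (in topological_action) has_euler_orbit_space:
  assumes "free_cellular G X \<phi> B e"
  shows "has_euler (subtopology (orbit_space G X \<phi>) (orbit G \<phi> ` B)) {} e"
  using assms
proof (induction rule: free_cellular.induct)
  case empty
  show ?case by (rule has_euler_empty) simp
next
  case (attach B e B' n q)
  note D = coherentD[OF attach.hyps(3)]
  let ?O = "orbit_space G X \<phi>" and ?r = "orbit G \<phi>" and ?D = "unit_disc n"
  let ?W = "subtopology ?O (?r ` B')"
  have B'X: "B' \<subseteq> topspace X" by fact
  have top: "topspace (subtopology X B') = B'" using B'X by auto
  have BB': "B \<subseteq> B'" using D(1) top by simp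
  have inv: "\<phi> g y \<in> B" if "g \<in> carrier G" "y \<in> B" for g y
    using free_cellular_invariant[OF attach.hyps(1) that] .
  have inv': "\<phi> g y \<in> B'" if "g \<in> carrier G" "y \<in> B'" for g y
    using free_cellular_invariant[OF free_cellular.attach[OF attach.hyps] that] .
  have topW: "topspace ?W = ?r ` B'" using B'X by (auto simp: topspace_orbit_space)
  have sub: "subtopology ?W (?r ` B) = subtopology ?O (?r ` B)"
    using BB' by (simp add: subtopology_subtopology Int_absorb1 image_mono)
  have qX: "q x \<in> topspace X" "q x \<in> B'" if "x \<in> topspace ?D" for x using attach.hyps(2,4) that by blast+
  have q: "continuous_map ?D (subtopology X B') q"
  proof (rule continuous_map_eq)
    show "continuous_map ?D (subtopology X B') (\<phi> \<one> \<circ> q)" using D(2)[of "\<phi> \<one> \<circ> q"] by auto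
  qed (use qX action_one in auto)
  have r: "continuous_map (subtopology X S) (subtopology ?O (?r ` S)) ?r" for S
    by (intro continuous_map_into_subtopology continuous_map_from_subtopology continuous_orbit) auto
  have orb: "?r (\<phi> g x) = ?r x" if "g \<in> carrier G" "x \<in> topspace X" for g x
    using that orbit_eq_iff action_closed by metis
  have memB: "x \<in> B" if x: "x \<in> topspace X" "?r x \<in> ?r ` B" for x
  proof -
    obtain b where b: "b \<in> B" "?r b = ?r x" using x(2) by (metis imageE)
    then obtain g where "g \<in> carrier G" "x = \<phi> g b"
      using orbit_eq_iff[of b x] x(1) BB' B'X by blast
    then show ?thesis using inv b(1) by simp
  qed
  have int: "x \<in> topspace ?D" if "x \<in> disc_interior n" for x using that by (simp add: disc_interior_def)
  have "cell_attached ?W (?r ` B) n (?r \<circ> q)"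
    unfolding cell_attached_def
  proof (intro conjI)
    show "(?r \<circ> q) ` disc_boundary n \<subseteq> ?r ` B" using attach.hyps(5) by auto
    show "inj_on (?r \<circ> q) (disc_interior n)"
    proof (rule inj_onI)
      fix x y assume xy: "x \<in> disc_interior n" "y \<in> disc_interior n" "(?r \<circ> q) x = (?r \<circ> q) y"
      then obtain g where g: "g \<in> carrier G" "q y = \<phi> g (q x)"
        using orbit_eq_iff qX(1) int by (metis comp_apply)
      then have "\<phi> \<one> (q y) = \<phi> g (q x)" using action_one[OF qX(1)[OF int[OF xy(2)]]] by simp
      then show "x = y" using attach.hyps(7)[of \<one> g y x] g xy by simp
    qed
    have "(?r \<circ> q) x \<notin> ?r ` B" if "x \<in> disc_interior n" for x
    proof
      assume "(?r \<circ> q) x \<in> ?r ` B"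
      then have "q x \<in> B" using memB qX(1) int that by simp
      then show False using attach.hyps(6)[of \<one> x] that action_one qX(1) int by simp
    qed
    then show "(?r \<circ> q) ` disc_interior n \<inter> ?r ` B = {}" by blast
    show "coherent ?W (?r ` B) ?D {?r \<circ> q}"
      unfolding coherent_def
    proof (intro conjI allI impI ballI)
      show "?r ` B \<subseteq> topspace ?W" unfolding topW using BB' by blast
      show "continuous_map ?D ?W k" if "k \<in> {?r \<circ> q}" for k
        using that continuous_map_compose[OF q r] by simp
      show "topspace ?W = ?r ` B \<union> (\<Union>e\<in>{?r \<circ> q}. e ` topspace ?D)"
      proof (intro subset_antisym subsetI)
        fix c assume "c \<in> topspace ?W"
        then obtain b where b: "b \<in> B'" "c = ?r b" unfolding topW by blast
        then consider "b \<in> B" | g x where "g \<in> carrier G" "x \<in> topspace ?D" "b = \<phi> g (q x)"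
          using D(3) unfolding top by auto
        then show "c \<in> ?r ` B \<union> (\<Union>e\<in>{?r \<circ> q}. e ` topspace ?D)"
          by cases (use b orb qX(1) in auto)
      qed (use BB' qX(2) topW in auto)
      fix C assume C: "C \<subseteq> topspace ?W" "openin (subtopology ?W (?r ` B)) (?r ` B \<inter> C)"
        "\<forall>e\<in>{?r \<circ> q}. openin ?D {x \<in> topspace ?D. e x \<in> C}"
      \<comment> \<open>The preimage of \<open>C\<close> in \<open>B'\<close> is invariant, so its
        trace on every translate of the cell is the same set and coherence upstairs shows that it is
        open.\<close>
      define T where "T = {y \<in> B'. ?r y \<in> C}"
      have "openin (subtopology X B') T"
      proof (rule D(4))
        show "T \<subseteq> topspace (subtopology X B')" unfolding top T_def by blast
        have "openin (subtopology X B) {y \<in> topspace (subtopology X B). ?r y \<in> ?r ` B \<inter> C}"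
          using openin_continuous_map_preimage[OF r C(2)[unfolded sub]] .
        moreover have "{y \<in> topspace (subtopology X B). ?r y \<in> ?r ` B \<inter> C} = B \<inter> T"
          using BB' B'X by (auto simp: T_def)
        ultimately have "openin (subtopology X B) (B \<inter> T)" by simp
        moreover have "subtopology (subtopology X B') B = subtopology X B"
          using BB' by (simp add: subtopology_subtopology Int_absorb1)
        ultimately show "openin (subtopology (subtopology X B') B) (B \<inter> T)" by simp
        fix k assume "k \<in> (\<lambda>g. \<phi> g \<circ> q) ` carrier G"
        then obtain g where g: "g \<in> carrier G" "k = \<phi> g \<circ> q" by blast
        have "{x \<in> topspace ?D. k x \<in> T} = {x \<in> topspace ?D. (?r \<circ> q) x \<in> C}"
          using g orb qX inv' by (auto simp: T_def)
        then show "openin ?D {x \<in> topspace ?D. k x \<in> T}" using C(3) by simp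
      qed
      \<comment> \<open>The image of \<open>B'\<close> carries the topology induced from the whole
        orbit space, not a quotient topology of its own. Hence \<open>T\<close> is first extended to
        an open set of \<open>X\<close>, whose image under the open orbit map then cuts out
        \<open>C\<close>.\<close>
      then obtain V where V: "openin X V" "T = V \<inter> B'" by (auto simp: openin_subtopology)
      have "C = ?r ` V \<inter> ?r ` B'"
      proof (intro subset_antisym subsetI)
        fix c assume c: "c \<in> C"
        then obtain b where b: "b \<in> B'" "c = ?r b" using C(1) unfolding topW by blast
        then have "b \<in> T" using c by (simp add: T_def)
        then show "c \<in> ?r ` V \<inter> ?r ` B'" using b V(2) by blast
      next
        fix c assume "c \<in> ?r ` V \<inter> ?r ` B'"
        then obtain v b where vb: "v \<in> V" "b \<in> B'" "c = ?r v" "c = ?r b" by blast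
        have "v \<in> topspace X" using vb(1) openin_subset[OF V(1)] by blast
        then obtain g where "g \<in> carrier G" "v = \<phi> g b"
          using orbit_eq_iff[of b v] vb B'X by auto
        then have "v \<in> T" using inv' vb V(2) by blast
        then show "c \<in> C" using vb(3) by (simp add: T_def)
      qed
      then show "openin ?W C" using openin_orbit_image[OF V(1)] by (auto simp: openin_subtopology)
    qed
  qed
  then show ?case by (rule has_euler_cell_attached) (use attach.IH sub in simp)
qed

section \<open>Finite \<open>G\<close>-CW complexes as free cellular spaces over a torsion-free subgroup\<close>

lemma (in group) l_coset_eqD:
  assumes "g \<in> carrier G" "h \<in> carrier G" "subgroup K G" "g <# K = h <# K"
  obtains k where "k \<in> K" "g = h \<otimes> k"
proof -
  have "g \<otimes> \<one> \<in> g <# K"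
    unfolding l_coset_def using subgroup.one_closed[OF assms(3)] by blast
  then have "g \<in> h <# K" using assms(1,4) by simp
  then obtain k where "k \<in> K" "g = h \<otimes> k" unfolding l_coset_def by blast
  then show ?thesis by (rule that)
qed

lemma (in group) r_coset_eqD:
  assumes "g \<in> carrier G" "h \<in> carrier G" "subgroup L G" "L #> g = L #> h"
  obtains l where "l \<in> L" "g = l \<otimes> h"
proof -
  have "g \<in> L #> h" using rcos_self[OF assms(1,3)] assms(4) by simp
  then obtain l where "l \<in> L" "g = l \<otimes> h" unfolding r_coset_def by blast
  then show ?thesis by (rule that)
qed

text \<open>When \<open>L\<close> meets no conjugate of \<open>K\<close>, every double coset \<open>L g K\<close> consists of exactly \<open>|K|\<close> cosets of \<open>L\<close>.\<close>

lemma (in group) double_coset_representatives: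
  assumes L: "subgroup L G" "finite (rcosets L)" and K: "subgroup K G" "finite K"
    and free: "\<And>g x. g \<in> carrier G \<Longrightarrow> x \<in> L \<Longrightarrow> inv g \<otimes> x \<otimes> g \<in> K \<Longrightarrow> x = \<one>"
  obtains R where "R \<subseteq> carrier G" "finite R" "card R * card K = card (rcosets L)"
    "\<And>g. g \<in> carrier G \<Longrightarrow> \<exists>r\<in>R. \<exists>l\<in>L. \<exists>k\<in>K. g = l \<otimes> r \<otimes> k"
    "\<And>r s l k. r \<in> R \<Longrightarrow> s \<in> R \<Longrightarrow> l \<in> L \<Longrightarrow> k \<in> K \<Longrightarrow> s = l \<otimes> r \<otimes> k \<Longrightarrow> r = s"
proof -
  note [simp] = subgroup.mem_carrier[OF L(1)] subgroup.mem_carrier[OF K(1)]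
  have LG: "L \<subseteq> carrier G" using L(1) by (rule subgroup.subset)
  \<comment> \<open>\<open>P g\<close> is the set of right cosets of \<open>L\<close> inside the
    double coset of \<open>g\<close>. These sets partition \<open>rcosets L\<close> into blocks of
    size \<open>card K\<close>.\<close>
  define P where "P = (\<lambda>g. (\<lambda>k. L #> (g \<otimes> k)) ` K)"
  have Lc: "L #> (l \<otimes> g) = L #> g" if "l \<in> L" "g \<in> carrier G" for l g
    using that coset_mult_assoc[OF LG, of l g] coset_join2[of l L] L(1) by simp
  have P_mult: "P (l \<otimes> g \<otimes> k) = P g" if lgk: "l \<in> L" "g \<in> carrier G" "k \<in> K" for l g k
  proof -
    have "P (l \<otimes> g \<otimes> k) = (\<lambda>k'. L #> (g \<otimes> (k \<otimes> k'))) ` K"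
      unfolding P_def using lgk Lc by (intro image_cong refl) (simp add: m_assoc)
    also have "\<dots> = (\<lambda>k'. L #> (g \<otimes> k')) ` (\<lambda>k'. k \<otimes> k') ` K" by (simp add: image_image)
    also have "(\<lambda>k'. k \<otimes> k') ` K = K"
      using coset_join3[OF _ K(1) lgk(3)] lgk(3) unfolding l_coset_def by (simp add: image_def) blast
    finally show ?thesis by (simp add: P_def)
  qed
  have P_eqD: "\<exists>l\<in>L. \<exists>k\<in>K. h = l \<otimes> g \<otimes> k" if gh: "g \<in> carrier G" "h \<in> carrier G" and ne: "P g \<inter> P h \<noteq> {}" for g h
  proof -
    obtain k k' where k: "k \<in> K" "k' \<in> K" "L #> (h \<otimes> k') = L #> (g \<otimes> k)"
      using ne unfolding P_def by blast
    obtain l where l: "l \<in> L" "h \<otimes> k' = l \<otimes> (g \<otimes> k)"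
      by (rule r_coset_eqD[OF _ _ L(1) k(3)]) (use gh k in auto)
    have "h = h \<otimes> k' \<otimes> inv k'" using gh k by (simp add: m_assoc)
    also have "\<dots> = l \<otimes> g \<otimes> (k \<otimes> inv k')" using gh k l by (simp add: m_assoc)
    finally show ?thesis using l(1) k subgroup.m_closed[OF K(1)] subgroup.m_inv_closed[OF K(1)] by blast
  qed
  have card_P: "card (P g) = card K" if g: "g \<in> carrier G" for g
    unfolding P_def
  proof (rule card_image, rule inj_onI)
    fix k k' assume k: "k \<in> K" "k' \<in> K" "L #> (g \<otimes> k) = L #> (g \<otimes> k')"
    obtain l where l: "l \<in> L" "g \<otimes> k = l \<otimes> (g \<otimes> k')"
      by (rule r_coset_eqD[OF _ _ L(1) k(3)]) (use g k in auto)
    \<comment> \<open>Two equal cosets yield an element of \<open>L\<close> that is conjugate into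
      \<open>K\<close>, and \<open>free\<close> makes it trivial.\<close>
    have "inv g \<otimes> l \<otimes> g = inv g \<otimes> (l \<otimes> (g \<otimes> k')) \<otimes> inv k'"
      using g k l by (simp add: m_assoc)
    also have "\<dots> = k \<otimes> inv k'" unfolding l(2)[symmetric] using g k by (simp add: m_assoc[symmetric])
    finally have "inv g \<otimes> l \<otimes> g \<in> K"
      using k subgroup.m_closed[OF K(1)] subgroup.m_inv_closed[OF K(1)] by simp
    then have "l = \<one>" using free g l(1) by blast
    then show "k = k'" using l g k by simp
  qed
  let ?\<P> = "P ` carrier G"
  have U: "\<Union>?\<P> = rcosets L"
  proof (intro subset_antisym subsetI)
    fix C assume "C \<in> rcosets L"
    then obtain g where "g \<in> carrier G" "C = L #> g" unfolding RCOSETS_def by blast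
    then have "C = L #> (g \<otimes> \<one>)" by simp
    then have "C \<in> P g" unfolding P_def by (rule image_eqI) (rule subgroup.one_closed[OF K(1)])
    then show "C \<in> \<Union>?\<P>" using \<open>g \<in> carrier G\<close> by blast
  next
    fix C assume "C \<in> \<Union>?\<P>"
    then show "C \<in> rcosets L" unfolding P_def using rcosetsI[OF LG] by auto
  qed
  have finP: "finite ?\<P>" using L(2) U by (metis finite_UnionD)
  have "card K * card ?\<P> = card (\<Union>?\<P>)"
  proof (rule card_partition[OF finP])
    show "finite (\<Union>?\<P>)" using U L(2) by simp
    show "c1 \<inter> c2 = {}" if c: "c1 \<in> ?\<P>" "c2 \<in> ?\<P>" "c1 \<noteq> c2" for c1 c2
    proof (rule ccontr)
      assume ne: "c1 \<inter> c2 \<noteq> {}"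
      obtain g h where gh: "g \<in> carrier G" "h \<in> carrier G" "c1 = P g" "c2 = P h" using c by blast
      then show False using P_eqD[OF gh(1,2)] ne P_mult c(3) by metis
    qed
  qed (use card_P in auto)
  then have card: "card ?\<P> * card K = card (rcosets L)" using U by (simp add: mult.commute)
  have "\<forall>c\<in>?\<P>. \<exists>g. g \<in> carrier G \<and> P g = c" by blast
  from bchoice[OF this] obtain \<rho> where \<rho>: "\<And>c. c \<in> ?\<P> \<Longrightarrow> \<rho> c \<in> carrier G \<and> P (\<rho> c) = c"
    by blast
  have inj: "inj_on \<rho> ?\<P>" using \<rho> by (metis inj_onI)
  show ?thesis
  proof
    show "\<rho> ` ?\<P> \<subseteq> carrier G" using \<rho> by blast
    show "finite (\<rho> ` ?\<P>)" using finP by simp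
    show "card (\<rho> ` ?\<P>) * card K = card (rcosets L)" using card card_image[OF inj] by simp
    show "\<exists>r\<in>\<rho> ` ?\<P>. \<exists>l\<in>L. \<exists>k\<in>K. g = l \<otimes> r \<otimes> k" if g: "g \<in> carrier G" for g
    proof -
      have "P (\<rho> (P g)) = P g" "\<rho> (P g) \<in> carrier G" using \<rho> g by blast+
      moreover have "P g \<noteq> {}" unfolding P_def using subgroup.one_closed[OF K(1)] by blast
      ultimately show ?thesis using P_eqD[of "\<rho> (P g)" g] g by auto
    qed
    show "r = s" if "r \<in> \<rho> ` ?\<P>" "s \<in> \<rho> ` ?\<P>" "l \<in> L" "k \<in> K" "s = l \<otimes> r \<otimes> k" for r s l k
    proof -
      obtain c d where c: "c \<in> ?\<P>" "r = \<rho> c" and d: "d \<in> ?\<P>" "s = \<rho> d" using \<open>r \<in> \<rho> ` ?\<P>\<close> \<open>s \<in> \<rho> ` ?\<P>\<close> by blast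
      have "P s = P r" using P_mult that(3-5) \<rho>[OF c(1)] c(2) by simp
      then show ?thesis using \<rho>[OF c(1)] \<rho>[OF d(1)] c(2) d(2) by simp
    qed
  qed
qed

section \<open>Skeleta of a finite complex and the orbits of its cells under a subgroup\<close>

locale finite_CW =
  fixes G :: "('a, 'm) monoid_scheme" (structure) and X :: "'x topology" and \<phi> cells
  assumes space: "G_space G X \<phi>"
    and cw: "G_CW_structure G X \<phi> cells"
    and finite_cells: "finite (SIGMA n:UNIV. cells n)"
begin

lemma action: "group_action G (topspace X) \<phi>"
  using space by (simp add: G_space_def)

end

sublocale finite_CW \<subseteq> topological_action G X \<phi>
proof -
  interpret group_action G "topspace X" \<phi> by (rule action)
  interpret group G using group_hom group_hom_def by blast
  have one: "\<phi> \<one> x = x" if "x \<in> topspace X" for x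
    using that by (simp add: id_eq_one[symmetric])
  show "topological_action G X \<phi>"
    by unfold_locales (use space one composition_rule in \<open>auto simp: G_space_def\<close>)
qed

context finite_CW
begin

abbreviation "sk \<equiv> skeleton_below G \<phi> cells"

lemma topological_action_subgroup:
  assumes "subgroup L G"
  shows "topological_action (G\<lparr>carrier := L\<rparr>) X \<phi>"
proof -
  interpret L: group "G\<lparr>carrier := L\<rparr>" using assms is_group by (rule subgroup.subgroup_is_group)
  show ?thesis
    by unfold_locales
      (use subgroup.mem_carrier[OF assms] action_continuous action_one action_mult in auto)
qed

lemma finite_cells_dim: "finite (cells n)"
proof -
  have "cells n \<subseteq> snd ` (SIGMA n:UNIV. cells n)" by force
  then show ?thesis using finite_cells by (metis finite_imageI finite_subset)
qed

lemma cells_bounded: obtains M where "\<And>n. n \<ge> M \<Longrightarrow> cells n = {}"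
proof -
  have "finite (fst ` (SIGMA n:UNIV. cells n))" using finite_cells by (rule finite_imageI)
  then obtain M where M: "\<And>n. n \<in> fst ` (SIGMA n:UNIV. cells n) \<Longrightarrow> n < M"
    by (metis finite_nat_set_iff_bounded)
  have "cells n = {}" if "n \<ge> M" for n
  proof (rule ccontr)
    assume "cells n \<noteq> {}"
    then have "n \<in> fst ` (SIGMA n:UNIV. cells n)" by force
    then show False using M[of n] that by simp
  qed
  then show ?thesis using that by blast
qed

lemma q_topspace:
  assumes "(K, q) \<in> cells n" "x \<in> topspace (unit_disc n)"
  shows "q x \<in> topspace X"
  using G_CW_structure_cell(2)[OF cw assms(1)] assms(2) by (auto simp: continuous_map_def)

lemma sk_Suc: "sk (Suc n) = sk n \<union> (\<Union>(K, q)\<in>cells n. \<Union>g\<in>carrier G. \<phi> g ` q ` topspace (unit_disc n))"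
  unfolding skeleton_below_def lessThan_Suc by (simp add: Un_commute)

lemma sk_0: "sk 0 = {}" by (simp add: skeleton_below_def)

lemma sk_subset: "sk n \<subseteq> topspace X"
  using G_CW_structure_topspace[OF cw] by blast

lemma sk_eventually:
  assumes "\<And>n. n \<ge> M \<Longrightarrow> cells n = {}" shows "sk M = topspace X"
proof -
  have "sk n \<subseteq> sk M" for n
  proof
    fix x assume "x \<in> sk n"
    then obtain m K q g where "(K, q) \<in> cells m" "g \<in> carrier G" "x \<in> \<phi> g ` q ` topspace (unit_disc m)"
      unfolding skeleton_below_def by blast
    moreover from this have "m < M" using assms[of m] by (cases "m < M") auto
    ultimately show "x \<in> sk M" unfolding skeleton_below_def by blast
  qed
  then show ?thesis using G_CW_structure_topspace[OF cw] by blast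
qed

lemma sk_invariant: "g \<in> carrier G \<Longrightarrow> x \<in> sk n \<Longrightarrow> \<phi> g x \<in> sk n"
  by (rule skeleton_below_translate[OF action cw])

lemma boundary_sk:
  assumes "(K, q) \<in> cells n" "g \<in> carrier G" "x \<in> disc_boundary n"
  shows "\<phi> g (q x) \<in> sk n"
  using sk_invariant G_CW_structure_cell(4)[OF cw assms(1)] assms by blast

lemma interior_not_sk:
  assumes "(K, q) \<in> cells n" "g \<in> carrier G" "x \<in> topspace (unit_disc n)" "\<phi> g (q x) \<notin> sk n"
  shows "x \<in> disc_interior n"
  using boundary_sk assms disc_interior_boundary(2)[of n] by blast

lemma char_map_continuous:
  assumes "(K, q) \<in> cells n" "g \<in> carrier G"
  shows "continuous_map (unit_disc n) X (\<phi> g \<circ> q)"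
  using G_CW_structure_cell(2)[OF cw assms(1)] action_continuous[OF assms(2)]
  by (rule continuous_map_compose)

text \<open>Orbits under a subgroup and cells in a fixed point space fill only part of a skeleton,
  so closedness must be decided between two skeleta. A translate inside \<open>B\<close> is governed
  by \<open>T \<inter> B\<close>; one whose open cell misses \<open>T\<close> is governed by its
  boundary, which lies in the lower skeleton; any other is tested on the disc.\<close>

lemma closedin_between_skeleta:
  assumes B: "sk n \<subseteq> B" "B \<subseteq> B'" "B' \<subseteq> sk (Suc n)"
    and T: "T \<subseteq> B'" "closedin (subtopology X B) (T \<inter> B)"
    and cells: "\<And>K q g. (K, q) \<in> cells n \<Longrightarrow> g \<in> carrier G \<Longrightarrow>
      (\<forall>x\<in>topspace (unit_disc n). \<phi> g (q x) \<in> B) \<or>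
      (\<forall>x\<in>disc_interior n. \<phi> g (q x) \<notin> T) \<or>
      closedin (unit_disc n) {x \<in> topspace (unit_disc n). \<phi> g (q x) \<in> T}"
  shows "closedin (subtopology X B') T"
proof -
  have BX: "B \<subseteq> topspace X" using B sk_subset by blast
  have Tsk: "T \<subseteq> sk (Suc n)" using T B by blast
  have T_sk: "closedin (subtopology X (sk n)) (T \<inter> sk n)"
  proof -
    have "closedin (subtopology (subtopology X B) (sk n)) (T \<inter> B \<inter> sk n)"
      using T(2) by (metis closedin_subtopology_Int_closed closedin_subtopology inf_commute)
    moreover have "T \<inter> B \<inter> sk n = T \<inter> sk n" "B \<inter> sk n = sk n" using B by blast+
    ultimately show ?thesis by (simp add: subtopology_subtopology)
  qed
  have "closedin (unit_disc n) {x \<in> topspace (unit_disc n). \<phi> g (q x) \<in> T}"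
    if Kq: "(K, q) \<in> cells n" and g: "g \<in> carrier G" for K q g
  proof -
    note cont = char_map_continuous[OF Kq g]
    consider "\<And>x. x \<in> topspace (unit_disc n) \<Longrightarrow> \<phi> g (q x) \<in> B" | "\<forall>x\<in>disc_interior n. \<phi> g (q x) \<notin> T"
      | "closedin (unit_disc n) {x \<in> topspace (unit_disc n). \<phi> g (q x) \<in> T}"
      using cells[OF Kq g] by blast
    then show ?thesis
    proof cases
      case 1
      then have "continuous_map (unit_disc n) (subtopology X B) (\<phi> g \<circ> q)"
        using cont by (intro continuous_map_into_subtopology) auto
      from closedin_continuous_map_preimage[OF this T(2)]
      have "closedin (unit_disc n) {x \<in> topspace (unit_disc n). (\<phi> g \<circ> q) x \<in> T \<inter> B}" .
      moreover have "{x \<in> topspace (unit_disc n). (\<phi> g \<circ> q) x \<in> T \<inter> B} = {x \<in> topspace (unit_disc n). \<phi> g (q x) \<in> T}"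
        using 1 by auto
      ultimately show ?thesis by simp
    next
      case 2
      have bd: "disc_boundary n \<subseteq> topspace (unit_disc n)" using disc_interior_boundary(2)[of n] by blast
      have "continuous_map (subtopology (unit_disc n) (disc_boundary n)) (subtopology X (sk n)) (\<phi> g \<circ> q)"
        using cont boundary_sk[OF Kq g] by (intro continuous_map_into_subtopology continuous_map_from_subtopology) auto
      from closedin_continuous_map_preimage[OF this T_sk]
      have "closedin (unit_disc n) {x \<in> topspace (subtopology (unit_disc n) (disc_boundary n)). (\<phi> g \<circ> q) x \<in> T \<inter> sk n}"
        using closedin_disc_boundary by (rule closedin_trans_full)
      moreover have "{x \<in> topspace (subtopology (unit_disc n) (disc_boundary n)). (\<phi> g \<circ> q) x \<in> T \<inter> sk n} =
          {x \<in> topspace (unit_disc n). \<phi> g (q x) \<in> T}"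
        using 2 T(1) boundary_sk[OF Kq g] bd disc_interior_boundary(2)[of n] by auto
      ultimately show ?thesis by simp
    qed
  qed
  then have "closedin (subtopology X (sk (Suc n))) T"
    using T_sk G_CW_structure_closedin_skeleton[OF cw Tsk] by blast
  then have "closedin (subtopology (subtopology X (sk (Suc n))) B') T"
    using T(1) by (rule closedin_subset_topspace)
  moreover have "sk (Suc n) \<inter> B' = B'" using B by blast
  ultimately show ?thesis by (simp add: subtopology_subtopology)
qed

text \<open>The boundaries of all \<open>n\<close>-cells lie in the lower skeleton, so the orbits
  under \<open>L\<close> can be attached one after the other in any order. Distinct double cosets
  keep them apart, and \<open>free\<close> makes each orbit free.\<close>

lemma free_cellular_add_cells:
  assumes L: "subgroup L G"
    and free: "\<And>K q g x. (K, q) \<in> cells n \<Longrightarrow> g \<in> carrier G \<Longrightarrow> x \<in> L \<Longrightarrow> inv g \<otimes> x \<otimes> g \<in> K \<Longrightarrow> x = \<one>"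
    and R: "\<And>K q r. (K, q) \<in> cells n \<Longrightarrow> r \<in> R K \<Longrightarrow> r \<in> carrier G"
      "\<And>K q r s l k. (K, q) \<in> cells n \<Longrightarrow> r \<in> R K \<Longrightarrow> s \<in> R K \<Longrightarrow> l \<in> L \<Longrightarrow> k \<in> K \<Longrightarrow>
        s = l \<otimes> r \<otimes> k \<Longrightarrow> r = s"
    and e: "free_cellular (G\<lparr>carrier := L\<rparr>) X \<phi> (sk n) e"
    and S: "finite S" "S \<subseteq> (SIGMA c:cells n. R (fst c))"
  shows "free_cellular (G\<lparr>carrier := L\<rparr>) X \<phi>
    (sk n \<union> {\<phi> l (\<phi> r (q x)) | K q r l x. ((K, q), r) \<in> S \<and> l \<in> L \<and> x \<in> topspace (unit_disc n)})
    (e + int (card S) * (-1) ^ n)"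
  using S
proof (induction S rule: finite_induct)
  case empty
  show ?case using e by simp
next
  case (insert c S)
  let ?D = "unit_disc n"
  note [simp] = subgroup.mem_carrier[OF L]
  obtain K q r where c: "c = ((K, q), r)" by (metis prod.exhaust)
  have Kq: "(K, q) \<in> cells n" and r: "r \<in> R K" using insert.prems c by auto
  have rG: "r \<in> carrier G" using R(1)[OF Kq r] .
  note K = G_CW_structure_cell(1)[OF cw Kq]
  define B where "B = sk n \<union> {\<phi> l (\<phi> r (q x)) | K q r l x. ((K, q), r) \<in> S \<and> l \<in> L \<and> x \<in> topspace ?D}"
  define B' where "B' = B \<union> (\<Union>l\<in>L. \<phi> l ` \<phi> r ` q ` topspace ?D)"
  have IH: "free_cellular (G\<lparr>carrier := L\<rparr>) X \<phi> B (e + int (card S) * (-1) ^ n)"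
    unfolding B_def using insert by auto
  have B'_eq: "sk n \<union> {\<phi> l (\<phi> r (q x)) | K q r l x. ((K, q), r) \<in> insert c S \<and> l \<in> L \<and> x \<in> topspace ?D} = B'"
    unfolding B'_def B_def c by blast
  have mult: "\<phi> l (\<phi> s (p x)) = \<phi> (l \<otimes> s) (p x)"
    if "(J, p) \<in> cells n" "l \<in> L" "s \<in> carrier G" "x \<in> topspace ?D" for J p l s x
    using that q_topspace[OF that(1,4)] by (simp add: action_mult)
  have new_sk: "\<phi> l (\<phi> s (p x)) \<in> sk (Suc n)"
    if "(J, p) \<in> cells n" "l \<in> L" "s \<in> carrier G" "x \<in> topspace ?D" for J p l s x
  proof -
    have "\<phi> l (\<phi> s (p x)) \<in> \<phi> (l \<otimes> s) ` p ` topspace ?D" using mult[OF that] that(4) by blast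
    moreover have "l \<otimes> s \<in> carrier G" using that by simp
    ultimately show ?thesis unfolding sk_Suc using that(1) by blast
  qed
  have S': "(J, p) \<in> cells n \<and> s \<in> R J \<and> s \<in> carrier G" if "((J, p), s) \<in> S" for J p s
  proof -
    have "(J, p) \<in> cells n" "s \<in> R J" using insert.prems that by auto
    then show ?thesis using R(1) by blast
  qed
  have B_sk: "B \<subseteq> sk (Suc n)"
  proof
    fix z assume "z \<in> B"
    then consider "z \<in> sk n" | J p s l y where "((J, p), s) \<in> S" "l \<in> L" "y \<in> topspace ?D" "z = \<phi> l (\<phi> s (p y))"
      unfolding B_def by blast
    then show "z \<in> sk (Suc n)"
    proof cases
      case 1
      then show ?thesis unfolding sk_Suc by blast
    next
      case 2
      then show ?thesis using new_sk[of J p l s y] S' by simp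
    qed
  qed
  have B'_sk: "B' \<subseteq> sk (Suc n)"
    unfolding B'_def using B_sk new_sk[OF Kq _ rG] by blast
  have B'X: "B' \<subseteq> topspace X" using B'_sk sk_subset by blast
  have skB: "sk n \<subseteq> B" by (simp add: B_def)
  have top: "topspace (subtopology X B') = B'" using B'X by auto
  have int_D: "x \<in> topspace ?D" if "x \<in> disc_interior n" for x using that by (simp add: disc_interior_def)
  have same: "(J, p) = (K, q) \<and> x = y \<and> (\<exists>k\<in>K. g = h \<otimes> k)"
    if "(J, p) \<in> cells n" "g \<in> carrier G" "h \<in> carrier G" "x \<in> disc_interior n" "y \<in> disc_interior n"
      "\<phi> g (p x) = \<phi> h (q y)" for J p g h x y
  proof -
    note inj = G_CW_structure_inj[OF cw that(1) Kq that(2-6)]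
    have "g <# K = h <# K" using inj(1,2) by simp
    then show ?thesis using inj(1,3) l_coset_eqD[OF that(2,3) K] by metis
  qed
  \<comment> \<open>A translate whose open cell meets the new orbit belongs to it: the common point
    is interior in both, and equality of the cosets of \<open>K\<close> puts \<open>g\<close> into
    the double coset of \<open>r\<close>.\<close>
  have in_new: "x \<in> disc_interior n \<and> (J, p) = (K, q) \<and> (\<exists>l\<in>L. \<exists>k\<in>K. g = l \<otimes> r \<otimes> k)"
    if "(J, p) \<in> cells n" "g \<in> carrier G" "x \<in> disc_interior n" "l \<in> L" "y \<in> topspace ?D"
      "\<phi> g (p x) = \<phi> l (\<phi> r (q y))" for J p g l x y
  proof -
    have eq: "\<phi> g (p x) = \<phi> (l \<otimes> r) (q y)" using that mult[OF Kq _ rG] by simp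
    have "\<phi> g (p x) \<notin> sk n" using G_CW_structure_not_below[OF cw that(1-3)] .
    then have "\<phi> (l \<otimes> r) (q y) \<notin> sk n" using eq by simp
    then have "y \<in> disc_interior n" using interior_not_sk[OF Kq _ that(5), of "l \<otimes> r"] that(4) rG by simp
    then show ?thesis using same[OF that(1,2) _ that(3) _ eq] that(3,4) rG by auto
  qed
  \<comment> \<open>A common point with an orbit attached earlier would place two chosen
    representatives in one double coset.\<close>
  have not_B: "\<phi> l (\<phi> r (q x)) \<notin> B" if l: "l \<in> L" and x: "x \<in> disc_interior n" for l x
  proof
    assume "\<phi> l (\<phi> r (q x)) \<in> B"
    then consider "\<phi> l (\<phi> r (q x)) \<in> sk n"
      | J p s l' y where "((J, p), s) \<in> S" "l' \<in> L" "y \<in> topspace ?D" "\<phi> l (\<phi> r (q x)) = \<phi> l' (\<phi> s (p y))"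
      unfolding B_def by blast
    then show False
    proof cases
      case 1
      then show False
        using G_CW_structure_not_below[OF cw Kq _ x, of "l \<otimes> r"] mult[OF Kq l rG int_D[OF x]] l rG by simp
    next
      case 2
      note s = S'[OF 2(1)]
      have eq: "\<phi> (l' \<otimes> s) (p y) = \<phi> (l \<otimes> r) (q x)"
        using 2(4) mult[OF Kq l rG int_D[OF x]] mult[of J p l' s y] s 2(2,3) by simp
      moreover have "\<phi> (l \<otimes> r) (q x) \<notin> sk n" using G_CW_structure_not_below[OF cw Kq _ x] l rG by simp
      ultimately have y: "y \<in> disc_interior n" using interior_not_sk[of J p n "l' \<otimes> s" y] s 2(2,3) by simp
      obtain k where JK: "(J, p) = (K, q)" and k: "k \<in> K" "l' \<otimes> s = l \<otimes> r \<otimes> k"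
        using same[where J = J and p = p and x = y and y = x and g = "l' \<otimes> s" and h = "l \<otimes> r"] eq x y s 2(2) l rG by auto
      have kG: "k \<in> carrier G" using subgroup.mem_carrier[OF K k(1)] .
      have "s = inv l' \<otimes> (l' \<otimes> s)" using 2(2) s by (simp add: m_assoc[symmetric])
      also have "\<dots> = (inv l' \<otimes> l) \<otimes> r \<otimes> k" unfolding k(2) using 2(2) l rG kG by (simp add: m_assoc)
      finally have "r = s"
        using R(2)[OF Kq r, of s "inv l' \<otimes> l" k] s JK k(1) subgroup.m_closed[OF L] subgroup.m_inv_closed[OF L] l 2(2) by auto
      then show False using insert.hyps(2) 2(1) JK c by simp
    qed
  qed
  have coh: "coherent (subtopology X B') B ?D ((\<lambda>l. \<phi> l \<circ> (\<phi> r \<circ> q)) ` L)"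
    unfolding coherent_def
  proof (intro conjI ballI allI impI)
    show "B \<subseteq> topspace (subtopology X B')" unfolding top by (auto simp: B'_def)
    have "B' = B \<union> (\<Union>e\<in>(\<lambda>l. \<phi> l \<circ> (\<phi> r \<circ> q)) ` L. e ` topspace ?D)"
      unfolding B'_def by (simp add: image_comp o_assoc)
    then show "topspace (subtopology X B') = B \<union> (\<Union>e\<in>(\<lambda>l. \<phi> l \<circ> (\<phi> r \<circ> q)) ` L. e ` topspace ?D)"
      unfolding top .
    fix f assume "f \<in> (\<lambda>l. \<phi> l \<circ> (\<phi> r \<circ> q)) ` L"
    then obtain l where l: "l \<in> L" "f = \<phi> l \<circ> (\<phi> r \<circ> q)" by blast
    have "continuous_map ?D X (\<phi> l \<circ> (\<phi> r \<circ> q))"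
      by (rule continuous_map_compose[OF char_map_continuous[OF Kq rG] action_continuous]) (use l in simp)
    then show "continuous_map ?D (subtopology X B') f"
      unfolding l(2) using l(1) by (intro continuous_map_into_subtopology) (auto simp: B'_def)
  next
    fix C assume C: "C \<subseteq> topspace (subtopology X B')" "openin (subtopology (subtopology X B') B) (B \<inter> C)"
      "\<forall>e\<in>(\<lambda>l. \<phi> l \<circ> (\<phi> r \<circ> q)) ` L. openin ?D {x \<in> topspace ?D. e x \<in> C}"
    \<comment> \<open>In terms of complements the claim has the form of
      \<open>closedin_between_skeleta\<close>.\<close>
    have "closedin (subtopology X B') (B' - C)"
    proof (rule closedin_between_skeleta[OF skB _ B'_sk])
      show BB': "B \<subseteq> B'" unfolding B'_def by blast
      have "topspace (subtopology X B) = B" using BB' B'X by auto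
      moreover have "subtopology (subtopology X B') B = subtopology X B"
        using BB' by (simp add: subtopology_subtopology Int_absorb1)
      ultimately have "closedin (subtopology X B) (B - B \<inter> C)"
        using C(2) by (metis closedin_diff closedin_topspace)
      moreover have "(B' - C) \<inter> B = B - B \<inter> C" using BB' by blast
      ultimately show "closedin (subtopology X B) ((B' - C) \<inter> B)" by simp
      fix J p g assume Jp: "(J, p) \<in> cells n" and g: "g \<in> carrier G"
      \<comment> \<open>Three kinds of translates: its open cell misses \<open>B'\<close>; or it
        belongs to an orbit attached before and lies in \<open>B\<close> as a whole; or it is one of
        the new cells, up to an element of the stabilizer, which fixes the cell pointwise, and there
        \<open>C\<close> has been tested.\<close>
      show "(\<forall>x\<in>topspace ?D. \<phi> g (p x) \<in> B) \<or> (\<forall>x\<in>disc_interior n. \<phi> g (p x) \<notin> B' - C) \<or>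
          closedin ?D {x \<in> topspace ?D. \<phi> g (p x) \<in> B' - C}"
      proof (cases "\<exists>x\<in>disc_interior n. \<phi> g (p x) \<in> B'")
        case True
        then obtain x where x: "x \<in> disc_interior n" "\<phi> g (p x) \<in> B'" by blast
        have nsk: "\<phi> g (p x) \<notin> sk n" using G_CW_structure_not_below[OF cw Jp g x(1)] .
        show ?thesis
        proof (cases "\<phi> g (p x) \<in> B")
          case True
          then obtain J' p' s l y where 2: "((J', p'), s) \<in> S" "l \<in> L" "y \<in> topspace ?D" "\<phi> g (p x) = \<phi> l (\<phi> s (p' y))"
            using nsk unfolding B_def by blast
          note s = S'[OF 2(1)]
          have ls: "l \<otimes> s \<in> carrier G" using 2(2) s by simp
          have eq: "\<phi> g (p x) = \<phi> (l \<otimes> s) (p' y)" using 2 mult s by metis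
          then have "y \<in> disc_interior n" using interior_not_sk[OF _ ls 2(3)] s nsk by auto
          note inj = G_CW_structure_inj[OF cw Jp conjunct1[OF s] g ls x(1) this eq]
          have "g <# J = (l \<otimes> s) <# J" using inj(1,2) by simp
          then obtain k where k: "k \<in> J" "g = l \<otimes> s \<otimes> k"
            using l_coset_eqD[OF g ls G_CW_structure_cell(1)[OF cw Jp]] by metis
          have "\<phi> g (p z) = \<phi> l (\<phi> s (p' z))" if z: "z \<in> topspace ?D" for z
          proof -
            have "\<phi> g (p z) = \<phi> (l \<otimes> s) (\<phi> k (p z))"
              using k ls subgroup.mem_carrier[OF G_CW_structure_cell(1)[OF cw Jp] k(1)] q_topspace[OF Jp z]
              by (simp add: action_mult)
            also have "\<phi> k (p z) = p' z" using G_CW_structure_cell(3)[OF cw Jp k(1) z] inj(1) by simp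
            finally show ?thesis using mult 2(2) s z by metis
          qed
          then have "\<forall>z\<in>topspace ?D. \<phi> g (p z) \<in> B" using 2(1,2) unfolding B_def by auto
          then show ?thesis by blast
        next
          case False
          then obtain l y where l: "l \<in> L" "y \<in> topspace ?D" "\<phi> g (p x) = \<phi> l (\<phi> r (q y))"
            using x(2) unfolding B'_def by blast
          obtain l' k where JK: "(J, p) = (K, q)" and lk: "l' \<in> L" "k \<in> K" "g = l' \<otimes> r \<otimes> k"
            using in_new[OF Jp g x(1) l] by blast
          have "\<phi> g (p z) = (\<phi> l' \<circ> (\<phi> r \<circ> q)) z" if z: "z \<in> topspace ?D" for z
          proof -
            have "\<phi> g (q z) = \<phi> (l' \<otimes> r) (\<phi> k (q z))"
              using lk rG subgroup.mem_carrier[OF K lk(2)] q_topspace[OF Kq z] by (simp add: action_mult)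
            also have "\<phi> k (q z) = q z" using G_CW_structure_cell(3)[OF cw Kq lk(2) z] .
            finally show ?thesis using mult[OF Kq lk(1) rG z] JK by simp
          qed
          moreover have "(\<phi> l' \<circ> (\<phi> r \<circ> q)) z \<in> B'" if "z \<in> topspace ?D" for z
            using lk(1) that unfolding B'_def by auto
          ultimately have "{z \<in> topspace ?D. \<phi> g (p z) \<in> B' - C} =
              topspace ?D - {z \<in> topspace ?D. (\<phi> l' \<circ> (\<phi> r \<circ> q)) z \<in> C}"
            by auto
          moreover have "openin ?D {z \<in> topspace ?D. (\<phi> l' \<circ> (\<phi> r \<circ> q)) z \<in> C}" using C(3) lk(1) by blast
          ultimately show ?thesis by (simp add: closedin_diff)
        qed
      qed blast
    qed blast
    then have "openin (subtopology X B') (topspace (subtopology X B') - (B' - C))"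
      by (rule openin_diff[OF openin_topspace])
    moreover have "topspace (subtopology X B') - (B' - C) = C" using C(1) unfolding top by blast
    ultimately show "openin (subtopology X B') C" by simp
  qed
  have inj: "g = h \<and> x = y"
    if gh: "g \<in> L" "h \<in> L" "x \<in> disc_interior n" "y \<in> disc_interior n"
      "\<phi> g ((\<phi> r \<circ> q) x) = \<phi> h ((\<phi> r \<circ> q) y)" for g h x y
  proof -
    have "\<phi> (g \<otimes> r) (q x) = \<phi> (h \<otimes> r) (q y)" using gh mult[OF Kq _ rG] int_D by simp
    then obtain k where k: "x = y" "k \<in> K" "g \<otimes> r = h \<otimes> r \<otimes> k"
      using same[OF Kq _ _ gh(3,4), of "g \<otimes> r" "h \<otimes> r"] gh rG by auto
    \<comment> \<open>A coincidence of two translates conjugates \<open>inv h \<otimes> g\<close>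
      into the stabilizer, where \<open>free\<close> applies.\<close>
    have "inv r \<otimes> (inv h \<otimes> g) \<otimes> r = inv r \<otimes> (inv h \<otimes> (g \<otimes> r))" using gh rG by (simp add: m_assoc)
    also have "\<dots> = k"
      unfolding k(3) using gh rG subgroup.mem_carrier[OF K k(2)] by (simp add: m_assoc inv_solve_left')
    finally have "inv h \<otimes> g = \<one>"
      using free[OF Kq rG, of "inv h \<otimes> g"] k(2) subgroup.m_closed[OF L] subgroup.m_inv_closed[OF L] gh(1,2) by simp
    then have "g = h" using gh(1,2) by (metis L inv_equality inv_inv subgroup.mem_carrier inv_closed)
    then show ?thesis using k(1) by simp
  qed
  have "free_cellular (G\<lparr>carrier := L\<rparr>) X \<phi> B' (e + int (card S) * (-1) ^ n + (-1) ^ n)"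
  proof (rule free_cellular.attach[OF IH B'X])
    show "coherent (subtopology X B') B ?D ((\<lambda>l. \<phi> l \<circ> (\<phi> r \<circ> q)) ` carrier (G\<lparr>carrier := L\<rparr>))"
      using coh by simp
    show "(\<phi> r \<circ> q) ` topspace ?D \<subseteq> B'"
    proof
      fix z assume "z \<in> (\<phi> r \<circ> q) ` topspace ?D"
      then obtain x where x: "x \<in> topspace ?D" "z = \<phi> r (q x)" by auto
      have "z = \<phi> \<one> (\<phi> r (q x))" using x action_one action_closed[OF rG q_topspace[OF Kq]] by simp
      then show "z \<in> B'" unfolding B'_def using x subgroup.one_closed[OF L] by blast
    qed
    show "(\<phi> r \<circ> q) ` disc_boundary n \<subseteq> B" using boundary_sk[OF Kq rG] skB by auto
    show "\<phi> g ((\<phi> r \<circ> q) x) \<notin> B" if "g \<in> carrier (G\<lparr>carrier := L\<rparr>)" "x \<in> disc_interior n" for g x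
      using not_B that by simp
    show "g = h \<and> x = y"
      if "g \<in> carrier (G\<lparr>carrier := L\<rparr>)" "h \<in> carrier (G\<lparr>carrier := L\<rparr>)" "x \<in> disc_interior n" "y \<in> disc_interior n"
        "\<phi> g ((\<phi> r \<circ> q) x) = \<phi> h ((\<phi> r \<circ> q) y)" for g h x y
      using inj that by simp
  qed
  moreover have "e + int (card S) * (-1) ^ n + (-1) ^ n = e + int (card (insert c S)) * (-1) ^ n"
    using insert.hyps by (simp add: algebra_simps)
  ultimately show ?case unfolding B'_eq by simp
qed

text \<open>The representatives depend on the stabilizer alone, so cells with the same stabilizer
  share them; each cell contributes one orbit under \<open>L\<close> for every member of
  \<open>R K\<close>.\<close>

lemma free_cellular_skeleton:
  assumes L: "subgroup L G"
    and free: "\<And>n K q g x. (K, q) \<in> cells n \<Longrightarrow> g \<in> carrier G \<Longrightarrow> x \<in> L \<Longrightarrow> inv g \<otimes> x \<otimes> g \<in> K \<Longrightarrow> x = \<one>"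
    and R: "\<And>n K q. (K, q) \<in> cells n \<Longrightarrow> R K \<subseteq> carrier G" "\<And>n K q. (K, q) \<in> cells n \<Longrightarrow> finite (R K)"
      "\<And>n K q g. (K, q) \<in> cells n \<Longrightarrow> g \<in> carrier G \<Longrightarrow> \<exists>r\<in>R K. \<exists>l\<in>L. \<exists>k\<in>K. g = l \<otimes> r \<otimes> k"
      "\<And>n K q r s l k. (K, q) \<in> cells n \<Longrightarrow> r \<in> R K \<Longrightarrow> s \<in> R K \<Longrightarrow> l \<in> L \<Longrightarrow> k \<in> K \<Longrightarrow>
        s = l \<otimes> r \<otimes> k \<Longrightarrow> r = s"
  shows "free_cellular (G\<lparr>carrier := L\<rparr>) X \<phi> (sk n) (\<Sum>m<n. \<Sum>c\<in>cells m. (-1) ^ m * int (card (R (fst c))))"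
proof (induction n)
  case 0
  show ?case unfolding sk_0 lessThan_0 sum.empty by (rule free_cellular.empty)
next
  case (Suc n)
  let ?D = "unit_disc n"
  note [simp] = subgroup.mem_carrier[OF L]
  define S where "S = (SIGMA c:cells n. R (fst c))"
  have fin: "finite S" unfolding S_def using finite_cells_dim R(2) by (intro finite_SigmaI) auto
  have card: "card S = (\<Sum>c\<in>cells n. card (R (fst c)))"
    unfolding S_def by (rule card_SigmaI) (use finite_cells_dim R(2) in auto)
  let ?U = "{\<phi> l (\<phi> r (q x)) | K q r l x. ((K, q), r) \<in> S \<and> l \<in> L \<and> x \<in> topspace ?D}"
  have "sk n \<union> ?U = sk (Suc n)"
  proof (intro subset_antisym subsetI)
    fix z assume "z \<in> sk n \<union> ?U"
    then consider "z \<in> sk n" | K q r l x where "((K, q), r) \<in> S" "l \<in> L" "x \<in> topspace ?D" "z = \<phi> l (\<phi> r (q x))"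
      by blast
    then show "z \<in> sk (Suc n)"
    proof cases
      case 1
      then show ?thesis unfolding sk_Suc by blast
    next
      case 2
      have Kq: "(K, q) \<in> cells n" "r \<in> R K" using 2(1) by (auto simp: S_def)
      then have r: "r \<in> carrier G" using R(1) by blast
      have "z = \<phi> (l \<otimes> r) (q x)" using 2 r q_topspace[OF Kq(1) 2(3)] by (simp add: action_mult)
      moreover have "l \<otimes> r \<in> carrier G" using 2(2) r by simp
      ultimately show ?thesis unfolding sk_Suc using Kq(1) 2(3) by blast
    qed
  next
    fix z assume "z \<in> sk (Suc n)"
    then consider "z \<in> sk n" | K q g x where "(K, q) \<in> cells n" "g \<in> carrier G" "x \<in> topspace ?D" "z = \<phi> g (q x)"
      unfolding sk_Suc by blast
    then show "z \<in> sk n \<union> ?U"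
    proof cases
      case 2
      obtain r l k where rlk: "r \<in> R K" "l \<in> L" "k \<in> K" "g = l \<otimes> r \<otimes> k" using R(3)[OF 2(1,2)] by blast
      have r: "r \<in> carrier G" using R(1)[OF 2(1)] rlk(1) by blast
      have "z = \<phi> l (\<phi> r (\<phi> k (q x)))"
        using 2 rlk r subgroup.mem_carrier[OF G_CW_structure_cell(1)[OF cw 2(1)] rlk(3)] q_topspace[OF 2(1,3)]
        by (simp add: action_mult action_closed)
      then have "z = \<phi> l (\<phi> r (q x))" using G_CW_structure_cell(3)[OF cw 2(1) rlk(3) 2(3)] by simp
      moreover have "((K, q), r) \<in> S" using 2(1) rlk(1) by (simp add: S_def)
      ultimately show ?thesis using rlk(2) 2(3) by blast
    qed blast
  qed
  moreover have "free_cellular (G\<lparr>carrier := L\<rparr>) X \<phi>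
    (sk n \<union> ?U)
    ((\<Sum>m<n. \<Sum>c\<in>cells m. (-1) ^ m * int (card (R (fst c)))) + int (card S) * (-1) ^ n)"
  proof (rule free_cellular_add_cells[OF L _ _ _ Suc fin])
    show "S \<subseteq> (SIGMA c:cells n. R (fst c))" by (simp add: S_def)
    show "r \<in> carrier G" if "(K, q) \<in> cells n" "r \<in> R K" for K q r using R(1) that by blast
    show "x = \<one>" if "(K, q) \<in> cells n" "g \<in> carrier G" "x \<in> L" "inv g \<otimes> x \<otimes> g \<in> K" for K q g x
      using free that by blast
    show "r = s" if "(K, q) \<in> cells n" "r \<in> R K" "s \<in> R K" "l \<in> L" "k \<in> K" "s = l \<otimes> r \<otimes> k" for K q r s l k
      using R(4) that by blast
  qed
  ultimately show ?case by (simp add: card sum_distrib_left mult.commute)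
qed

end

section \<open>The orbifold Euler characteristic counts cells\<close>

lemma (in group) conj_nat_pow:
  assumes "g \<in> carrier G" "x \<in> carrier G"
  shows "(inv g \<otimes> x \<otimes> g) [^] (m::nat) = inv g \<otimes> x [^] m \<otimes> g"
proof (induction m)
  case (Suc m)
  have "(inv g \<otimes> x \<otimes> g) [^] Suc m = (inv g \<otimes> x [^] m \<otimes> g) \<otimes> (inv g \<otimes> x \<otimes> g)"
    by (simp only: nat_pow_Suc Suc.IH)
  also have "\<dots> = inv g \<otimes> x [^] m \<otimes> (g \<otimes> inv g) \<otimes> x \<otimes> g"
    using assms by (simp only: m_assoc m_closed inv_closed nat_pow_closed)
  finally have "(inv g \<otimes> x \<otimes> g) [^] Suc m = inv g \<otimes> x [^] m \<otimes> (g \<otimes> inv g) \<otimes> x \<otimes> g" .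
  then show ?case using assms by (simp add: m_assoc)
qed (use assms in simp)

lemma (in group) subgroup_pow_card:
  assumes "subgroup K G" "finite K" "x \<in> K"
  shows "x [^] card K = \<one>"
proof -
  interpret K: group "G\<lparr>carrier := K\<rparr>" by (rule subgroup_imp_group[OF assms(1)])
  have "x [^]\<^bsub>G\<lparr>carrier := K\<rparr>\<^esub> order (G\<lparr>carrier := K\<rparr>) = \<one>" using K.pow_order_eq_1[of x] assms(3) by simp
  then show ?thesis by (simp add: order_def nat_pow_consistent[symmetric])
qed

locale finite_EG = finite_CW +
  assumes EG: "subgroup H G \<Longrightarrow>
    (if finite H
     then fixed_points X \<phi> H \<noteq> {} \<and> contractible_space (subtopology X (fixed_points X \<phi> H))
     else fixed_points X \<phi> H = {})"
begin

lemma finite_iff_fixed: "subgroup H G \<Longrightarrow> finite H \<longleftrightarrow> fixed_points X \<phi> H \<noteq> {}"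
  using EG by metis

lemma contractible: "contractible_space X" "topspace X \<noteq> {}"
proof -
  have "fixed_points X \<phi> {\<one>} = topspace X" by (auto simp: fixed_points_def action_one)
  then show "contractible_space X" "topspace X \<noteq> {}" using EG[OF triv_subgroup] by auto
qed

text \<open>The image of the centre of the disc is fixed by \<open>K\<close>, and infinite subgroups
  have no fixed points.\<close>

lemma finite_cell_stabilizer:
  assumes "(K, q) \<in> cells n" shows "finite K"
proof -
  have "(\<lambda>_. 0) \<in> topspace (unit_disc n)" by (simp add: topspace_unit_disc)
  then have "q (\<lambda>_. 0) \<in> fixed_points X \<phi> K"
    using G_CW_structure_cell(3)[OF cw assms] q_topspace[OF assms] by (auto simp: fixed_points_def)
  then show ?thesis using finite_iff_fixed G_CW_structure_cell(1)[OF cw assms] by blast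
qed

text \<open>The stabilizer is finite, so an element of \<open>L\<close> conjugate into it has finite
  order.\<close>

lemma torsion_free_conj_cell:
  assumes L: "torsion_free_finite_index G L" and Kq: "(K, q) \<in> cells n"
    and g: "g \<in> carrier G" and x: "x \<in> L" "inv g \<otimes> x \<otimes> g \<in> K"
  shows "x = \<one>"
proof -
  note K = G_CW_structure_cell(1)[OF cw Kq] and fin = finite_cell_stabilizer[OF Kq]
  have xG: "x \<in> carrier G" using L x(1) unfolding torsion_free_finite_index_def by (meson subgroup.mem_carrier)
  have "inv g \<otimes> x [^] card K \<otimes> g = \<one>"
    using subgroup_pow_card[OF K fin x(2)] conj_nat_pow[OF g xG] by simp
  then have "x [^] card K = g \<otimes> \<one> \<otimes> inv g"
    using g xG by (metis inv_closed inv_solve_left' inv_solve_right l_one m_assoc m_closed nat_pow_closed one_closed r_one)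
  then have "x [^] card K = \<one>" using g by simp
  moreover have "card K > 0" using fin subgroup.one_closed[OF K] by (metis card_gt_0_iff empty_iff)
  ultimately show ?thesis using L x(1) unfolding torsion_free_finite_index_def by blast
qed

text \<open>Division by the index removes \<open>L\<close> from the value. This makes values
  comparable that belong to different groups and different choices of subgroups.\<close>

lemma free_cellular_total:
  assumes L: "torsion_free_finite_index G L"
  obtains e where "free_cellular (G\<lparr>carrier := L\<rparr>) X \<phi> (topspace X) e"
    "(of_int e :: rat) / of_nat (card (rcosets L)) =
      (\<Sum>(n, K, q)\<in>(SIGMA n:UNIV. cells n). (-1) ^ n / of_nat (card K))"
proof -
  have sub: "subgroup L G" and idx: "finite (rcosets L)" using L by (auto simp: torsion_free_finite_index_def)
  define Q where "Q = (\<lambda>K R. R \<subseteq> carrier G \<and> finite R \<and> card R * card K = card (rcosets L) \<and>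
    (\<forall>g\<in>carrier G. \<exists>r\<in>R. \<exists>l\<in>L. \<exists>k\<in>K. g = l \<otimes> r \<otimes> k) \<and>
    (\<forall>r\<in>R. \<forall>s\<in>R. \<forall>l\<in>L. \<forall>k\<in>K. s = l \<otimes> r \<otimes> k \<longrightarrow> r = s))"
  have "\<exists>R. Q K R" if Kq: "(K, q) \<in> cells n" for n K q
  proof (rule double_coset_representatives[OF sub idx G_CW_structure_cell(1)[OF cw Kq] finite_cell_stabilizer[OF Kq]])
    show "x = \<one>" if "g \<in> carrier G" "x \<in> L" "inv g \<otimes> x \<otimes> g \<in> K" for g x
      using torsion_free_conj_cell[OF L Kq] that .
    fix R assume "R \<subseteq> carrier G" "finite R" "card R * card K = card (rcosets L)"
      "\<And>g. g \<in> carrier G \<Longrightarrow> \<exists>r\<in>R. \<exists>l\<in>L. \<exists>k\<in>K. g = l \<otimes> r \<otimes> k"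
      "\<And>r s l k. r \<in> R \<Longrightarrow> s \<in> R \<Longrightarrow> l \<in> L \<Longrightarrow> k \<in> K \<Longrightarrow> s = l \<otimes> r \<otimes> k \<Longrightarrow> r = s"
    then have "Q K R" unfolding Q_def by (intro conjI ballI impI)
    then show "\<exists>R. Q K R" ..
  qed
  \<comment> \<open>The choice is made once for every stabilizer that occurs, so that
    \<open>R\<close> is a function of \<open>K\<close>.\<close>
  then have "\<forall>K\<in>{K. \<exists>n q. (K, q) \<in> cells n}. \<exists>R. Q K R" by blast
  from bchoice[OF this] obtain R where QR: "\<And>n K q. (K, q) \<in> cells n \<Longrightarrow> Q K (R K)" by blast
  have R: "R K \<subseteq> carrier G" "finite (R K)" "card (R K) * card K = card (rcosets L)"
    "\<And>g. g \<in> carrier G \<Longrightarrow> \<exists>r\<in>R K. \<exists>l\<in>L. \<exists>k\<in>K. g = l \<otimes> r \<otimes> k"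
    "\<And>r s l k. r \<in> R K \<Longrightarrow> s \<in> R K \<Longrightarrow> l \<in> L \<Longrightarrow> k \<in> K \<Longrightarrow> s = l \<otimes> r \<otimes> k \<Longrightarrow> r = s"
    if "(K, q) \<in> cells n" for n K q
    using QR[OF that] unfolding Q_def by (elim conjE, simp)+
  have sk: "free_cellular (G\<lparr>carrier := L\<rparr>) X \<phi> (sk n) (\<Sum>m<n. \<Sum>c\<in>cells m. (-1) ^ m * int (card (R (fst c))))" for n
    by (rule free_cellular_skeleton[OF sub]) (fact torsion_free_conj_cell[OF L] R)+
  obtain M where M: "\<And>n. n \<ge> M \<Longrightarrow> cells n = {}" by (rule cells_bounded) (rule that)
  define e where "e = (\<Sum>m<M. \<Sum>c\<in>cells m. (-1) ^ m * int (card (R (fst c))))"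
  have "free_cellular (G\<lparr>carrier := L\<rparr>) X \<phi> (topspace X) e"
    using sk[of M] sk_eventually[OF M] unfolding e_def by simp
  moreover have "(of_int e :: rat) / of_nat (card (rcosets L)) =
      (\<Sum>(n, K, q)\<in>(SIGMA n:UNIV. cells n). (-1) ^ n / of_nat (card K))"
  proof -
    have "rcosets L \<noteq> {}" unfolding RCOSETS_def by blast
    then have idx0: "card (rcosets L) > 0" using idx by (simp add: card_gt_0_iff)
    have cardR: "(of_nat (card (R (fst c))) :: rat) / of_nat (card (rcosets L)) = 1 / of_nat (card (fst c))"
      if "c \<in> cells m" for c m
    proof -
      have eq: "card (R (fst c)) * card (fst c) = card (rcosets L)" using R(3)[of "fst c" "snd c" m] that by simp
      then have "(of_nat (card (R (fst c))) :: rat) * of_nat (card (fst c)) = of_nat (card (rcosets L))"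
        by (metis of_nat_mult)
      moreover have "card (fst c) \<noteq> 0" using eq idx0 by (metis mult_0_right less_irrefl)
      ultimately show ?thesis using idx0 by (simp add: field_simps)
    qed
    have "(of_int e :: rat) / of_nat (card (rcosets L)) =
        (\<Sum>m<M. \<Sum>c\<in>cells m. (-1) ^ m * (of_nat (card (R (fst c))) / of_nat (card (rcosets L))))"
      unfolding e_def by (simp add: sum_divide_distrib)
    also have "\<dots> = (\<Sum>m<M. \<Sum>c\<in>cells m. (-1) ^ m / of_nat (card (fst c)))"
      using cardR by (intro sum.cong refl) simp
    also have "\<dots> = (\<Sum>(m, c)\<in>(SIGMA m:{..<M}. cells m). (-1) ^ m / of_nat (card (fst c)))"
      by (rule sum.Sigma) (use finite_cells_dim in auto)
    also have "(SIGMA m:{..<M}. cells m) = (SIGMA n:UNIV. cells n)"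
      using M by (auto simp: not_le[symmetric])
    finally show ?thesis by (simp add: case_prod_unfold)
  qed
  ultimately show ?thesis by (rule that)
qed

end

lemma finite_EGI:
  assumes "finite_EG_model G X \<phi>" "G_CW_structure G X \<phi> cells" "finite (SIGMA n:UNIV. cells n)"
  shows "finite_EG G X \<phi> cells"
  using assms unfolding finite_EG_model_def finite_G_CW_complex_def
  by unfold_locales auto

text \<open>The given model and the one selected by the definition are divided by the same
  \<open>L\<close>, and their orbit spaces are homotopy equivalent. The selected model enters
  through its orbit space only; the cells that are counted are those of \<open>X\<close>.\<close>

lemma orbifold_euler_eq_sum_cells:
  fixes G (structure)
  assumes model: "finite_EG_model G X \<phi>" and cw: "G_CW_structure G X \<phi> cells"
    and fin: "finite (SIGMA n:UNIV. cells n)" and vtf: "virtually_torsion_free G"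
  shows "orbifold_euler G = (\<Sum>(n, K, q)\<in>(SIGMA n:UNIV. cells n). (-1) ^ n / of_nat (card K))"
proof -
  interpret X: finite_EG G X \<phi> cells by (rule finite_EGI[OF model cw fin])
  define L where "L = (SOME L. torsion_free_finite_index G L)"
  have L: "torsion_free_finite_index G L"
    using vtf unfolding L_def virtually_torsion_free_def by (rule someI_ex)
  then have sub: "subgroup L G" by (simp add: torsion_free_finite_index_def)
  define u :: "'a points topology \<times> ('a \<Rightarrow> 'a points \<Rightarrow> 'a points)"
    where "u = (SOME (Y, \<psi>). finite_EG_model G Y \<psi>)"
  obtain Y \<psi> where u: "u = (Y, \<psi>)" by force
  \<comment> \<open>\<open>X\<close> may live on any type; a model on the type of the definition
    exists nevertheless, so the choice there does yield a model.\<close>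
  have "\<exists>u :: 'a points topology \<times> ('a \<Rightarrow> 'a points \<Rightarrow> 'a points). case u of (Y, \<psi>) \<Rightarrow> finite_EG_model G Y \<psi>"
    using finite_EG_model_imp_admits_finite_EG[OF model] unfolding admits_finite_EG_def by simp
  then have "case u of (Y, \<psi>) \<Rightarrow> finite_EG_model G Y \<psi>" unfolding u_def by (rule someI_ex)
  then have Y: "finite_EG_model G Y \<psi>" by (simp add: u)
  then obtain cells' where "G_CW_structure G Y \<psi> cells'" "finite (SIGMA n:UNIV. cells' n)"
    unfolding finite_EG_model_def finite_G_CW_complex_def by blast
  then interpret Y: finite_EG G Y \<psi> cells' by (rule finite_EGI[OF Y])
  obtain e where e: "free_cellular (G\<lparr>carrier := L\<rparr>) X \<phi> (topspace X) e"
    "(of_int e :: rat) / of_nat (card (rcosets L)) =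
      (\<Sum>(n, K, q)\<in>(SIGMA n:UNIV. cells n). (-1) ^ n / of_nat (card K))"
    by (rule X.free_cellular_total[OF L])
  obtain d where d: "free_cellular (G\<lparr>carrier := L\<rparr>) Y \<psi> (topspace Y) d"
    by (rule Y.free_cellular_total[OF L])
  interpret XL: topological_action "G\<lparr>carrier := L\<rparr>" X \<phi> by (rule X.topological_action_subgroup[OF sub])
  interpret YL: topological_action "G\<lparr>carrier := L\<rparr>" Y \<psi> by (rule Y.topological_action_subgroup[OF sub])
  have "has_euler (orbit_space (G\<lparr>carrier := L\<rparr>) X \<phi>) {} e"
    using XL.has_euler_orbit_space[OF e(1)] by (simp flip: XL.topspace_orbit_space)
  moreover have "orbit_space (G\<lparr>carrier := L\<rparr>) X \<phi> homotopy_equivalent_space orbit_space (G\<lparr>carrier := L\<rparr>) Y \<psi>"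
    by (rule orbit_spaces_homotopy_equivalent[OF XL.topological_action_axioms e(1) X.contractible
          YL.topological_action_axioms d Y.contractible])
  ultimately have "has_euler (orbit_space (G\<lparr>carrier := L\<rparr>) Y \<psi>) {} e"
    using has_euler_iso homotopy_equivalent_space_imp_isomorphic_homology_groups by blast
  then have "euler_characteristic (orbit_space (G\<lparr>carrier := L\<rparr>) Y \<psi>) = e"
    by (rule euler_characteristic_eq)
  then have "orbifold_euler G = of_int e / of_nat (card (rcosets L))"
    unfolding orbifold_euler_def u_def[symmetric] u orbifold_euler_space_def L_def[symmetric] by simp
  then show ?thesis using e(2) by simp
qed

section \<open>Fixed point spaces\<close>

context group
begin

text \<open>For a subgroup \<open>K\<close> these are the elements \<open>g\<close> whose coset
  \<open>g K\<close> is fixed by \<open>H\<close>. So they index the translates of a cell with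
  stabilizer \<open>K\<close> that lie in the fixed point space.\<close>

definition transporter :: "'a set \<Rightarrow> 'a set \<Rightarrow> 'a set"
  where "transporter H K = {g \<in> carrier G. \<forall>h\<in>H. inv g \<otimes> h \<otimes> g \<in> K}"

lemma conj_image: "g <# H #> h = (\<lambda>x. g \<otimes> x \<otimes> h) ` H"
  unfolding l_coset_def r_coset_def by blast

lemma in_normalizer_iff:
  assumes "H \<subseteq> carrier G"
  shows "g \<in> normalizer G H \<longleftrightarrow> g \<in> carrier G \<and> (\<lambda>x. g \<otimes> x \<otimes> inv g) ` H = H"
  using assms by (auto simp: normalizer_def stabilizer_def conj_image)

lemma normalizer_conj:
  assumes H: "subgroup H G" and g: "g \<in> normalizer G H" and h: "h \<in> H"
  shows "g \<otimes> h \<otimes> inv g \<in> H" "inv g \<otimes> h \<otimes> g \<in> H"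
proof -
  have HG: "H \<subseteq> carrier G" using H by (rule subgroup.subset)
  note N = in_normalizer_iff[OF HG]
  show "g \<otimes> h \<otimes> inv g \<in> H" using N g h by blast
  have "inv g \<in> normalizer G H"
    using subgroup.m_inv_closed[OF normalizer_imp_subgroup[OF HG] g] .
  moreover have "inv (inv g) = g" using N g by simp
  ultimately show "inv g \<otimes> h \<otimes> g \<in> H" using N[of "inv g"] h by (metis image_eqI)
qed

lemma transporter_mult:
  assumes H: "subgroup H G" and K: "subgroup K G"
    and "\<nu> \<in> normalizer G H" "g \<in> transporter H K" "k \<in> K"
  shows "\<nu> \<otimes> g \<otimes> k \<in> transporter H K"
proof -
  have HG: "H \<subseteq> carrier G" using H by (rule subgroup.subset)
  have G: "\<nu> \<in> carrier G" "g \<in> carrier G" "k \<in> carrier G"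
    using assms in_normalizer_iff[OF HG] subgroup.mem_carrier[OF K] by (auto simp: transporter_def)
  have "inv (\<nu> \<otimes> g \<otimes> k) \<otimes> h \<otimes> (\<nu> \<otimes> g \<otimes> k) \<in> K" if h: "h \<in> H" for h
  proof -
    have "inv (\<nu> \<otimes> g \<otimes> k) \<otimes> h \<otimes> (\<nu> \<otimes> g \<otimes> k) = inv k \<otimes> (inv g \<otimes> (inv \<nu> \<otimes> h \<otimes> \<nu>) \<otimes> g) \<otimes> k"
      using G h HG by (simp add: inv_mult_group m_assoc subset_iff)
    moreover have "inv g \<otimes> (inv \<nu> \<otimes> h \<otimes> \<nu>) \<otimes> g \<in> K"
      using normalizer_conj(2)[OF H assms(3) h] assms(4) unfolding transporter_def by blast
    ultimately show ?thesis
      using subgroup.m_closed[OF K] subgroup.m_inv_closed[OF K] assms(5) by simp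
  qed
  then show ?thesis using G unfolding transporter_def by simp
qed

lemma conj_mult_image:
  assumes "g \<in> carrier G" "k \<in> carrier G" "H \<subseteq> carrier G"
  shows "(\<lambda>h. inv (g \<otimes> k) \<otimes> h \<otimes> (g \<otimes> k)) ` H = (\<lambda>x. inv k \<otimes> x \<otimes> k) ` (\<lambda>h. inv g \<otimes> h \<otimes> g) ` H"
  unfolding image_image using assms
  by (intro image_cong refl) (simp add: inv_mult_group m_assoc subset_iff)

lemma conj_eq_imp_normalizer:
  assumes H: "subgroup H G" and g: "g \<in> carrier G" "g' \<in> carrier G"
    and eq: "(\<lambda>h. inv g \<otimes> h \<otimes> g) ` H = (\<lambda>h. inv g' \<otimes> h \<otimes> g') ` H"
  shows "g' \<otimes> inv g \<in> normalizer G H"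
proof -
  have HG: "H \<subseteq> carrier G" using H by (rule subgroup.subset)
  have "(\<lambda>x. (g' \<otimes> inv g) \<otimes> x \<otimes> inv (g' \<otimes> inv g)) ` H = (\<lambda>x. g' \<otimes> x \<otimes> inv g') ` (\<lambda>h. inv g \<otimes> h \<otimes> g) ` H"
    unfolding image_image using g HG
    by (intro image_cong refl) (simp add: inv_mult_group m_assoc subset_iff)
  also have "\<dots> = (\<lambda>x. g' \<otimes> x \<otimes> inv g') ` (\<lambda>h. inv g' \<otimes> h \<otimes> g') ` H" unfolding eq ..
  also have "\<dots> = (\<lambda>x. x) ` H"
    unfolding image_image
  proof (intro image_cong refl)
    fix x assume x: "x \<in> H"
    have "g' \<otimes> (inv g' \<otimes> x \<otimes> g') \<otimes> inv g' = (g' \<otimes> inv g') \<otimes> x \<otimes> (g' \<otimes> inv g')"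
      using g x HG by (simp only: m_assoc m_closed inv_closed subsetD)
    then show "g' \<otimes> (inv g' \<otimes> x \<otimes> g') \<otimes> inv g' = x" using g x HG by auto
  qed
  finally show ?thesis unfolding in_normalizer_iff[OF HG] using g by simp
qed

text \<open>Sending \<open>g\<close> to \<open>g\<^sup>-\<^sup>1Hg\<close> identifies the double cosets of \<open>N(H)\<close> and \<open>K\<close> in the transporter with the
  \<open>K\<close>-conjugacy classes of the subgroups of \<open>K\<close> that are conjugate to \<open>H\<close>, and the orbit-stabilizer
  theorem counts each class.\<close>

lemma transporter_representatives:
  assumes H: "subgroup H G" and K: "subgroup K G" "finite K"
  obtains R where "R \<subseteq> transporter H K" "finite R"
    "\<And>g. g \<in> transporter H K \<Longrightarrow> \<exists>r\<in>R. \<exists>\<nu>\<in>normalizer G H. \<exists>k\<in>K. g = \<nu> \<otimes> r \<otimes> k"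
    "\<And>r s \<nu> k. r \<in> R \<Longrightarrow> s \<in> R \<Longrightarrow> \<nu> \<in> normalizer G H \<Longrightarrow> k \<in> K \<Longrightarrow> s = \<nu> \<otimes> r \<otimes> k \<Longrightarrow> r = s"
    "(\<Sum>r\<in>R. 1 / (of_nat (card (normalizer G H \<inter> (\<lambda>k. r \<otimes> k \<otimes> inv r) ` K)) :: rat)) =
      of_nat (card {H'. H' \<subseteq> K \<and> H' \<in> conjugacy_class G H}) / of_nat (card K)"
proof -
  have HG: "H \<subseteq> carrier G" using H by (rule subgroup.subset)
  have N: "subgroup (normalizer G H) G" by (rule normalizer_imp_subgroup[OF HG])
  note [simp] = subgroup.mem_carrier[OF K(1)] subgroup.mem_carrier[OF N]
  let ?T = "transporter H K"
  have TG: "g \<in> carrier G" if "g \<in> ?T" for g using that by (simp add: transporter_def)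
  \<comment> \<open>\<open>C g\<close> is the conjugate of \<open>H\<close> that lands in
    \<open>K\<close> when \<open>g\<close> is in the transporter, and \<open>P g\<close> is the
    class of \<open>C g\<close> under \<open>K\<close>. The double coset of \<open>g\<close> can be
    recovered from this class.\<close>
  define C where "C = (\<lambda>g. (\<lambda>h. inv g \<otimes> h \<otimes> g) ` H)"
  define P where "P = (\<lambda>g. (\<lambda>k. C (g \<otimes> k)) ` K)"
  define S where "S = {H'. H' \<subseteq> K \<and> H' \<in> conjugacy_class G H}"
  have C_norm: "C (\<nu> \<otimes> g) = C g" if "\<nu> \<in> normalizer G H" "g \<in> carrier G" for \<nu> g
  proof -
    have inv: "inv \<nu> \<in> normalizer G H" using subgroup.m_inv_closed[OF N that(1)] .
    have "(\<lambda>h. inv \<nu> \<otimes> h \<otimes> \<nu>) ` H = H"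
      using inv in_normalizer_iff[OF HG, of "inv \<nu>"] that(1) by simp
    then show ?thesis using conj_mult_image[of \<nu> g H] that HG by (simp add: C_def)
  qed
  have C_eqD: "\<exists>\<nu>\<in>normalizer G H. g' = \<nu> \<otimes> g" if g: "g \<in> carrier G" "g' \<in> carrier G" and eq: "C g = C g'" for g g'
  proof -
    have "g' \<otimes> inv g \<in> normalizer G H" by (rule conj_eq_imp_normalizer[OF H g eq[unfolded C_def]])
    moreover have "g' = g' \<otimes> inv g \<otimes> g" using g by (simp add: m_assoc)
    ultimately show ?thesis by blast
  qed
  have C_S: "C g \<in> S" if "g \<in> ?T" for g
  proof -
    have "C g \<subseteq> K" using that by (auto simp: C_def transporter_def)
    moreover have "C g = inv g <# H #> inv (inv g)" using TG[OF that] by (simp add: C_def conj_image)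
    then have "C g \<in> conjugacy_class G H" unfolding conjugacy_class_def using TG[OF that] by blast
    ultimately show ?thesis by (simp add: S_def)
  qed
  have S_C: "\<exists>g\<in>?T. c = C g" if c: "c \<in> S" for c
  proof -
    obtain a where a: "a \<in> carrier G" "c = a <# H #> inv a" using c by (auto simp: S_def conjugacy_class_def)
    have "C (inv a) = c" using a by (simp add: C_def conj_image)
    moreover from this have "inv a \<in> ?T" using c a(1) by (auto simp: transporter_def S_def C_def)
    ultimately show ?thesis by blast
  qed
  have P_mult: "P (\<nu> \<otimes> g \<otimes> k) = P g" if "\<nu> \<in> normalizer G H" "g \<in> carrier G" "k \<in> K" for \<nu> g k
  proof -
    have "P (\<nu> \<otimes> g \<otimes> k) = (\<lambda>k'. C (g \<otimes> (k \<otimes> k'))) ` K"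
      unfolding P_def using that C_norm[of \<nu>] by (intro image_cong refl) (simp add: m_assoc)
    also have "\<dots> = (\<lambda>k'. C (g \<otimes> k')) ` (\<lambda>k'. k \<otimes> k') ` K" by (simp add: image_image)
    also have "(\<lambda>k'. k \<otimes> k') ` K = K"
      using coset_join3[OF _ K(1) that(3)] that(3) unfolding l_coset_def by (simp add: image_def) blast
    finally show ?thesis by (simp add: P_def)
  qed
  have P_eqD: "\<exists>\<nu>\<in>normalizer G H. \<exists>k\<in>K. h = \<nu> \<otimes> g \<otimes> k"
    if gh: "g \<in> carrier G" "h \<in> carrier G" and ne: "P g \<inter> P h \<noteq> {}" for g h
  proof -
    obtain k k' where k: "k \<in> K" "k' \<in> K" "C (g \<otimes> k) = C (h \<otimes> k')" using ne unfolding P_def by blast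
    obtain \<nu> where \<nu>: "\<nu> \<in> normalizer G H" "h \<otimes> k' = \<nu> \<otimes> (g \<otimes> k)" using C_eqD[OF _ _ k(3)] gh k by auto
    have "h = h \<otimes> k' \<otimes> inv k'" using gh k by (simp add: m_assoc)
    also have "\<dots> = \<nu> \<otimes> g \<otimes> (k \<otimes> inv k')" using gh k \<nu> by (simp add: m_assoc)
    finally show ?thesis using \<nu>(1) k subgroup.m_closed[OF K(1)] subgroup.m_inv_closed[OF K(1)] by blast
  qed
  have card_P: "card (P g) * card (normalizer G H \<inter> (\<lambda>k. g \<otimes> k \<otimes> inv g) ` K) = card K" if g: "g \<in> carrier G" for g
  proof -
    let ?F = "\<lambda>c. {k \<in> K. C (g \<otimes> k) = c}"
    \<comment> \<open>\<open>?M\<close> is the part of \<open>g K g^-1\<close> that normalizes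
      \<open>H\<close>. Every fibre of \<open>C (g \<otimes> k)\<close>, as a function of
      \<open>k\<close> in \<open>K\<close>, is a copy of it once a base point \<open>k0\<close> is
      fixed.\<close>
    let ?M = "normalizer G H \<inter> (\<lambda>k. g \<otimes> k \<otimes> inv g) ` K"
    have card_F: "card (?F c) = card ?M" if c: "c \<in> P g" for c
    proof -
      obtain k0 where k0: "k0 \<in> K" "c = C (g \<otimes> k0)" using c unfolding P_def by blast
      have "bij_betw (\<lambda>k. g \<otimes> (k \<otimes> inv k0) \<otimes> inv g) (?F c) ?M"
      proof (rule bij_betw_imageI)
        show "inj_on (\<lambda>k. g \<otimes> (k \<otimes> inv k0) \<otimes> inv g) (?F c)" using g k0 by (intro inj_onI) auto
        show "(\<lambda>k. g \<otimes> (k \<otimes> inv k0) \<otimes> inv g) ` ?F c = ?M"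
        proof (intro subset_antisym subsetI)
          fix m assume "m \<in> (\<lambda>k. g \<otimes> (k \<otimes> inv k0) \<otimes> inv g) ` ?F c"
          then obtain k where k: "k \<in> K" "C (g \<otimes> k) = C (g \<otimes> k0)" "m = g \<otimes> (k \<otimes> inv k0) \<otimes> inv g"
            using k0 by blast
          have "(g \<otimes> k) \<otimes> inv (g \<otimes> k0) \<in> normalizer G H"
            by (rule conj_eq_imp_normalizer[OF H]) (use k g k0 in \<open>auto simp: C_def\<close>)
          moreover have "(g \<otimes> k) \<otimes> inv (g \<otimes> k0) = m" using k g k0 by (simp add: inv_mult_group m_assoc)
          moreover have "k \<otimes> inv k0 \<in> K" using k k0 subgroup.m_closed[OF K(1)] subgroup.m_inv_closed[OF K(1)] by blast
          ultimately show "m \<in> ?M" using k(3) by auto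
        next
          fix m assume m: "m \<in> ?M"
          then obtain k where k: "k \<in> K" "m = g \<otimes> k \<otimes> inv g" "m \<in> normalizer G H" by blast
          have kk0: "k \<otimes> k0 \<in> K" using k k0 subgroup.m_closed[OF K(1)] by blast
          have "g \<otimes> (k \<otimes> k0) = m \<otimes> (g \<otimes> k0)" using k g k0 by (simp add: m_assoc) (simp flip: m_assoc)
          then have "C (g \<otimes> (k \<otimes> k0)) = c" using C_norm[OF k(3)] g k0 by simp
          moreover have "m = g \<otimes> (k \<otimes> k0 \<otimes> inv k0) \<otimes> inv g" using k k0 by (simp add: m_assoc)
          ultimately show "m \<in> (\<lambda>k. g \<otimes> (k \<otimes> inv k0) \<otimes> inv g) ` ?F c" using kk0 by blast
        qed
      qed
      then show ?thesis by (rule bij_betw_same_card)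
    qed
    have "card K = card (\<Union>c\<in>P g. ?F c)" by (rule arg_cong[of _ _ card]) (auto simp: P_def)
    also have "\<dots> = (\<Sum>c\<in>P g. card (?F c))"
      by (rule card_UN_disjoint) (use K(2) in \<open>auto simp: P_def\<close>)
    also have "\<dots> = card (P g) * card ?M" using card_F by simp
    finally show ?thesis by simp
  qed
  let ?\<P> = "P ` ?T"
  have U: "\<Union>?\<P> = S"
  proof (intro subset_antisym subsetI)
    fix c assume "c \<in> S"
    then obtain g where g: "g \<in> ?T" "c = C g" using S_C by blast
    then have "c = C (g \<otimes> \<one>)" using TG by simp
    then have "c \<in> P g" unfolding P_def by (rule image_eqI) (rule subgroup.one_closed[OF K(1)])
    then show "c \<in> \<Union>?\<P>" using g by blast
  next
    fix c assume "c \<in> \<Union>?\<P>"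
    then obtain g k where gk: "g \<in> ?T" "k \<in> K" "c = C (g \<otimes> k)" unfolding P_def by blast
    have "\<one> \<otimes> g \<otimes> k \<in> ?T" by (rule transporter_mult[OF H K(1) subgroup.one_closed[OF N] gk(1,2)])
    then show "c \<in> S" using C_S gk TG by simp
  qed
  have finS: "finite S" using K(2) by (auto simp: S_def intro: finite_subset[of _ "Pow K"])
  then have finP: "finite ?\<P>" using U by (metis finite_UnionD)
  have disj: "c1 \<inter> c2 = {}" if c: "c1 \<in> ?\<P>" "c2 \<in> ?\<P>" "c1 \<noteq> c2" for c1 c2
  proof (rule ccontr)
    assume ne: "c1 \<inter> c2 \<noteq> {}"
    obtain g h where gh: "g \<in> ?T" "h \<in> ?T" "c1 = P g" "c2 = P h" using c by blast
    then show False using P_eqD[OF TG TG, of g h] ne P_mult TG c(3) by metis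
  qed
  have "\<forall>c\<in>?\<P>. \<exists>g. g \<in> ?T \<and> P g = c" by blast
  from bchoice[OF this] obtain \<rho> where \<rho>: "\<And>c. c \<in> ?\<P> \<Longrightarrow> \<rho> c \<in> ?T \<and> P (\<rho> c) = c" by blast
  have inj: "inj_on \<rho> ?\<P>" using \<rho> by (metis inj_onI)
  have K0: "card K > 0" using K subgroup.one_closed[OF K(1)] by (metis card_gt_0_iff empty_iff)
  show ?thesis
  proof
    show "\<rho> ` ?\<P> \<subseteq> ?T" using \<rho> by blast
    show "finite (\<rho> ` ?\<P>)" using finP by simp
    show "\<exists>r\<in>\<rho> ` ?\<P>. \<exists>\<nu>\<in>normalizer G H. \<exists>k\<in>K. g = \<nu> \<otimes> r \<otimes> k" if g: "g \<in> ?T" for g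
    proof -
      have "P (\<rho> (P g)) = P g" "\<rho> (P g) \<in> carrier G" using \<rho> g TG by blast+
      moreover have "P g \<noteq> {}" unfolding P_def using subgroup.one_closed[OF K(1)] by blast
      ultimately show ?thesis using P_eqD[of "\<rho> (P g)" g] g TG by auto
    qed
    show "r = s" if "r \<in> \<rho> ` ?\<P>" "s \<in> \<rho> ` ?\<P>" "\<nu> \<in> normalizer G H" "k \<in> K" "s = \<nu> \<otimes> r \<otimes> k" for r s \<nu> k
    proof -
      obtain c d where c: "c \<in> ?\<P>" "r = \<rho> c" and d: "d \<in> ?\<P>" "s = \<rho> d" using \<open>r \<in> \<rho> ` ?\<P>\<close> \<open>s \<in> \<rho> ` ?\<P>\<close> by blast
      have "P s = P r" using P_mult that(3-5) \<rho>[OF c(1)] c(2) TG by simp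
      then show ?thesis using \<rho>[OF c(1)] \<rho>[OF d(1)] c(2) d(2) by simp
    qed
    have "(\<Sum>r\<in>\<rho> ` ?\<P>. 1 / (of_nat (card (normalizer G H \<inter> (\<lambda>k. r \<otimes> k \<otimes> inv r) ` K)) :: rat)) =
        (\<Sum>c\<in>?\<P>. 1 / of_nat (card (normalizer G H \<inter> (\<lambda>k. \<rho> c \<otimes> k \<otimes> inv (\<rho> c)) ` K)))"
      by (simp add: sum.reindex[OF inj])
    also have "\<dots> = (\<Sum>c\<in>?\<P>. of_nat (card c) / of_nat (card K))"
    proof (intro sum.cong refl)
      fix c assume c: "c \<in> ?\<P>"
      let ?m = "card (normalizer G H \<inter> (\<lambda>k. \<rho> c \<otimes> k \<otimes> inv (\<rho> c)) ` K)"
      have "card c * ?m = card K" using card_P[of "\<rho> c"] \<rho>[OF c] TG by simp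
      then have "(of_nat (card c) :: rat) * of_nat ?m = of_nat (card K)" by (metis of_nat_mult)
      moreover have "?m \<noteq> 0" using \<open>card c * ?m = card K\<close> K0 by (metis mult_0_right less_irrefl)
      ultimately show "1 / (of_nat ?m :: rat) = of_nat (card c) / of_nat (card K)" using K0 by (simp add: field_simps)
    qed
    also have "\<dots> = of_nat (\<Sum>c\<in>?\<P>. card c) / of_nat (card K)" by (simp add: sum_divide_distrib)
    also have "(\<Sum>c\<in>?\<P>. card c) = card S"
    proof -
      have "card (\<Union>c\<in>?\<P>. c) = (\<Sum>c\<in>?\<P>. card c)"
        by (rule card_UN_disjoint[OF finP]) (use finS U disj in \<open>auto intro: finite_subset\<close>)
      then show ?thesis using U by simp
    qed
    finally show "(\<Sum>r\<in>\<rho> ` ?\<P>. 1 / (of_nat (card (normalizer G H \<inter> (\<lambda>k. r \<otimes> k \<otimes> inv r) ` K)) :: rat)) =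
      of_nat (card {H'. H' \<subseteq> K \<and> H' \<in> conjugacy_class G H}) / of_nat (card K)"
      unfolding S_def .
  qed
qed

end

lemma closedin_subtopology_shrink:
  assumes "closedin (subtopology X S) A" "S' \<subseteq> S"
  shows "closedin (subtopology X S') (A \<inter> S')"
proof -
  obtain T where T: "closedin X T" "A = T \<inter> S" using assms(1) unfolding closedin_subtopology by blast
  then have "A \<inter> S' = T \<inter> S'" using assms(2) by blast
  then show ?thesis using T(1) unfolding closedin_subtopology by blast
qed

context finite_CW
begin

lemma sk_mono: "m \<le> n \<Longrightarrow> sk m \<subseteq> sk n"
  unfolding skeleton_below_def by (intro UN_mono) auto

lemma open_cell:
  assumes "x \<in> sk n"
  obtains m K q g y where "m < n" "(K, q) \<in> cells m" "g \<in> carrier G" "y \<in> disc_interior m" "x = \<phi> g (q y)"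
proof -
  obtain m K q g y where *: "(K, q) \<in> cells m" "g \<in> carrier G" "y \<in> disc_interior m" "x = \<phi> g (q y)"
    using skeleton_below_open_cell[OF action cw assms] by metis
  have "m < n"
  proof (rule ccontr)
    assume "\<not> m < n"
    then have "x \<in> sk m" using sk_mono[of n m] assms by auto
    then show False using G_CW_structure_not_below[OF cw *(1-3)] *(4) by simp
  qed
  then show ?thesis using * that by blast
qed

lemma fixed_pointsI: "x \<in> topspace X \<Longrightarrow> (\<And>h. h \<in> H \<Longrightarrow> \<phi> h x = x) \<Longrightarrow> x \<in> fixed_points X \<phi> H"
  by (simp add: fixed_points_def)

lemma transporter_fixed:
  assumes H: "subgroup H G" and Kq: "(K, q) \<in> cells n" and g: "g \<in> transporter H K" and x: "x \<in> topspace (unit_disc n)"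
  shows "\<phi> g (q x) \<in> fixed_points X \<phi> H"
proof (rule fixed_pointsI)
  have gG: "g \<in> carrier G" using g by (simp add: transporter_def)
  note qx = q_topspace[OF Kq x]
  show "\<phi> g (q x) \<in> topspace X" using action_closed[OF gG qx] .
  fix h assume h: "h \<in> H"
  have hG: "h \<in> carrier G" using subgroup.mem_carrier[OF H h] .
  have "\<phi> h (\<phi> g (q x)) = \<phi> (g \<otimes> (inv g \<otimes> h \<otimes> g)) (q x)"
    using gG hG qx by (simp add: action_mult[symmetric] m_assoc[symmetric])
  also have "\<dots> = \<phi> g (\<phi> (inv g \<otimes> h \<otimes> g) (q x))" using gG hG qx by (intro action_mult) auto
  also have "\<phi> (inv g \<otimes> h \<otimes> g) (q x) = q x"
    using G_CW_structure_cell(3)[OF cw Kq _ x] g h by (simp add: transporter_def)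
  finally show "\<phi> h (\<phi> g (q x)) = \<phi> g (q x)" .
qed

text \<open>If \<open>h\<close> fixes an interior point of the translate by \<open>g\<close>, then
  \<open>h \<otimes> g\<close> and \<open>g\<close> represent the same coset of \<open>K\<close>,
  since distinct cosets give disjoint open cells.\<close>

lemma fixed_transporter:
  assumes H: "subgroup H G" and Kq: "(K, q) \<in> cells n" and g: "g \<in> carrier G" and x: "x \<in> disc_interior n"
    and fixed: "\<phi> g (q x) \<in> fixed_points X \<phi> H"
  shows "g \<in> transporter H K"
  unfolding transporter_def
proof (intro CollectI conjI ballI g)
  fix h assume h: "h \<in> H"
  have hG: "h \<in> carrier G" using subgroup.mem_carrier[OF H h] .
  have hg: "h \<otimes> g \<in> carrier G" using hG g by simp
  note K = G_CW_structure_cell(1)[OF cw Kq]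
  have xD: "x \<in> topspace (unit_disc n)" using x by (simp add: disc_interior_def)
  have "\<phi> (h \<otimes> g) (q x) = \<phi> g (q x)"
    using fixed h action_mult[OF hG g q_topspace[OF Kq xD]] by (simp add: fixed_points_def)
  then have "(h \<otimes> g) <# K = g <# K" by (rule G_CW_structure_inj(2)[OF cw Kq Kq hg g x x])
  then obtain k where k: "k \<in> K" "h \<otimes> g = g \<otimes> k" using l_coset_eqD[OF hg g K] by metis
  have "inv g \<otimes> h \<otimes> g = inv g \<otimes> (h \<otimes> g)" using g hG by (simp add: m_assoc)
  also have "\<dots> = k" unfolding k(2) using g subgroup.mem_carrier[OF K k(1)] by (simp add: m_assoc[symmetric])
  finally show "inv g \<otimes> h \<otimes> g \<in> K" using k(1) by simp
qed

lemma normalizer_fixed: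
  assumes H: "subgroup H G" and \<nu>: "\<nu> \<in> normalizer G H" and x: "x \<in> fixed_points X \<phi> H"
  shows "\<phi> \<nu> x \<in> fixed_points X \<phi> H"
proof (rule fixed_pointsI)
  have \<nu>G: "\<nu> \<in> carrier G" using \<nu> in_normalizer_iff[OF subgroup.subset[OF H]] by blast
  have xX: "x \<in> topspace X" using x by (simp add: fixed_points_def)
  show "\<phi> \<nu> x \<in> topspace X" using action_closed[OF \<nu>G xX] .
  fix h assume h: "h \<in> H"
  have hG: "h \<in> carrier G" using subgroup.mem_carrier[OF H h] .
  have "\<phi> h (\<phi> \<nu> x) = \<phi> (\<nu> \<otimes> (inv \<nu> \<otimes> h \<otimes> \<nu>)) x"
    using \<nu>G hG xX by (simp add: action_mult[symmetric] m_assoc[symmetric])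
  also have "\<dots> = \<phi> \<nu> (\<phi> (inv \<nu> \<otimes> h \<otimes> \<nu>) x)" using \<nu>G hG xX by (intro action_mult) auto
  also have "\<phi> (inv \<nu> \<otimes> h \<otimes> \<nu>) x = x"
    using normalizer_conj(2)[OF H \<nu> h] x by (simp add: fixed_points_def)
  finally show "\<phi> h (\<phi> \<nu> x) = \<phi> \<nu> x" .
qed

text \<open>A translate of a cell is either fixed pointwise or has no fixed point in its interior,
  so closedness climbs from one skeleton to the next.\<close>

lemma closedin_fixed_skeleton:
  assumes H: "subgroup H G"
  shows "closedin (subtopology X (sk n)) (sk n \<inter> fixed_points X \<phi> H)"
proof (induction n)
  case (Suc n)
  have "sk n \<subseteq> sk (Suc n)" by (rule sk_mono) simp
  show ?case
  proof (rule closedin_between_skeleta[where B = "sk n"])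
    have "sk (Suc n) \<inter> fixed_points X \<phi> H \<inter> sk n = sk n \<inter> fixed_points X \<phi> H"
      using \<open>sk n \<subseteq> sk (Suc n)\<close> by blast
    then show "closedin (subtopology X (sk n)) (sk (Suc n) \<inter> fixed_points X \<phi> H \<inter> sk n)" using Suc by simp
    fix K q g assume Kq: "(K, q) \<in> cells n" and g: "g \<in> carrier G"
    show "(\<forall>x\<in>topspace (unit_disc n). \<phi> g (q x) \<in> sk n) \<or>
        (\<forall>x\<in>disc_interior n. \<phi> g (q x) \<notin> sk (Suc n) \<inter> fixed_points X \<phi> H) \<or>
        closedin (unit_disc n) {x \<in> topspace (unit_disc n). \<phi> g (q x) \<in> sk (Suc n) \<inter> fixed_points X \<phi> H}"
    proof (cases "g \<in> transporter H K")
      case True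
      have "\<phi> g (q x) \<in> sk (Suc n)" if "x \<in> topspace (unit_disc n)" for x
        unfolding sk_Suc using Kq g that by blast
      then have "{x \<in> topspace (unit_disc n). \<phi> g (q x) \<in> sk (Suc n) \<inter> fixed_points X \<phi> H} = topspace (unit_disc n)"
        using transporter_fixed[OF H Kq True] by blast
      then show ?thesis by simp
    next
      case False
      then show ?thesis using fixed_transporter[OF H Kq g] by blast
    qed
  qed (use \<open>sk n \<subseteq> sk (Suc n)\<close> in auto)
qed (simp add: sk_0)

lemma fixed_points_action:
  assumes H: "subgroup H G"
  defines "F \<equiv> fixed_points X \<phi> H"
  shows "G_space (G\<lparr>carrier := normalizer G H\<rparr>) (subtopology X F) (\<lambda>g. \<lambda>x\<in>F. \<phi> g x)"
proof -
  have HG: "H \<subseteq> carrier G" using H by (rule subgroup.subset)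
  have N: "subgroup (normalizer G H) G" by (rule normalizer_imp_subgroup[OF HG])
  have FX: "F \<subseteq> topspace X" by (auto simp: F_def fixed_points_def)
  then have top: "topspace (subtopology X F) = F" by auto
  have inv: "\<phi> g x \<in> F" if "g \<in> normalizer G H" "x \<in> F" for g x
    using normalizer_fixed[OF H that(1)] that(2) by (simp add: F_def)
  note NG = subgroup.mem_carrier[OF N]
  have Bij: "(\<lambda>x\<in>F. \<phi> g x) \<in> Bij F" if g: "g \<in> normalizer G H" for g
  proof -
    have "bij_betw (\<phi> g) F F"
    proof (rule bij_betwI[where g = "\<phi> (inv g)"])
      have g': "inv g \<in> normalizer G H" by (rule subgroup.m_inv_closed[OF N g])
      show "\<phi> g \<in> F \<rightarrow> F" "\<phi> (inv g) \<in> F \<rightarrow> F" using inv g g' by auto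
      show "\<phi> (inv g) (\<phi> g x) = x" "\<phi> g (\<phi> (inv g) x) = x" if "x \<in> F" for x
        using that FX action_inv[OF NG[OF g]] action_inv'[OF NG[OF g]] by auto
    qed
    then have "bij_betw (\<lambda>x\<in>F. \<phi> g x) F F" by (rule iffD1[OF bij_betw_cong, rotated]) simp
    then show ?thesis by (simp add: Bij_def)
  qed
  have "group_action (G\<lparr>carrier := normalizer G H\<rparr>) F (\<lambda>g. \<lambda>x\<in>F. \<phi> g x)"
    unfolding group_action_def group_hom_def group_hom_axioms_def
  proof (intro conjI)
    show "Group.group (G\<lparr>carrier := normalizer G H\<rparr>)" by (rule subgroup_imp_group[OF N])
    show "Group.group (BijGroup F)" by (rule group_BijGroup)
    show "(\<lambda>g. \<lambda>x\<in>F. \<phi> g x) \<in> hom (G\<lparr>carrier := normalizer G H\<rparr>) (BijGroup F)"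
    proof (rule homI)
      fix g assume "g \<in> carrier (G\<lparr>carrier := normalizer G H\<rparr>)"
      then show "(\<lambda>x\<in>F. \<phi> g x) \<in> carrier (BijGroup F)" using Bij by (simp add: BijGroup_def)
    next
      fix g h assume "g \<in> carrier (G\<lparr>carrier := normalizer G H\<rparr>)" "h \<in> carrier (G\<lparr>carrier := normalizer G H\<rparr>)"
      then have gh: "g \<in> normalizer G H" "h \<in> normalizer G H" by auto
      have "(\<lambda>x\<in>F. \<phi> (g \<otimes> h) x) = compose F (\<lambda>x\<in>F. \<phi> g x) (\<lambda>x\<in>F. \<phi> h x)"
      proof
        fix y
        show "(\<lambda>x\<in>F. \<phi> (g \<otimes> h) x) y = compose F (\<lambda>x\<in>F. \<phi> g x) (\<lambda>x\<in>F. \<phi> h x) y"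
          using gh inv NG FX action_mult by (auto simp: compose_def)
      qed
      then show "(\<lambda>x\<in>F. \<phi> (g \<otimes>\<^bsub>G\<lparr>carrier := normalizer G H\<rparr>\<^esub> h) x) =
          (\<lambda>x\<in>F. \<phi> g x) \<otimes>\<^bsub>BijGroup F\<^esub> (\<lambda>x\<in>F. \<phi> h x)"
        using Bij gh by (simp add: BijGroup_def)
    qed
  qed
  moreover have "continuous_map (subtopology X F) (subtopology X F) (\<lambda>x\<in>F. \<phi> g x)" if g: "g \<in> normalizer G H" for g
  proof (rule continuous_map_eq)
    show "continuous_map (subtopology X F) (subtopology X F) (\<phi> g)"
      using action_continuous[OF NG[OF g]] inv[OF g] top
      by (intro continuous_map_into_subtopology continuous_map_from_subtopology) auto
  qed (simp add: top)
  ultimately show ?thesis unfolding G_space_def top by simp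
qed

end

context finite_EG
begin

text \<open>Each double coset of \<open>N\<close> and \<open>K\<close> in the transporter gives one
  orbit of cells: a representative \<open>r\<close> has characteristic map
  \<open>\<phi> r \<circ> q\<close> and stabilizer \<open>N \<inter> r K r^-1\<close>. The
  reciprocals of the orders of these stabilizers are summed by
  \<open>transporter_representatives\<close>.\<close>

lemma fixed_points_CW:
  assumes H: "subgroup H G" and finH: "finite H"
  defines "F \<equiv> fixed_points X \<phi> H" and "N \<equiv> normalizer G H"
  obtains cells' where
    "G_CW_structure (G\<lparr>carrier := N\<rparr>) (subtopology X F) (\<lambda>g. \<lambda>x\<in>F. \<phi> g x) cells'"
    "finite (SIGMA n:UNIV. cells' n)"
    "(\<Sum>(n, K, q)\<in>(SIGMA n:UNIV. cells' n). (-1) ^ n / (of_nat (card K) :: rat)) =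
      (\<Sum>(n, K, q)\<in>(SIGMA n:UNIV. cells n). (-1) ^ n *
        of_nat (card {H'. H' \<subseteq> K \<and> H' \<in> conjugacy_class G H}) / of_nat (card K))"
proof -
  have HG: "H \<subseteq> carrier G" using H by (rule subgroup.subset)
  have N: "subgroup N G" unfolding N_def by (rule normalizer_imp_subgroup[OF HG])
  note NG = subgroup.mem_carrier[OF N]
  have FX: "F \<subseteq> topspace X" by (auto simp: F_def fixed_points_def)
  then have topF: "topspace (subtopology X F) = F" by auto
  have invF: "\<phi> g x \<in> F" if "g \<in> N" "x \<in> F" for g x
    using normalizer_fixed[OF H] that unfolding N_def F_def by blast
  let ?G = "G\<lparr>carrier := N\<rparr>" and ?Z = "subtopology X F" and ?T = "transporter H"
  let ?st = "\<lambda>K r. N \<inter> (\<lambda>k. r \<otimes> k \<otimes> inv r) ` K"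
  define Q where "Q = (\<lambda>K R. R \<subseteq> ?T K \<and> finite R \<and>
    (\<forall>g\<in>?T K. \<exists>r\<in>R. \<exists>\<nu>\<in>N. \<exists>k\<in>K. g = \<nu> \<otimes> r \<otimes> k) \<and>
    (\<forall>r\<in>R. \<forall>s\<in>R. \<forall>\<nu>\<in>N. \<forall>k\<in>K. s = \<nu> \<otimes> r \<otimes> k \<longrightarrow> r = s) \<and>
    (\<Sum>r\<in>R. 1 / (of_nat (card (?st K r)) :: rat)) =
      of_nat (card {H'. H' \<subseteq> K \<and> H' \<in> conjugacy_class G H}) / of_nat (card K))"
  have "\<exists>R. Q K R" if Kq: "(K, q) \<in> cells n" for n K q
  proof (rule transporter_representatives[OF H G_CW_structure_cell(1)[OF cw Kq] finite_cell_stabilizer[OF Kq]])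
    fix R assume "R \<subseteq> ?T K" "finite R"
      "\<And>g. g \<in> ?T K \<Longrightarrow> \<exists>r\<in>R. \<exists>\<nu>\<in>normalizer G H. \<exists>k\<in>K. g = \<nu> \<otimes> r \<otimes> k"
      "\<And>r s \<nu> k. r \<in> R \<Longrightarrow> s \<in> R \<Longrightarrow> \<nu> \<in> normalizer G H \<Longrightarrow> k \<in> K \<Longrightarrow> s = \<nu> \<otimes> r \<otimes> k \<Longrightarrow> r = s"
      "(\<Sum>r\<in>R. 1 / (of_nat (card (normalizer G H \<inter> (\<lambda>k. r \<otimes> k \<otimes> inv r) ` K)) :: rat)) =
        of_nat (card {H'. H' \<subseteq> K \<and> H' \<in> conjugacy_class G H}) / of_nat (card K)"
    then have "Q K R" unfolding Q_def N_def by (intro conjI ballI impI)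
    then show "\<exists>R. Q K R" ..
  qed
  then have "\<forall>K\<in>{K. \<exists>n q. (K, q) \<in> cells n}. \<exists>R. Q K R" by blast
  from bchoice[OF this] obtain R where QR: "\<And>n K q. (K, q) \<in> cells n \<Longrightarrow> Q K (R K)" by blast
  have R: "R K \<subseteq> ?T K" "finite (R K)"
    "\<And>g. g \<in> ?T K \<Longrightarrow> \<exists>r\<in>R K. \<exists>\<nu>\<in>N. \<exists>k\<in>K. g = \<nu> \<otimes> r \<otimes> k"
    "\<And>r s \<nu> k. r \<in> R K \<Longrightarrow> s \<in> R K \<Longrightarrow> \<nu> \<in> N \<Longrightarrow> k \<in> K \<Longrightarrow> s = \<nu> \<otimes> r \<otimes> k \<Longrightarrow> r = s"
    "(\<Sum>r\<in>R K. 1 / (of_nat (card (?st K r)) :: rat)) =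
      of_nat (card {H'. H' \<subseteq> K \<and> H' \<in> conjugacy_class G H}) / of_nat (card K)"
    if "(K, q) \<in> cells n" for n K q
    using QR[OF that] unfolding Q_def by (elim conjE, simp)+
  have RG: "r \<in> carrier G" if "(K, q) \<in> cells n" "r \<in> R K" for n K q r
    using R(1) that by (auto simp: transporter_def)
  define cells' where "cells' = (\<lambda>n. {(?st K r, \<phi> r \<circ> q) | K q r. (K, q) \<in> cells n \<and> r \<in> R K})"
  let ?\<phi> = "\<lambda>g. \<lambda>x\<in>F. \<phi> g x" and ?D = unit_disc
  let ?sk = "skeleton_below ?G ?\<phi> cells'"
  have cellF: "\<phi> r (q x) \<in> F" if "(K, q) \<in> cells n" "r \<in> R K" "x \<in> topspace (?D n)" for n K q r x
    unfolding F_def using transporter_fixed[OF H that(1) _ that(3)] R(1) that(1,2) by blast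
  have int_D: "x \<in> topspace (?D n)" if "x \<in> disc_interior n" for x n using that by (simp add: disc_interior_def)
  have trans: "?\<phi> \<nu> ((\<phi> r \<circ> q) x) = \<phi> (\<nu> \<otimes> r) (q x)"
    if "(K, q) \<in> cells n" "r \<in> R K" "\<nu> \<in> N" "x \<in> topspace (?D n)" for n K q r \<nu> x
    using cellF[OF that(1,2,4)] NG[OF that(3)] RG[OF that(1,2)] q_topspace[OF that(1,4)] by (simp add: action_mult)
  have sk'_iff: "z \<in> ?sk n \<longleftrightarrow> (\<exists>m<n. \<exists>K q r \<nu> x. (K, q) \<in> cells m \<and> r \<in> R K \<and> \<nu> \<in> N \<and>
      x \<in> topspace (?D m) \<and> z = \<phi> (\<nu> \<otimes> r) (q x))" for z n
  proof
    assume "z \<in> ?sk n"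
    then obtain m K' q' \<nu> x where *: "m < n" "(K', q') \<in> cells' m" "\<nu> \<in> carrier ?G" "x \<in> topspace (?D m)" "z = ?\<phi> \<nu> (q' x)"
      unfolding skeleton_below_def by blast
    then have "\<nu> \<in> N" by simp
    obtain K q r where **: "(K, q) \<in> cells m" "r \<in> R K" "q' = \<phi> r \<circ> q"
      using *(2) unfolding cells'_def by blast
    have "z = \<phi> (\<nu> \<otimes> r) (q x)" unfolding *(5) **(3) by (rule trans[OF **(1,2) \<open>\<nu> \<in> N\<close> *(4)])
    then show "\<exists>m<n. \<exists>K q r \<nu> x. (K, q) \<in> cells m \<and> r \<in> R K \<and> \<nu> \<in> N \<and>
      x \<in> topspace (?D m) \<and> z = \<phi> (\<nu> \<otimes> r) (q x)" using *(1,4) **(1,2) \<open>\<nu> \<in> N\<close> by blast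
  next
    assume "\<exists>m<n. \<exists>K q r \<nu> x. (K, q) \<in> cells m \<and> r \<in> R K \<and> \<nu> \<in> N \<and>
      x \<in> topspace (?D m) \<and> z = \<phi> (\<nu> \<otimes> r) (q x)"
    then obtain m K q r \<nu> x where *: "m < n" "(K, q) \<in> cells m" "r \<in> R K" "\<nu> \<in> N" "x \<in> topspace (?D m)" "z = \<phi> (\<nu> \<otimes> r) (q x)"
      by blast
    have "(?st K r, \<phi> r \<circ> q) \<in> cells' m" unfolding cells'_def using *(2,3) by blast
    moreover have "z \<in> ?\<phi> \<nu> ` (\<phi> r \<circ> q) ` topspace (?D m)"
      using trans[OF *(2-5)] *(5,6) by (metis image_eqI)
    moreover have "\<nu> \<in> carrier ?G" using *(4) by simp
    ultimately show "z \<in> ?sk n" unfolding skeleton_below_def using *(1) by blast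
  qed
  \<comment> \<open>The new skeleta are traces of the old ones, so the topological conditions can be
    read off from those of \<open>X\<close>.\<close>
  have sk': "?sk n = sk n \<inter> F" for n
  proof (intro subset_antisym subsetI)
    fix z assume "z \<in> ?sk n"
    then obtain m K q r \<nu> x where *: "m < n" "(K, q) \<in> cells m" "r \<in> R K" "\<nu> \<in> N" "x \<in> topspace (?D m)" "z = \<phi> (\<nu> \<otimes> r) (q x)"
      unfolding sk'_iff by blast
    have "\<nu> \<otimes> r \<in> carrier G" using NG[OF *(4)] RG[OF *(2,3)] by simp
    then have "z \<in> sk n" unfolding skeleton_below_def using * by blast
    moreover have "z = \<phi> \<nu> (\<phi> r (q x))"
      using *(6) NG[OF *(4)] RG[OF *(2,3)] q_topspace[OF *(2,5)] by (simp add: action_mult)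
    then have "z \<in> F" using invF[OF *(4) cellF[OF *(2,3,5)]] by simp
    ultimately show "z \<in> sk n \<inter> F" by blast
  next
    fix z assume z: "z \<in> sk n \<inter> F"
    then obtain m K q g x where *: "m < n" "(K, q) \<in> cells m" "g \<in> carrier G" "x \<in> disc_interior m" "z = \<phi> g (q x)"
      using open_cell by blast
    have "g \<in> ?T K" using fixed_transporter[OF H *(2-4)] z *(5) by (simp add: F_def)
    then obtain r \<nu> k where rk: "r \<in> R K" "\<nu> \<in> N" "k \<in> K" "g = \<nu> \<otimes> r \<otimes> k" using R(3)[OF *(2)] by blast
    have "\<phi> g (q x) = \<phi> (\<nu> \<otimes> r) (\<phi> k (q x))"
      using rk NG RG[OF *(2) rk(1)] subgroup.mem_carrier[OF G_CW_structure_cell(1)[OF cw *(2)] rk(3)]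
        q_topspace[OF *(2) int_D[OF *(4)]] by (simp add: action_mult)
    also have "\<phi> k (q x) = q x" using G_CW_structure_cell(3)[OF cw *(2) rk(3) int_D[OF *(4)]] .
    finally show "z \<in> ?sk n" unfolding sk'_iff using * rk int_D[OF *(4)] by blast
  qed
  have trans_all: "\<exists>r\<in>R K. \<exists>\<nu>\<in>N. \<forall>x\<in>topspace (?D n). \<phi> g (q x) = ?\<phi> \<nu> ((\<phi> r \<circ> q) x)"
    if Kq: "(K, q) \<in> cells n" and g: "g \<in> ?T K" for n K q g
  proof -
    obtain r \<nu> k where rk: "r \<in> R K" "\<nu> \<in> N" "k \<in> K" "g = \<nu> \<otimes> r \<otimes> k" using R(3)[OF Kq g] by blast
    have "\<phi> g (q x) = ?\<phi> \<nu> ((\<phi> r \<circ> q) x)" if x: "x \<in> topspace (?D n)" for x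
    proof -
      have "\<phi> g (q x) = \<phi> (\<nu> \<otimes> r) (\<phi> k (q x))"
        using rk NG RG[OF Kq rk(1)] subgroup.mem_carrier[OF G_CW_structure_cell(1)[OF cw Kq] rk(3)]
          q_topspace[OF Kq x] by (simp add: action_mult)
      also have "\<phi> k (q x) = q x" using G_CW_structure_cell(3)[OF cw Kq rk(3) x] .
      finally show ?thesis using trans[OF Kq rk(1,2) x] by simp
    qed
    then show ?thesis using rk by blast
  qed
  have sub: "subtopology ?Z (?sk n) = subtopology X (sk n \<inter> F)" for n
    unfolding sk' by (simp add: subtopology_subtopology Int_commute Int_left_commute)
  \<comment> \<open>The trace of a skeleton on \<open>F\<close> is closed in the skeleton. So closed
    subsets of the trace are closed in the skeleton, where the structure of \<open>X\<close>
    applies.\<close>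
  have to_sk: "closedin (subtopology X (sk n)) A" if A: "closedin (subtopology X (sk n \<inter> F)) A" for n A
  proof -
    have "closedin (subtopology (subtopology X (sk n)) (sk n \<inter> F)) A"
      using A by (simp add: subtopology_subtopology)
    then show ?thesis
      using closedin_fixed_skeleton[OF H, of n] unfolding F_def[symmetric] by (rule closedin_trans_full)
  qed
  have skSuc: "sk n \<subseteq> sk (Suc n)" for n by (rule sk_mono) simp
  have cells'D: "\<exists>K q r. K' = ?st K r \<and> q' = \<phi> r \<circ> q \<and> (K, q) \<in> cells n \<and> r \<in> R K"
    if "(K', q') \<in> cells' n" for K' q' n using that unfolding cells'_def by blast
  have cellcont: "continuous_map (?D n) ?Z (\<lambda>x. ?\<phi> \<nu> ((\<phi> r \<circ> q) x))"
    if "(K, q) \<in> cells n" "r \<in> R K" "\<nu> \<in> N" for n K q r \<nu>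
  proof (rule continuous_map_eq)
    have "\<phi> (\<nu> \<otimes> r) (q x) \<in> F" if "x \<in> topspace (?D n)" for x
    proof -
      have "\<phi> (\<nu> \<otimes> r) (q x) = \<phi> \<nu> (\<phi> r (q x))"
        using NG[OF \<open>\<nu> \<in> N\<close>] RG[OF \<open>(K, q) \<in> cells n\<close> \<open>r \<in> R K\<close>] q_topspace[OF \<open>(K, q) \<in> cells n\<close> that] by (rule action_mult)
      then show ?thesis using invF[OF \<open>\<nu> \<in> N\<close> cellF[OF \<open>(K, q) \<in> cells n\<close> \<open>r \<in> R K\<close> that]] by simp
    qed
    then show "continuous_map (?D n) ?Z (\<phi> (\<nu> \<otimes> r) \<circ> q)"
      using that NG RG[OF that(1,2)] by (intro continuous_map_into_subtopology char_map_continuous[OF that(1)]) auto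
    show "(\<phi> (\<nu> \<otimes> r) \<circ> q) x = ?\<phi> \<nu> ((\<phi> r \<circ> q) x)" if "x \<in> topspace (?D n)" for x
      using trans[OF \<open>(K, q) \<in> cells n\<close> \<open>r \<in> R K\<close> \<open>\<nu> \<in> N\<close> that] by simp
  qed
  have one_N: "\<one> \<in> N" by (rule subgroup.one_closed[OF N])

  have CW: "G_CW_structure ?G ?Z ?\<phi> cells'"
    unfolding G_CW_structure_def
  proof (intro conjI)
    show "topspace ?Z = (\<Union>n. ?sk n)"
      unfolding topF sk' using FX G_CW_structure_topspace[OF cw] by blast
    show "\<forall>n. \<forall>(K, q)\<in>cells' n. subgroup K ?G \<and> continuous_map (?D n) ?Z q \<and>
        (\<forall>k\<in>K. \<forall>x\<in>topspace (?D n). ?\<phi> k (q x) = q x) \<and> q ` disc_boundary n \<subseteq> ?sk n"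
    proof (intro allI ballI, clarify)
      fix n K' q' assume "(K', q') \<in> cells' n"
      then obtain K q r where K': "K' = ?st K r" and q': "q' = \<phi> r \<circ> q" and Kq: "(K, q) \<in> cells n" and r: "r \<in> R K"
        using cells'D by blast
      have rG: "r \<in> carrier G" using RG[OF Kq r] .
      note K = G_CW_structure_cell(1)[OF cw Kq]
      have conj: "subgroup ((\<lambda>k. r \<otimes> k \<otimes> inv r) ` K) G"
      proof (rule subgroupI)
        show "(\<lambda>k. r \<otimes> k \<otimes> inv r) ` K \<subseteq> carrier G" using rG subgroup.mem_carrier[OF K] by auto
        show "(\<lambda>k. r \<otimes> k \<otimes> inv r) ` K \<noteq> {}" using subgroup.one_closed[OF K] by blast
        show "inv a \<in> (\<lambda>k. r \<otimes> k \<otimes> inv r) ` K" if a: "a \<in> (\<lambda>k. r \<otimes> k \<otimes> inv r) ` K" for a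
        proof -
          obtain k where k: "k \<in> K" "a = r \<otimes> k \<otimes> inv r" using a by blast
          have "inv a = r \<otimes> inv k \<otimes> inv r"
            unfolding k(2) using rG subgroup.mem_carrier[OF K k(1)] by (simp add: inv_mult_group m_assoc)
          then show ?thesis using subgroup.m_inv_closed[OF K k(1)] by blast
        qed
        show "a \<otimes> b \<in> (\<lambda>k. r \<otimes> k \<otimes> inv r) ` K"
          if ab: "a \<in> (\<lambda>k. r \<otimes> k \<otimes> inv r) ` K" "b \<in> (\<lambda>k. r \<otimes> k \<otimes> inv r) ` K" for a b
        proof -
          obtain k l where kl: "k \<in> K" "a = r \<otimes> k \<otimes> inv r" "l \<in> K" "b = r \<otimes> l \<otimes> inv r" using ab by blast
          have [simp]: "k \<in> carrier G" "l \<in> carrier G" using kl subgroup.mem_carrier[OF K] by auto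
          have "a \<otimes> b = r \<otimes> k \<otimes> (inv r \<otimes> r) \<otimes> l \<otimes> inv r" unfolding kl using rG by (simp only: m_assoc m_closed inv_closed \<open>k \<in> carrier G\<close> \<open>l \<in> carrier G\<close>)
          also have "\<dots> = r \<otimes> (k \<otimes> l) \<otimes> inv r" using rG by (simp add: m_assoc)
          finally show ?thesis using subgroup.m_closed[OF K kl(1,3)] by blast
        qed
      qed
      have "subgroup K' ?G"
        unfolding K' using subgroups_Inter_pair[OF N conj] by (rule subgroup_incl[OF _ N]) simp
      moreover have "continuous_map (?D n) ?Z q'"
      proof (rule continuous_map_eq[OF cellcont[OF Kq r one_N]])
        fix x assume "x \<in> topspace (?D n)"
        then show "?\<phi> \<one> ((\<phi> r \<circ> q) x) = q' x" unfolding q' using cellF[OF Kq r] FX action_one by auto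
      qed
      moreover have "?\<phi> k' (q' x) = q' x" if k': "k' \<in> K'" and x: "x \<in> topspace (?D n)" for k' x
      proof -
        obtain k where k: "k \<in> K" "k' = r \<otimes> k \<otimes> inv r" "k' \<in> N" using k' unfolding K' by blast
        have kG: "k \<in> carrier G" using subgroup.mem_carrier[OF K k(1)] .
        have "?\<phi> k' (q' x) = \<phi> (k' \<otimes> r) (q x)" unfolding q' by (rule trans[OF Kq r k(3) x])
        also have "k' \<otimes> r = r \<otimes> k" unfolding k(2) using rG kG by (simp add: m_assoc)
        also have "\<phi> (r \<otimes> k) (q x) = \<phi> r (\<phi> k (q x))" by (rule action_mult[OF rG kG q_topspace[OF Kq x]])
        also have "\<phi> k (q x) = q x" by (rule G_CW_structure_cell(3)[OF cw Kq k(1) x])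
        finally show ?thesis by (simp add: q')
      qed
      moreover have "q' ` disc_boundary n \<subseteq> ?sk n"
        unfolding sk' q' using boundary_sk[OF Kq rG] cellF[OF Kq r] disc_interior_boundary(2)[of n] by auto
      ultimately show "subgroup K' ?G \<and> continuous_map (?D n) ?Z q' \<and>
          (\<forall>k\<in>K'. \<forall>x\<in>topspace (?D n). ?\<phi> k (q' x) = q' x) \<and> q' ` disc_boundary n \<subseteq> ?sk n" by blast
    qed
    show "\<forall>n. \<forall>(K, q)\<in>cells' n. \<forall>g\<in>carrier ?G. \<forall>x\<in>disc_interior n. ?\<phi> g (q x) \<notin> ?sk n"
    proof (intro allI ballI, clarify)
      fix n K' q' g x assume c: "(K', q') \<in> cells' n" and gx: "g \<in> carrier ?G" "x \<in> disc_interior n"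
        and in_S: "?\<phi> g (q' x) \<in> ?sk n"
      obtain K q r where q': "q' = \<phi> r \<circ> q" and Kq: "(K, q) \<in> cells n" and r: "r \<in> R K"
        using cells'D[OF c] by blast
      have g: "g \<in> N" using gx by simp
      have "\<phi> (g \<otimes> r) (q x) \<in> sk n" using in_S trans[OF Kq r g int_D[OF gx(2)]] unfolding q' sk' by simp
      then show False using G_CW_structure_not_below[OF cw Kq _ gx(2)] NG[OF g] RG[OF Kq r] by blast
    qed
    show "\<forall>n. \<forall>(K, q)\<in>cells' n. \<forall>(L, p)\<in>cells' n. \<forall>g\<in>carrier ?G. \<forall>h\<in>carrier ?G.
        \<forall>x\<in>disc_interior n. \<forall>y\<in>disc_interior n. ?\<phi> g (q x) = ?\<phi> h (p y) \<longrightarrow>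
        (K, q) = (L, p) \<and> g <#\<^bsub>?G\<^esub> K = h <#\<^bsub>?G\<^esub> K \<and> x = y"
    proof (intro allI ballI, clarify)
      fix n K' q' L' p' g h x y
      assume c: "(K', q') \<in> cells' n" "(L', p') \<in> cells' n" and gh: "g \<in> carrier ?G" "h \<in> carrier ?G"
        and xy: "x \<in> disc_interior n" "y \<in> disc_interior n" and eq: "?\<phi> g (q' x) = ?\<phi> h (p' y)"
      obtain K q r where K': "K' = ?st K r" and q': "q' = \<phi> r \<circ> q" and Kq: "(K, q) \<in> cells n" and r: "r \<in> R K"
        using cells'D[OF c(1)] by blast
      obtain L p s where L': "L' = ?st L s" and p': "p' = \<phi> s \<circ> p" and Lp: "(L, p) \<in> cells n" and s: "s \<in> R L"
        using cells'D[OF c(2)] by blast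
      have g: "g \<in> N" and h: "h \<in> N" using gh by auto
      note [simp] = NG[OF g] NG[OF h] RG[OF Kq r] RG[OF Lp s]
      note K = G_CW_structure_cell(1)[OF cw Kq]
      have e: "\<phi> (g \<otimes> r) (q x) = \<phi> (h \<otimes> s) (p y)"
        using eq trans[OF Kq r g int_D[OF xy(1)]] trans[OF Lp s h int_D[OF xy(2)]] unfolding q' p' by simp
      have gr: "g \<otimes> r \<in> carrier G" "h \<otimes> s \<in> carrier G" by simp_all
      note inj = G_CW_structure_inj[OF cw Kq Lp gr xy e]
      have LK: "L = K" "p = q" using inj(1) by simp_all
      obtain k where k: "k \<in> K" "g \<otimes> r = h \<otimes> s \<otimes> k" by (rule l_coset_eqD[OF gr K inj(2)])
      have [simp]: "k \<in> carrier G" using subgroup.mem_carrier[OF K k(1)] .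
      \<comment> \<open>Equal points put \<open>r\<close> and \<open>s\<close> into one double
        coset, so both cells come from the same representative.\<close>
      have "r = inv g \<otimes> (g \<otimes> r)" by (simp add: m_assoc[symmetric])
      also have "\<dots> = (inv g \<otimes> h) \<otimes> s \<otimes> k" unfolding k(2) by (simp add: m_assoc)
      finally have "s = r"
        using R(4)[OF Kq _ r _ k(1), of s "inv g \<otimes> h"] s LK subgroup.m_closed[OF N subgroup.m_inv_closed[OF N g] h] by blast
      then have "K' = L'" "q' = p'" unfolding K' L' q' p' LK by simp_all
      moreover have "g <#\<^bsub>?G\<^esub> K' = h <#\<^bsub>?G\<^esub> K'"
      proof -
        have "inv h \<otimes> g = r \<otimes> k \<otimes> inv r"
        proof -
          have "r \<otimes> k \<otimes> inv r = inv h \<otimes> (h \<otimes> s \<otimes> k) \<otimes> inv r"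
            using \<open>s = r\<close> by (simp add: m_assoc) (simp add: m_assoc[symmetric])
          also have "\<dots> = inv h \<otimes> g" unfolding k(2)[symmetric] by (simp add: m_assoc)
          finally show ?thesis by simp
        qed
        then have mem: "inv h \<otimes> g \<in> K'"
          unfolding K' using k(1) subgroup.m_closed[OF N subgroup.m_inv_closed[OF N h] g] by blast
        have "K' \<subseteq> N" unfolding K' by blast
        have subK': "subgroup K' G"
          using \<open>\<forall>n. \<forall>(K, q)\<in>cells' n. subgroup K ?G \<and> continuous_map (?D n) ?Z q \<and>
            (\<forall>k\<in>K. \<forall>x\<in>topspace (?D n). ?\<phi> k (q x) = q x) \<and> q ` disc_boundary n \<subseteq> ?sk n\<close> c(1)
            incl_subgroup[OF N] by blast
        have "g \<in> h <# K'"
          unfolding l_coset_def using mem by (intro UN_I[of "inv h \<otimes> g"]) (simp_all add: m_assoc[symmetric])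
        then have "h <# K' = g <# K'" by (rule l_repr_independence[OF _ NG[OF h] subK'])
        then show ?thesis by (simp add: l_coset_def)
      qed
      ultimately show "(K', q') = (L', p') \<and> g <#\<^bsub>?G\<^esub> K' = h <#\<^bsub>?G\<^esub> K' \<and> x = y" using inj(3) by blast
    qed
    show "\<forall>n. \<forall>A \<subseteq> ?sk (Suc n). closedin (subtopology ?Z (?sk (Suc n))) A \<longleftrightarrow>
        closedin (subtopology ?Z (?sk n)) (A \<inter> ?sk n) \<and>
        (\<forall>(K, q)\<in>cells' n. \<forall>g\<in>carrier ?G. closedin (?D n) {x \<in> topspace (?D n). ?\<phi> g (q x) \<in> A})"
    proof (intro allI impI iffI conjI)
      fix n A assume A: "A \<subseteq> ?sk (Suc n)" and cl: "closedin (subtopology ?Z (?sk (Suc n))) A"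
      show "closedin (subtopology ?Z (?sk n)) (A \<inter> ?sk n)"
        by (rule closedin_subtopology_shrink[OF cl]) (use skSuc in \<open>auto simp: sk'\<close>)
      show "\<forall>(K, q)\<in>cells' n. \<forall>g\<in>carrier ?G. closedin (?D n) {x \<in> topspace (?D n). ?\<phi> g (q x) \<in> A}"
      proof (intro ballI, clarify)
        fix K' q' g assume c: "(K', q') \<in> cells' n" and g: "g \<in> carrier ?G"
        obtain K q r where q': "q' = \<phi> r \<circ> q" and Kq: "(K, q) \<in> cells n" and r: "r \<in> R K"
          using cells'D[OF c] by blast
        have gN: "g \<in> N" using g by simp
        have "?\<phi> g ((\<phi> r \<circ> q) x) \<in> ?sk (Suc n)" if "x \<in> topspace (?D n)" for x
          unfolding sk'_iff trans[OF Kq r gN that] using Kq r gN that by blast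
        then have "continuous_map (?D n) (subtopology ?Z (?sk (Suc n))) (\<lambda>x. ?\<phi> g ((\<phi> r \<circ> q) x))"
          by (intro continuous_map_into_subtopology[OF cellcont[OF Kq r gN]] Pi_I)
        from closedin_continuous_map_preimage[OF this cl]
        show "closedin (?D n) {x \<in> topspace (?D n). ?\<phi> g (q' x) \<in> A}" unfolding q' .
      qed
    next
      fix n A assume A: "A \<subseteq> ?sk (Suc n)" and cl: "closedin (subtopology ?Z (?sk n)) (A \<inter> ?sk n) \<and>
        (\<forall>(K, q)\<in>cells' n. \<forall>g\<in>carrier ?G. closedin (?D n) {x \<in> topspace (?D n). ?\<phi> g (q x) \<in> A})"
      have AF: "A \<subseteq> F" "A \<subseteq> sk (Suc n)" using A unfolding sk' by auto
      \<comment> \<open>Translates by elements outside the transporter have no interior point in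
        \<open>F\<close>, hence none in \<open>A\<close>. All others are translates under
        \<open>N\<close> of new cells, where closedness is given.\<close>
      have "closedin (subtopology X (sk (Suc n))) A"
      proof (rule closedin_between_skeleta[where B = "sk n"])
        have "A \<inter> ?sk n = A \<inter> sk n" using AF unfolding sk' by blast
        then show "closedin (subtopology X (sk n)) (A \<inter> sk n)" using cl unfolding sub by (intro to_sk) simp
        fix K q g assume Kq: "(K, q) \<in> cells n" and g: "g \<in> carrier G"
        show "(\<forall>x\<in>topspace (?D n). \<phi> g (q x) \<in> sk n) \<or> (\<forall>x\<in>disc_interior n. \<phi> g (q x) \<notin> A) \<or>
            closedin (?D n) {x \<in> topspace (?D n). \<phi> g (q x) \<in> A}"
        proof (cases "g \<in> ?T K")
          case True
          obtain r \<nu> where r: "r \<in> R K" "\<nu> \<in> N" "\<forall>x\<in>topspace (?D n). \<phi> g (q x) = ?\<phi> \<nu> ((\<phi> r \<circ> q) x)"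
            using trans_all[OF Kq True] by blast
          have "(?st K r, \<phi> r \<circ> q) \<in> cells' n" unfolding cells'_def using Kq r(1) by blast
          from bspec[OF conjunct2[OF cl] this]
          have "\<forall>g\<in>carrier ?G. closedin (?D n) {x \<in> topspace (?D n). ?\<phi> g ((\<phi> r \<circ> q) x) \<in> A}"
            by (simp only: prod.case)
          moreover have "\<nu> \<in> carrier ?G" using r(2) by simp
          ultimately have "closedin (?D n) {x \<in> topspace (?D n). ?\<phi> \<nu> ((\<phi> r \<circ> q) x) \<in> A}" by (rule bspec)
          moreover have "{x \<in> topspace (?D n). ?\<phi> \<nu> ((\<phi> r \<circ> q) x) \<in> A} = {x \<in> topspace (?D n). \<phi> g (q x) \<in> A}"
            using r(3) by (intro Collect_cong conj_cong refl) simp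
          ultimately show ?thesis by simp
        next
          case False
          then show ?thesis using fixed_transporter[OF H Kq g] AF(1) unfolding F_def by blast
        qed
      qed (use skSuc AF in auto)
      then have "closedin (subtopology X (sk (Suc n) \<inter> F)) (A \<inter> (sk (Suc n) \<inter> F))"
        by (rule closedin_subtopology_shrink) blast
      moreover have "A \<inter> (sk (Suc n) \<inter> F) = A" using AF by blast
      ultimately show "closedin (subtopology ?Z (?sk (Suc n))) A" unfolding sub by simp
    qed
    show "\<forall>A \<subseteq> topspace ?Z. closedin ?Z A \<longleftrightarrow> (\<forall>n. closedin (subtopology ?Z (?sk n)) (A \<inter> ?sk n))"
    proof (intro allI impI iffI)
      fix A n assume "A \<subseteq> topspace ?Z" "closedin ?Z A"
      then have "closedin (subtopology X (sk n \<inter> F)) (A \<inter> (sk n \<inter> F))"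
        by (intro closedin_subtopology_shrink[of X F]) auto
      then show "closedin (subtopology ?Z (?sk n)) (A \<inter> ?sk n)" unfolding sk' sub[unfolded sk'] .
    next
      fix A assume A: "A \<subseteq> topspace ?Z" and cl: "\<forall>n. closedin (subtopology ?Z (?sk n)) (A \<inter> ?sk n)"
      have AF: "A \<subseteq> F" using A topF by simp
      have "closedin (subtopology X (sk n)) (A \<inter> sk n)" for n
      proof -
        have "A \<inter> ?sk n = A \<inter> sk n" using AF unfolding sk' by blast
        then show ?thesis using cl unfolding sub by (intro to_sk) metis
      qed
      then have "closedin X A" using G_CW_structure_closedin[OF cw, of A] AF FX by blast
      then show "closedin ?Z A" using AF by (rule closedin_subset_topspace)
    qed
  qed
  let ?S = "SIGMA u:(SIGMA n:UNIV. cells n). R (fst (snd u))"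
  define j where "j = (\<lambda>((n :: nat, K, q :: (nat \<Rightarrow> real) \<Rightarrow> 'c), r). (n, ?st K r, \<phi> r \<circ> q))"
  have S': "(SIGMA n:UNIV. cells' n) = j ` ?S"
  proof (intro subset_antisym subsetI)
    fix v assume v: "v \<in> (SIGMA n:UNIV. cells' n)"
    obtain n K' q' where v': "v = (n, K', q')" by (metis prod.exhaust)
    then obtain K q r where *: "K' = ?st K r" "q' = \<phi> r \<circ> q" "(K, q) \<in> cells n" "r \<in> R K" using v cells'D by blast
    then have "v = j ((n, K, q), r)" by (simp add: v' j_def)
    moreover have "((n, K, q), r) \<in> ?S" using * by simp
    ultimately show "v \<in> j ` ?S" by blast
  next
    fix v assume "v \<in> j ` ?S"
    then show "v \<in> (SIGMA n:UNIV. cells' n)" unfolding j_def cells'_def by fastforce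
  qed
  \<comment> \<open>Two pairs with the same new cell agree at the centre of the disc. This
    identifies the original cell, and then the double cosets identify the representative; so no new
    cell is counted twice.\<close>
  have injj: "inj_on j ?S"
  proof (rule inj_onI)
    fix u v assume uv: "u \<in> ?S" "v \<in> ?S" "j u = j v"
    obtain n K q r where u: "u = ((n, K, q), r)" by (metis prod.exhaust)
    obtain m L p s where v: "v = ((m, L, p), s)" by (metis prod.exhaust)
    have Kq: "(K, q) \<in> cells n" "r \<in> R K" and Lp: "(L, p) \<in> cells m" "s \<in> R L" using uv u v by auto
    have mn: "m = n" and eq: "\<phi> r \<circ> q = \<phi> s \<circ> p" using uv(3) by (simp_all add: u v j_def)
    have z: "(\<lambda>_. 0) \<in> disc_interior n" by (simp add: disc_interior_def topspace_unit_disc)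
    have e: "\<phi> r (q (\<lambda>_. 0)) = \<phi> s (p (\<lambda>_. 0))" using fun_cong[OF eq, of "\<lambda>_. 0"] by simp
    have rs: "r \<in> carrier G" "s \<in> carrier G" using RG Kq Lp by blast+
    note inj = G_CW_structure_inj[OF cw Kq(1) Lp(1)[unfolded mn] rs z z e]
    have LK: "L = K" "p = q" using inj(1) by simp_all
    obtain k where k: "k \<in> K" "r = s \<otimes> k" by (rule l_coset_eqD[OF rs G_CW_structure_cell(1)[OF cw Kq(1)] inj(2)])
    then have "r = \<one> \<otimes> s \<otimes> k" using rs by simp
    then have "s = r" using R(4)[OF Kq(1) _ Kq(2) one_N k(1), of s] Lp(2) LK by blast
    then show "u = v" by (simp add: u v LK mn)
  qed
  have finS: "finite ?S"
  proof (rule finite_SigmaI[OF finite_cells])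
    fix u assume "u \<in> (SIGMA n:UNIV. cells n)"
    then show "finite (R (fst (snd u)))" using R(2)[of "fst (snd u)" "snd (snd u)" "fst u"] by auto
  qed
  have "(\<Sum>(n, K, q)\<in>(SIGMA n:UNIV. cells' n). (-1) ^ n / (of_nat (card K) :: rat)) =
      (\<Sum>u\<in>?S. case j u of (n, K, q) \<Rightarrow> (-1) ^ n / of_nat (card K))"
    unfolding S' by (simp add: sum.reindex[OF injj])
  also have "\<dots> = (\<Sum>(u, r)\<in>?S. (-1) ^ fst u / of_nat (card (?st (fst (snd u)) r)))"
    by (intro sum.cong refl) (auto simp: j_def)
  also have "\<dots> = (\<Sum>u\<in>(SIGMA n:UNIV. cells n). \<Sum>r\<in>R (fst (snd u)). (-1) ^ fst u / of_nat (card (?st (fst (snd u)) r)))"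
  proof (rule sum.Sigma[OF finite_cells, symmetric], intro ballI)
    fix u assume "u \<in> (SIGMA n:UNIV. cells n)"
    then show "finite (R (fst (snd u)))" using R(2)[of "fst (snd u)" "snd (snd u)" "fst u"] by auto
  qed
  also have "\<dots> = (\<Sum>(n, K, q)\<in>(SIGMA n:UNIV. cells n). (-1) ^ n *
        of_nat (card {H'. H' \<subseteq> K \<and> H' \<in> conjugacy_class G H}) / of_nat (card K))"
  proof (intro sum.cong refl, clarify)
    fix n K q assume Kq: "(K, q) \<in> cells n"
    have "(\<Sum>r\<in>R K. (-1) ^ n / (of_nat (card (?st K r)) :: rat)) = (-1) ^ n * (\<Sum>r\<in>R K. 1 / of_nat (card (?st K r)))"
      by (simp add: sum_distrib_left)
    then show "(\<Sum>r\<in>R (fst (snd (n, K, q))). (-1) ^ fst (n, K, q) / (of_nat (card (?st (fst (snd (n, K, q))) r)) :: rat)) =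
        (-1) ^ n * of_nat (card {H'. H' \<subseteq> K \<and> H' \<in> conjugacy_class G H}) / of_nat (card K)"
      by (simp add: R(5)[OF Kq])
  qed
  finally show ?thesis using that[OF CW] finS unfolding S' by blast
qed

text \<open>A point of \<open>X^H\<close> is fixed by \<open>U\<close> exactly if it is fixed by the
  product of \<open>U\<close> and \<open>H\<close>. This product is a subgroup because
  \<open>U\<close> normalizes \<open>H\<close>, and it is finite exactly if \<open>U\<close> is. So
  the conditions on \<open>X^H\<close> are instances of those on \<open>X\<close>.\<close>

lemma fixed_points_model:
  assumes H: "subgroup H G" and finH: "finite H"
  defines "F \<equiv> fixed_points X \<phi> H"
  shows "finite_EG_model (G\<lparr>carrier := normalizer G H\<rparr>) (subtopology X F) (\<lambda>g. \<lambda>x\<in>F. \<phi> g x)"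
proof -
  have HG: "H \<subseteq> carrier G" using H by (rule subgroup.subset)
  have N: "subgroup (normalizer G H) G" by (rule normalizer_imp_subgroup[OF HG])
  note [simp] = subgroup.mem_carrier[OF H]
  have fp: "if finite U
       then fixed_points (subtopology X F) (\<lambda>g. \<lambda>x\<in>F. \<phi> g x) U \<noteq> {} \<and>
         contractible_space (subtopology (subtopology X F) (fixed_points (subtopology X F) (\<lambda>g. \<lambda>x\<in>F. \<phi> g x) U))
       else fixed_points (subtopology X F) (\<lambda>g. \<lambda>x\<in>F. \<phi> g x) U = {}"
    if U: "subgroup U (G\<lparr>carrier := normalizer G H\<rparr>)" for U
  proof -
    have UG: "subgroup U G" by (rule incl_subgroup[OF N U])
    have UN: "U \<subseteq> normalizer G H" using subgroup.subset[OF U] by simp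
    note [simp] = subgroup.mem_carrier[OF UG]
    let ?UH = "U <#> H"
    have memI: "u \<otimes> h \<in> ?UH" if "u \<in> U" "h \<in> H" for u h using that unfolding set_mult_def by blast
    have memE: "\<exists>u\<in>U. \<exists>h\<in>H. a = u \<otimes> h" if "a \<in> ?UH" for a using that unfolding set_mult_def by blast
    have conj: "inv u \<otimes> h \<otimes> u \<in> H" "u \<otimes> h \<otimes> inv u \<in> H" if "u \<in> U" "h \<in> H" for u h
      using normalizer_conj[OF H] UN that by auto
    have UH: "subgroup ?UH G"
    proof (rule subgroupI)
      show "?UH \<subseteq> carrier G" using memE by fastforce
      show "?UH \<noteq> {}" using memI subgroup.one_closed[OF UG] subgroup.one_closed[OF H] by blast
      show "inv a \<in> ?UH" if "a \<in> ?UH" for a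
      proof -
        obtain u h where a: "u \<in> U" "h \<in> H" "a = u \<otimes> h" using memE \<open>a \<in> ?UH\<close> by blast
        have "inv a = inv u \<otimes> (u \<otimes> inv h \<otimes> inv u)" using a by (simp add: inv_mult_group m_assoc[symmetric])
        then show ?thesis
          using memI[OF subgroup.m_inv_closed[OF UG a(1)] conj(2)[OF a(1) subgroup.m_inv_closed[OF H a(2)]]] by simp
      qed
      show "a \<otimes> b \<in> ?UH" if "a \<in> ?UH" "b \<in> ?UH" for a b
      proof -
        obtain u h where a: "u \<in> U" "h \<in> H" "a = u \<otimes> h" using memE \<open>a \<in> ?UH\<close> by blast
        obtain v k where b: "v \<in> U" "k \<in> H" "b = v \<otimes> k" using memE \<open>b \<in> ?UH\<close> by blast
        have "a \<otimes> b = u \<otimes> v \<otimes> (inv v \<otimes> h \<otimes> v \<otimes> k)"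
        proof -
          have "u \<otimes> v \<otimes> (inv v \<otimes> h \<otimes> v \<otimes> k) = u \<otimes> (v \<otimes> inv v) \<otimes> h \<otimes> v \<otimes> k"
            using a b by (simp only: m_assoc m_closed inv_closed subgroup.mem_carrier[OF UG] subgroup.mem_carrier[OF H])
          then show ?thesis using a b by (simp add: m_assoc)
        qed
        then show ?thesis
          using memI[OF subgroup.m_closed[OF UG a(1) b(1)] subgroup.m_closed[OF H conj(1)[OF b(1) a(2)] b(2)]] by simp
      qed
    qed
    have fixed: "fixed_points (subtopology X F) (\<lambda>g. \<lambda>x\<in>F. \<phi> g x) U = fixed_points X \<phi> ?UH"
    proof (intro subset_antisym subsetI)
      fix x assume x: "x \<in> fixed_points (subtopology X F) (\<lambda>g. \<lambda>x\<in>F. \<phi> g x) U"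
      then have xF: "x \<in> F" "x \<in> topspace X" and fx: "\<And>u. u \<in> U \<Longrightarrow> \<phi> u x = x" by (auto simp: fixed_points_def)
      show "x \<in> fixed_points X \<phi> ?UH"
      proof (rule fixed_pointsI[OF xF(2)])
        fix a assume "a \<in> ?UH"
        then obtain u h where a: "u \<in> U" "h \<in> H" "a = u \<otimes> h" using memE by blast
        have "\<phi> a x = \<phi> u (\<phi> h x)" unfolding a(3) using a xF by (intro action_mult) auto
        then show "\<phi> a x = x" using fx[OF a(1)] xF(1) a(2) by (simp add: F_def fixed_points_def)
      qed
    next
      fix x assume x: "x \<in> fixed_points X \<phi> ?UH"
      have xX: "x \<in> topspace X" using x by (simp add: fixed_points_def)
      have "\<phi> u x = x" if "u \<in> U" for u
        using x memI[OF that subgroup.one_closed[OF H]] that by (simp add: fixed_points_def)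
      moreover have "\<phi> h x = x" if "h \<in> H" for h
        using x memI[OF subgroup.one_closed[OF UG] that] that by (simp add: fixed_points_def)
      ultimately show "x \<in> fixed_points (subtopology X F) (\<lambda>g. \<lambda>x\<in>F. \<phi> g x) U"
        using xX by (simp add: F_def fixed_points_def)
    qed
    have fin: "finite ?UH \<longleftrightarrow> finite U"
    proof
      assume "finite ?UH"
      moreover have "U \<subseteq> ?UH"
      proof
        fix u assume "u \<in> U"
        then show "u \<in> ?UH" using memI[of u \<one>] subgroup.one_closed[OF H] by simp
      qed
      ultimately show "finite U" by (rule rev_finite_subset)
    next
      assume "finite U"
      then show "finite ?UH" unfolding set_mult_def using finH by auto
    qed
    have "fixed_points X \<phi> ?UH \<subseteq> F"
      using fixed by (auto simp: fixed_points_def)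
    then have "subtopology (subtopology X F) (fixed_points X \<phi> ?UH) = subtopology X (fixed_points X \<phi> ?UH)"
      by (simp add: subtopology_subtopology Int_absorb1)
    then show ?thesis using EG[OF UH] unfolding fixed fin by simp
  qed
  obtain cells' where "G_CW_structure (G\<lparr>carrier := normalizer G H\<rparr>) (subtopology X F) (\<lambda>g. \<lambda>x\<in>F. \<phi> g x) cells'"
    "finite (SIGMA n:UNIV. cells' n)"
    using fixed_points_CW[OF H finH] unfolding F_def by blast
  then show ?thesis
    unfolding finite_EG_model_def finite_G_CW_complex_def
    using fp fixed_points_action[OF H] unfolding F_def by blast
qed

lemma orbifold_euler_normalizer:
  assumes H: "subgroup H G" and finH: "finite H" and vtf: "virtually_torsion_free (G\<lparr>carrier := normalizer G H\<rparr>)"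
  shows "orbifold_euler (G\<lparr>carrier := normalizer G H\<rparr>) =
    (\<Sum>(n, K, q)\<in>(SIGMA n:UNIV. cells n). (-1) ^ n *
        of_nat (card {H'. H' \<subseteq> K \<and> H' \<in> conjugacy_class G H}) / of_nat (card K))"
proof (rule fixed_points_CW[OF H finH])
  fix cells' assume *: "G_CW_structure (G\<lparr>carrier := normalizer G H\<rparr>) (subtopology X (fixed_points X \<phi> H))
      (\<lambda>g. \<lambda>x\<in>fixed_points X \<phi> H. \<phi> g x) cells'" "finite (SIGMA n:UNIV. cells' n)"
    and eq: "(\<Sum>(n, K, q)\<in>(SIGMA n:UNIV. cells' n). (-1) ^ n / (of_nat (card K) :: rat)) =
      (\<Sum>(n, K, q)\<in>(SIGMA n:UNIV. cells n). (-1) ^ n *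
        of_nat (card {H'. H' \<subseteq> K \<and> H' \<in> conjugacy_class G H}) / of_nat (card K))"
  show ?thesis using orbifold_euler_eq_sum_cells[OF fixed_points_model[OF H finH] * vtf] eq by simp
qed

end

text \<open>A coset of \<open>L \<inter> N\<close> in \<open>N\<close> is the trace of a coset of
  \<open>L\<close>, so there are finitely many.\<close>

lemma virtually_torsion_free_subgroup:
  fixes G (structure)
  assumes "group G" "virtually_torsion_free G" and N: "subgroup N G"
  shows "virtually_torsion_free (G\<lparr>carrier := N\<rparr>)"
proof -
  interpret group G by fact
  obtain L where L: "subgroup L G" "finite (rcosets L)"
    and tf: "\<And>x k. x \<in> L \<Longrightarrow> (k::nat) > 0 \<Longrightarrow> x [^] k = \<one> \<Longrightarrow> x = \<one>"
    using assms(2) unfolding virtually_torsion_free_def torsion_free_finite_index_def by blast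
  let ?G = "G\<lparr>carrier := N\<rparr>"
  note [simp] = subgroup.mem_carrier[OF N] subgroup.mem_carrier[OF L(1)]
  have sub: "subgroup (L \<inter> N) G" by (rule subgroups_Inter_pair[OF L(1) N])
  then have "subgroup (L \<inter> N) ?G" by (rule subgroup_incl[OF _ N]) simp
  moreover have "finite (rcosets\<^bsub>?G\<^esub> (L \<inter> N))"
  proof (rule finite_subset)
    show "rcosets\<^bsub>?G\<^esub> (L \<inter> N) \<subseteq> (\<lambda>C. C \<inter> N) ` (rcosets L)"
    proof
      fix C assume "C \<in> rcosets\<^bsub>?G\<^esub> (L \<inter> N)"
      then obtain g where g: "g \<in> N" "C = (L \<inter> N) #> g" by (auto simp: RCOSETS_def r_coset_def)
      have "C = (L #> g) \<inter> N"
      proof (intro subset_antisym subsetI)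
        fix x assume "x \<in> C"
        then obtain l where "l \<in> L" "l \<in> N" "x = l \<otimes> g" using g unfolding r_coset_def by blast
        then show "x \<in> (L #> g) \<inter> N" using g(1) subgroup.m_closed[OF N] unfolding r_coset_def by blast
      next
        fix x assume "x \<in> (L #> g) \<inter> N"
        then obtain l where l: "l \<in> L" "x = l \<otimes> g" "x \<in> N" unfolding r_coset_def by blast
        have "l = x \<otimes> inv g" using l g by (simp add: m_assoc)
        then have "l \<in> N" using l(3) g(1) subgroup.m_closed[OF N] subgroup.m_inv_closed[OF N] by blast
        then show "x \<in> C" using l g unfolding r_coset_def by blast
      qed
      moreover have "L #> g \<in> rcosets L" using g(1) subgroup.subset[OF L(1)] by (intro rcosetsI) auto
      ultimately show "C \<in> (\<lambda>C. C \<inter> N) ` (rcosets L)" by blast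
    qed
  qed (use L(2) in simp)
  moreover have "x = \<one>\<^bsub>?G\<^esub>" if "x \<in> L \<inter> N" "(k::nat) > 0" "x [^]\<^bsub>?G\<^esub> k = \<one>\<^bsub>?G\<^esub>" for x k
    using tf[of x k] that by (simp add: nat_pow_consistent[symmetric])
  ultimately show ?thesis unfolding virtually_torsion_free_def torsion_free_finite_index_def by blast
qed

section \<open>Commuting tuples of elements of prime power order\<close>

context group
begin

section \<open>Cauchy's theorem and groups of prime power order\<close>

lemma coprime_pow_eq_one:
  assumes "x \<in> carrier G" "x [^] (a::nat) = \<one>" "x [^] (b::nat) = \<one>" "coprime a b"
  shows "x = \<one>"
proof -
  have "ord x dvd a" "ord x dvd b" using assms(1-3) by (simp_all add: pow_eq_id)
  then have "ord x = 1" using assms(4) by (meson coprime_common_divisor_nat)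
  then show ?thesis using ord_eq_1[OF assms(1)] by simp
qed

text \<open>Cauchy's theorem. Sylow's theorem with exponent 1 gives a subgroup of order
  \<open>q\<close>, and any of its nontrivial elements will do.\<close>

lemma prime_dvd_card_imp_element:
  fixes q :: nat
  assumes "subgroup K G" "finite K" "prime q" "q dvd card K"
  obtains x where "x \<in> K" "x \<noteq> \<one>" "x [^] q = \<one>"
proof -
  let ?K = "G\<lparr>carrier := K\<rparr>"
  have gK: "group ?K" by (rule subgroup_imp_group[OF assms(1)])
  obtain m where m: "card K = q * m" using assms(4) by blast
  have "\<exists>H. subgroup H ?K \<and> card H = q ^ 1"
    using assms(2) m by (intro sylow_thm[OF assms(3) gK, of 1 m]) (simp_all add: order_def)
  then obtain H where H: "subgroup H ?K" "card H = q" by auto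
  have HK: "H \<subseteq> K" using subgroup.subset[OF H(1)] by simp
  have sub: "subgroup H G" by (rule incl_subgroup[OF assms(1) H(1)])
  have "2 \<le> card H" using prime_ge_2_nat[OF assms(3)] H(2) by simp
  then have "\<not> H \<subseteq> {\<one>}" using card_mono[of "{\<one>}" H] by auto
  then obtain x where x: "x \<in> H" "x \<noteq> \<one>" by blast
  then have "x [^] q = \<one>" using subgroup_pow_card[OF sub _ x(1)] finite_subset[OF HK assms(2)] H(2) by simp
  then show ?thesis using that x HK by blast
qed

definition p_elements :: "nat \<Rightarrow> 'a set \<Rightarrow> 'a set"
  where "p_elements p K = {x \<in> K. \<exists>k::nat. x [^] (p ^ k) = \<one>}"

definition centralizer_in :: "'a set \<Rightarrow> 'a \<Rightarrow> 'a set"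
  where "centralizer_in K x = {k \<in> K. k \<otimes> x = x \<otimes> k}"

text \<open>Another prime divisor of the order would give an element of that prime order, which a
  power of \<open>p\<close> also annihilates.\<close>

lemma card_p_group:
  assumes H: "subgroup H G" "finite H" and p: "prime p" and el: "p_elements p H = H"
  obtains k where "card H = p ^ k"
proof -
  have c: "card H > 0" using subgroup.one_closed[OF H(1)] H(2) by (auto simp: card_gt_0_iff)
  have "\<not> is_unit p" using not_prime_unit[of p] p by blast
  then obtain y where y: "card H = p ^ multiplicity p (card H) * y" "\<not> p dvd y"
    using multiplicity_decompose'[of "card H" p] c by auto
  have "y = 1"
  proof (rule ccontr)
    assume "y \<noteq> 1"
    then obtain q where q: "prime q" "q dvd y" using prime_factor_nat by blast
    then have "q dvd card H" using y(1) by (metis dvd_mult)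
    then obtain x where x: "x \<in> H" "x \<noteq> \<one>" "x [^] q = \<one>"
      by (rule prime_dvd_card_imp_element[OF H q(1)])
    then obtain k where k: "x [^] (p ^ k) = \<one>" using el unfolding p_elements_def by blast
    have "coprime q p" using p q y(2) primes_coprime by blast
    then have "coprime q (p ^ k)" by simp
    then show False using coprime_pow_eq_one[OF _ x(3) k] x subgroup.mem_carrier[OF H(1)] by blast
  qed
  then show ?thesis using that y(1) by simp
qed

section \<open>Centralizers, conjugacy classes and sums of class functions\<close>

lemma subgroup_centralizer_in:
  assumes K: "subgroup K G" and x: "x \<in> carrier G"
  shows "subgroup (centralizer_in K x) G"
proof (rule subgroupI)
  note [simp] = subgroup.mem_carrier[OF K]
  show "centralizer_in K x \<subseteq> carrier G" by (auto simp: centralizer_in_def)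
  have "\<one> \<in> centralizer_in K x" using subgroup.one_closed[OF K] x by (simp add: centralizer_in_def)
  then show "centralizer_in K x \<noteq> {}" by blast
  fix a assume a: "a \<in> centralizer_in K x"
  then have aG: "a \<in> carrier G" and e: "a \<otimes> x = x \<otimes> a" by (auto simp: centralizer_in_def)
  have "inv a \<otimes> x = inv a \<otimes> (x \<otimes> a) \<otimes> inv a" using aG x by (simp add: m_assoc)
  also have "\<dots> = inv a \<otimes> (a \<otimes> x) \<otimes> inv a" by (simp only: e)
  also have "\<dots> = x \<otimes> inv a" using aG x by (simp flip: m_assoc)
  finally show "inv a \<in> centralizer_in K x"
    using a subgroup.m_inv_closed[OF K] by (simp add: centralizer_in_def)
  fix b assume b: "b \<in> centralizer_in K x"
  then have bG: "b \<in> carrier G" and eb: "b \<otimes> x = x \<otimes> b" by (auto simp: centralizer_in_def)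
  have "(a \<otimes> b) \<otimes> x = a \<otimes> (x \<otimes> b)" using aG bG x eb by (simp add: m_assoc)
  also have "\<dots> = x \<otimes> (a \<otimes> b)" using aG bG x e by (simp flip: m_assoc)
  finally show "a \<otimes> b \<in> centralizer_in K x"
    using a b subgroup.m_closed[OF K] by (simp add: centralizer_in_def)
qed

lemma centralizer_in_subset: "centralizer_in K x \<subseteq> K"
  by (auto simp: centralizer_in_def)

lemma conj_commute_iff:
  assumes "k \<in> carrier G" "a \<in> carrier G" "b \<in> carrier G"
  shows "(k \<otimes> a \<otimes> inv k) \<otimes> (k \<otimes> b \<otimes> inv k) = (k \<otimes> b \<otimes> inv k) \<otimes> (k \<otimes> a \<otimes> inv k) \<longleftrightarrow> a \<otimes> b = b \<otimes> a"
proof -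
  have *: "(k \<otimes> a \<otimes> inv k) \<otimes> (k \<otimes> b \<otimes> inv k) = k \<otimes> (a \<otimes> b) \<otimes> inv k"
    if "a \<in> carrier G" "b \<in> carrier G" for a b
  proof -
    have "(k \<otimes> a \<otimes> inv k) \<otimes> (k \<otimes> b \<otimes> inv k) = k \<otimes> a \<otimes> (inv k \<otimes> k) \<otimes> b \<otimes> inv k"
      using assms(1) that by (simp only: m_assoc m_closed inv_closed)
    then show ?thesis using assms(1) that by (simp add: m_assoc)
  qed
  show ?thesis using assms by (simp add: *)
qed

lemma conj_in_subgroup:
  "subgroup K G \<Longrightarrow> k \<in> K \<Longrightarrow> x \<in> K \<Longrightarrow> k \<otimes> x \<otimes> inv k \<in> K"
  by (simp add: subgroup.m_closed subgroup.m_inv_closed)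

lemma conj_inverse:
  assumes "k \<in> carrier G" "x \<in> carrier G"
  shows "inv k \<otimes> (k \<otimes> x \<otimes> inv k) \<otimes> inv (inv k) = x" "k \<otimes> (inv k \<otimes> x \<otimes> inv (inv k)) \<otimes> inv k = x"
proof -
  have "inv k \<otimes> (k \<otimes> x \<otimes> inv k) \<otimes> k = (inv k \<otimes> k) \<otimes> x \<otimes> (inv k \<otimes> k)"
    using assms by (simp only: m_assoc m_closed inv_closed)
  then show "inv k \<otimes> (k \<otimes> x \<otimes> inv k) \<otimes> inv (inv k) = x" using assms by simp
  have "k \<otimes> (inv k \<otimes> x \<otimes> k) \<otimes> inv k = (k \<otimes> inv k) \<otimes> x \<otimes> (k \<otimes> inv k)"
    using assms by (simp only: m_assoc m_closed inv_closed)
  then show "k \<otimes> (inv k \<otimes> x \<otimes> inv (inv k)) \<otimes> inv k = x" using assms by simp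
qed

lemma conj_inj_on: "k \<in> carrier G \<Longrightarrow> inj_on (\<lambda>x. k \<otimes> x \<otimes> inv k) (carrier G)"
  by (intro inj_onI) (metis conj_inverse(1))

lemma conj_conj:
  assumes "k \<in> carrier G" "l \<in> carrier G" "x \<in> carrier G"
  shows "l \<otimes> (k \<otimes> x \<otimes> inv k) \<otimes> inv l = (l \<otimes> k) \<otimes> x \<otimes> inv (l \<otimes> k)"
  using assms by (simp add: inv_mult_group m_assoc)

lemma centralizer_in_conj:
  assumes K: "subgroup K G" and k: "k \<in> K" and x: "x \<in> carrier G"
  shows "centralizer_in K (k \<otimes> x \<otimes> inv k) = (\<lambda>y. k \<otimes> y \<otimes> inv k) ` centralizer_in K x"
proof (intro equalityI subsetI)
  note [simp] = subgroup.mem_carrier[OF K]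
  fix z assume z: "z \<in> centralizer_in K (k \<otimes> x \<otimes> inv k)"
  define y where "y = inv k \<otimes> z \<otimes> inv (inv k)"
  have zK: "z \<in> K" using z by (simp add: centralizer_in_def)
  have yK: "y \<in> K" unfolding y_def using conj_in_subgroup[OF K subgroup.m_inv_closed[OF K k] zK] .
  have zy: "z = k \<otimes> y \<otimes> inv k" unfolding y_def using conj_inverse(2)[of k z] k zK by simp
  have "y \<otimes> x = x \<otimes> y"
    using conj_commute_iff[of k y x] z k x yK by (simp add: centralizer_in_def zy)
  then show "z \<in> (\<lambda>y. k \<otimes> y \<otimes> inv k) ` centralizer_in K x" using yK zy by (auto simp: centralizer_in_def)
next
  note [simp] = subgroup.mem_carrier[OF K]
  fix z assume "z \<in> (\<lambda>y. k \<otimes> y \<otimes> inv k) ` centralizer_in K x"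
  then obtain y where y: "y \<in> K" "y \<otimes> x = x \<otimes> y" "z = k \<otimes> y \<otimes> inv k" by (auto simp: centralizer_in_def)
  then show "z \<in> centralizer_in K (k \<otimes> x \<otimes> inv k)"
    using conj_commute_iff[of k y x] k x conj_in_subgroup[OF K k y(1)] by (simp add: centralizer_in_def)
qed

text \<open>The elements that conjugate \<open>x\<close> to a given conjugate form a coset of the
  centralizer.\<close>

lemma card_conj_orbit:
  assumes K: "subgroup K G" "finite K" and x: "x \<in> carrier G"
  shows "card ((\<lambda>k. k \<otimes> x \<otimes> inv k) ` K) * card (centralizer_in K x) = card K"
proof -
  note [simp] = subgroup.mem_carrier[OF K(1)]
  let ?f = "\<lambda>k. k \<otimes> x \<otimes> inv k"
  have fib: "card {k \<in> K. ?f k = ?f l} = card (centralizer_in K x)" if l: "l \<in> K" for l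
  proof -
    have "{k \<in> K. ?f k = ?f l} = (\<lambda>c. l \<otimes> c) ` centralizer_in K x"
    proof (intro equalityI subsetI)
      fix k assume "k \<in> {k \<in> K. ?f k = ?f l}"
      then have k: "k \<in> K" "?f k = ?f l" by simp_all
      let ?c = "inv l \<otimes> k"
      have "inv l \<otimes> (k \<otimes> x \<otimes> inv k) \<otimes> k = inv l \<otimes> (l \<otimes> x \<otimes> inv l) \<otimes> k" by (simp only: k(2))
      moreover have "inv l \<otimes> (k \<otimes> x \<otimes> inv k) \<otimes> k = inv l \<otimes> k \<otimes> x \<otimes> (inv k \<otimes> k)"
        "inv l \<otimes> (l \<otimes> x \<otimes> inv l) \<otimes> k = (inv l \<otimes> l) \<otimes> x \<otimes> (inv l \<otimes> k)"
        using k(1) l x subgroup.mem_carrier[OF K(1)] by (simp_all only: m_assoc m_closed inv_closed)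
      ultimately have "?c \<otimes> x = x \<otimes> ?c" using k(1) l x by simp
      then have "?c \<in> centralizer_in K x"
        using k l K(1) by (simp add: centralizer_in_def subgroup.m_closed subgroup.m_inv_closed)
      moreover have "k = l \<otimes> ?c" using k l by (simp flip: m_assoc)
      ultimately show "k \<in> (\<lambda>c. l \<otimes> c) ` centralizer_in K x" by (rule rev_image_eqI)
    next
      fix k assume "k \<in> (\<lambda>c. l \<otimes> c) ` centralizer_in K x"
      then obtain c where c: "c \<in> K" "c \<otimes> x = x \<otimes> c" "k = l \<otimes> c" by (auto simp: centralizer_in_def)
      have "?f k = l \<otimes> (c \<otimes> x) \<otimes> inv c \<otimes> inv l" using c(1,3) l x by (simp add: inv_mult_group m_assoc)
      also have "\<dots> = l \<otimes> x \<otimes> (c \<otimes> inv c) \<otimes> inv l"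
        unfolding c(2) using c(1) l x subgroup.mem_carrier[OF K(1)] by (simp only: m_assoc m_closed inv_closed)
      also have "\<dots> = ?f l" using c(1) l x by simp
      finally show "k \<in> {k \<in> K. ?f k = ?f l}" using c l K(1) by (simp add: subgroup.m_closed)
    qed
    moreover have "inj_on (\<lambda>c. l \<otimes> c) (centralizer_in K x)"
      using l by (intro inj_onI) (auto simp: centralizer_in_def)
    ultimately show ?thesis by (simp add: card_image)
  qed
  have "card K = (\<Sum>k\<in>K. 1)" by simp
  also have "\<dots> = (\<Sum>y\<in>?f ` K. \<Sum>k\<in>{k \<in> K. ?f k = y}. 1)" by (rule sum.image_gen[OF K(2)])
  also have "\<dots> = (\<Sum>y\<in>?f ` K. card (centralizer_in K x))" using fib by (intro sum.cong refl) auto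
  finally show ?thesis by simp
qed

text \<open>A class contributes its length times one value of \<open>f\<close>. The length is the
  index of a centralizer, and the \<open>p\<close>-part of \<open>card K\<close> is the product of
  the \<open>p\<close>-parts of this index and of the order of the centralizer; the latter divides
  the value.\<close>

lemma class_sum_dvd:
  fixes f :: "'a \<Rightarrow> nat"
  assumes K: "subgroup K G" "finite K" and p: "prime p"
    and S: "S \<subseteq> K" "\<And>k x. k \<in> K \<Longrightarrow> x \<in> S \<Longrightarrow> k \<otimes> x \<otimes> inv k \<in> S"
    and f: "\<And>k x. k \<in> K \<Longrightarrow> x \<in> S \<Longrightarrow> f (k \<otimes> x \<otimes> inv k) = f x"
    and d: "\<And>x. x \<in> S \<Longrightarrow> p ^ multiplicity p (card (centralizer_in K x)) dvd f x"
  shows "p ^ multiplicity p (card K) dvd sum f S"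
proof -
  note [simp] = subgroup.mem_carrier[OF K(1)]
  have finS: "finite S" using finite_subset[OF S(1) K(2)] .
  have SG: "x \<in> carrier G" if "x \<in> S" for x using S(1) that by auto
  define orb where "orb = (\<lambda>x. (\<lambda>k. k \<otimes> x \<otimes> inv k) ` K)"
  have self: "x \<in> orb x" if "x \<in> S" for x
    unfolding orb_def using SG[OF that] subgroup.one_closed[OF K(1)] by (intro image_eqI[of _ _ \<one>]) auto
  have orb_eq: "orb (l \<otimes> x \<otimes> inv l) = orb x" if "x \<in> S" "l \<in> K" for x l
  proof -
    have "orb (l \<otimes> x \<otimes> inv l) = (\<lambda>k. (k \<otimes> l) \<otimes> x \<otimes> inv (k \<otimes> l)) ` K"
      unfolding orb_def using that SG by (intro image_cong refl) (simp add: conj_conj)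
    also have "\<dots> = (\<lambda>k. k \<otimes> x \<otimes> inv k) ` (\<lambda>k. k \<otimes> l) ` K" by (simp add: image_image)
    also have "(\<lambda>k. k \<otimes> l) ` K = K"
    proof (intro equalityI subsetI)
      show "z \<in> K" if "z \<in> (\<lambda>k. k \<otimes> l) ` K" for z
        using that \<open>l \<in> K\<close> subgroup.m_closed[OF K(1)] by auto
      show "z \<in> (\<lambda>k. k \<otimes> l) ` K" if "z \<in> K" for z
        using that \<open>l \<in> K\<close> K(1)
        by (intro image_eqI[of _ _ "z \<otimes> inv l"]) (simp_all add: m_assoc subgroup.m_closed subgroup.m_inv_closed)
    qed
    finally show ?thesis by (simp add: orb_def)
  qed
  have fibre: "{y \<in> S. orb y = orb x} = orb x" if x: "x \<in> S" for x
  proof (intro equalityI subsetI)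
    show "y \<in> orb x" if "y \<in> {y \<in> S. orb y = orb x}" for y using that self by auto
    show "y \<in> {y \<in> S. orb y = orb x}" if y: "y \<in> orb x" for y
    proof -
      obtain k where "k \<in> K" "y = k \<otimes> x \<otimes> inv k" using y unfolding orb_def by blast
      then show ?thesis using S(2) x orb_eq by simp
    qed
  qed
  have "p ^ multiplicity p (card K) dvd sum f {y \<in> S. orb y = o'}" if "o' \<in> orb ` S" for o'
  proof -
    obtain x where x: "x \<in> S" "o' = orb x" using \<open>o' \<in> orb ` S\<close> by blast
    have "sum f {y \<in> S. orb y = o'} = (\<Sum>y\<in>orb x. f x)"
      unfolding x(2) fibre[OF x(1)] using f x(1) by (intro sum.cong refl) (auto simp: orb_def)
    then have s: "sum f {y \<in> S. orb y = o'} = card (orb x) * f x" by simp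
    have card: "card (orb x) * card (centralizer_in K x) = card K"
      unfolding orb_def by (rule card_conj_orbit[OF K SG[OF x(1)]])
    moreover have "card K > 0" using subgroup.one_closed[OF K(1)] K(2) by (auto simp: card_gt_0_iff)
    ultimately have "card (orb x) \<noteq> 0" "card (centralizer_in K x) \<noteq> 0" by (metis mult_is_0 not_gr_zero)+
    then have "multiplicity p (card K) = multiplicity p (card (orb x)) + multiplicity p (card (centralizer_in K x))"
      unfolding card[symmetric] using p by (intro prime_elem_multiplicity_mult_distrib) auto
    then show ?thesis unfolding s power_add using d[OF x(1)]
      by (simp only: power_add) (intro mult_dvd_mono multiplicity_dvd)
  qed
  then show ?thesis unfolding sum.image_gen[OF finS, of f orb] by (rule dvd_sum)
qed

section \<open>Elements of prime power order and Frobenius' theorem\<close>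

lemma p_elements_subset: "p_elements p K \<subseteq> K"
  by (auto simp: p_elements_def)

lemma conj_nat_pow':
  "k \<in> carrier G \<Longrightarrow> x \<in> carrier G \<Longrightarrow> (k \<otimes> x \<otimes> inv k) [^] (m::nat) = k \<otimes> x [^] m \<otimes> inv k"
  using conj_nat_pow[of "inv k" x m] by simp

lemma p_elements_conj_image:
  assumes "L \<subseteq> carrier G" "k \<in> carrier G"
  shows "p_elements p ((\<lambda>y. k \<otimes> y \<otimes> inv k) ` L) = (\<lambda>y. k \<otimes> y \<otimes> inv k) ` p_elements p L"
proof -
  have "k \<otimes> z \<otimes> inv k = \<one> \<longleftrightarrow> z = \<one>" if "z \<in> carrier G" for z
    using inj_on_eq_iff[OF conj_inj_on[OF assms(2)] that one_closed] assms(2) by simp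
  then have "(k \<otimes> y \<otimes> inv k) [^] (m::nat) = \<one> \<longleftrightarrow> y [^] m = \<one>" if "y \<in> L" for y m
    using that assms by (simp add: conj_nat_pow' subset_iff)
  then show ?thesis unfolding p_elements_def by auto
qed

text \<open>The order of such an element divides a power of \<open>p\<close> and the group order, so
  one exponent serves for all of them.\<close>

lemma p_elements_alt:
  assumes K: "subgroup K G" "finite K" and p: "prime p" and c: "card K = p ^ v * m" "\<not> p dvd m"
  shows "p_elements p K = {x \<in> K. x [^] (p ^ v) = \<one>}"
proof -
  have "x [^] (p ^ v) = \<one>" if x: "x \<in> K" "x [^] (p ^ k) = \<one>" for x k
  proof -
    have xG: "x \<in> carrier G" using subgroup.mem_carrier[OF K(1) x(1)] .
    have "ord x dvd p ^ k" "ord x dvd p ^ v * m"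
      using xG x(2) subgroup_pow_card[OF K x(1)] c(1) by (simp_all add: pow_eq_id)
    moreover have "coprime (p ^ k) m" using prime_imp_coprime[OF p c(2)] by simp
    ultimately have "ord x dvd p ^ v"
      by (meson coprime_divisors coprime_dvd_mult_left_iff dvd_refl)
    then show ?thesis using xG by (simp add: pow_eq_id)
  qed
  then show ?thesis unfolding p_elements_def by blast
qed

text \<open>Every element is in exactly one way a product of two commuting elements of
  \<open>K\<close>, one of \<open>p\<close>-power order and one annihilated by \<open>m\<close>. For
  a given second factor \<open>y\<close>, the first ranges over the elements of
  \<open>p\<close>-power order of the centralizer of \<open>y\<close>.\<close>

lemma card_eq_sum_p_elements:
  assumes K: "subgroup K G" "finite K" and p: "prime p" and c: "card K = p ^ v * m" "\<not> p dvd m"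
  shows "card K = (\<Sum>y\<in>{y \<in> K. y [^] m = \<one>}. card (p_elements p (centralizer_in K y)))"
proof -
  note [simp] = subgroup.mem_carrier[OF K(1)]
  let ?Q = "{y \<in> K. y [^] m = \<one>}" let ?P = "\<lambda>y. p_elements p (centralizer_in K y)"
  have cop: "coprime (p ^ v) m" using prime_imp_coprime[OF p c(2)] by simp
  \<comment> \<open>The exponents are idempotents modulo \<open>p ^ v * m\<close>: the
    \<open>e\<close>-th power extracts the factor of \<open>p\<close>-power order, the
    \<open>f\<close>-th power the other factor.\<close>
  obtain e where e: "[e = 1] (mod p ^ v)" "[e = 0] (mod m)" using binary_chinese_remainder_nat[OF cop] by blast
  obtain f where f: "[f = 0] (mod p ^ v)" "[f = 1] (mod m)" using binary_chinese_remainder_nat[OF cop] by blast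
  have pow: "x [^] a = x [^] b" if "x \<in> carrier G" "x [^] N = \<one>" "[a = b] (mod N)" for x and a b N :: nat
  proof -
    have "x [^] a = x [^] (a mod N)" for a
    proof -
      have "x [^] a = x [^] (N * (a div N) + a mod N)" by simp
      also have "\<dots> = (x [^] N) [^] (a div N) \<otimes> x [^] (a mod N)"
        using that(1) by (simp only: nat_pow_mult nat_pow_pow nat_pow_closed)
      also have "\<dots> = x [^] (a mod N)" using that(1,2) by simp
      finally show ?thesis .
    qed
    then show ?thesis using that(3) unfolding cong_def by metis
  qed
  have pc: "x [^] (p ^ v) = \<one>" if "x \<in> p_elements p K" for x
    using that unfolding p_elements_alt[OF K p c] by simp
  have PK: "?P y \<subseteq> p_elements p K" for y
    unfolding p_elements_def centralizer_in_def by blast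
  have "bij_betw (\<lambda>(y, x). x \<otimes> y) (SIGMA y:?Q. ?P y) K"
  proof (rule bij_betw_byWitness[where f' = "\<lambda>g. (g [^] f, g [^] e)"])
    show "\<forall>u\<in>(SIGMA y:?Q. ?P y). (\<lambda>g. (g [^] f, g [^] e)) ((\<lambda>(y, x). x \<otimes> y) u) = u"
    proof (rule ballI)
      fix u assume "u \<in> (SIGMA y:?Q. ?P y)"
      then obtain y x where u: "u = (y, x)" and y: "y \<in> K" "y [^] m = \<one>" and x: "x \<in> ?P y" by blast
      have xK: "x \<in> K" "x \<otimes> y = y \<otimes> x" using x by (auto simp: p_elements_def centralizer_in_def)
      have xp: "x [^] (p ^ v) = \<one>" using pc PK x by blast
      have "x [^] e = x" using pow[OF _ xp e(1)] xK by simp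
      moreover have "y [^] e = \<one>" using pow[OF _ y(2) e(2)] y by simp
      moreover have "x [^] f = \<one>" using pow[OF _ xp f(1)] xK by simp
      moreover have "y [^] f = y" using pow[OF _ y(2) f(2)] y by simp
      ultimately show "(\<lambda>g. (g [^] f, g [^] e)) ((\<lambda>(y, x). x \<otimes> y) u) = u"
        using xK(1) y(1) pow_mult_distrib[OF xK(2), of e] pow_mult_distrib[OF xK(2), of f] by (simp add: u)
    qed
    show "\<forall>g\<in>K. (\<lambda>(y, x). x \<otimes> y) (g [^] f, g [^] e) = g"
    proof (rule ballI)
      fix g assume g: "g \<in> K"
      have "[e + f = 1] (mod p ^ v)" "[e + f = 1] (mod m)" using cong_add[OF e(1) f(1)] cong_add[OF e(2) f(2)] by simp_all
      then have "[e + f = 1] (mod p ^ v * m)" using cop coprime_cong_mult_nat by blast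
      then have "g [^] (e + f) = g [^] (1::nat)" using pow[of g "p ^ v * m"] subgroup_pow_card[OF K g] c(1) g by simp
      then show "(\<lambda>(y, x). x \<otimes> y) (g [^] f, g [^] e) = g" using g by (simp add: nat_pow_mult)
    qed
    show "(\<lambda>(y, x). x \<otimes> y) ` (SIGMA y:?Q. ?P y) \<subseteq> K"
      using subgroup.m_closed[OF K(1)] by (auto simp: p_elements_def centralizer_in_def)
    show "(\<lambda>g. (g [^] f, g [^] e)) ` K \<subseteq> (SIGMA y:?Q. ?P y)"
    proof (intro image_subsetI)
      fix g assume g: "g \<in> K"
      have gG: "g \<in> carrier G" using g by simp
      have pw: "g [^] (a::nat) \<in> K" for a
        using subgroup.one_closed[OF K(1)] subgroup.m_closed[OF K(1)] g by (induction a) auto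
      have one: "g [^] (p ^ v * m) = \<one>" using subgroup_pow_card[OF K g] c(1) by simp
      have "[f * m = 0 * m] (mod (p ^ v * m))" using f(1) cong_cmult_rightI by (auto simp: cong_0_iff intro: mult_dvd_mono)
      then have "(g [^] f) [^] m = \<one>" using pow[OF gG one, of "f * m" 0] gG by (simp add: nat_pow_pow)
      moreover have "[e * p ^ v = 0] (mod (p ^ v * m))" using e(2) by (simp add: cong_0_iff mult.commute[of e] mult_dvd_mono)
      then have "(g [^] e) [^] (p ^ v) = \<one>" using pow[OF gG one, of "e * p ^ v" 0] gG by (simp add: nat_pow_pow)
      moreover have "g [^] e \<otimes> g [^] f = g [^] f \<otimes> g [^] e" using gG by (simp add: nat_pow_mult add.commute)
      ultimately show "(g [^] f, g [^] e) \<in> (SIGMA y:?Q. ?P y)"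
        using pw by (auto simp: p_elements_def centralizer_in_def)
    qed
  qed
  then have "card K = card (SIGMA y:?Q. ?P y)" by (simp add: bij_betw_same_card)
  also have "\<dots> = (\<Sum>y\<in>?Q. card (?P y))"
    using K(2) by (intro card_SigmaI ballI) (auto intro: finite_subset[OF _ K(2)] simp: p_elements_def centralizer_in_def)
  finally show ?thesis .
qed

lemma p_elements_card_conj:
  assumes K: "subgroup K G" and k: "k \<in> K" and x: "x \<in> K"
  shows "card (p_elements p (centralizer_in K (k \<otimes> x \<otimes> inv k))) = card (p_elements p (centralizer_in K x))"
proof -
  note [simp] = subgroup.mem_carrier[OF K]
  have sub: "centralizer_in K x \<subseteq> carrier G" by (auto simp: centralizer_in_def)
  have "p_elements p (centralizer_in K (k \<otimes> x \<otimes> inv k)) = (\<lambda>y. k \<otimes> y \<otimes> inv k) ` p_elements p (centralizer_in K x)"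
    using k x p_elements_conj_image[OF sub] by (simp add: centralizer_in_conj[OF K])
  moreover have "inj_on (\<lambda>y. k \<otimes> y \<otimes> inv k) (p_elements p (centralizer_in K x))"
    using k sub p_elements_subset by (intro inj_on_subset[OF conj_inj_on]) auto
  ultimately show ?thesis by (simp add: card_image)
qed

text \<open>Frobenius' theorem for the \<open>p\<close>-part of the group order. By induction, the elements \<open>y\<close> that are not central
  contribute multiples of the \<open>p\<close>-part to the sum above, and the number of the central ones is prime to \<open>p\<close>.\<close>

lemma p_part_dvd_card_p_elements:
  assumes "subgroup K G" "finite K" and p: "prime p"
  shows "p ^ multiplicity p (card K) dvd card (p_elements p K)"
  using assms(1,2)
proof (induction "card K" arbitrary: K rule: less_induct)
  case less
  note K = less.prems
  note [simp] = subgroup.mem_carrier[OF K(1)]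
  have c0: "card K > 0" using subgroup.one_closed[OF K(1)] K(2) by (auto simp: card_gt_0_iff)
  have "\<not> is_unit p" using not_prime_unit[of p] p by blast
  then obtain m where m: "card K = p ^ multiplicity p (card K) * m" "\<not> p dvd m"
    using multiplicity_decompose'[of "card K" p] c0 by auto
  let ?d = "p ^ multiplicity p (card K)"
  define Q where "Q = {y \<in> K. y [^] m = \<one>}"
  define Z where "Z = {y \<in> Q. centralizer_in K y = K}"
  let ?f = "\<lambda>y. card (p_elements p (centralizer_in K y))"
  have finQ: "finite Q" using K(2) by (simp add: Q_def)
  have "card K = sum ?f Q" unfolding Q_def by (rule card_eq_sum_p_elements[OF K p m])
  also have "\<dots> = sum ?f (Q - Z) + sum ?f Z"
    using finQ by (intro sum.subset_diff) (auto simp: Z_def)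
  also have "sum ?f Z = card Z * card (p_elements p K)" by (simp add: Z_def)
  finally have sum: "card K = sum ?f (Q - Z) + card Z * card (p_elements p K)" .
  have pw: "(k \<otimes> x \<otimes> inv k) [^] m = \<one>" if "k \<in> K" "x \<in> K" "x [^] m = \<one>" for k x
    using that by (simp add: conj_nat_pow')
  have Qconj: "k \<otimes> x \<otimes> inv k \<in> Q" if "k \<in> K" "x \<in> Q" for k x
    using that pw conj_in_subgroup[OF K(1)] by (simp add: Q_def)
  \<comment> \<open>A conjugate of \<open>x\<close> that is central in \<open>K\<close> equals
    \<open>x\<close>; hence \<open>Q - Z\<close> is closed under conjugation, as
    \<open>class_sum_dvd\<close> demands.\<close>
  have Zconj: "x \<in> Z" if "k \<in> K" "x \<in> Q" "k \<otimes> x \<otimes> inv k \<in> Z" for k x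
  proof -
    have xK: "x \<in> K" using that(2) by (simp add: Q_def)
    have "k \<in> centralizer_in K (k \<otimes> x \<otimes> inv k)" using that by (simp add: Z_def)
    then have "k \<otimes> (k \<otimes> x \<otimes> inv k) = (k \<otimes> x \<otimes> inv k) \<otimes> k" by (simp add: centralizer_in_def)
    also have "\<dots> = k \<otimes> x" using that(1) xK by (simp add: m_assoc)
    finally have "k \<otimes> x \<otimes> inv k = x" using that(1) xK by simp
    then show ?thesis using that(3) by simp
  qed
  have "?d dvd sum ?f (Q - Z)"
  proof (rule class_sum_dvd[OF K p])
    show "Q - Z \<subseteq> K" by (auto simp: Q_def)
    show "k \<otimes> x \<otimes> inv k \<in> Q - Z" if "k \<in> K" "x \<in> Q - Z" for k x
      using that Qconj Zconj by blast
    show "?f (k \<otimes> x \<otimes> inv k) = ?f x" if "k \<in> K" "x \<in> Q - Z" for k x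
      using that by (intro p_elements_card_conj[OF K(1)]) (auto simp: Q_def)
    show "p ^ multiplicity p (card (centralizer_in K x)) dvd ?f x" if x: "x \<in> Q - Z" for x
    proof (rule less.hyps)
      have "centralizer_in K x \<subset> K" using x centralizer_in_subset by (auto simp: Z_def)
      then show "card (centralizer_in K x) < card K" by (rule psubset_card_mono[OF K(2)])
      show "subgroup (centralizer_in K x) G" using x by (intro subgroup_centralizer_in[OF K(1)]) (auto simp: Q_def)
      show "finite (centralizer_in K x)" using K(2) by (simp add: centralizer_in_def)
    qed
  qed
  moreover have "?d dvd card K" by (rule multiplicity_dvd)
  ultimately have "?d dvd card Z * card (p_elements p K)" using sum by (metis dvd_add_right_iff)
  moreover have "coprime ?d (card Z)"
  proof -
    have Zsub: "subgroup Z G"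
    proof (rule subgroupI)
      have Zi: "y \<in> Z \<longleftrightarrow> y \<in> K \<and> y [^] m = \<one> \<and> (\<forall>k\<in>K. k \<otimes> y = y \<otimes> k)" for y
        by (auto simp: Z_def Q_def centralizer_in_def)
      show "Z \<subseteq> carrier G" by (auto simp: Zi)
      have "\<one> \<in> Z" using subgroup.one_closed[OF K(1)] by (simp add: Zi)
      then show "Z \<noteq> {}" by blast
      fix a assume "a \<in> Z"
      then have a: "a \<in> K" "a [^] m = \<one>" and ac: "k \<otimes> a = a \<otimes> k" if "k \<in> K" for k using that by (auto simp: Zi)
      have aK: "a \<in> K" "a [^] m = \<one>" using a[OF subgroup.one_closed[OF K(1)]] by blast+
      have aG: "a \<in> carrier G" using aK(1) by simp
      have "k \<otimes> inv a = inv a \<otimes> k" if k: "k \<in> K" for k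
      proof -
        have kG: "k \<in> carrier G" using k by simp
        have "k \<otimes> inv a = inv a \<otimes> (a \<otimes> k) \<otimes> inv a" using aG kG by (simp flip: m_assoc)
        also have "\<dots> = inv a \<otimes> (k \<otimes> a) \<otimes> inv a" by (simp only: ac[OF k])
        also have "\<dots> = inv a \<otimes> k" using aG kG by (simp add: m_assoc)
        finally show ?thesis .
      qed
      then show "inv a \<in> Z" using aK aG subgroup.m_inv_closed[OF K(1)] by (simp add: Zi nat_pow_inv)
      fix b assume "b \<in> Z"
      then have b: "b \<in> K" "b [^] m = \<one>" and bc: "k \<otimes> b = b \<otimes> k" if "k \<in> K" for k using that by (auto simp: Zi)
      have bK: "b \<in> K" "b [^] m = \<one>" using b[OF subgroup.one_closed[OF K(1)]] by blast+
      have bG: "b \<in> carrier G" using bK(1) by simp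
      have "(a \<otimes> b) [^] m = \<one>" using pow_mult_distrib[OF bc[OF aK(1)] aG bG] aK(2) bK(2) by simp
      moreover have "k \<otimes> (a \<otimes> b) = (a \<otimes> b) \<otimes> k" if k: "k \<in> K" for k
      proof -
        have kG: "k \<in> carrier G" using k by simp
        have "k \<otimes> (a \<otimes> b) = (k \<otimes> a) \<otimes> b" using aG bG kG by (simp add: m_assoc)
        also have "\<dots> = (a \<otimes> k) \<otimes> b" by (simp only: ac[OF k])
        also have "\<dots> = a \<otimes> (k \<otimes> b)" using aG bG kG by (simp add: m_assoc)
        also have "\<dots> = a \<otimes> (b \<otimes> k)" by (simp only: bc[OF k])
        also have "\<dots> = (a \<otimes> b) \<otimes> k" using aG bG kG by (simp add: m_assoc)
        finally show ?thesis .
      qed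
      ultimately show "a \<otimes> b \<in> Z" using aK(1) bK(1) subgroup.m_closed[OF K(1)] by (simp add: Zi)
    qed
    have finZ: "finite Z" using finQ by (simp add: Z_def)
    \<comment> \<open>An element of order \<open>p\<close> in \<open>Z\<close> would also be
      annihilated by \<open>m\<close>, which is prime to \<open>p\<close>.\<close>
    have "\<not> p dvd card Z"
    proof
      assume "p dvd card Z"
      then obtain x where x: "x \<in> Z" "x \<noteq> \<one>" "x [^] p = \<one>"
        by (rule prime_dvd_card_imp_element[OF Zsub finZ p])
      have "x [^] m = \<one>" using x(1) by (simp add: Z_def Q_def)
      moreover have "coprime p m" by (rule prime_imp_coprime[OF p m(2)])
      ultimately have "x = \<one>" using coprime_pow_eq_one[OF subgroup.mem_carrier[OF Zsub x(1)] x(3)] by blast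
      then show False using x(2) by contradiction
    qed
    then have "coprime p (card Z)" by (rule prime_imp_coprime[OF p])
    then show ?thesis by simp
  qed
  ultimately show ?case by (simp add: coprime_dvd_mult_right_iff)
qed

section \<open>Commuting tuples and the subgroups they generate\<close>

definition commuting_tuples :: "nat \<Rightarrow> nat \<Rightarrow> 'a set \<Rightarrow> 'a list set"
  where "commuting_tuples p n K = {xs. length xs = n \<and> set xs \<subseteq> p_elements p K \<and>
    (\<forall>x\<in>set xs. \<forall>y\<in>set xs. x \<otimes> y = y \<otimes> x)}"

lemma finite_commuting_tuples:
  assumes "finite K" shows "finite (commuting_tuples p n K)"
  by (rule finite_subset[OF _ finite_lists_length_eq[OF assms, of n]])
    (auto simp: commuting_tuples_def p_elements_def)

lemma commuting_tuples_Suc: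
  "commuting_tuples p (Suc n) K = (\<Union>x\<in>p_elements p K. (#) x ` commuting_tuples p n (centralizer_in K x))"
proof (intro equalityI subsetI)
  fix xs assume xs: "xs \<in> commuting_tuples p (Suc n) K"
  then obtain x ys where e: "xs = x # ys" by (auto simp: commuting_tuples_def length_Suc_conv)
  have "x \<in> p_elements p K" "ys \<in> commuting_tuples p n (centralizer_in K x)"
    using xs by (auto simp: e commuting_tuples_def p_elements_def centralizer_in_def)
  then show "xs \<in> (\<Union>x\<in>p_elements p K. (#) x ` commuting_tuples p n (centralizer_in K x))" using e by blast
qed (auto simp: commuting_tuples_def p_elements_def centralizer_in_def subset_iff)

lemma commuting_tuples_conj_image:
  assumes L: "L \<subseteq> carrier G" and k: "k \<in> carrier G"
  shows "commuting_tuples p n ((\<lambda>y. k \<otimes> y \<otimes> inv k) ` L) = map (\<lambda>y. k \<otimes> y \<otimes> inv k) ` commuting_tuples p n L"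
proof (intro equalityI subsetI)
  let ?c = "\<lambda>y. k \<otimes> y \<otimes> inv k"
  have PL: "p_elements p L \<subseteq> carrier G" using L p_elements_subset by blast
  fix xs assume xs: "xs \<in> commuting_tuples p n (?c ` L)"
  then have "set xs \<subseteq> ?c ` p_elements p L"
    unfolding commuting_tuples_def p_elements_conj_image[OF L k] by blast
  then have "xs \<in> lists (?c ` p_elements p L)" by auto
  then obtain ys where ys: "set ys \<subseteq> p_elements p L" "xs = map ?c ys"
    unfolding lists_image by auto
  have "ys \<in> commuting_tuples p n L" using xs ys(1) conj_commute_iff[OF k] PL
    by (auto simp: ys(2) commuting_tuples_def subset_iff)
  then show "xs \<in> map ?c ` commuting_tuples p n L" using ys(2) by blast
next
  let ?c = "\<lambda>y. k \<otimes> y \<otimes> inv k"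
  have PL: "p_elements p L \<subseteq> carrier G" using L p_elements_subset by blast
  fix xs assume "xs \<in> map ?c ` commuting_tuples p n L"
  then obtain ys where ys: "ys \<in> commuting_tuples p n L" "xs = map ?c ys" by blast
  then show "xs \<in> commuting_tuples p n (?c ` L)"
    using conj_commute_iff[OF k] PL unfolding commuting_tuples_def p_elements_conj_image[OF L k]
    by (auto simp: subset_iff)
qed

text \<open>Once the first entry is fixed, the others range over its centralizer, and
  \<open>class_sum_dvd\<close> lifts the divisibility from there. Frobenius' theorem is the case of
  length 1, where the induction has to start.\<close>

lemma p_part_dvd_card_commuting_tuples:
  assumes "subgroup K G" "finite K" and p: "prime p" and "n \<ge> 1"
  shows "p ^ multiplicity p (card K) dvd card (commuting_tuples p n K)"
  using assms(4,1,2)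
proof (induction n arbitrary: K rule: dec_induct)
  case base
  have "commuting_tuples p 1 K = (\<lambda>x. [x]) ` p_elements p K"
    by (auto simp: commuting_tuples_def length_Suc_conv)
  then have "card (commuting_tuples p 1 K) = card (p_elements p K)" by (simp add: card_image inj_on_def)
  then show ?case using p_part_dvd_card_p_elements[OF base p] by simp
next
  case (step n)
  note K = step.prems
  note [simp] = subgroup.mem_carrier[OF K(1)]
  let ?f = "\<lambda>x. card (commuting_tuples p n (centralizer_in K x))"
  have fc: "finite (centralizer_in K x)" for x using K(2) by (simp add: centralizer_in_def)
  have "card (commuting_tuples p (Suc n) K) = (\<Sum>x\<in>p_elements p K. card ((#) x ` commuting_tuples p n (centralizer_in K x)))"
    unfolding commuting_tuples_Suc
  proof (rule card_UN_disjoint)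
    show "finite (p_elements p K)" using K(2) by (simp add: p_elements_def)
    show "\<forall>x\<in>p_elements p K. finite ((#) x ` commuting_tuples p n (centralizer_in K x))"
      using fc finite_commuting_tuples by blast
  qed auto
  also have "\<dots> = sum ?f (p_elements p K)" by (simp add: card_image)
  finally have eq: "card (commuting_tuples p (Suc n) K) = sum ?f (p_elements p K)" .
  show ?case unfolding eq
  proof (rule class_sum_dvd[OF K p])
    show "p_elements p K \<subseteq> K" by (rule p_elements_subset)
    fix x assume x: "x \<in> p_elements p K"
    have xK: "x \<in> K" using x p_elements_subset by blast
    have sub: "centralizer_in K x \<subseteq> carrier G" by (auto simp: centralizer_in_def)
    show "p ^ multiplicity p (card (centralizer_in K x)) dvd ?f x"
      using xK fc by (intro step.IH subgroup_centralizer_in K(1)) auto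
    fix k assume k: "k \<in> K"
    obtain j :: nat where "x [^] (p ^ j) = \<one>" using x by (auto simp: p_elements_def)
    then have "(k \<otimes> x \<otimes> inv k) [^] (p ^ j) = \<one>" using k xK by (simp add: conj_nat_pow')
    then show "k \<otimes> x \<otimes> inv k \<in> p_elements p K"
      using conj_in_subgroup[OF K(1) k xK] by (auto simp: p_elements_def)
    have "inj_on (map (\<lambda>y. k \<otimes> y \<otimes> inv k)) (commuting_tuples p n (centralizer_in K x))"
      using inj_on_subset[OF conj_inj_on[of k]] k sub
      by (intro inj_on_mapI inj_on_subset[OF conj_inj_on]) (auto simp: commuting_tuples_def p_elements_def)
    then show "?f (k \<otimes> x \<otimes> inv k) = ?f x"
      using k xK by (simp add: centralizer_in_conj[OF K(1)] commuting_tuples_conj_image[OF sub] card_image)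
  qed
qed

definition generating_tuples :: "nat \<Rightarrow> 'a set \<Rightarrow> 'a list set"
  where "generating_tuples n H = {xs. length xs = n \<and> set xs \<subseteq> H \<and> generate G (set xs) = H}"

text \<open>A centralizer is a subgroup, so an element that commutes with the generators commutes
  with all they generate. This is used once for each argument.\<close>

lemma generate_commute:
  assumes S: "S \<subseteq> carrier G" and comm: "\<And>x y. x \<in> S \<Longrightarrow> y \<in> S \<Longrightarrow> x \<otimes> y = y \<otimes> x"
    and "x \<in> generate G S" "y \<in> generate G S"
  shows "x \<otimes> y = y \<otimes> x"
proof -
  have step: "x \<otimes> y = y \<otimes> x"
    if y: "y \<in> carrier G" "\<And>s. s \<in> S \<Longrightarrow> s \<otimes> y = y \<otimes> s" and x: "x \<in> generate G S" for x y
  proof -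
    have "S \<subseteq> centralizer_in (carrier G) y" using S y by (auto simp: centralizer_in_def)
    then have "generate G S \<subseteq> centralizer_in (carrier G) y"
      using subgroup_centralizer_in[OF subgroup_self y(1)] by (rule generate_subgroup_incl)
    then show ?thesis using x by (auto simp: centralizer_in_def)
  qed
  have xG: "x \<in> carrier G" "y \<in> carrier G" using generate_in_carrier[OF S] assms by auto
  show ?thesis
  proof (rule step[OF xG(2) _ assms(3)])
    fix s assume s: "s \<in> S"
    show "s \<otimes> y = y \<otimes> s" using step[of s y] comm s S assms(4) by (metis subsetD)
  qed
qed

lemma generate_p_elements:
  assumes S: "S \<subseteq> p_elements p (carrier G)" and comm: "\<And>x y. x \<in> S \<Longrightarrow> y \<in> S \<Longrightarrow> x \<otimes> y = y \<otimes> x"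
  shows "generate G S \<subseteq> p_elements p (carrier G)"
proof
  have SG: "S \<subseteq> carrier G" using S p_elements_subset by blast
  fix x assume "x \<in> generate G S"
  then have "x \<in> generate G S \<and> (\<exists>k::nat. x [^] (p ^ k) = \<one>)"
  proof (induction rule: generate.induct)
    case one then show ?case by (auto intro: generate.one)
  next
    case (incl h) then show ?case using S by (auto simp: p_elements_def intro: generate.incl)
  next
    case (inv h)
    then obtain k :: nat where "h [^] (p ^ k) = \<one>" using S by (auto simp: p_elements_def)
    then have "inv h [^] (p ^ k) = \<one>" using inv SG by (simp add: nat_pow_inv subset_iff)
    then show ?case using inv by (auto intro: generate.inv)
  next
    case (eng h1 h2)
    obtain k l :: nat where kl: "h1 [^] (p ^ k) = \<one>" "h2 [^] (p ^ l) = \<one>" using eng by blast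
    have hG: "h1 \<in> carrier G" "h2 \<in> carrier G" using generate_in_carrier[OF SG] eng by auto
    have c: "h1 \<otimes> h2 = h2 \<otimes> h1" using generate_commute[OF SG comm] eng by blast
    have "(h1 \<otimes> h2) [^] (p ^ k * p ^ l) = (h1 [^] (p ^ k)) [^] (p ^ l) \<otimes> (h2 [^] (p ^ l)) [^] (p ^ k)"
      using hG by (simp add: pow_mult_distrib[OF c hG] nat_pow_pow mult.commute)
    then have "(h1 \<otimes> h2) [^] (p ^ (k + l)) = \<one>" by (simp add: kl power_add)
    then show ?case using eng by (auto intro: generate.eng)
  qed
  then show "x \<in> p_elements p (carrier G)" using generate_in_carrier[OF SG] by (auto simp: p_elements_def)
qed

text \<open>Tuples are sorted by the subgroup they generate. This is an abelian
  \<open>p\<close>-group inside \<open>K\<close>, and its number of generators is bounded by the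
  length of the tuple, which is where the bound \<open>n\<close> in the sum comes from.\<close>

lemma commuting_tuples_eq_generating_tuples:
  assumes K: "subgroup K G" "finite K" and p: "prime p"
  shows "commuting_tuples p n K = (\<Union>H\<in>{H \<in> abelian_p_subgroups G p n. H \<subseteq> K}. generating_tuples n H)"
proof (intro equalityI subsetI)
  fix xs assume xs: "xs \<in> commuting_tuples p n K"
  define H where "H = generate G (set xs)"
  have S: "set xs \<subseteq> p_elements p (carrier G)" "set xs \<subseteq> K" "set xs \<subseteq> carrier G"
    using xs subgroup.subset[OF K(1)] by (auto simp: commuting_tuples_def p_elements_def)
  have comm: "x \<otimes> y = y \<otimes> x" if "x \<in> set xs" "y \<in> set xs" for x y
    using xs that by (simp add: commuting_tuples_def)
  have H: "subgroup H G" unfolding H_def by (rule generate_is_subgroup[OF S(3)])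
  have HK: "H \<subseteq> K" unfolding H_def by (rule generate_subgroup_incl[OF S(2) K(1)])
  have finH: "finite H" using finite_subset[OF HK K(2)] .
  have "p_elements p H = H"
    using generate_p_elements[OF S(1) comm] unfolding H_def p_elements_def by blast
  then obtain k where k: "card H = p ^ k" by (rule card_p_group[OF H finH p])
  have "comm_group (G\<lparr>carrier := H\<rparr>)"
  proof (rule group.group_comm_groupI[OF subgroup_imp_group[OF H]])
    show "x \<otimes>\<^bsub>G\<lparr>carrier := H\<rparr>\<^esub> y = y \<otimes>\<^bsub>G\<lparr>carrier := H\<rparr>\<^esub> x"
      if "x \<in> carrier (G\<lparr>carrier := H\<rparr>)" "y \<in> carrier (G\<lparr>carrier := H\<rparr>)" for x y
      using that generate_commute[OF S(3) comm] by (simp add: H_def)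
  qed
  have xsH: "set xs \<subseteq> H" unfolding H_def by (auto intro: generate.incl)
  moreover have "generate (G\<lparr>carrier := H\<rparr>) (set xs) = H"
    using generate_consistent[OF xsH H] by (simp add: H_def)
  moreover have "card (set xs) \<le> n" using card_length[of xs] xs by (simp add: commuting_tuples_def)
  ultimately have "generated_by_at_most n (G\<lparr>carrier := H\<rparr>)"
    unfolding generated_by_at_most_def by (intro exI[of _ "set xs"]) simp
  then have "H \<in> abelian_p_subgroups G p n"
    using H finH k \<open>comm_group (G\<lparr>carrier := H\<rparr>)\<close> by (auto simp: abelian_p_subgroups_def)
  moreover have "xs \<in> generating_tuples n H"
    using xs xsH by (simp add: generating_tuples_def commuting_tuples_def H_def)
  ultimately show "xs \<in> (\<Union>H\<in>{H \<in> abelian_p_subgroups G p n. H \<subseteq> K}. generating_tuples n H)"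
    using HK by blast
next
  fix xs assume "xs \<in> (\<Union>H\<in>{H \<in> abelian_p_subgroups G p n. H \<subseteq> K}. generating_tuples n H)"
  then obtain H where H: "subgroup H G" "finite H" "comm_group (G\<lparr>carrier := H\<rparr>)" "H \<subseteq> K"
    and k: "\<exists>k. card H = p ^ k" and xs: "length xs = n" "set xs \<subseteq> H"
    by (auto simp: abelian_p_subgroups_def generating_tuples_def)
  obtain k where k: "card H = p ^ k" using k by blast
  have "x [^] (p ^ k) = \<one>" if "x \<in> H" for x using subgroup_pow_card[OF H(1,2) that] k by simp
  then have "set xs \<subseteq> p_elements p K" using xs(2) H(4) by (auto simp: p_elements_def)
  moreover have "x \<otimes> y = y \<otimes> x" if "x \<in> H" "y \<in> H" for x y
    using comm_groupE(4)[OF H(3), of x y] that by simp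
  ultimately show "xs \<in> commuting_tuples p n K" using xs by (auto simp: commuting_tuples_def)
qed

lemma card_commuting_tuples:
  assumes K: "subgroup K G" "finite K" and p: "prime p"
  shows "card (commuting_tuples p n K) = (\<Sum>H\<in>{H \<in> abelian_p_subgroups G p n. H \<subseteq> K}. card (generating_tuples n H))"
  unfolding commuting_tuples_eq_generating_tuples[OF assms]
proof (rule card_UN_disjoint)
  show "finite {H \<in> abelian_p_subgroups G p n. H \<subseteq> K}"
    by (rule finite_subset[of _ "Pow K"]) (use K(2) in auto)
  show "\<forall>H\<in>{H \<in> abelian_p_subgroups G p n. H \<subseteq> K}. finite (generating_tuples n H)"
  proof
    fix H assume "H \<in> {H \<in> abelian_p_subgroups G p n. H \<subseteq> K}"
    then have "finite H" by (simp add: abelian_p_subgroups_def)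
    then show "finite (generating_tuples n H)"
      by (intro finite_subset[OF _ finite_lists_length_eq[of H n]]) (auto simp: generating_tuples_def)
  qed
qed (auto simp: generating_tuples_def)

end

section \<open>Counting generating tuples\<close>

lemma p_binomial_0: "p_binomial p r 0 = 1"
  by (simp add: p_binomial_def)

text \<open>The factor of the numerator with \<open>j = r\<close> is
  \<open>p ^ 0 - 1\<close>.\<close>

lemma p_binomial_eq_0: "p_binomial p r (Suc r) = 0"
  by (simp add: p_binomial_def)

text \<open>With \<open>N\<close> the numerator, this is
  \<open>p^(r+1) - 1 = (p^(r-i) - 1) + p^(r-i) (p^(i+1) - 1)\<close>, multiplied by
  \<open>N r i\<close> and divided by \<open>N (i+1) (i+1)\<close>.\<close>

lemma p_binomial_Pascal:
  assumes p: "prime p" and i: "i \<le> r"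
  shows "p_binomial p (Suc r) (Suc i) = p_binomial p r (Suc i) + of_nat p ^ (r - i) * p_binomial p r i"
proof -
  let ?P = "of_nat p :: rat"
  define N where "N = (\<lambda>r i. \<Prod>j<i. ?P ^ (r - j) - 1)"
  have P: "1 < ?P" using prime_gt_1_nat[OF p] by simp
  have N1: "N r (Suc i) = N r i * (?P ^ (r - i) - 1)" by (simp add: N_def)
  have N2: "N (Suc r) (Suc i) = (?P ^ Suc r - 1) * N r i" for r i
    unfolding N_def by (subst prod.lessThan_Suc_shift) simp
  have "?P ^ (k - j) \<noteq> 1" if "j < k" for k j using one_less_power[OF P, of "k - j"] that by simp
  then have D: "N k k \<noteq> 0" for k by (simp add: N_def)
  have i1: "?P ^ Suc i - 1 \<noteq> 0" using one_less_power[OF P, of "Suc i"] by simp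
  have pw: "?P ^ (r - i) * ?P ^ Suc i = ?P ^ Suc r" using i by (simp flip: power_add)
  have "N (Suc r) (Suc i) = N r (Suc i) + ?P ^ (r - i) * N r i * (?P ^ Suc i - 1)"
    unfolding N1 N2 pw[symmetric] by (simp add: algebra_simps)
  moreover have "N r (Suc i) + ?P ^ (r - i) * N r i * (?P ^ Suc i - 1) =
      N r (Suc i) + ?P ^ (r - i) * (N r i / N i i) * N (Suc i) (Suc i)"
    using D[of i] by (simp add: N2)
  ultimately have "N (Suc r) (Suc i) / N (Suc i) (Suc i) = N r (Suc i) / N (Suc i) (Suc i) + ?P ^ (r - i) * (N r i / N i i)"
    using D[of "Suc i"] by (simp add: field_simps)
  then show ?thesis by (simp only: p_binomial_def N_def)
qed

text \<open>The \<open>q\<close>-binomial theorem for \<open>q = p\<close>. At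
  \<open>X = p ^ n\<close> the product is the number of linear surjections from dimension
  \<open>n\<close> to dimension \<open>r\<close> over the field with \<open>p\<close> elements, and
  the sum is the factor that appears in the theorem.\<close>

lemma prod_diff_power_eq:
  assumes p: "prime p"
  shows "(\<Prod>j<r. X - of_nat p ^ j) = (\<Sum>i\<le>r. (-1) ^ i * of_nat p ^ (i choose 2) * p_binomial p r i * X ^ (r - i))"
proof (induction r)
  case 0
  show ?case by (simp add: p_binomial_0 binomial_eq_0)
next
  case (Suc r)
  let ?P = "of_nat p :: rat"
  let ?a = "\<lambda>r i. (-1) ^ i * ?P ^ (i choose 2) * p_binomial p r i"
  \<comment> \<open>The exponents \<open>(k+1 choose 2) + (r - k)\<close> and
    \<open>(k choose 2) + r\<close> agree. This turns Pascal's rule into the effect of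
    multiplication by \<open>X - p ^ r\<close>.\<close>
  have step: "?a (Suc r) (Suc k) * X ^ (Suc r - Suc k) = ?a r (Suc k) * X ^ (r - k) - ?P ^ r * (?a r k * X ^ (r - k))"
    if k: "k \<le> r" for k
  proof -
    have "Suc k choose 2 = (k choose 2) + k" by (simp add: numeral_2_eq_2)
    then have "?P ^ (Suc k choose 2) * ?P ^ (r - k) = ?P ^ (k choose 2) * ?P ^ r"
      using k by (simp flip: power_add)
    then have "(-1) ^ Suc k * (?P ^ (Suc k choose 2) * ?P ^ (r - k)) * p_binomial p r k =
        - (?P ^ r * ((-1) ^ k * ?P ^ (k choose 2) * p_binomial p r k))" by simp
    then have "?a (Suc r) (Suc k) = ?a r (Suc k) - ?P ^ r * ?a r k"
      unfolding p_binomial_Pascal[OF p k] by (simp only: distrib_left mult.assoc)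
    then show ?thesis by (simp only: diff_Suc_Suc left_diff_distrib mult.assoc)
  qed
  \<comment> \<open>The term \<open>k = r\<close> vanishes; in the others a factor \<open>X\<close>
    can be split off.\<close>
  have shift: "X ^ Suc r + (\<Sum>k\<le>r. ?a r (Suc k) * X ^ (r - k)) = X * (\<Sum>i\<le>r. ?a r i * X ^ (r - i))"
  proof -
    have "(\<Sum>k\<le>r. ?a r (Suc k) * X ^ (r - k)) = (\<Sum>k<r. ?a r (Suc k) * X ^ (r - k))"
      by (simp add: lessThan_Suc_atMost[symmetric] p_binomial_eq_0)
    also have "\<dots> = (\<Sum>k<r. X * (?a r (Suc k) * X ^ (r - Suc k)))"
    proof (intro sum.cong refl)
      fix k assume "k \<in> {..<r}"
      then have "r - k = Suc (r - Suc k)" by simp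
      then have "X ^ (r - k) = X * X ^ (r - Suc k)" by simp
      then show "?a r (Suc k) * X ^ (r - k) = X * (?a r (Suc k) * X ^ (r - Suc k))" by simp
    qed
    finally have "X ^ Suc r + (\<Sum>k\<le>r. ?a r (Suc k) * X ^ (r - k)) =
        X * (?a r 0 * X ^ (r - 0) + (\<Sum>k<r. ?a r (Suc k) * X ^ (r - Suc k)))"
      by (simp add: distrib_left sum_distrib_left p_binomial_0 binomial_eq_0)
    also have "?a r 0 * X ^ (r - 0) + (\<Sum>k<r. ?a r (Suc k) * X ^ (r - Suc k)) = (\<Sum>i\<le>r. ?a r i * X ^ (r - i))"
      unfolding lessThan_Suc_atMost[symmetric] sum.lessThan_Suc_shift by simp
    finally show ?thesis .
  qed
  have "(\<Sum>i\<le>Suc r. ?a (Suc r) i * X ^ (Suc r - i)) =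
      ?a (Suc r) 0 * X ^ (Suc r - 0) + (\<Sum>k\<le>r. ?a (Suc r) (Suc k) * X ^ (Suc r - Suc k))"
    by (rule sum.atMost_Suc_shift)
  also have "\<dots> = X ^ Suc r + ((\<Sum>k\<le>r. ?a r (Suc k) * X ^ (r - k)) - ?P ^ r * (\<Sum>k\<le>r. ?a r k * X ^ (r - k)))"
    unfolding sum_distrib_left sum_subtractf[symmetric]
    using step by (intro arg_cong2[of _ _ _ _ "(+)"] sum.cong refl) (simp_all add: p_binomial_0 binomial_eq_0)
  also have "\<dots> = X * (\<Sum>i\<le>r. ?a r i * X ^ (r - i)) - ?P ^ r * (\<Sum>i\<le>r. ?a r i * X ^ (r - i))"
    unfolding shift[symmetric] by simp
  also have "\<dots> = (\<Prod>j<Suc r. X - ?P ^ j)" unfolding Suc.IH[symmetric] by (simp add: algebra_simps)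
  finally show ?case by simp
qed

section \<open>Generating tuples of finite abelian groups of prime power order\<close>

context comm_group
begin

lemma generate_generate_Un:
  assumes "A \<subseteq> carrier G" "B \<subseteq> carrier G"
  shows "generate G (generate G A \<union> B) = generate G (A \<union> B)"
proof
  have AB: "A \<union> B \<subseteq> carrier G" using assms by blast
  show "generate G (generate G A \<union> B) \<subseteq> generate G (A \<union> B)"
    by (intro generate_subgroup_incl[OF _ generate_is_subgroup[OF AB]])
      (use mono_generate[of A "A \<union> B"] in \<open>auto intro: generate.incl\<close>)
  show "generate G (A \<union> B) \<subseteq> generate G (generate G A \<union> B)"
    by (intro mono_generate) (auto intro: generate.incl)
qed

lemma generate_subgroup_self: "subgroup V G \<Longrightarrow> generate G V = V"
  by (meson equalityI generate_subgroup_incl generate.incl subset_refl subsetI)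

text \<open>Modulo \<open>V\<close> the element \<open>x\<close> has order \<open>p\<close>, so its
  powers with exponents from 0 to \<open>p - 1\<close> represent the cosets of \<open>V\<close> in
  the larger subgroup.\<close>

lemma card_generate_insert:
  assumes V: "subgroup V G" and fin: "finite (carrier G)" and p: "prime p"
    and x: "x \<in> carrier G" "x \<notin> V" "x [^] p \<in> V"
  shows "card (generate G (insert x V)) = p * card V"
proof -
  have VG: "V \<subseteq> carrier G" using subgroup.subset[OF V] .
  note [simp] = subgroup.mem_carrier[OF V]
  have p0: "int p > 0" using p prime_gt_0_nat by simp
  define W where "W = (\<lambda>(v, i). v \<otimes> x [^] (i::int)) ` (V \<times> {0..<int p})"
  have xpV: "x [^] (int p * k) \<in> V" for k :: int
  proof -
    have "(x [^] p) [^] k \<in> V" by (rule subgroup_int_pow_closed[OF V x(3)])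
    moreover have "x [^] (int p * k) = (x [^] p) [^] k"
      using x(1) by (simp add: int_pow_pow int_pow_int[symmetric])
    ultimately show ?thesis by simp
  qed
  have inW: "v \<otimes> x [^] (i::int) \<in> W" if v: "v \<in> V" for v i
  proof -
    have "x [^] i = x [^] (int p * (i div int p)) \<otimes> x [^] (i mod int p)"
      using x(1) by (simp flip: int_pow_mult)
    then have "v \<otimes> x [^] i = (v \<otimes> x [^] (int p * (i div int p))) \<otimes> x [^] (i mod int p)"
      using v x(1) by (simp add: m_assoc)
    moreover have "v \<otimes> x [^] (int p * (i div int p)) \<in> V" using v xpV subgroup.m_closed[OF V] by simp
    ultimately show ?thesis unfolding W_def using p0
      by (intro image_eqI[of _ _ "(v \<otimes> x [^] (int p * (i div int p)), i mod int p)"]) auto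
  qed
  have W: "subgroup W G"
  proof (rule subgroupI)
    show "W \<subseteq> carrier G" using x(1) by (auto simp: W_def)
    show "W \<noteq> {}" using inW[OF subgroup.one_closed[OF V]] by blast
    fix a assume "a \<in> W"
    then obtain v i where a: "v \<in> V" "a = v \<otimes> x [^] (i::int)" by (auto simp: W_def)
    have "inv a = inv v \<otimes> x [^] (- i)" using a x(1) by (simp add: inv_mult int_pow_neg)
    then show "inv a \<in> W" using inW[OF subgroup.m_inv_closed[OF V a(1)]] by simp
    fix b assume "b \<in> W"
    then obtain w j where b: "w \<in> V" "b = w \<otimes> x [^] (j::int)" by (auto simp: W_def)
    have "a \<otimes> b = (v \<otimes> w) \<otimes> x [^] (i + j)" using a b x(1) by (simp add: int_pow_mult m_ac)
    then show "a \<otimes> b \<in> W" using inW[OF subgroup.m_closed[OF V a(1) b(1)]] by simp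
  qed
  have "generate G (insert x V) = W"
  proof
    have "x = \<one> \<otimes> x [^] (1::int)" using x(1) by simp
    then have "x \<in> W" using inW[OF subgroup.one_closed[OF V], of 1] by simp
    moreover have "v \<in> W" if "v \<in> V" for v using inW[OF that, of 0] that by simp
    ultimately show "generate G (insert x V) \<subseteq> W" by (intro generate_subgroup_incl[OF _ W]) auto
    have sub: "subgroup (generate G (insert x V)) G" using x(1) VG by (intro generate_is_subgroup) auto
    have "x \<in> generate G (insert x V)" "V \<subseteq> generate G (insert x V)" by (auto intro: generate.incl)
    then show "W \<subseteq> generate G (insert x V)"
      using subgroup.m_closed[OF sub] subgroup_int_pow_closed[OF sub] by (auto simp: W_def)
  qed
  moreover have "card W = card (V \<times> {0..<int p})" unfolding W_def
  proof (rule card_image, rule inj_onI)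
    \<comment> \<open>If two of these cosets coincided, a power of \<open>x\<close> with exponent
      prime to \<open>p\<close> would lie in \<open>V\<close>, and by Bezout so would
      \<open>x\<close>.\<close>
    have less: False if "v \<in> V" "w \<in> V" "0 \<le> i" "i < j" "j < int p" and e: "v \<otimes> x [^] i = w \<otimes> x [^] j" for v w and i j :: int
    proof -
      have "x [^] (j - i) = inv w \<otimes> (w \<otimes> x [^] j) \<otimes> inv (x [^] i)"
        proof -
        have "x [^] (j - i) = inv w \<otimes> w \<otimes> (x [^] j \<otimes> inv (x [^] i))" using that x(1) by (simp add: int_pow_diff)
        then show ?thesis using that(1,2) x(1) by (simp only: m_assoc m_closed inv_closed int_pow_closed subgroup.mem_carrier[OF V])
      qed
      also have "\<dots> = inv w \<otimes> v" unfolding e[symmetric] using that(1,2) x(1) by (simp add: m_assoc)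
      finally have ji: "x [^] (j - i) \<in> V"
        using that subgroup.m_closed[OF V] subgroup.m_inv_closed[OF V] by simp
      have "\<not> int p dvd j - i" using that zdvd_not_zless[of "j - i" "int p"] by simp
      then have "coprime (int p) (j - i)" using p by (intro prime_imp_coprime) auto
      then obtain a b where ab: "a * int p + b * (j - i) = 1"
        using bezout_int[of "int p" "j - i"] by (auto simp: coprime_iff_gcd_eq_1)
      have "x = x [^] (a * int p + b * (j - i))" using x(1) by (simp add: ab)
      also have "\<dots> = x [^] (int p * a) \<otimes> (x [^] (j - i)) [^] b"
        using x(1) by (simp add: int_pow_mult int_pow_pow mult.commute)
      finally show False
        using x(2) subgroup.m_closed[OF V xpV subgroup_int_pow_closed[OF V ji]] by metis
    qed
    fix u v assume uv: "u \<in> V \<times> {0..<int p}" "v \<in> V \<times> {0..<int p}"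
      and e: "(\<lambda>(v, i). v \<otimes> x [^] i) u = (\<lambda>(v, i). v \<otimes> x [^] i) v"
    obtain a i b j where u: "u = (a, i)" "v = (b, j)" by fastforce
    have *: "a \<in> V" "b \<in> V" "0 \<le> i" "0 \<le> j" "i < int p" "j < int p" "a \<otimes> x [^] i = b \<otimes> x [^] j"
      using uv e by (auto simp: u)
    then have ij: "i = j" using less[of a b i j] less[of b a j i] by (metis linorder_less_linear)
    then have "a = b" using * x(1) by simp
    then show "u = v" using ij u by simp
  qed
  ultimately show ?thesis by (simp add: card_cartesian_product)
qed

text \<open>The quotient by \<open>V\<close> is elementary abelian of rank \<open>s\<close>; each
  entry of a generating tuple of the quotient has \<open>card V\<close> lifts. The induction works
  with \<open>V\<close> instead of the quotient: a first entry in \<open>V\<close> changes nothing,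
  any other multiplies the order of \<open>V\<close> by \<open>p\<close> and lowers \<open>s\<close>
  by one.\<close>

lemma card_relative_generating_tuples:
  assumes fin: "finite (carrier G)" and p: "prime p"
    and "subgroup V G" "\<And>x. x \<in> carrier G \<Longrightarrow> x [^] p \<in> V" "card (carrier G) = card V * p ^ s"
  shows "of_nat (card {xs. length xs = n \<and> set xs \<subseteq> carrier G \<and> generate G (V \<union> set xs) = carrier G}) =
    of_nat (card V) ^ n * (\<Prod>j<s. of_nat p ^ n - of_nat p ^ j :: rat)"
  using assms(3-5)
proof (induction n arbitrary: V s)
  case (0 V s)
  note V = 0
  have VG: "V \<subseteq> carrier G" using subgroup.subset[OF V(1)] .
  have "V = carrier G \<longleftrightarrow> s = 0"
  proof
    assume "V = carrier G"
    then have "card (carrier G) * p ^ s = card (carrier G) * 1" using V(3) by (metis mult.right_neutral)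
    moreover have "card (carrier G) \<noteq> 0" using fin by auto
    ultimately have "p ^ s = 1" by (metis mult_cancel_left)
    then show "s = 0" using prime_gt_1_nat[OF p] by simp
  next
    assume "s = 0"
    then show "V = carrier G" using card_subset_eq[OF fin VG] V(3) by simp
  qed
  moreover have "card {xs. length xs = 0 \<and> set xs \<subseteq> carrier G \<and> generate G (V \<union> set xs) = carrier G} =
      (if V = carrier G then 1 else 0)"
  proof -
    have "{xs. length xs = 0 \<and> set xs \<subseteq> carrier G \<and> generate G (V \<union> set xs) = carrier G} =
        {xs. xs = [] \<and> V = carrier G}"
      using generate_subgroup_self[OF V(1)] by (intro Collect_cong) (simp cong: conj_cong)
    then show ?thesis by (cases "V = carrier G") simp_all
  qed
  \<comment> \<open>For \<open>s > 0\<close> the factor with \<open>j = 0\<close> is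
    \<open>1 - 1\<close>, in accordance with the empty tuple generating nothing beyond
    \<open>V\<close>.\<close>
  moreover have "(\<Prod>j<s. of_nat p ^ 0 - of_nat p ^ j :: rat) = (if s = 0 then 1 else 0)"
    by (auto intro!: prod_zero bexI[of _ 0])
  ultimately show ?case by simp
next
  case (Suc n V s)
  note V = Suc.prems
  have VG: "V \<subseteq> carrier G" using subgroup.subset[OF V(1)] .
  have finV: "finite V" using finite_subset[OF VG fin] .
  define A where "A = (\<lambda>n V. {xs. length xs = n \<and> set xs \<subseteq> carrier G \<and> generate G (V \<union> set xs) = carrier G})"
  define a where "a = (\<lambda>x. of_nat (card (A n (generate G (insert x V)))) :: rat)"
  have finA: "finite (A n V)" for n V
    by (rule finite_subset[OF _ finite_lists_length_eq[OF fin, of n]]) (auto simp: A_def)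
  have "A (Suc n) V = (\<Union>x\<in>carrier G. (#) x ` A n (generate G (insert x V)))"
  proof -
    have "generate G (generate G (insert x V) \<union> set ys) = generate G (V \<union> set (x # ys))"
      if "x \<in> carrier G" "set ys \<subseteq> carrier G" for x ys
      using generate_generate_Un[of "insert x V" "set ys"] that VG by simp
    then have iff: "x # ys \<in> A (Suc n) V \<longleftrightarrow> x \<in> carrier G \<and> ys \<in> A n (generate G (insert x V))" for x ys
      by (auto simp: A_def)
    have "xs \<in> A (Suc n) V \<longleftrightarrow> xs \<in> (\<Union>x\<in>carrier G. (#) x ` A n (generate G (insert x V)))" for xs
    proof (cases xs)
      case Nil
      then show ?thesis by (auto simp: A_def)
    next
      case (Cons x ys)
      then show ?thesis using iff by auto
    qed
    then show ?thesis by blast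
  qed
  then have "of_nat (card (A (Suc n) V)) = (of_nat (\<Sum>x\<in>carrier G. card ((#) x ` A n (generate G (insert x V)))) :: rat)"
    using fin finA by (subst card_UN_disjoint[symmetric]) auto
  also have "\<dots> = (\<Sum>x\<in>carrier G. a x)" by (simp add: card_image a_def)
  also have "\<dots> = (\<Sum>x\<in>carrier G - V. a x) + (\<Sum>x\<in>V. a x)"
    by (rule sum.subset_diff[OF VG fin])
  also have "(\<Sum>x\<in>V. a x) = of_nat (card V) * (of_nat (card V) ^ n * (\<Prod>j<s. of_nat p ^ n - of_nat p ^ j))"
  proof -
    have "a x = of_nat (card V) ^ n * (\<Prod>j<s. of_nat p ^ n - of_nat p ^ j)" if "x \<in> V" for x
      using Suc.IH[OF V] that generate_subgroup_self[OF V(1)] by (simp add: a_def A_def insert_absorb)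
    then show ?thesis by simp
  qed
  finally have eq: "of_nat (card (A (Suc n) V)) = (\<Sum>x\<in>carrier G - V. a x) +
      of_nat (card V) * (of_nat (card V) ^ n * (\<Prod>j<s. of_nat p ^ n - of_nat p ^ j))" .
  let ?c = "of_nat (card V) :: rat" and ?P = "of_nat p :: rat"
  have "(\<Sum>x\<in>carrier G - V. a x) + ?c * (?c ^ n * (\<Prod>j<s. ?P ^ n - ?P ^ j)) = ?c ^ Suc n * (\<Prod>j<s. ?P ^ Suc n - ?P ^ j)"
  proof (cases s)
    case 0
    then have "V = carrier G" using card_subset_eq[OF fin VG] V(3) by simp
    then show ?thesis using 0 by simp
  next
    case (Suc t)
    define q where "q = (\<Prod>j<t. ?P ^ n - ?P ^ j)"
    have "a x = (?P * ?c) ^ n * q" if x: "x \<in> carrier G - V" for x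
    proof -
      have c: "card (generate G (insert x V)) = p * card V"
        using x V(2) by (intro card_generate_insert[OF V(1) fin p]) auto
      have "of_nat (card (A n (generate G (insert x V)))) =
          (of_nat (card (generate G (insert x V))) ^ n * (\<Prod>j<t. ?P ^ n - ?P ^ j) :: rat)"
        unfolding A_def
      proof (rule Suc.IH)
        show "subgroup (generate G (insert x V)) G" using x VG by (intro generate_is_subgroup) auto
        show "y [^] p \<in> generate G (insert x V)" if "y \<in> carrier G" for y
          using V(2)[OF that] by (auto intro: generate.incl)
        show "card (carrier G) = card (generate G (insert x V)) * p ^ t"
          using V(3) by (simp add: c Suc)
      qed
      then show ?thesis by (simp add: a_def c q_def)
    qed
    then have "(\<Sum>x\<in>carrier G - V. a x) = of_nat (card (carrier G - V)) * ((?P * ?c) ^ n * q)" by simp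
    also have "of_nat (card (carrier G - V)) = ?c * (?P * ?P ^ t - 1)"
      using V(3) card_mono[OF fin VG] by (simp add: card_Diff_subset[OF finV VG] of_nat_diff Suc algebra_simps)
    finally have "(\<Sum>x\<in>carrier G - V. a x) = ?c ^ Suc n * (q * ((?P * ?P ^ t - 1) * ?P ^ n))"
      by (simp add: power_mult_distrib)
    moreover have "(\<Prod>j<s. ?P ^ n - ?P ^ j) = q * (?P ^ n - ?P ^ t)" by (simp add: Suc q_def)
    \<comment> \<open>The factor with \<open>j = 0\<close> is split off and a factor
      \<open>p\<close> is taken out of each of the others; what remains is the common part
      \<open>q\<close>.\<close>
    moreover have "(\<Prod>j<s. ?P ^ Suc n - ?P ^ j) = q * ((?P * ?P ^ n - 1) * ?P ^ t)"
    proof -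
      have "(\<Prod>j<s. ?P ^ Suc n - ?P ^ j) = (?P ^ Suc n - 1) * (\<Prod>j<t. ?P ^ Suc n - ?P ^ Suc j)"
        unfolding Suc by (subst prod.lessThan_Suc_shift) simp
      also have "(\<Prod>j<t. ?P ^ Suc n - ?P ^ Suc j) = (\<Prod>j<t. ?P * (?P ^ n - ?P ^ j))"
        by (intro prod.cong refl) (simp add: algebra_simps)
      also have "\<dots> = ?P ^ t * q" by (simp add: prod.distrib q_def)
      finally show ?thesis by simp
    qed
    ultimately have "(\<Sum>x\<in>carrier G - V. a x) + ?c * (?c ^ n * (\<Prod>j<s. ?P ^ n - ?P ^ j)) =
        ?c ^ Suc n * (q * ((?P * ?P ^ t - 1) * ?P ^ n) + q * (?P ^ n - ?P ^ t))"
      by (simp only: power_Suc distrib_left mult.assoc)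
    also have "q * ((?P * ?P ^ t - 1) * ?P ^ n) + q * (?P ^ n - ?P ^ t) = q * ((?P * ?P ^ n - 1) * ?P ^ t)"
      by (simp add: algebra_simps)
    finally show ?thesis by (simp only: \<open>(\<Prod>j<s. ?P ^ Suc n - ?P ^ j) = q * ((?P * ?P ^ n - 1) * ?P ^ t)\<close>)
  qed
  then show ?case unfolding eq[unfolded A_def] .
qed

text \<open>With trivial \<open>V\<close> the number of generating \<open>r\<close>-tuples is
  nonzero exactly if no factor \<open>p ^ r - p ^ j\<close> with \<open>j < s\<close> vanishes, that
  is, if \<open>r\<close> is at least \<open>s\<close>.\<close>

lemma group_rank_elementary_abelian:
  assumes "elementary_abelian p G" "finite (carrier G)" "prime p" "card (carrier G) = p ^ s"
  shows "group_rank G = s"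
proof -
  have one: "subgroup {\<one>} G" by (rule triv_subgroup)
  define A where "A = (\<lambda>r. {xs. length xs = r \<and> set xs \<subseteq> carrier G \<and> generate G ({\<one>} \<union> set xs) = carrier G})"
  have cardA: "of_nat (card (A r)) = (\<Prod>j<s. of_nat p ^ r - of_nat p ^ j :: rat)" for r
    using card_relative_generating_tuples[OF assms(2,3) one, of s r] assms(1,4)
    by (simp add: elementary_abelian_def A_def)
  have finA: "finite (A r)" for r
    by (rule finite_subset[OF _ finite_lists_length_eq[OF assms(2), of r]]) (auto simp: A_def)
  have p1: "1 < (of_nat p :: rat)" using prime_gt_1_nat[OF assms(3)] by simp
  have "A r \<noteq> {} \<longleftrightarrow> s \<le> r" for r
  proof -
    have "A r \<noteq> {} \<longleftrightarrow> (of_nat (card (A r)) :: rat) \<noteq> 0" using finA by simp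
    also have "\<dots> \<longleftrightarrow> (\<forall>j\<in>{..<s}. (of_nat p :: rat) ^ r \<noteq> of_nat p ^ j)" unfolding cardA by simp
    also have "\<dots> \<longleftrightarrow> (\<forall>j\<in>{..<s}. r \<noteq> j)" by (simp only: power_inject_exp[OF p1])
    also have "\<dots> \<longleftrightarrow> s \<le> r" by force
    finally show ?thesis .
  qed
  moreover have "generated_by_at_most r G \<longleftrightarrow> A r \<noteq> {}" for r
  proof
    assume "generated_by_at_most r G"
    then obtain S where S: "S \<subseteq> carrier G" "finite S" "card S \<le> r" "generate G S = carrier G"
      by (auto simp: generated_by_at_most_def)
    obtain ys where ys: "set ys = S" "distinct ys" using finite_distinct_list[OF S(2)] by blast
    \<comment> \<open>Padding with \<open>\<one>\<close> turns a generating set of at most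
      \<open>r\<close> elements into a tuple of length exactly \<open>r\<close>.\<close>
    define xs where "xs = ys @ replicate (r - card S) \<one>"
    have "length xs = r" using S(3) distinct_card[OF ys(2)] ys(1) by (simp add: xs_def)
    moreover have sub: "set xs \<subseteq> carrier G" "S \<subseteq> set xs" using S(1) ys(1) by (auto simp: xs_def)
    moreover have "generate G ({\<one>} \<union> set xs) = carrier G"
    proof
      show "generate G ({\<one>} \<union> set xs) \<subseteq> carrier G" using sub(1) by (intro generate_incl) auto
      show "carrier G \<subseteq> generate G ({\<one>} \<union> set xs)"
        using mono_generate[of S "{\<one>} \<union> set xs"] sub(2) S(4) by blast
    qed
    ultimately show "A r \<noteq> {}" by (auto simp: A_def)
  next
    assume "A r \<noteq> {}"
    then obtain xs where xs: "length xs = r" "set xs \<subseteq> carrier G" "generate G ({\<one>} \<union> set xs) = carrier G"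
      by (auto simp: A_def)
    have "generate G ({\<one>} \<union> set xs) \<subseteq> generate G (set xs)"
      by (intro generate_subgroup_incl[OF _ generate_is_subgroup[OF xs(2)]]) (auto intro: generate.intros)
    then have "generate G (set xs) = carrier G" using xs(3) generate_incl[OF xs(2)] by blast
    then show "generated_by_at_most r G"
      unfolding generated_by_at_most_def using xs card_length[of xs] by (intro exI[of _ "set xs"]) simp
  qed
  ultimately have "generated_by_at_most r G \<longleftrightarrow> s \<le> r" for r by blast
  then show ?thesis unfolding group_rank_def by (intro Least_equality) auto
qed

text \<open>The Frattini subgroup of an abelian \<open>p\<close>-group consists of \<open>p\<close>-th powers, so it is superfluous
  in every generating set.\<close>

lemma generate_frattini_Un:
  assumes k: "card (carrier G) = p ^ k" and fin: "finite (carrier G)" and S: "S \<subseteq> carrier G"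
  shows "generate G (frattini p G \<union> S) = carrier G \<longleftrightarrow> generate G S = carrier G"
proof
  let ?F = "frattini p G"
  note F = frattini_smallest[OF comm_group_axioms, where p = p]
  have FG: "?F \<subseteq> carrier G" using subgroup.subset[OF F(1)] .
  show "generate G (?F \<union> S) = carrier G" if "generate G S = carrier G"
    using that mono_generate[of S "?F \<union> S"] generate_incl[of "?F \<union> S"] FG S by blast
  assume gen: "generate G (?F \<union> S) = carrier G"
  let ?H = "generate G S"
  have H: "subgroup ?H G" by (rule generate_is_subgroup[OF S])
  have HG: "?H \<subseteq> carrier G" by (rule generate_incl[OF S])
  note [simp] = subgroup.mem_carrier[OF H]
  have Hpow: "h [^] (j::nat) \<in> ?H" if "h \<in> ?H" for h j
    using subgroup.one_closed[OF H] subgroup.m_closed[OF H] that by (induction j) auto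
  \<comment> \<open>The product of the subgroup of \<open>p\<close>-th powers with
    \<open>?H\<close>. The quotient by \<open>W\<close> has exponent \<open>p\<close>, so
    \<open>W\<close> contains the Frattini subgroup; as it contains \<open>S\<close> too, it is the
    whole group.\<close>
  define W where "W = {y [^] p \<otimes> h | y h. y \<in> carrier G \<and> h \<in> ?H}"
  have WI: "y [^] p \<otimes> h \<in> W" if "y \<in> carrier G" "h \<in> ?H" for y h using that by (auto simp: W_def)
  have W: "subgroup W G"
  proof (rule subgroupI)
    show "W \<subseteq> carrier G" by (auto simp: W_def)
    show "W \<noteq> {}" using WI[OF one_closed subgroup.one_closed[OF H]] by blast
    fix a assume "a \<in> W"
    then obtain y h where a: "y \<in> carrier G" "h \<in> ?H" "a = y [^] p \<otimes> h" by (auto simp: W_def)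
    have "inv a = inv y [^] p \<otimes> inv h" using a by (simp add: inv_mult nat_pow_inv)
    then show "inv a \<in> W" using WI[of "inv y" "inv h"] a subgroup.m_inv_closed[OF H] by simp
    fix b assume "b \<in> W"
    then obtain z l where b: "z \<in> carrier G" "l \<in> ?H" "b = z [^] p \<otimes> l" by (auto simp: W_def)
    have "a \<otimes> b = (y \<otimes> z) [^] p \<otimes> (h \<otimes> l)" using a b by (simp add: nat_pow_distrib m_ac)
    then show "a \<otimes> b \<in> W" using WI[of "y \<otimes> z" "h \<otimes> l"] a b subgroup.m_closed[OF H] by simp
  qed
  have pW: "x [^] p \<in> W" if "x \<in> carrier G" for x using WI[OF that subgroup.one_closed[OF H]] that by simp
  have "?F \<subseteq> W" using F(3)[OF W] pW elementary_abelian_Mod_iff[OF comm_group_axioms W] by blast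
  moreover have "S \<subseteq> W"
  proof
    fix x assume x: "x \<in> S"
    then have "x \<in> ?H" by (auto intro: generate.incl)
    then show "x \<in> W" using WI[OF one_closed, of x] by simp
  qed
  ultimately have GW: "carrier G \<subseteq> W" using generate_subgroup_incl[OF _ W, of "?F \<union> S"] gen by blast
  \<comment> \<open>Decomposing the base of the power again raises its exponent by a factor
    \<open>p\<close>. At \<open>j = k\<close> the power is trivial and only the factor from
    \<open>?H\<close> remains.\<close>
  have it: "\<exists>y\<in>carrier G. \<exists>h\<in>?H. x = y [^] (p ^ j) \<otimes> h" if "x \<in> carrier G" for x j
  proof (induction j)
    case 0
    show ?case using subgroup.one_closed[OF H] that by (intro bexI[of _ x] bexI[of _ \<one>]) auto
  next
    case (Suc j)
    then obtain y h where y: "y \<in> carrier G" "h \<in> ?H" "x = y [^] (p ^ j) \<otimes> h" by blast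
    obtain z l where z: "z \<in> carrier G" "l \<in> ?H" "y = z [^] p \<otimes> l" using GW y(1) by (auto simp: W_def)
    have "x = z [^] (p ^ Suc j) \<otimes> (l [^] (p ^ j) \<otimes> h)"
      using y(1,2) z(1,2) by (simp add: y(3) z(3) nat_pow_distrib nat_pow_pow m_assoc)
    then show ?case using z y Hpow subgroup.m_closed[OF H] by blast
  qed
  show "?H = carrier G"
  proof (rule equalityI[OF HG], rule subsetI)
    fix x assume "x \<in> carrier G"
    then obtain y h where y: "y \<in> carrier G" "h \<in> ?H" "x = y [^] (p ^ k) \<otimes> h" using it by blast
    have "y [^] (p ^ k) = \<one>" using pow_order_eq_1[OF y(1)] k by (simp add: order_def)
    then show "x \<in> ?H" using y by simp
  qed
qed

text \<open>By \<open>generate_frattini_Un\<close> the Frattini subgroup may be added to every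
  generating set, so the relative count applies with \<open>V = F\<close>. The
  \<open>q\<close>-binomial theorem at \<open>X = p ^ n\<close> then expands the product.\<close>

lemma card_generating_tuples:
  assumes p: "prime p" and fin: "finite (carrier G)" and k: "card (carrier G) = p ^ k"
  defines "F \<equiv> frattini p G"
  shows "of_nat (card (generating_tuples n (carrier G))) = of_nat (card F) ^ n *
    (\<Sum>i=0..group_rank (G Mod F). (-1) ^ i * of_nat p ^ (n * (group_rank (G Mod F) - i) + (i choose 2)) *
      p_binomial p (group_rank (G Mod F)) i)"
proof -
  note F = frattini_smallest[OF comm_group_axioms, where p = p, folded F_def]
  have FG: "F \<subseteq> carrier G" using subgroup.subset[OF F(1)] .
  have lag: "card (rcosets F) * card F = p ^ k" using lagrange[OF F(1)] k by (simp add: order_def)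
  then have "card (rcosets F) dvd p ^ k" by (metis dvd_triv_left)
  then obtain s where s: "card (rcosets F) = p ^ s" using divides_primepow_nat[OF p] by blast
  interpret E: comm_group "G Mod F" by (rule abelian_FactGroup[OF F(1)])
  have cE: "carrier (G Mod F) = rcosets F" by (simp add: FactGroup_def)
  have rk: "group_rank (G Mod F) = s"
  proof (rule E.group_rank_elementary_abelian[OF F(2) _ p])
    show "finite (carrier (G Mod F))" unfolding cE RCOSETS_def using fin by auto
    show "card (carrier (G Mod F)) = p ^ s" unfolding cE by (rule s)
  qed
  have "generating_tuples n (carrier G) = {xs. length xs = n \<and> set xs \<subseteq> carrier G \<and> generate G (F \<union> set xs) = carrier G}"
    using generate_frattini_Un[OF k fin] by (auto simp: generating_tuples_def F_def)
  then have "of_nat (card (generating_tuples n (carrier G))) = of_nat (card F) ^ n * (\<Prod>j<s. of_nat p ^ n - of_nat p ^ j :: rat)"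
    using card_relative_generating_tuples[OF fin p F(1), of s n] F(2) lag s k
    by (simp add: elementary_abelian_Mod_iff[OF comm_group_axioms F(1)] mult.commute)
  also have "(\<Prod>j<s. of_nat p ^ n - of_nat p ^ j :: rat) =
      (\<Sum>i\<le>s. (-1) ^ i * of_nat p ^ (i choose 2) * p_binomial p s i * (of_nat p ^ n) ^ (s - i))"
    by (rule prod_diff_power_eq[OF p])
  also have "\<dots> = (\<Sum>i=0..s. (-1) ^ i * of_nat p ^ (n * (s - i) + (i choose 2)) * p_binomial p s i)"
    unfolding atMost_atLeast0 by (intro sum.cong refl) (simp add: power_add power_mult)
  finally show ?thesis unfolding rk .
qed

end

section \<open>Summation over conjugacy classes\<close>

context group
begin

lemma conj_group_hom:
  assumes "g \<in> carrier G" shows "group_hom G G (\<lambda>x. g \<otimes> x \<otimes> inv g)"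
proof -
  have "(\<lambda>x. g \<otimes> x \<otimes> inv g) \<in> hom G G"
  proof (rule homI)
    fix x y assume xy: "x \<in> carrier G" "y \<in> carrier G"
    have "(g \<otimes> x \<otimes> inv g) \<otimes> (g \<otimes> y \<otimes> inv g) = g \<otimes> x \<otimes> (inv g \<otimes> g) \<otimes> y \<otimes> inv g"
      using assms xy by (simp only: m_assoc m_closed inv_closed)
    then show "g \<otimes> (x \<otimes> y) \<otimes> inv g = (g \<otimes> x \<otimes> inv g) \<otimes> (g \<otimes> y \<otimes> inv g)"
      using assms xy by (simp add: m_assoc)
  qed (use assms in simp)
  then show ?thesis by (simp add: group_hom_def group_hom_axioms_def is_group)
qed

lemma in_own_conjugacy_class: "H \<subseteq> carrier G \<Longrightarrow> H \<in> conjugacy_class G H"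
  unfolding conjugacy_class_def conj_image
  by (intro CollectI exI[of _ \<one>]) (auto simp: image_iff subset_iff)

lemma conjugacy_class_conj:
  assumes H: "H \<subseteq> carrier G" and g: "g \<in> carrier G"
  shows "conjugacy_class G ((\<lambda>x. g \<otimes> x \<otimes> inv g) ` H) = conjugacy_class G H"
proof -
  have c: "a <# ((\<lambda>x. g \<otimes> x \<otimes> inv g) ` H) #> inv a = (a \<otimes> g) <# H #> inv (a \<otimes> g)" if "a \<in> carrier G" for a
    unfolding conj_image image_image using that H g
    by (intro image_cong refl) (simp add: inv_mult_group m_assoc subset_iff)
  show ?thesis
  proof (intro equalityI subsetI)
    fix C assume "C \<in> conjugacy_class G ((\<lambda>x. g \<otimes> x \<otimes> inv g) ` H)"
    then obtain a where "a \<in> carrier G" "C = (a \<otimes> g) <# H #> inv (a \<otimes> g)"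
      using c unfolding conjugacy_class_def by blast
    then show "C \<in> conjugacy_class G H" using g unfolding conjugacy_class_def by blast
  next
    fix C assume "C \<in> conjugacy_class G H"
    then obtain a where a: "a \<in> carrier G" "C = a <# H #> inv a" unfolding conjugacy_class_def by blast
    have ag: "a \<otimes> inv g \<in> carrier G" "a \<otimes> inv g \<otimes> g = a" using a(1) g by (simp_all add: m_assoc)
    have "C = (a \<otimes> inv g) <# ((\<lambda>x. g \<otimes> x \<otimes> inv g) ` H) #> inv (a \<otimes> inv g)"
      unfolding c[OF ag(1)] ag(2) by (rule a(2))
    then show "C \<in> conjugacy_class G ((\<lambda>x. g \<otimes> x \<otimes> inv g) ` H)"
      using ag(1) unfolding conjugacy_class_def by blast
  qed
qed

lemma conjugacy_class_eq:
  assumes "H \<subseteq> carrier G" "H' \<in> conjugacy_class G H"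
  shows "conjugacy_class G H' = conjugacy_class G H"
proof -
  obtain g where "g \<in> carrier G" "H' = g <# H #> inv g" using assms(2) unfolding conjugacy_class_def by blast
  then show ?thesis using conjugacy_class_conj[OF assms(1)] by (simp add: conj_image)
qed

lemma generate_conj_image:
  assumes "g \<in> carrier G" "S \<subseteq> carrier G"
  shows "generate G ((\<lambda>x. g \<otimes> x \<otimes> inv g) ` S) = (\<lambda>x. g \<otimes> x \<otimes> inv g) ` generate G S"
  using group_hom.generate_img[OF conj_group_hom[OF assms(1)] assms(2)] by simp

lemma card_generating_tuples_conj:
  assumes H: "subgroup H G" and H': "H' \<in> conjugacy_class G H"
  shows "card (generating_tuples n H') = card (generating_tuples n H)"
proof -
  have HG: "H \<subseteq> carrier G" using subgroup.subset[OF H] .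
  obtain g where g: "g \<in> carrier G" "H' = (\<lambda>x. g \<otimes> x \<otimes> inv g) ` H"
    using H' unfolding conjugacy_class_def conj_image by blast
  let ?c = "\<lambda>x. g \<otimes> x \<otimes> inv g"
  have inj: "inj_on ?c (carrier G)" by (rule conj_inj_on[OF g(1)])
  have iff: "?c ` generate G (set ys) = ?c ` H \<longleftrightarrow> generate G (set ys) = H" if "set ys \<subseteq> H" for ys
    using inj_on_image_eq_iff[OF inj _ HG] generate_incl[of "set ys"] that HG by blast
  have "generating_tuples n H' = map ?c ` generating_tuples n H"
  proof (intro equalityI subsetI)
    fix xs assume xs: "xs \<in> generating_tuples n H'"
    then have "xs \<in> lists (?c ` H)" by (auto simp: generating_tuples_def g(2))
    then obtain ys where ys: "set ys \<subseteq> H" "xs = map ?c ys" unfolding lists_image by auto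
    have "set ys \<subseteq> carrier G" using ys(1) HG by blast
    then have "ys \<in> generating_tuples n H"
      using xs ys(1) iff[OF ys(1)] by (simp add: generating_tuples_def ys(2) g(2) generate_conj_image[OF g(1)])
    then show "xs \<in> map ?c ` generating_tuples n H" using ys(2) by blast
  next
    fix xs assume "xs \<in> map ?c ` generating_tuples n H"
    then obtain ys where ys: "length ys = n" "set ys \<subseteq> H" "generate G (set ys) = H" "xs = map ?c ys"
      by (auto simp: generating_tuples_def)
    have "set ys \<subseteq> carrier G" using ys(2) HG by blast
    then show "xs \<in> generating_tuples n H'"
      using ys by (auto simp: generating_tuples_def g(2) generate_conj_image[OF g(1)])
  qed
  moreover have "inj_on (map ?c) (generating_tuples n H)"
    using HG by (intro inj_on_mapI inj_on_subset[OF inj]) (auto simp: generating_tuples_def)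
  ultimately show ?thesis by (simp add: card_image)
qed

lemma abelian_p_subgroups_conj:
  assumes H: "H \<in> abelian_p_subgroups G p n" and H': "H' \<in> conjugacy_class G H"
  shows "H' \<in> abelian_p_subgroups G p n"
proof -
  have sub: "subgroup H G" and fin: "finite H" and pk: "\<exists>k. card H = p ^ k"
    and comm: "comm_group (G\<lparr>carrier := H\<rparr>)" and gen: "generated_by_at_most n (G\<lparr>carrier := H\<rparr>)"
    using H by (auto simp: abelian_p_subgroups_def)
  have HG: "H \<subseteq> carrier G" using subgroup.subset[OF sub] .
  obtain g where g: "g \<in> carrier G" "H' = (\<lambda>x. g \<otimes> x \<otimes> inv g) ` H"
    using H' unfolding conjugacy_class_def conj_image by blast
  let ?c = "\<lambda>x. g \<otimes> x \<otimes> inv g"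
  have sub': "subgroup H' G"
    unfolding g(2) by (rule group_hom.subgroup_img_is_subgroup[OF conj_group_hom[OF g(1)] sub])
  have "card H' = card H" unfolding g(2)
    by (rule card_image) (rule inj_on_subset[OF conj_inj_on[OF g(1)] HG])
  then have pk': "\<exists>k. card H' = p ^ k" using pk by simp
  have fin': "finite H'" using fin g(2) by simp
  have comm': "comm_group (G\<lparr>carrier := H'\<rparr>)"
  proof (rule group.group_comm_groupI[OF subgroup_imp_group[OF sub']])
    fix x y assume "x \<in> carrier (G\<lparr>carrier := H'\<rparr>)" "y \<in> carrier (G\<lparr>carrier := H'\<rparr>)"
    then obtain a b where ab: "a \<in> H" "b \<in> H" "x = ?c a" "y = ?c b" by (auto simp: g(2))
    have "a \<otimes> b = b \<otimes> a" using comm_groupE(4)[OF comm, of a b] ab by simp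
    then show "x \<otimes>\<^bsub>G\<lparr>carrier := H'\<rparr>\<^esub> y = y \<otimes>\<^bsub>G\<lparr>carrier := H'\<rparr>\<^esub> x"
      using conj_commute_iff[OF g(1), of a b] ab HG by auto
  qed
  obtain S where S: "S \<subseteq> H" "finite S" "card S \<le> n" "generate (G\<lparr>carrier := H\<rparr>) S = H"
    using gen by (auto simp: generated_by_at_most_def)
  have cS: "?c ` S \<subseteq> H'" using S(1) g(2) by blast
  have "generate (G\<lparr>carrier := H'\<rparr>) (?c ` S) = H'"
    using generate_consistent[OF cS sub'] generate_consistent[OF S(1) sub] S(1,4) HG
      generate_conj_image[OF g(1), of S] by (simp add: g(2) subset_trans[OF S(1) HG])
  moreover have "card (?c ` S) \<le> n" using card_image_le[OF S(2), of ?c] S(3) by simp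
  ultimately have "generated_by_at_most n (G\<lparr>carrier := H'\<rparr>)"
    unfolding generated_by_at_most_def using cS S(2) by (intro exI[of _ "?c ` S"]) simp
  then show ?thesis using sub' fin' pk' comm' by (simp add: abelian_p_subgroups_def)
qed

text \<open>A tuple in \<open>H\<close> generates the same set in \<open>H\<close> as in
  \<open>G\<close>, so the count made inside the group \<open>P\<close> is the one needed in
  \<open>G\<close>.\<close>

lemma card_generating_tuples_subgroup:
  assumes p: "prime p" and H: "H \<in> abelian_p_subgroups G p n"
  defines "P \<equiv> G\<lparr>carrier := H\<rparr>"
  shows "of_nat (card (generating_tuples n H)) = of_nat (card (frattini p P)) ^ n *
    (\<Sum>i=0..group_rank (P Mod frattini p P). (-1) ^ i *
      of_nat p ^ (n * (group_rank (P Mod frattini p P) - i) + (i choose 2)) *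
      p_binomial p (group_rank (P Mod frattini p P)) i)"
proof -
  have sub: "subgroup H G" and fin: "finite H" and comm: "comm_group P"
    using H by (auto simp: abelian_p_subgroups_def P_def)
  obtain k where k: "card H = p ^ k" using H by (auto simp: abelian_p_subgroups_def)
  interpret P: comm_group P by (rule comm)
  have "P.generating_tuples n (carrier P) = generating_tuples n H"
  proof -
    have cP: "carrier P = H" by (simp add: P_def)
    have "generate P (set xs) = generate G (set xs)" if "set xs \<subseteq> H" for xs
      using generate_consistent[OF that sub] by (simp add: P_def)
    then show ?thesis unfolding P.generating_tuples_def generating_tuples_def cP by auto
  qed
  then show ?thesis
    using P.card_generating_tuples[OF p, of k n] fin k by (simp add: P_def)
qed

end

lemma localization_at_add:
  assumes p: "prime p" and "a \<in> localization_at p" "b \<in> localization_at p"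
  shows "a + b \<in> localization_at p"
proof -
  obtain x y where a: "a = of_int x / of_int y" "\<not> int p dvd y" using assms by (auto simp: localization_at_def)
  obtain z w where b: "b = of_int z / of_int w" "\<not> int p dvd w" using assms by (auto simp: localization_at_def)
  have "y \<noteq> 0" "w \<noteq> 0" using a(2) b(2) by auto
  then have "a + b = of_int (x * w + z * y) / of_int (y * w)" by (simp add: a(1) b(1) field_simps)
  moreover have "\<not> int p dvd y * w" using a(2) b(2) p prime_dvd_mult_iff[of "int p" y w] by simp
  ultimately show ?thesis unfolding localization_at_def by blast
qed

lemma localization_at_sum:
  assumes p: "prime p" and "\<And>x. x \<in> A \<Longrightarrow> f x \<in> localization_at p"
  shows "sum f A \<in> localization_at p"
proof -
  have "(0 :: rat) = of_int 0 / of_int 1 \<and> \<not> int p dvd 1" using p not_prime_unit[of p] by auto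
  then have "0 \<in> localization_at p" unfolding localization_at_def by blast
  then show ?thesis using assms(2)
    by (induction A rule: infinite_finite_induct) (simp_all add: localization_at_add[OF p])
qed

text \<open>The \<open>p\<close>-part of \<open>b\<close> cancels against \<open>a\<close> and
  leaves a denominator prime to \<open>p\<close>.\<close>

lemma of_nat_divide_in_localization:
  assumes p: "prime p" and b: "b > 0" and d: "p ^ multiplicity p b dvd a"
  shows "(-1) ^ n * (of_nat a / of_nat b) \<in> localization_at p"
proof -
  have "\<not> is_unit p" using not_prime_unit[of p] p by blast
  then obtain m where m: "b = p ^ multiplicity p b * m" "\<not> p dvd m"
    using multiplicity_decompose'[of b p] b by auto
  obtain c where c: "a = p ^ multiplicity p b * c" using d by blast
  have "p ^ multiplicity p b \<noteq> 0" using p by (auto simp: prime_gt_0_nat)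
  moreover have "(of_nat a / of_nat b :: rat) = (of_nat (p ^ multiplicity p b) * of_nat c) / (of_nat (p ^ multiplicity p b) * of_nat m)"
    by (subst c, subst (2) m(1)) (simp only: of_nat_mult)
  ultimately have "(of_nat a / of_nat b :: rat) = of_nat c / of_nat m"
    by (metis mult_divide_mult_cancel_left of_nat_eq_0_iff)
  then have "(-1) ^ n * (of_nat a / of_nat b :: rat) = of_int ((-1) ^ n * int c) / of_int (int m)" by simp
  moreover have "\<not> int p dvd int m" using m(2) by simp
  ultimately show ?thesis unfolding localization_at_def by blast
qed

text \<open>The number of generating tuples is constant on a conjugacy class. So it can be moved
  inside the count of the conjugates of \<open>h C\<close> in a stabilizer \<open>K\<close>, and the
  sum over all classes then runs over every subgroup of \<open>K\<close> of the given kind once. The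
  representatives \<open>h\<close> are arbitrary, which covers the choice made in the
  theorem.\<close>

lemma (in finite_EG) sum_normalizer_eq_sum_cells:
  assumes vtf: "virtually_torsion_free G" and p: "prime p" and n: "n \<ge> 1"
    and fin: "finite (conjugacy_class G ` abelian_p_subgroups G p n)"
    and rep: "\<And>C. C \<in> conjugacy_class G ` abelian_p_subgroups G p n \<Longrightarrow> h C \<in> C"
  shows "(\<Sum>C\<in>conjugacy_class G ` abelian_p_subgroups G p n.
      orbifold_euler (G\<lparr>carrier := normalizer G (h C)\<rparr>) * of_nat (card (generating_tuples n (h C)))) =
    (\<Sum>(m, K, q)\<in>(SIGMA m:UNIV. cells m). (-1) ^ m * (of_nat (card (commuting_tuples p n K)) / of_nat (card K)))"
proof -
  let ?A = "abelian_p_subgroups G p n" let ?\<C> = "conjugacy_class G ` ?A" let ?S = "SIGMA m:UNIV. cells m"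
  let ?M = "\<lambda>H. of_nat (card (generating_tuples n H)) :: rat"
  have AG: "subgroup H G" "finite H" "H \<subseteq> carrier G" if "H \<in> ?A" for H
    using that subgroup.subset by (auto simp: abelian_p_subgroups_def)
  have hC: "h C \<in> ?A" "conjugacy_class G (h C) = C" if C: "C \<in> ?\<C>" for C
  proof -
    obtain H where H: "H \<in> ?A" "C = conjugacy_class G H" using C by blast
    then have "h C \<in> conjugacy_class G H" using rep[OF C] by simp
    then show "h C \<in> ?A" "conjugacy_class G (h C) = C"
      using abelian_p_subgroups_conj[OF H(1)] conjugacy_class_eq[OF AG(3)[OF H(1)]] H(2) by auto
  qed
  have mem: "H' \<in> C \<longleftrightarrow> H' \<in> ?A \<and> conjugacy_class G H' = C" if C: "C \<in> ?\<C>" for H' C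
  proof
    assume "H' \<in> C"
    then have "H' \<in> conjugacy_class G (h C)" using hC(2)[OF C] by simp
    then show "H' \<in> ?A \<and> conjugacy_class G H' = C"
      using abelian_p_subgroups_conj[OF hC(1)[OF C]] conjugacy_class_eq[OF AG(3)[OF hC(1)[OF C]]] hC(2)[OF C] by auto
  next
    assume "H' \<in> ?A \<and> conjugacy_class G H' = C"
    then show "H' \<in> C" using in_own_conjugacy_class[OF AG(3), of H'] by simp
  qed
  have M: "?M H' = ?M (h C)" if C: "C \<in> ?\<C>" and "H' \<in> C" for C H'
  proof -
    have "H' \<in> conjugacy_class G (h C)" using \<open>H' \<in> C\<close> hC(2)[OF C] by simp
    then show ?thesis using card_generating_tuples_conj[OF AG(1)[OF hC(1)[OF C]]] by simp
  qed
  have "(\<Sum>C\<in>?\<C>. orbifold_euler (G\<lparr>carrier := normalizer G (h C)\<rparr>) * ?M (h C)) =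
      (\<Sum>C\<in>?\<C>. \<Sum>(m, K, q)\<in>?S. (-1) ^ m / of_nat (card K) * (\<Sum>H\<in>{H \<in> ?A. H \<subseteq> K \<and> conjugacy_class G H = C}. ?M H))"
  proof (rule sum.cong[OF refl])
    fix C assume C: "C \<in> ?\<C>"
    have N: "subgroup (normalizer G (h C)) G" by (rule normalizer_imp_subgroup[OF AG(3)[OF hC(1)[OF C]]])
    have "orbifold_euler (G\<lparr>carrier := normalizer G (h C)\<rparr>) =
        (\<Sum>(m, K, q)\<in>?S. (-1) ^ m * of_nat (card {H'. H' \<subseteq> K \<and> H' \<in> C}) / of_nat (card K))"
      using orbifold_euler_normalizer[OF AG(1,2)[OF hC(1)[OF C]] virtually_torsion_free_subgroup[OF is_group vtf N]]
      by (simp only: hC(2)[OF C])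
    moreover have "of_nat (card {H'. H' \<subseteq> K \<and> H' \<in> C}) * ?M (h C) =
        (\<Sum>H\<in>{H \<in> ?A. H \<subseteq> K \<and> conjugacy_class G H = C}. ?M H)" for K
    proof -
      have "{H'. H' \<subseteq> K \<and> H' \<in> C} = {H \<in> ?A. H \<subseteq> K \<and> conjugacy_class G H = C}" using mem[OF C] by blast
      moreover have "(\<Sum>H\<in>{H'. H' \<subseteq> K \<and> H' \<in> C}. ?M H) = (\<Sum>H\<in>{H'. H' \<subseteq> K \<and> H' \<in> C}. ?M (h C))"
        using M[OF C] by (intro sum.cong refl) blast
      ultimately show ?thesis by simp
    qed
    ultimately show "orbifold_euler (G\<lparr>carrier := normalizer G (h C)\<rparr>) * ?M (h C) =
        (\<Sum>(m, K, q)\<in>?S. (-1) ^ m / of_nat (card K) * (\<Sum>H\<in>{H \<in> ?A. H \<subseteq> K \<and> conjugacy_class G H = C}. ?M H))"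
      by (simp add: sum_distrib_right case_prod_unfold mult.assoc flip: times_divide_eq_left)
  qed
  also have "\<dots> = (\<Sum>(m, K, q)\<in>?S. (-1) ^ m / of_nat (card K) *
      (\<Sum>C\<in>?\<C>. \<Sum>H\<in>{H \<in> ?A. H \<subseteq> K \<and> conjugacy_class G H = C}. ?M H))"
    by (subst sum.swap) (simp add: sum_distrib_left case_prod_unfold)
  also have "\<dots> = (\<Sum>(m, K, q)\<in>?S. (-1) ^ m * (of_nat (card (commuting_tuples p n K)) / of_nat (card K)))"
  proof (intro sum.cong refl, clarify)
    fix m K q assume Kq: "(K, q) \<in> cells m"
    have K: "subgroup K G" "finite K" using G_CW_structure_cell(1)[OF cw Kq] finite_cell_stabilizer[OF Kq] by simp_all
    have "finite {H \<in> ?A. H \<subseteq> K}" by (rule finite_subset[of _ "Pow K"]) (use K(2) in auto)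
    \<comment> \<open>The classes sort the subgroups of \<open>K\<close>; regrouping the sum in this
      way requires finitely many classes.\<close>
    then have "(\<Sum>C\<in>?\<C>. \<Sum>H\<in>{H \<in> {H \<in> ?A. H \<subseteq> K}. conjugacy_class G H = C}. ?M H) = sum ?M {H \<in> ?A. H \<subseteq> K}"
      using fin by (intro sum.group) auto
    also have "\<dots> = of_nat (card (commuting_tuples p n K))" by (simp add: card_commuting_tuples[OF K p])
    finally have "(\<Sum>C\<in>?\<C>. \<Sum>H\<in>{H \<in> ?A. H \<subseteq> K \<and> conjugacy_class G H = C}. ?M H) = of_nat (card (commuting_tuples p n K))"
      by (simp add: conj_assoc)
    then show "(-1) ^ m / of_nat (card K) * (\<Sum>C\<in>?\<C>. \<Sum>H\<in>{H \<in> ?A. H \<subseteq> K \<and> conjugacy_class G H = C}. ?M H) =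
        (-1) ^ m * (of_nat (card (commuting_tuples p n K)) / of_nat (card K) :: rat)" by simp
  qed
  finally show ?thesis .
qed

theorem theorem2:
  fixes G :: "('g, 'm) monoid_scheme" and p n :: nat
  assumes "prime p" and "n \<ge> 1"
    and "group G"
    and "virtually_torsion_free G"
    and "admits_finite_EG G"
  shows "cong_mod_localization p
    (\<Sum>C \<in> conjugacy_class G ` abelian_p_subgroups G p n.
      let H = (SOME H. H \<in> C);
          P = G\<lparr>carrier := H\<rparr>;
          F = frattini p P;
          r = group_rank (P Mod F)
      in orbifold_euler (G\<lparr>carrier := normalizer G H\<rparr>) * of_nat (card F) ^ n *
         (\<Sum>i=0..r. (-1) ^ i * of_nat p ^ (n * (r - i) + (i choose 2)) * p_binomial p r i))
    0"
proof -
  obtain X :: "'g points topology" and \<phi> where model: "finite_EG_model G X \<phi>"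
    using assms(5) unfolding admits_finite_EG_def by blast
  then obtain cells where "G_CW_structure G X \<phi> cells" "finite (SIGMA n:UNIV. cells n)"
    unfolding finite_EG_model_def finite_G_CW_complex_def by blast
  then interpret finite_EG G X \<phi> cells using finite_EGI[OF model] by blast
  let ?\<C> = "conjugacy_class G ` abelian_p_subgroups G p n"
  \<comment> \<open>A name for the choice in the statement, from which only membership in the class
    is carried on.\<close>
  define h where "h = (\<lambda>C :: 'g set set. SOME H. H \<in> C)"
  have h_SOME: "(SOME H. H \<in> C) = h C" for C by (simp add: h_def)
  \<comment> \<open>Each class of the sum is the class of a finite subgroup, and of these there are
    finitely many because the model has finitely many orbits of cells.\<close>
  have "?\<C> \<subseteq> conjugacy_class G ` {H. subgroup H G \<and> finite H}" by (auto simp: abelian_p_subgroups_def)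
  then have fin: "finite ?\<C>" using finite_conjugacy_classes[OF assms(5)] by (rule finite_subset)
  have h: "h C \<in> C" "h C \<in> abelian_p_subgroups G p n" if "C \<in> ?\<C>" for C
  proof -
    obtain H where H: "H \<in> abelian_p_subgroups G p n" "C = conjugacy_class G H" using \<open>C \<in> ?\<C>\<close> by blast
    have "H \<in> C" using in_own_conjugacy_class[OF subgroup.subset] H by (simp add: abelian_p_subgroups_def)
    then show "h C \<in> C" unfolding h_def by (rule someI)
    then show "h C \<in> abelian_p_subgroups G p n" using abelian_p_subgroups_conj[OF H(1)] H(2) by simp
  qed
  have "(\<Sum>C \<in> ?\<C>.
      let H = (SOME H. H \<in> C); P = G\<lparr>carrier := H\<rparr>; F = frattini p P; r = group_rank (P Mod F)
      in orbifold_euler (G\<lparr>carrier := normalizer G H\<rparr>) * of_nat (card F) ^ n *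
         (\<Sum>i=0..r. (-1) ^ i * of_nat p ^ (n * (r - i) + (i choose 2)) * p_binomial p r i)) =
    (\<Sum>C\<in>?\<C>. orbifold_euler (G\<lparr>carrier := normalizer G (h C)\<rparr>) * of_nat (card (generating_tuples n (h C))))"
    by (intro sum.cong refl)
      (simp only: h_SOME Let_def card_generating_tuples_subgroup[OF assms(1) h(2)] mult.assoc)
  also have "\<dots> = (\<Sum>(m, K, q)\<in>(SIGMA m:UNIV. cells m). (-1) ^ m *
      (of_nat (card (commuting_tuples p n K)) / of_nat (card K)))"
    by (rule sum_normalizer_eq_sum_cells[OF assms(4,1,2) fin h(1)])
  also have "\<dots> \<in> localization_at p"
  proof (rule localization_at_sum[OF assms(1)], clarify)
    fix m K q assume Kq: "(K, q) \<in> cells m"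
    have K: "subgroup K G" "finite K" using G_CW_structure_cell(1)[OF cw Kq] finite_cell_stabilizer[OF Kq] by simp_all
    have "card K > 0" using subgroup.one_closed[OF K(1)] K(2) by (auto simp: card_gt_0_iff)
    then show "(-1) ^ m * (of_nat (card (commuting_tuples p n K)) / of_nat (card K)) \<in> localization_at p"
      by (rule of_nat_divide_in_localization[OF assms(1) _ p_part_dvd_card_commuting_tuples[OF K assms(1,2)]])
  qed
  finally show ?thesis by (simp add: cong_mod_localization_def)
qed

end
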